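(* Let $\Omega\subset\mathbb{R}^2$ be a bounded simply connected curvilinear polygonal domain whose boundary consists of arcs of algebraic curves of order at most two, and let $\triangle$ be a triangulation of $\Omega$ with pie-shaped triangles at the boundary, such that $\Omega$ and $\triangle$ satisfy all the assumptions listed in the context (including (a)--(g)). Let $S^{1,2}_{5,0}(\triangle)$ be the spline space, and let $M_v$ ($v\in V_I$), $M_e$ ($e\in E_I^0$), $M_v^P$ ($v\in V_B^1$), $M_T^P$ ($T\in\triangle_P$), $M_T^B$ ($T\in\triangle_B$) be the sets of domain points, identified with linear functionals on $S^{1,2}_{5,0}(\triangle)$, defined in the context (for any admissible choice of the triangles $T_v$, $T_e$). Then the set $$M := \bigcup_{v\in V_I} M_v \;\cup\; \bigcup_{e\in E_I^0} M_e \;\cup\; \bigcup_{v\in V_B^1} M_v^P \;\cup\; \bigcup_{T\in\triangle_P} M_T^P \;\cup\; \bigcup_{T\in\triangle_B} M_T^B$$ is a $1$-local minimal determining set for the space $S^{1,2}_{5,0}(\triangle)$.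
   Context: **Domain.** $\mathbb{P}_d$ is the space of bivariate real polynomials of total degree at most $d$. $\Omega\subset\mathbb{R}^2$ is a bounded, simply connected curvilinear polygonal domain with $\Gamma=\partial\Omega=\bigcup_{j=1}^n\overline{\Gamma}_j$, where each $\Gamma_j$ is an open arc of an algebraic curve of at most second order (a straight line or a conic). $Z=\{z_1,\dots,z_n\}$ is the set of endpoints of all arcs, numbered counter-clockwise, so that $z_j,z_{j+1}$ are the endpoints of $\Gamma_j$ (with $z_{j+n}=z_j$). $\omega_j$ is the internal angle at $z_j$ between the tangents to $\Gamma_j$ and $\Gamma_{j-1}$; it is assumed that $\omega_j>0$ for all $j$. For each $j$, $q_j\in\mathbb{P}_2$ is a polynomial with $\Gamma_j\subset\{x\in\mathbb{R}^2: q_j(x)=0\}$ and $\partial_{\nu_x}q_j(x)<0$ for $x$ in the interior of $\Gamma_j$, where $\nu_x$ is the unit outer normal (so $q_j>0$ in $\Omega$ near $\Gamma_j$); $q_j\in\mathbb{P}_1$ if $\Gamma_j$ is straight, and $q_j$ is an irreducible quadratic if $\Gamma_j$ is a genuine conic arc; in all cases $\nabla q_j(x)\neq0$ for $x\in\Gamma_j$. **Triangulation.** $\triangle$ is a subdivision of $\Omega$ into triangles, where each $T\in\triangle$ has at most one edge replaced by a curved segment of $\partial\Omega$, and the intersection of any two triangles, if non-empty, is a common vertex or a common (straight) edge. Triangles with a curved edge are *pie-shaped* (set $\triangle_P$); a (non-pie-shaped) triangle sharing at least one edge with a pie-shaped triangle is a *buffer* triangle (set $\triangle_B$); the remaining triangles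 are *ordinary* (set $\triangle_0$); $\triangle=\triangle_0\cup\triangle_B\cup\triangle_P$ is a disjoint union. $V_I,E_I,V_B,E_B$ denote the sets of interior vertices, interior edges, boundary vertices and boundary edges. Assumptions: - (a) $Z\subset V_B$. - (b) No interior edge has both endpoints on the boundary. - (c) No pair of pie-shaped triangles shares an edge. - (d) Every $T\in\triangle_P$ is star-shaped with respect to its interior vertex. - (e) For any $T\in\triangle_P$ with its curved side on $\Gamma_j$, $q_j(z)>0$ for all $z\in T\setminus\overline{\Gamma}_j$. - (f) All boundary edges are curved. - (g) No pair of buffer triangles shares an edge, and no boundary vertex has more than one buffer triangle attached to it. $V_B^1$ is the set of boundary vertices $v\in V_B$ where $\partial\Omega$ has a well-defined tangent, i.e. either $v\notin Z$, or $v=z_j$ for some $j$ with $\omega_j=\pi$. $E_{P,B}$ is the set of edges shared by a pie-shaped and a buffer triangle, and $E_I^0:=E_I\setminus E_{P,B}$. **Spline space.** $S^{1,2}_{5,0}(\triangle)$ is the space of all $s\in C^1(\Omega)$ such that $s|_T\in\mathbb{P}_5$ for $T\in\triangle_0$, $s|_T\in\mathbb{P}_6$ for $T\in\triangle_P\cup\triangle_B$, $s$ is twice differentiable at every $v\in V_I$, and $s|_\Gamma=0$. **Bernstein--Bézier form.** For a non-degenerate triangle $T=\langle v_1,v_2,v_3\rangle$ with barycentric coordinates $b_1,b_2,b_3$, the Bernstein polynomials of degree $d$ are $B^d_{ijk}=\frac{d!}{i!j!k!}b_1^ib_2^jb_3^k$, $i+j+k=d$; they form a basis of $\mathbb{P}_d$.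 The domain points are $D_{d,T}=\{\xi_{ijk}=(iv_1+jv_2+kv_3)/d: i+j+k=d,\ i,j,k\ge0\}$, and $B^d_\xi:=B^d_{ijk}$, $c_\xi:=c_{ijk}$ for $\xi=\xi_{ijk}$. **Functionals and sets of domain points.** Domain points $\xi$ are identified with linear functionals $\lambda_\xi$ on $S^{1,2}_{5,0}(\triangle)$, and the sets below are understood as sets of functionals, as follows. - For $T\in\triangle_0$ and $\xi\in D_{5,T}$, $\lambda_\xi(s)$ is the coefficient $c_\xi$ in $s|_T=\sum_{\xi\in D_{5,T}}c_\xi B^5_\xi$. For each $v\in V_I$ choose $T_v=\langle v_1,v_2,v_3\rangle\in\triangle_0$ attached to $v$ with $v_1=v$, and set $M_v:=\{\xi_{500},\xi_{410},\xi_{401},\xi_{320},\xi_{302},\xi_{311}\}\subset D_{5,T_v}$. For each $e=\langle v_2,v_3\rangle\in E_I^0$ choose $T_e=\langle v_1,v_2,v_3\rangle\in\triangle_0$ attached to $e$, and set $M_e:=\{\xi_{122}\}\subset D_{5,T_e}$. - For $T\in\triangle_P$ with vertices $v_1,v_2,v_3$, $v_1\in V_I$, let the curved edge be given by $q(x)=0$ with $q\in\mathbb{P}_2\setminus\mathbb{P}_1$ irreducible and normalized by $q(v_1)=1$, and let $T^*$ be the straight-sided triangle with vertices $v_1,v_2,v_3$. Every $s\in S^{1,2}_{5,0}(\triangle)$ satisfies $s|_T=q\sum_{\xi\in D^*_{4,T}}c_\xi B^4_\xi$, where $B^4_\xi$ are the Bernstein polynomials of degree 4 with respect to $T^*$ and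 $D^*_{4,T}$ denotes the set of domain points $D_{4,T^*}$, each $\xi\in D^*_{4,T}$ now representing the functional $\lambda_\xi$ that picks the coefficient $c_\xi$ in this expansion. Set $M_T^P:=\{\xi_{130},\xi_{121},\xi_{112},\xi_{103},\xi_{022}\}\subset D^*_{4,T}$. - For each $v\in V_B^1$, let $T_v$ be one (chosen) of the two pie-shaped triangles attached to $v$, and set $M_v^P:=\{v\}\subset D^*_{4,T_v}$, with $\lambda_v$ picking the coefficient $c_v$ of the expansion in the previous item for $T=T_v$. - For each $T=\langle v_1,v_2,v_3\rangle\in\triangle_B$ with $v_1\in V_B$, set $M_T^B:=\{\xi_{411},\xi_{222}\}\subset D_{6,T}$, where $\lambda_\xi(s)$ for $\xi\in D_{6,T}$ is the coefficient $c_\xi$ in $s|_T=\sum_{\xi\in D_{6,T}}c_\xi B^6_\xi$. **Minimal determining sets and locality.** Write $S=S^{1,2}_{5,0}(\triangle)$. A finite set $\Lambda$ of linear functionals on $S$ is a *determining set* if $\lambda(s)=0$ for all $\lambda\in\Lambda$ implies $s=0$, and a *minimal determining set* (MDS) if there is no smaller determining set; equivalently, $\Lambda$ is a basis of $S^*$. An MDS $\Lambda$ determines the dual basis $\{s_\lambda:\lambda\in\Lambda\}$ of $S$ by $\lambda(s_\mu)=\delta_{\lambda,\mu}$. For a set $A$, $\operatorname{star}^1(A)=\operatorname{star}(A):=\bigcup\{T\in\triangle: T\cap A\neq\emptyset\}$ and $\operatorname{star}^\ell(A):=\operatorname{star}(\operatorname{star}^{\ell-1}(A))$ for $\ell\ge2$.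 A set $\omega$ is a *supporting set* of $\lambda\in S^*$ if $\lambda(s)=0$ for all $s\in S$ with $s|_\omega=0$. For an MDS $\Lambda$ and $T\in\triangle$ let $\Lambda_T:=\{\lambda\in\Lambda: T\subset\operatorname{supp}s_\lambda\}$. An MDS $\Lambda$ is *$\ell$-local* if there is a family of supporting sets $\omega_\lambda$ of $\lambda\in\Lambda$ such that $\omega_\lambda\subset\operatorname{star}^\ell(T)$ for any $T\in\triangle$ with $\lambda\in\Lambda_T$.
   Formalization: Two cusp cases in which M is not a minimal determining set are excluded: corners of Ω with internal angle 2π (the assumption on ω_j also rules out inward cusps), and pie-shaped triangles with a straight edge tangent to the curved edge at their common vertex. *)

theory Defs
  imports "HOL-Complex_Analysis.Complex_Analysis"
begin

type_synonym point = "real^2"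

section \<open>Bivariate polynomials\<close>

text \<open>Since the real field is infinite, polynomials are identified with polynomial functions.\<close>

definition Pd :: "nat \<Rightarrow> (point \<Rightarrow> real) set" where
  "Pd d = {p. \<exists>c. \<forall>x. p x = (\<Sum>i\<le>d. \<Sum>j\<le>d - i. c i j * (x $ 1) ^ i * (x $ 2) ^ j)}"

text \<open>Irreducibility in the ring of real bivariate polynomials, whose units are the nonzero
  constants.\<close>

definition irreducible_Pd :: "(point \<Rightarrow> real) \<Rightarrow> bool" where
  "irreducible_Pd q \<longleftrightarrow>
     q \<in> (\<Union>d. Pd d) \<and> q \<notin> Pd 0 \<and>
     (\<forall>f \<in> (\<Union>d. Pd d). \<forall>g \<in> (\<Union>d. Pd d).
        (\<forall>x. q x = f x * g x) \<longrightarrow> f \<in> Pd 0 \<or> g \<in> Pd 0)"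

definition grad :: "(point \<Rightarrow> real) \<Rightarrow> point \<Rightarrow> point" where
  "grad f x = (\<chi> i. frechet_derivative f (at x) (axis i 1))"

section \<open>Curvilinear polygonal domains\<close>

text \<open>The boundary is parametrised by one closed path on \<open>[0,1]\<close>; the knots
  \<open>0 = knot 0 < \<dots> < knot n = 1\<close> cut it into the arcs. Arcs and corners are indexed by
  \<open>0, \<dots>, n - 1\<close>.\<close>

record cdomain =
  region :: "point set"
  nsides :: nat
  bdry :: "real \<Rightarrow> point"
  knot :: "nat \<Rightarrow> real"
  qpol :: "nat \<Rightarrow> point \<Rightarrow> real"

definition side :: "cdomain \<Rightarrow> nat \<Rightarrow> point set" where
  "side D j = bdry D ` {knot D j <..< knot D (Suc j)}"

definition corner :: "cdomain \<Rightarrow> nat \<Rightarrow> point" where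
  "corner D j = bdry D (knot D j)"

definition corners :: "cdomain \<Rightarrow> point set" where
  "corners D = corner D ` {..<nsides D}"

text \<open>One-sided at the two ends of the arc.\<close>

definition tangent :: "cdomain \<Rightarrow> nat \<Rightarrow> real \<Rightarrow> point" where
  "tangent D j u = vector_derivative (bdry D) (at u within {knot D j .. knot D (Suc j)})"

definition cplx :: "point \<Rightarrow> complex" where
  "cplx x = Complex (x $ 1) (x $ 2)"

text \<open>The internal angle is the angle in \<open>[0, 2\<pi>)\<close> from the tangent ray of the outgoing arc
  counter-clockwise to the tangent ray of the incoming arc (both rays start in the corner and
  point along the respective arc). Hence the value is 0 at every cusp, where the two rays coincide,
  no matter on which side of the cusp the domain lies.\<close>

definition internal_angle :: "cdomain \<Rightarrow> nat \<Rightarrow> real" where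
  "internal_angle D j =
     (let p = (j + nsides D - 1) mod nsides D
      in Arg2pi (cplx (- tangent D p (knot D (Suc p))) / cplx (tangent D j (knot D j))))"

text \<open>\<open>\<nu>\<close> is the unit outer normal to \<open>\<Omega>\<close> at a boundary point \<open>x\<close> where the boundary
  has tangent vector \<open>\<tau>\<close>.\<close>

definition outer_normal :: "point set \<Rightarrow> point \<Rightarrow> point \<Rightarrow> point \<Rightarrow> bool" where
  "outer_normal \<Omega> x \<tau> \<nu> \<longleftrightarrow>
     norm \<nu> = 1 \<and> \<nu> \<bullet> \<tau> = 0 \<and>
     (\<forall>\<^sub>F \<epsilon> in at_right 0. x - \<epsilon> *\<^sub>R \<nu> \<in> \<Omega> \<and> x + \<epsilon> *\<^sub>R \<nu> \<notin> closure \<Omega>)"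

text \<open>That the arcs have regular \<open>C\<^sup>1\<close> parametrisations is no restriction, because they lie on
  lines or nondegenerate conics. Counter-clockwise means winding number 1.\<close>

definition curvilinear_polygon :: "cdomain \<Rightarrow> bool" where
  "curvilinear_polygon D \<longleftrightarrow>
     open (region D) \<and> connected (region D) \<and> region D \<noteq> {} \<and>
     bounded (region D) \<and> simply_connected (region D) \<and>
     nsides D \<ge> 1 \<and> knot D 0 = 0 \<and> knot D (nsides D) = 1 \<and>
     (\<forall>j<nsides D. knot D j < knot D (Suc j)) \<and>
     simple_path (bdry D) \<and> pathfinish (bdry D) = pathstart (bdry D) \<and>
     path_image (bdry D) = frontier (region D) \<and>
     (\<forall>w\<in>region D. winding_number (cplx \<circ> bdry D) (cplx w) = 1) \<and>
     (\<forall>j<nsides D.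
        (\<forall>u\<in>{knot D j .. knot D (Suc j)}.
           (bdry D has_vector_derivative tangent D j u)
             (at u within {knot D j .. knot D (Suc j)}) \<and>
           tangent D j u \<noteq> 0) \<and>
        continuous_on {knot D j .. knot D (Suc j)} (tangent D j) \<and>
        internal_angle D j > 0 \<and>
        (qpol D j \<in> Pd 1 \<or> qpol D j \<in> Pd 2 - Pd 1 \<and> irreducible_Pd (qpol D j)) \<and>
        (\<forall>x\<in>side D j. qpol D j x = 0 \<and> grad (qpol D j) x \<noteq> 0) \<and>
        (\<forall>u\<in>{knot D j <..< knot D (Suc j)}.
           \<exists>\<nu>. outer_normal (region D) (bdry D u) (tangent D j u) \<nu> \<and>
               grad (qpol D j) (bdry D u) \<bullet> \<nu> < 0))"

section \<open>Triangulations with pie-shaped triangles\<close>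

definition straight_tri :: "point set \<Rightarrow> point \<Rightarrow> point \<Rightarrow> point \<Rightarrow> bool" where
  "straight_tri T a b c \<longleftrightarrow> \<not> collinear {a, b, c} \<and> T = convex hull {a, b, c}"

text \<open>\<open>T\<close> is the compact region enclosed by the segments \<open>[a,b]\<close>, \<open>[a,c]\<close> and the
  segment \<open>C\<close> of the \<open>j\<close>-th boundary arc, a genuine conic arc. The two gradient conditions say that
  the straight edges are not tangent to \<open>C\<close>, i.e. that the curvilinear triangle has no
  cusp at \<open>b\<close> or \<open>c\<close>.\<close>

definition pie :: "cdomain \<Rightarrow> point set \<Rightarrow> nat \<Rightarrow> point \<Rightarrow> point \<Rightarrow> point \<Rightarrow> point set \<Rightarrow> bool"
  where
  "pie D T j a b c C \<longleftrightarrow>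
     j < nsides D \<and> qpol D j \<notin> Pd 1 \<and>
     (\<exists>s t. knot D j \<le> s \<and> s < t \<and> t \<le> knot D (Suc j) \<and>
            C = bdry D ` {s..t} \<and> {b, c} = {bdry D s, bdry D t}) \<and>
     \<not> collinear {a, b, c} \<and>
     closed_segment a b \<inter> C = {b} \<and> closed_segment a c \<inter> C = {c} \<and>
     grad (qpol D j) b \<bullet> (a - b) \<noteq> 0 \<and> grad (qpol D j) c \<bullet> (a - c) \<noteq> 0 \<and>
     (let F = closed_segment a b \<union> closed_segment a c \<union> C in T = F \<union> inside F)"

definition is_cell :: "cdomain \<Rightarrow> point set \<Rightarrow> point \<Rightarrow> point \<Rightarrow> point \<Rightarrow> bool" where
  "is_cell D T a b c \<longleftrightarrow> straight_tri T a b c \<or> (\<exists>j C. pie D T j a b c C)"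

definition vertices :: "cdomain \<Rightarrow> point set \<Rightarrow> point set" where
  "vertices D T = {v. \<exists>a b c. is_cell D T a b c \<and> v \<in> {a, b, c}}"

text \<open>All straight edges are obtained as \<open>[a,b]\<close>: \<open>straight_tri\<close> is symmetric in all three
  vertices, and \<open>pie\<close> in \<open>b\<close> and \<open>c\<close>.\<close>

definition straight_edges :: "cdomain \<Rightarrow> point set \<Rightarrow> point set set" where
  "straight_edges D T = {closed_segment a b | a b. \<exists>c. is_cell D T a b c}"

definition curved_edges :: "cdomain \<Rightarrow> point set \<Rightarrow> point set set" where
  "curved_edges D T = {C. \<exists>j a b c. pie D T j a b c C}"

definition subdivision :: "cdomain \<Rightarrow> point set set \<Rightarrow> bool" where
  "subdivision D \<Delta> \<longleftrightarrow>
     finite \<Delta> \<and> \<Union>\<Delta> = closure (region D) \<and>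
     (\<forall>T\<in>\<Delta>. \<exists>a b c. is_cell D T a b c) \<and>
     (\<forall>T\<in>\<Delta>. \<forall>T'\<in>\<Delta>. T \<noteq> T' \<longrightarrow>
        T \<inter> T' = {} \<or>
        (\<exists>v \<in> vertices D T \<inter> vertices D T'. T \<inter> T' = {v}) \<or>
        T \<inter> T' \<in> straight_edges D T \<inter> straight_edges D T')"

definition pies :: "cdomain \<Rightarrow> point set set \<Rightarrow> point set set" where
  "pies D \<Delta> = {T\<in>\<Delta>. \<exists>j a b c C. pie D T j a b c C}"

definition buffers :: "cdomain \<Rightarrow> point set set \<Rightarrow> point set set" where
  "buffers D \<Delta> =
     {T \<in> \<Delta> - pies D \<Delta>. \<exists>T'\<in>pies D \<Delta>. straight_edges D T \<inter> straight_edges D T' \<noteq> {}}"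

definition ordinary :: "cdomain \<Rightarrow> point set set \<Rightarrow> point set set" where
  "ordinary D \<Delta> = \<Delta> - pies D \<Delta> - buffers D \<Delta>"

definition VI :: "cdomain \<Rightarrow> point set set \<Rightarrow> point set" where
  "VI D \<Delta> = (\<Union>T\<in>\<Delta>. vertices D T) \<inter> region D"

definition VB :: "cdomain \<Rightarrow> point set set \<Rightarrow> point set" where
  "VB D \<Delta> = (\<Union>T\<in>\<Delta>. vertices D T) \<inter> frontier (region D)"

definition edges :: "cdomain \<Rightarrow> point set set \<Rightarrow> point set set" where
  "edges D \<Delta> = (\<Union>T\<in>\<Delta>. straight_edges D T \<union> curved_edges D T)"

definition EB :: "cdomain \<Rightarrow> point set set \<Rightarrow> point set set" where
  "EB D \<Delta> = {e \<in> edges D \<Delta>. e \<subseteq> frontier (region D)}"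

definition EI :: "cdomain \<Rightarrow> point set set \<Rightarrow> point set set" where
  "EI D \<Delta> = edges D \<Delta> - EB D \<Delta>"

definition EPB :: "cdomain \<Rightarrow> point set set \<Rightarrow> point set set" where
  "EPB D \<Delta> =
     {e. \<exists>T\<in>pies D \<Delta>. \<exists>T'\<in>buffers D \<Delta>. e \<in> straight_edges D T \<inter> straight_edges D T'}"

definition EI0 :: "cdomain \<Rightarrow> point set set \<Rightarrow> point set set" where
  "EI0 D \<Delta> = EI D \<Delta> - EPB D \<Delta>"

definition VB1 :: "cdomain \<Rightarrow> point set set \<Rightarrow> point set" where
  "VB1 D \<Delta> =
     {v \<in> VB D \<Delta>. v \<notin> corners D \<or>
        (\<exists>j<nsides D. v = corner D j \<and> internal_angle D j = pi)}"

definition admissible_triangulation :: "cdomain \<Rightarrow> point set set \<Rightarrow> bool" where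
  "admissible_triangulation D \<Delta> \<longleftrightarrow>
     subdivision D \<Delta> \<and>
     corners D \<subseteq> VB D \<Delta> \<and>
     (\<forall>a b. closed_segment a b \<in> EI D \<Delta> \<longrightarrow>
        \<not> (a \<in> frontier (region D) \<and> b \<in> frontier (region D))) \<and>
     (\<forall>T\<in>pies D \<Delta>. \<forall>T'\<in>pies D \<Delta>. T \<noteq> T' \<longrightarrow>
        straight_edges D T \<inter> straight_edges D T' = {}) \<and>
     (\<forall>T\<in>pies D \<Delta>. \<forall>j a b c C. pie D T j a b c C \<longrightarrow>
        (\<forall>x\<in>T. closed_segment a x \<subseteq> T) \<and>
        (\<forall>z \<in> T - closure (side D j). qpol D j z > 0)) \<and>
     (\<forall>e\<in>EB D \<Delta>. \<exists>T\<in>\<Delta>. e \<in> curved_edges D T) \<and>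
     (\<forall>T\<in>buffers D \<Delta>. \<forall>T'\<in>buffers D \<Delta>. T \<noteq> T' \<longrightarrow>
        straight_edges D T \<inter> straight_edges D T' = {}) \<and>
     (\<forall>v\<in>VB D \<Delta>. \<forall>T\<in>buffers D \<Delta>. \<forall>T'\<in>buffers D \<Delta>.
        v \<in> vertices D T \<and> v \<in> vertices D T' \<longrightarrow> T = T')"

section \<open>The spline space\<close>

text \<open>A spline is extended continuously to the closure of the domain, and by 0 outside of it, so
  that splines are equal as functions on the whole plane iff they agree on the domain.\<close>

definition spline_space :: "cdomain \<Rightarrow> point set set \<Rightarrow> (point \<Rightarrow> real) set" where
  "spline_space D \<Delta> =
     {s. (\<forall>x. x \<notin> closure (region D) \<longrightarrow> s x = 0) \<and>
         (\<forall>x\<in>region D. s differentiable (at x)) \<and>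
         continuous_on (region D) (grad s) \<and>
         (\<forall>T\<in>ordinary D \<Delta>. \<exists>p\<in>Pd 5. \<forall>x\<in>T. s x = p x) \<and>
         (\<forall>T\<in>pies D \<Delta> \<union> buffers D \<Delta>. \<exists>p\<in>Pd 6. \<forall>x\<in>T. s x = p x) \<and>
         (\<forall>v\<in>VI D \<Delta>. grad s differentiable (at v)) \<and>
         (\<forall>x\<in>frontier (region D). s x = 0)}"

section \<open>Bernstein--Bezier coefficients\<close>

text \<open>Twice the signed area of the triangle \<open>a b c\<close>.\<close>

definition area2 :: "point \<Rightarrow> point \<Rightarrow> point \<Rightarrow> real" where
  "area2 a b c = (b $ 1 - a $ 1) * (c $ 2 - a $ 2) - (b $ 2 - a $ 2) * (c $ 1 - a $ 1)"

text \<open>The barycentric coordinates of \<open>x\<close> are quotients of signed areas.\<close>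

definition bernstein ::
  "nat \<Rightarrow> point \<Rightarrow> point \<Rightarrow> point \<Rightarrow> nat \<times> nat \<times> nat \<Rightarrow> point \<Rightarrow> real" where
  "bernstein d a b c = (\<lambda>(i, j, k) x.
     fact d / (fact i * fact j * fact k) *
     (area2 x b c / area2 a b c) ^ i *
     (area2 a x c / area2 a b c) ^ j *
     (area2 a b x / area2 a b c) ^ k)"

text \<open>The domain point \<open>\<xi>\<^sub>i\<^sub>j\<^sub>k = (i a + j b + k c) / d\<close> is represented by its index.\<close>

definition indices :: "nat \<Rightarrow> (nat \<times> nat \<times> nat) set" where
  "indices d = {(i, j, k). i + j + k = d}"

text \<open>The coefficients \<open>c\<^sub>\<alpha>\<close> in \<open>s = w \<Sum> c\<^sub>\<alpha> B\<^sub>\<alpha>\<close> on \<open>T\<close>.\<close>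

definition bb_coeffs ::
  "(point \<Rightarrow> real) \<Rightarrow> nat \<Rightarrow> point set \<Rightarrow> point \<Rightarrow> point \<Rightarrow> point \<Rightarrow>
    (point \<Rightarrow> real) \<Rightarrow> nat \<times> nat \<times> nat \<Rightarrow> real" where
  "bb_coeffs w d T a b c s =
     (THE coef. (\<forall>\<alpha>. \<alpha> \<notin> indices d \<longrightarrow> coef \<alpha> = 0) \<and>
        (\<forall>x\<in>T. s x = w x * (\<Sum>\<alpha>\<in>indices d. coef \<alpha> * bernstein d a b c \<alpha> x)))"

text \<open>Functionals on a space \<open>S\<close> are \<open>undefined\<close> outside of \<open>S\<close>, so that they are equal
  iff they agree on \<open>S\<close>.\<close>

definition tri_functional ::
  "(point \<Rightarrow> real) set \<Rightarrow> nat \<Rightarrow> point set \<Rightarrow> point \<Rightarrow> point \<Rightarrow> point \<Rightarrow>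
    nat \<times> nat \<times> nat \<Rightarrow> (point \<Rightarrow> real) \<Rightarrow> real" where
  "tri_functional S d T a b c \<alpha> = (\<lambda>s\<in>S. bb_coeffs (\<lambda>x. 1) d T a b c s \<alpha>)"

definition pie_functional ::
  "cdomain \<Rightarrow> (point \<Rightarrow> real) set \<Rightarrow> point set \<Rightarrow> nat \<Rightarrow> point \<Rightarrow> point \<Rightarrow> point \<Rightarrow>
    nat \<times> nat \<times> nat \<Rightarrow> (point \<Rightarrow> real) \<Rightarrow> real" where
  "pie_functional D S T j a b c \<alpha> =
     (\<lambda>s\<in>S. bb_coeffs (\<lambda>x. qpol D j x / qpol D j a) 4 T a b c s \<alpha>)"

section \<open>The sets of functionals\<close>

text \<open>Each of the index sets below is invariant under those reorderings of the vertices of \<open>T\<close>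
  that the comprehension leaves open, so that the ordering does not matter.\<close>

definition Mv :: "(point \<Rightarrow> real) set \<Rightarrow> point set \<Rightarrow> point \<Rightarrow> ((point \<Rightarrow> real) \<Rightarrow> real) set" where
  "Mv S T v = {tri_functional S 5 T v b c \<alpha> | b c \<alpha>. straight_tri T v b c \<and>
     \<alpha> \<in> {(5,0,0), (4,1,0), (4,0,1), (3,2,0), (3,0,2), (3,1,1)}}"

definition Me ::
  "(point \<Rightarrow> real) set \<Rightarrow> point set \<Rightarrow> point set \<Rightarrow> ((point \<Rightarrow> real) \<Rightarrow> real) set" where
  "Me S T e = {tri_functional S 5 T a b c (1,2,2) | a b c.
     straight_tri T a b c \<and> e = closed_segment b c}"

definition MvP ::
  "cdomain \<Rightarrow> (point \<Rightarrow> real) set \<Rightarrow> point set \<Rightarrow> point \<Rightarrow> ((point \<Rightarrow> real) \<Rightarrow> real) set" where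
  "MvP D S T v = {pie_functional D S T j a v c (0,4,0) | j a c. \<exists>C. pie D T j a v c C}"

definition MTP ::
  "cdomain \<Rightarrow> (point \<Rightarrow> real) set \<Rightarrow> point set \<Rightarrow> ((point \<Rightarrow> real) \<Rightarrow> real) set" where
  "MTP D S T = {pie_functional D S T j a b c \<alpha> | j a b c \<alpha>. (\<exists>C. pie D T j a b c C) \<and>
     \<alpha> \<in> {(1,3,0), (1,2,1), (1,1,2), (1,0,3), (0,2,2)}}"

definition MTB ::
  "cdomain \<Rightarrow> (point \<Rightarrow> real) set \<Rightarrow> point set \<Rightarrow> ((point \<Rightarrow> real) \<Rightarrow> real) set" where
  "MTB D S T = {tri_functional S 6 T a b c \<alpha> | a b c \<alpha>. straight_tri T a b c \<and>
     a \<in> frontier (region D) \<and> \<alpha> \<in> {(4,1,1), (2,2,2)}}"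

text \<open>\<open>TI\<close>, \<open>TE\<close> and \<open>TB\<close> are the choices of triangles for the interior vertices, the edges
  and the boundary vertices, respectively.\<close>

definition M_choice ::
  "cdomain \<Rightarrow> point set set \<Rightarrow> (point \<Rightarrow> point set) \<Rightarrow> (point set \<Rightarrow> point set) \<Rightarrow>
    (point \<Rightarrow> point set) \<Rightarrow> bool" where
  "M_choice D \<Delta> TI TE TB \<longleftrightarrow>
     (\<forall>v\<in>VI D \<Delta>. TI v \<in> ordinary D \<Delta> \<and> v \<in> vertices D (TI v)) \<and>
     (\<forall>e\<in>EI0 D \<Delta>. TE e \<in> ordinary D \<Delta> \<and> e \<in> straight_edges D (TE e)) \<and>
     (\<forall>v\<in>VB1 D \<Delta>. TB v \<in> pies D \<Delta> \<and> v \<in> vertices D (TB v))"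

definition M_set ::
  "cdomain \<Rightarrow> point set set \<Rightarrow> (point \<Rightarrow> point set) \<Rightarrow> (point set \<Rightarrow> point set) \<Rightarrow>
    (point \<Rightarrow> point set) \<Rightarrow> ((point \<Rightarrow> real) \<Rightarrow> real) set" where
  "M_set D \<Delta> TI TE TB =
     (let S = spline_space D \<Delta> in
      (\<Union>v\<in>VI D \<Delta>. Mv S (TI v) v) \<union>
      (\<Union>e\<in>EI0 D \<Delta>. Me S (TE e) e) \<union>
      (\<Union>v\<in>VB1 D \<Delta>. MvP D S (TB v) v) \<union>
      (\<Union>T\<in>pies D \<Delta>. MTP D S T) \<union>
      (\<Union>T\<in>buffers D \<Delta>. MTB D S T))"

section \<open>Minimal determining sets and locality\<close>

definition dual_space :: "(point \<Rightarrow> real) set \<Rightarrow> ((point \<Rightarrow> real) \<Rightarrow> real) set" where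
  "dual_space S =
     {l \<in> extensional S.
        (\<forall>s\<in>S. \<forall>t\<in>S. l (\<lambda>x. s x + t x) = l s + l t) \<and>
        (\<forall>s\<in>S. \<forall>r. l (\<lambda>x. r * s x) = r * l s)}"

definition determining_set ::
  "(point \<Rightarrow> real) set \<Rightarrow> ((point \<Rightarrow> real) \<Rightarrow> real) set \<Rightarrow> bool" where
  "determining_set S \<Lambda> \<longleftrightarrow>
     finite \<Lambda> \<and> \<Lambda> \<subseteq> dual_space S \<and>
     (\<forall>s\<in>S. (\<forall>l\<in>\<Lambda>. l s = 0) \<longrightarrow> s = (\<lambda>x. 0))"

definition minimal_determining_set ::
  "(point \<Rightarrow> real) set \<Rightarrow> ((point \<Rightarrow> real) \<Rightarrow> real) set \<Rightarrow> bool" where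
  "minimal_determining_set S \<Lambda> \<longleftrightarrow>
     determining_set S \<Lambda> \<and> \<not> (\<exists>\<Lambda>'. determining_set S \<Lambda>' \<and> card \<Lambda>' < card \<Lambda>)"

definition dual_basis ::
  "(point \<Rightarrow> real) set \<Rightarrow> ((point \<Rightarrow> real) \<Rightarrow> real) set \<Rightarrow>
    ((point \<Rightarrow> real) \<Rightarrow> real) \<Rightarrow> point \<Rightarrow> real" where
  "dual_basis S \<Lambda> l = (THE s. s \<in> S \<and> (\<forall>m\<in>\<Lambda>. m s = (if m = l then 1 else 0)))"

definition star :: "point set set \<Rightarrow> point set \<Rightarrow> point set" where
  "star \<Delta> A = \<Union>{T\<in>\<Delta>. T \<inter> A \<noteq> {}}"

definition supporting_set ::
  "(point \<Rightarrow> real) set \<Rightarrow> ((point \<Rightarrow> real) \<Rightarrow> real) \<Rightarrow> point set \<Rightarrow> bool" where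
  "supporting_set S l \<omega> \<longleftrightarrow> (\<forall>s\<in>S. (\<forall>x\<in>\<omega>. s x = 0) \<longrightarrow> l s = 0)"

definition active_functionals ::
  "(point \<Rightarrow> real) set \<Rightarrow> ((point \<Rightarrow> real) \<Rightarrow> real) set \<Rightarrow> point set \<Rightarrow>
    ((point \<Rightarrow> real) \<Rightarrow> real) set" where
  "active_functionals S \<Lambda> T = {l\<in>\<Lambda>. T \<subseteq> closure {x. dual_basis S \<Lambda> l x \<noteq> 0}}"

definition local_MDS ::
  "nat \<Rightarrow> point set set \<Rightarrow> (point \<Rightarrow> real) set \<Rightarrow> ((point \<Rightarrow> real) \<Rightarrow> real) set \<Rightarrow> bool" where
  "local_MDS n \<Delta> S \<Lambda> \<longleftrightarrow>
     minimal_determining_set S \<Lambda> \<and>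
     (\<exists>\<omega>. (\<forall>l\<in>\<Lambda>. supporting_set S l (\<omega> l)) \<and>
          (\<forall>T\<in>\<Delta>. \<forall>l\<in>active_functionals S \<Lambda> T. \<omega> l \<subseteq> (star \<Delta> ^^ n) T))"

end

theory Submission
  imports Defs "HOL-Computational_Algebra.Field_as_Ring" "HOL-Computational_Algebra.Polynomial_Factorial"
begin

text \<open>
  On every triangle a spline is a polynomial, and near a conic arc it is \<open>q h\<close> with \<open>h\<close> of degree 4,
  because an irreducible conic divides any polynomial vanishing on an arc of it. The smoothness
  conditions then say that the pieces of adjacent triangles agree to first order along the common
  edge and to second order at interior vertices, i.e. that certain Bernstein coefficients coincide.

  Given arbitrary values of the functionals, the pieces can be built one after the other: the
  2-jets at the interior vertices; quintics along the edges in \<open>E\<^sub>I\<^sup>0\<close>; the ordinary triangles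
  by Argyris interpolation; the gradient of the spline at every boundary vertex; the factors \<open>h\<close> of
  the pie-shaped triangles; and finally the buffer triangles, where all coefficients but \<open>c\<^sub>2\<^sub>2\<^sub>2\<close>
  are now fixed by the neighbours. At a boundary vertex the two pie-shaped triangles contribute
  gradients \<open>h(v) \<nabla>q\<close>, so that they agree for a free common value if the conics are tangent
  there and force \<open>h(v) = 0\<close> otherwise; this is the role of \<open>V\<^sub>B\<^sup>1\<close>. The coefficient
  \<open>c\<^sub>4\<^sub>1\<^sub>1\<close> of the buffer triangle is the mixed derivative at \<open>v\<close> along both of its pie edges, and
  it is prescribed so that it can be met from both sides.

  If all functionals evaluated in triangles that meet \<open>T\<close> vanish, the same steps show one after
  the other that all these data around \<open>T\<close> are zero, hence that the spline vanishes on \<open>T\<close>. This gives both the determining property and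
  the 1-locality, while minimality follows from the unrestricted interpolation.
\<close>

text \<open>Much of what a picture shows is not among the hypotheses: that every straight edge has a
  cell on its other side, and that only pie-shaped and buffer triangles touch the boundary. Both are
  derived, mainly by filling neighbourhoods with cells: whatever is open inside the closure of the
  domain lies in the domain, by the Jordan curve theorem.

  Pieces of degree 5, of degree 6 and of the form \<open>q h\<close> are compared through the order
  of vanishing of their differences, which refers to no triangle; coefficients with respect to any
  triangle at hand are then read off. This is decisive for the coefficient (4,1,1), which belongs to
  the product \<open>q h\<close> but is taken with respect to the neighbouring buffer triangle. It
  sees only the 1-jet of \<open>h\<close> at the boundary vertex. There the coefficient (0,3,1) of
  \<open>h\<close> is the only one not yet fixed, and it enters with a nonzero factor because the
  straight edge crosses the conic transversally.

  Interpolation is proved for values attached to pairs of a triangle and a functional. Hence a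
  functional cannot come from two triangles, and each has a single triangle as its supporting
  set.\<close>

no_notation fps_nth (infixl \<open>$\<close> 75)

section \<open>Bivariate polynomial functions\<close>

text \<open>Polynomial functions in two arbitrary functions \<open>X\<close> and \<open>Y\<close>.
  \<open>Pd\<close> is the case of the two coordinates; coordinates centred at a vertex and
  coordinates adapted to a conic are further instances, so that the algebra is done only
  once.\<close>

definition pspan :: "('a \<Rightarrow> real) \<Rightarrow> ('a \<Rightarrow> real) \<Rightarrow> nat \<Rightarrow> ('a \<Rightarrow> real) set" where
  "pspan X Y d = {f. \<exists>c. \<forall>x. f x = (\<Sum>i\<le>d. \<Sum>j\<le>d - i. c i j * X x ^ i * Y x ^ j)}"

lemma pspan_add:
  assumes "f \<in> pspan X Y d" "g \<in> pspan X Y d"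
  shows "(\<lambda>x. f x + g x) \<in> pspan X Y d"
proof -
  obtain c c' where "\<forall>x. f x = (\<Sum>i\<le>d. \<Sum>j\<le>d - i. c i j * X x ^ i * Y x ^ j)"
     "\<forall>x. g x = (\<Sum>i\<le>d. \<Sum>j\<le>d - i. c' i j * X x ^ i * Y x ^ j)"
    using assms unfolding pspan_def by blast
  then show ?thesis unfolding pspan_def
    by (auto intro!: exI[of _ "\<lambda>i j. c i j + c' i j"] simp: distrib_right sum.distrib)
qed

lemma pspan_scale:
  assumes "f \<in> pspan X Y d" shows "(\<lambda>x. r * f x) \<in> pspan X Y d"
proof -
  obtain c where "\<forall>x. f x = (\<Sum>i\<le>d. \<Sum>j\<le>d - i. c i j * X x ^ i * Y x ^ j)"
    using assms unfolding pspan_def by blast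
  then show ?thesis unfolding pspan_def
    by (auto intro!: exI[of _ "\<lambda>i j. r * c i j"] simp: sum_distrib_left mult.assoc)
qed

lemma pspan_monom:
  assumes "i + j \<le> d" shows "(\<lambda>x. X x ^ i * Y x ^ j) \<in> pspan X Y d"
proof -
  define c where "c = (\<lambda>i' j'. if i' = i then (if j' = j then 1 else 0) else (0::real))"
  have inner: "(\<Sum>j'\<le>d - i'. c i' j' * X x ^ i' * Y x ^ j') = (if i' = i then X x ^ i * Y x ^ j else 0)"
    for x i'
  proof (cases "i' = i")
    case True
    have "(\<Sum>j'\<le>d - i'. c i' j' * X x ^ i' * Y x ^ j') =
       (\<Sum>j'\<le>d - i'. if j' = j then X x ^ i * Y x ^ j' else 0)"
      by (rule sum.cong) (auto simp: True c_def)
    then show ?thesis using assms True by (auto simp: sum.delta)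
  qed (auto simp: c_def)
  have "X x ^ i * Y x ^ j = (\<Sum>i'\<le>d. \<Sum>j'\<le>d - i'. c i' j' * X x ^ i' * Y x ^ j')" for x
    unfolding inner using assms by (auto simp: sum.delta)
  then show ?thesis unfolding pspan_def by blast
qed

lemma pspan_zero: "(\<lambda>x. 0) \<in> pspan X Y d"
  using pspan_scale[OF pspan_monom[of 0 0 d X Y], of 0] by simp

lemma pspan_sum:
  assumes "\<And>i. i \<in> I \<Longrightarrow> f i \<in> pspan X Y d"
  shows "(\<lambda>x. \<Sum>i\<in>I. f i x) \<in> pspan X Y d"
  using assms
  by (induction I rule: infinite_finite_induct) (auto simp: pspan_zero intro: pspan_add)

lemma pspan_induct [consumes 1, case_names add scale monom]:
  assumes f: "f \<in> pspan X Y d"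
    and add: "\<And>f g. P f \<Longrightarrow> P g \<Longrightarrow> P (\<lambda>x. f x + g x)"
    and scale: "\<And>r f. P f \<Longrightarrow> P (\<lambda>x. r * f x)"
    and monom: "\<And>i j. i + j \<le> d \<Longrightarrow> P (\<lambda>x. X x ^ i * Y x ^ j)"
  shows "P f"
proof -
  obtain c where c: "\<forall>x. f x = (\<Sum>i\<le>d. \<Sum>j\<le>d - i. c i j * X x ^ i * Y x ^ j)"
    using f unfolding pspan_def by blast
  have zero: "P (\<lambda>x. 0)" using scale[OF monom[of 0 0], of 0] by simp
  have Psum: "P (\<lambda>x. \<Sum>i\<in>I. g i x)" if "\<And>i. i \<in> I \<Longrightarrow> P (g i)" for I :: "nat set" and g
    using that by (induction I rule: infinite_finite_induct) (auto simp: zero intro: add)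
  have "P (\<lambda>x. c i j * X x ^ i * Y x ^ j)" if "i + j \<le> d" for i j
    using scale[OF monom[OF that], of "c i j"] by (simp add: mult.assoc)
  then have "P (\<lambda>x. \<Sum>i\<le>d. \<Sum>j\<le>d - i. c i j * X x ^ i * Y x ^ j)"
    by (intro Psum) auto
  moreover have "f = (\<lambda>x. \<Sum>i\<le>d. \<Sum>j\<le>d - i. c i j * X x ^ i * Y x ^ j)"
    using c by auto
  ultimately show ?thesis by simp
qed

lemma pspan_mono: "f \<in> pspan X Y m \<Longrightarrow> m \<le> n \<Longrightarrow> f \<in> pspan X Y n"
  by (induction rule: pspan_induct) (auto intro: pspan_add pspan_scale pspan_monom)

lemma pspan_mult:
  assumes "f \<in> pspan X Y m" "g \<in> pspan X Y n"
  shows "(\<lambda>x. f x * g x) \<in> pspan X Y (m + n)"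
  using assms(1)
proof (induction rule: pspan_induct)
  case (add f1 f2)
  from pspan_add[OF this] show ?case by (simp add: distrib_right)
next
  case (scale r f)
  from pspan_scale[OF this, of r] show ?case by (simp add: mult.assoc)
next
  case (monom i j)
  from assms(2) show ?case
  proof (induction rule: pspan_induct)
    case (add f1 f2)
    from pspan_add[OF this] show ?case by (simp add: distrib_left)
  next
    case (scale r f)
    from pspan_scale[OF this, of r] show ?case by (simp add: mult.left_commute)
  next
    case (monom i' j')
    from pspan_monom[of "i + i'" "j + j'" "m + n" X Y] monom \<open>i + j \<le> m\<close> show ?case
      by (simp add: power_add mult_ac)
  qed
qed

lemma pspan_const: "(\<lambda>x. r) \<in> pspan X Y d"
  using pspan_scale[OF pspan_monom[of 0 0 d X Y], of r] by simp

lemma pspan_power: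
  assumes "f \<in> pspan X Y m" shows "(\<lambda>x. f x ^ n) \<in> pspan X Y (m * n)"
  by (induction n) (use assms in \<open>auto intro: pspan_const pspan_mult\<close>)

lemma pspan_mult_le:
  "f \<in> pspan X Y m \<Longrightarrow> g \<in> pspan X Y n \<Longrightarrow> m + n \<le> k \<Longrightarrow> (\<lambda>x. f x * g x) \<in> pspan X Y k"
  using pspan_mono[OF pspan_mult] .

text \<open>Affine change of coordinates: a monomial of total degree \<open>i + j\<close> becomes a
  product of \<open>i + j\<close> functions of degree 1. It serves to pass to adapted coordinates
  and to return from them, both times without loss in the degree.\<close>

lemma pspan_subst:
  assumes "f \<in> pspan X Y d" "X \<in> pspan X' Y' 1" "Y \<in> pspan X' Y' 1"
  shows "f \<in> pspan X' Y' d"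
  using assms(1)
proof (induction rule: pspan_induct)
  case (monom i j)
  then show ?case
    using pspan_power[OF assms(2), of i] pspan_power[OF assms(3), of j]
    by (auto intro: pspan_mult_le)
qed (auto intro: pspan_add pspan_scale)

lemma Pd_eq_pspan: "Pd d = pspan (\<lambda>x. x $ 1) (\<lambda>x. x $ 2) d"
  unfolding Pd_def pspan_def by simp

lemmas Pd_add = pspan_add[of _ "\<lambda>x::point. x $ 1" "\<lambda>x::point. x $ 2", folded Pd_eq_pspan]
lemmas Pd_scale = pspan_scale[of _ "\<lambda>x::point. x $ 1" "\<lambda>x::point. x $ 2", folded Pd_eq_pspan]
lemmas Pd_sum = pspan_sum[of _ _ "\<lambda>x::point. x $ 1" "\<lambda>x::point. x $ 2", folded Pd_eq_pspan]
lemmas Pd_const = pspan_const[of _ "\<lambda>x::point. x $ 1" "\<lambda>x::point. x $ 2", folded Pd_eq_pspan]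
lemmas Pd_mono = pspan_mono[of _ "\<lambda>x::point. x $ 1" "\<lambda>x::point. x $ 2", folded Pd_eq_pspan]
lemmas Pd_mult = pspan_mult[of _ "\<lambda>x::point. x $ 1" "\<lambda>x::point. x $ 2", folded Pd_eq_pspan]
lemmas Pd_power = pspan_power[of _ "\<lambda>x::point. x $ 1" "\<lambda>x::point. x $ 2", folded Pd_eq_pspan]
lemmas Pd_induct [consumes 1, case_names add scale monom] =
  pspan_induct[of _ "\<lambda>x::point. x $ 1" "\<lambda>x::point. x $ 2", folded Pd_eq_pspan]

lemma Pd_coords: "(\<lambda>x. x $ 1) \<in> Pd 1" "(\<lambda>x. x $ 2) \<in> Pd 1"
  using pspan_monom[of 1 0 1 "\<lambda>x::point. x $ 1" "\<lambda>x::point. x $ 2"]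
    pspan_monom[of 0 1 1 "\<lambda>x::point. x $ 1" "\<lambda>x::point. x $ 2"]
  by (simp_all add: Pd_eq_pspan)

lemma Pd_diff: "f \<in> Pd d \<Longrightarrow> g \<in> Pd d \<Longrightarrow> (\<lambda>x. f x - g x) \<in> Pd d"
  using Pd_add[of f d "\<lambda>x. (-1) * g x"] Pd_scale[of g d "-1"] by simp

text \<open>Restriction to lines reduces bivariate questions to \<open>real poly\<close>, where root
  counting and divisibility are available. The order of vanishing is defined in the same
  way.\<close>

lemma Pd_line:
  assumes "f \<in> Pd d" shows "\<exists>p. \<forall>t. f (u + t *\<^sub>R h) = poly p t"
  using assms
proof (induction rule: Pd_induct)
  case (add f g)
  then obtain p q where "\<forall>t. f (u + t *\<^sub>R h) = poly p t" "\<forall>t. g (u + t *\<^sub>R h) = poly q t"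
    by blast
  then show ?case by (intro exI[of _ "p + q"]) simp
next
  case (scale r f)
  then obtain p where "\<forall>t. f (u + t *\<^sub>R h) = poly p t" by blast
  then show ?case by (intro exI[of _ "smult r p"]) simp
next
  case (monom i j)
  show ?case
    by (intro exI[of _ "[:u $ 1, h $ 1:] ^ i * [:u $ 2, h $ 2:] ^ j"]) (simp add: poly_power)
qed

lemma poly_zero_interval:
  fixes p :: "real poly"
  assumes "e > 0" "\<And>t. 0 < t \<Longrightarrow> t < e \<Longrightarrow> poly p t = 0"
  shows "p = 0"
proof (rule ccontr)
  assume "p \<noteq> 0"
  then have "finite {t. poly p t = 0}" by (rule poly_roots_finite)
  moreover have "{0<..<e} \<subseteq> {t. poly p t = 0}" using assms by auto
  ultimately have "finite {0<..<e}" by (rule rev_finite_subset)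
  then show False using assms(1) by (simp add: infinite_Ioo)
qed

text \<open>On the line from a point \<open>u\<close> of the open set to an arbitrary
  \<open>x\<close> there are infinitely many zeros, so the restriction is the zero polynomial; its
  value at parameter 1 is the value at \<open>x\<close>.\<close>

lemma Pd_zero_open:
  assumes "f \<in> Pd d" "open U" "U \<noteq> {}" "\<And>x. x \<in> U \<Longrightarrow> f x = 0"
  shows "f x = 0"
proof -
  obtain u where "u \<in> U" using assms by blast
  then obtain e where e: "e > 0" "ball u e \<subseteq> U" using assms(2) openE by blast
  obtain p where p: "\<And>t. f (u + t *\<^sub>R (x - u)) = poly p t" using Pd_line[OF assms(1)] by metis
  have "p = 0"
  proof (rule poly_zero_interval)
    \<comment> \<open>The summand 1 keeps the bound meaningful when \<open>x = u\<close>.\<close>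
    show "e / (norm (x - u) + 1) > 0" using e by (simp add: add_nonneg_pos)
    fix t :: real assume t: "0 < t" "t < e / (norm (x - u) + 1)"
    have "t * norm (x - u) < e"
    proof -
      have "t * norm (x - u) \<le> t * (norm (x - u) + 1)" using t by simp
      also have "\<dots> < e" using t by (simp add: pos_less_divide_eq add_nonneg_pos)
      finally show ?thesis .
    qed
    then have "u + t *\<^sub>R (x - u) \<in> ball u e" using t by (simp add: dist_norm)
    then show "poly p t = 0" using assms(4) e p by (metis subsetD)
  qed
  with p[of 1] show ?thesis by simp
qed

lemma Pd_eq_open:
  assumes "f \<in> Pd m" "g \<in> Pd n" "open U" "U \<noteq> {}" "\<And>x. x \<in> U \<Longrightarrow> f x = g x"
  shows "f = g"
proof
  fix x
  have "(\<lambda>x. f x - g x) \<in> Pd (max m n)"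
    using assms by (intro Pd_diff) (auto intro: Pd_mono)
  from Pd_zero_open[OF this assms(3,4)] assms(5) show "f x = g x" by force
qed

subsection \<open>Derivatives\<close>

lemma point_axis_expand: "(h::point) = h $ 1 *\<^sub>R axis 1 1 + h $ 2 *\<^sub>R axis 2 1"
  by (simp add: vec_eq_iff forall_2 axis_def)

lemma grad_eqI:
  assumes "(f has_derivative (\<lambda>h. g \<bullet> h)) (at x)"
  shows "grad f x = g"
proof -
  have "frechet_derivative f (at x) = (\<lambda>h. g \<bullet> h)"
    using assms by (metis frechet_derivative_at)
  then show ?thesis by (simp add: grad_def vec_eq_iff inner_axis)
qed

lemma differentiable_grad:
  assumes "f differentiable (at x)"
  shows "(f has_derivative (\<lambda>h. grad f x \<bullet> h)) (at x)"
proof -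
  let ?L = "frechet_derivative f (at x)"
  have L: "(f has_derivative ?L) (at x)" using assms frechet_derivative_works by blast
  then have lin: "linear ?L" using has_derivative_linear by blast
  have "?L h = grad f x \<bullet> h" for h
  proof -
    have "?L h = ?L (h $ 1 *\<^sub>R axis 1 1 + h $ 2 *\<^sub>R axis 2 1)"
      using point_axis_expand by metis
    also have "\<dots> = h $ 1 * ?L (axis 1 1) + h $ 2 * ?L (axis 2 1)"
      by (simp add: linear_add[OF lin] linear_scale[OF lin])
    finally show ?thesis by (simp add: grad_def inner_vec_def sum_2 mult.commute)
  qed
  then show ?thesis using L by (metis (no_types, lifting) ext)
qed

lemma Pd_deriv:
  assumes "f \<in> Pd d"
  shows "\<exists>g1\<in>Pd d. \<exists>g2\<in>Pd d. \<forall>x. (f has_derivative (\<lambda>h. vector [g1 x, g2 x] \<bullet> h)) (at x)"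
  using assms
proof (induction rule: Pd_induct)
  case (add f g)
  then obtain a b a' b' where *: "a \<in> Pd d" "b \<in> Pd d" "a' \<in> Pd d" "b' \<in> Pd d"
    "\<And>x. (f has_derivative (\<lambda>h. vector [a x, b x] \<bullet> h)) (at x)"
    "\<And>x. (g has_derivative (\<lambda>h. vector [a' x, b' x] \<bullet> h)) (at x)" by blast
  have "((\<lambda>x. f x + g x) has_derivative (\<lambda>h. vector [a x + a' x, b x + b' x] \<bullet> h)) (at x)" for x
    by (rule has_derivative_eq_rhs[OF has_derivative_add[OF *(5,6)]])
      (simp add: fun_eq_iff inner_vec_def sum_2 algebra_simps)
  then show ?case
    by (intro bexI[OF _ Pd_add[OF *(1,3)]] bexI[OF _ Pd_add[OF *(2,4)]]) simp
next
  case (scale r f)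
  then obtain a b where *: "a \<in> Pd d" "b \<in> Pd d"
    "\<And>x. (f has_derivative (\<lambda>h. vector [a x, b x] \<bullet> h)) (at x)" by blast
  have "((\<lambda>x. r * f x) has_derivative (\<lambda>h. vector [r * a x, r * b x] \<bullet> h)) (at x)" for x
    by (rule has_derivative_eq_rhs[OF has_derivative_mult_right[OF *(3)]])
      (simp add: fun_eq_iff inner_vec_def sum_2 algebra_simps)
  then show ?case
    by (intro bexI[OF _ Pd_scale[OF *(1), of r]] bexI[OF _ Pd_scale[OF *(2), of r]]) simp
next
  case (monom i j)
  \<comment> \<open>For \<open>i = 0\<close> the truncated exponent \<open>i - 1\<close> is 0
    instead of -1, which is harmless because of the factor \<open>real i\<close>; likewise for
    \<open>j\<close>.\<close>
  let ?a = "\<lambda>x::point. real i * (x $ 1 ^ (i - 1) * x $ 2 ^ j)"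
  let ?b = "\<lambda>x::point. real j * (x $ 1 ^ i * x $ 2 ^ (j - 1))"
  have "?a \<in> Pd d" "?b \<in> Pd d"
    using monom unfolding Pd_eq_pspan
    by (intro pspan_scale pspan_monom; simp)+
  moreover have "((\<lambda>x::point. x $ 1 ^ i * x $ 2 ^ j) has_derivative
      (\<lambda>h. vector [?a x, ?b x] \<bullet> h)) (at x)" for x
  proof -
    have c: "((\<lambda>x::point. x $ k) has_derivative (\<lambda>h. h $ k)) (at x)" for k
      by (rule bounded_linear_imp_has_derivative) (rule bounded_linear_vec_nth)
    show ?thesis
      by (rule has_derivative_eq_rhs[OF has_derivative_mult[OF
            has_derivative_power[OF c[of 1]] has_derivative_power[OF c[of 2]]]])
        (simp add: fun_eq_iff inner_vec_def sum_2 algebra_simps)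
  qed
  ultimately show ?case by (intro bexI[of _ ?a] bexI[of _ ?b]) simp_all
qed

lemma Pd_grad:
  assumes "f \<in> Pd d"
  shows "(f has_derivative (\<lambda>h. grad f x \<bullet> h)) (at x)"
  using Pd_deriv[OF assms] by (meson differentiable_def differentiable_grad)

lemma Pd_grad_nth:
  assumes "f \<in> Pd d" shows "(\<lambda>x. grad f x $ k) \<in> Pd d"
proof -
  obtain g1 g2 where g: "g1 \<in> Pd d" "g2 \<in> Pd d"
    "\<And>x. (f has_derivative (\<lambda>h. vector [g1 x, g2 x] \<bullet> h)) (at x)"
    using Pd_deriv[OF assms] by blast
  then have "grad f x = vector [g1 x, g2 x]" for x by (intro grad_eqI)
  then show ?thesis using g exhaust_2[of k] by auto
qed

lemma Pd_continuous: "f \<in> Pd d \<Longrightarrow> continuous_on A f"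
  using Pd_grad[of f d] by (meson continuous_at_imp_continuous_on has_derivative_continuous)

lemma has_derivative_vecI:
  fixes F :: "point \<Rightarrow> point"
  assumes "\<And>k. ((\<lambda>x. F x $ k) has_derivative (\<lambda>h. F' h $ k)) (at x)"
  shows "(F has_derivative F') (at x)"
  using assms
  by (subst has_derivative_componentwise_within)
    (auto simp: Basis_vec_def inner_axis)

lemma Pd_grad_differentiable:
  assumes "f \<in> Pd d" shows "grad f differentiable (at x)"
proof -
  have "((\<lambda>x. grad f x $ k) has_derivative (\<lambda>h. grad (\<lambda>x. grad f x $ k) x \<bullet> h)) (at x)" for k
    using Pd_grad[OF Pd_grad_nth[OF assms]] .
  then have "(grad f has_derivative (\<lambda>h. \<chi> k. grad (\<lambda>x. grad f x $ k) x \<bullet> h)) (at x)"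
    by (intro has_derivative_vecI) simp
  then show ?thesis using differentiable_def by blast
qed

lemma grad_diff:
  assumes "f differentiable (at x)" "g differentiable (at x)"
  shows "grad (\<lambda>x. f x - g x) x = grad f x - grad g x"
  by (rule grad_eqI, rule has_derivative_eq_rhs,
     rule has_derivative_diff[OF differentiable_grad[OF assms(1)] differentiable_grad[OF assms(2)]])
   (simp add: inner_diff_left)

lemma grad_mult:
  assumes "f differentiable (at x)" "g differentiable (at x)"
  shows "grad (\<lambda>x. f x * g x) x = f x *\<^sub>R grad g x + g x *\<^sub>R grad f x"
  by (rule grad_eqI, rule has_derivative_eq_rhs,
     rule has_derivative_mult[OF differentiable_grad[OF assms(1)] differentiable_grad[OF assms(2)]])
   (simp add: inner_add_left mult.commute)

lemma Pd_differentiable: "f \<in> Pd d \<Longrightarrow> f differentiable (at x)"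
  using Pd_grad differentiable_def by blast

section \<open>Order of vanishing\<close>

text \<open>For polynomials this means that all derivatives of order less than \<open>n\<close> vanish at \<open>x\<close>.\<close>

definition van :: "nat \<Rightarrow> (point \<Rightarrow> real) \<Rightarrow> point \<Rightarrow> bool" where
  "van n f x \<longleftrightarrow> (\<forall>h. \<exists>r. \<forall>t. f (x + t *\<^sub>R h) = t ^ n * poly r t)"

lemma van_Pd: "f \<in> Pd d \<Longrightarrow> van 0 f x"
  unfolding van_def using Pd_line by simp

lemma van_zero: "van n (\<lambda>x. 0) x"
  unfolding van_def by (intro allI exI[of _ 0]) simp

lemma van_add: "van n f x \<Longrightarrow> van n g x \<Longrightarrow> van n (\<lambda>x. f x + g x) x"
  unfolding van_def by (metis distrib_left poly_add)

lemma van_scale: "van n f x \<Longrightarrow> van n (\<lambda>x. r * f x) x"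
  unfolding van_def by (metis mult.left_commute poly_smult)

lemma van_diff: "van n f x \<Longrightarrow> van n g x \<Longrightarrow> van n (\<lambda>x. f x - g x) x"
  unfolding van_def by (metis right_diff_distrib poly_diff)

lemma van_sum: "(\<And>i. i \<in> I \<Longrightarrow> van n (f i) x) \<Longrightarrow> van n (\<lambda>x. \<Sum>i\<in>I. f i x) x"
  by (induction I rule: infinite_finite_induct) (auto simp: van_zero intro: van_add)

lemma van_mult: "van m f x \<Longrightarrow> van n g x \<Longrightarrow> van (m + n) (\<lambda>x. f x * g x) x"
  unfolding van_def
proof
  fix h
  assume "\<forall>h. \<exists>r. \<forall>t. f (x + t *\<^sub>R h) = t ^ m * poly r t"
    "\<forall>h. \<exists>r. \<forall>t. g (x + t *\<^sub>R h) = t ^ n * poly r t"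
  then obtain r s where "\<forall>t. f (x + t *\<^sub>R h) = t ^ m * poly r t"
    "\<forall>t. g (x + t *\<^sub>R h) = t ^ n * poly s t" by meson
  then show "\<exists>r. \<forall>t. f (x + t *\<^sub>R h) * g (x + t *\<^sub>R h) = t ^ (m + n) * poly r t"
    by (intro exI[of _ "r * s"]) (simp add: power_add mult_ac)
qed

lemma van_mono: "van n f x \<Longrightarrow> m \<le> n \<Longrightarrow> van m f x"
  unfolding van_def
proof
  fix h
  assume "\<forall>h. \<exists>r. \<forall>t. f (x + t *\<^sub>R h) = t ^ n * poly r t" and mn: "m \<le> n"
  then obtain r where r: "\<forall>t. f (x + t *\<^sub>R h) = t ^ n * poly r t" by meson
  have "(t::real) ^ n = t ^ m * t ^ (n - m)" for t
    using mn by (simp flip: power_add)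
  with r have "\<forall>t. f (x + t *\<^sub>R h) = t ^ m * poly (monom 1 (n - m) * r) t"
    by (simp add: poly_monom)
  then show "\<exists>r. \<forall>t. f (x + t *\<^sub>R h) = t ^ m * poly r t" by blast
qed

lemma van_mult_left: "van n f x \<Longrightarrow> g \<in> Pd d \<Longrightarrow> van n (\<lambda>x. f x * g x) x"
  using van_mult[OF _ van_Pd, of n f x g d] by simp

lemma van_mult_right: "van n f x \<Longrightarrow> g \<in> Pd d \<Longrightarrow> van n (\<lambda>x. g x * f x) x"
  using van_mult_left[of n f x g d] by (simp add: mult.commute)

lemma van_power: "van m f x \<Longrightarrow> van (m * n) (\<lambda>x. f x ^ n) x"
proof (induction n)
  case 0
  show ?case using van_Pd[OF Pd_const] by simp
next
  case (Suc n)
  then show ?case using van_mult[of m f x "m * n" "\<lambda>x. f x ^ n"] by simp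
qed

lemma van_Suc_imp_zero: "van (Suc n) f x \<Longrightarrow> f x = 0"
  unfolding van_def by (metis add.right_neutral mult_zero_left power_0_Suc scaleR_zero_left)

lemma van_1_iff: assumes "f \<in> Pd d" shows "van 1 f x \<longleftrightarrow> f x = 0"
proof
  assume f: "f x = 0"
  show "van 1 f x" unfolding van_def
  proof
    fix h
    obtain p where p: "\<And>t. f (x + t *\<^sub>R h) = poly p t" using Pd_line[OF assms] by metis
    from p[of 0] f have "poly p 0 = 0" by simp
    then obtain q where "p = [:0, 1:] * q" using poly_eq_0_iff_dvd[of p 0] by (auto simp: dvd_def)
    then show "\<exists>r. \<forall>t. f (x + t *\<^sub>R h) = t ^ 1 * poly r t"
      using p by (intro exI[of _ q]) simp
  qed
qed (use van_Suc_imp_zero[of 0] in simp)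

lemma van_sym: "van n (\<lambda>x. f x - g x) x \<Longrightarrow> van n (\<lambda>x. g x - f x) x"
  using van_scale[of n "\<lambda>x. f x - g x" x "-1"] by simp

lemma van_trans:
  "van n (\<lambda>x. f x - g x) x \<Longrightarrow> van n (\<lambda>x. g x - h x) x \<Longrightarrow> van n (\<lambda>x. f x - h x) x"
  using van_add[of n "\<lambda>x. f x - g x" x "\<lambda>x. g x - h x"] by simp

lemma van_directional:
  assumes f: "f \<in> Pd d" and p: "\<And>t. f (x + t *\<^sub>R h) = poly p t"
  shows "poly (pderiv p) t = grad f (x + t *\<^sub>R h) \<bullet> h"
proof -
  have "((\<lambda>t. f (x + t *\<^sub>R h)) has_derivative (\<lambda>s. grad f (x + t *\<^sub>R h) \<bullet> (s *\<^sub>R h))) (at t)"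
    by (rule has_derivative_compose[of "\<lambda>t. x + t *\<^sub>R h" _ _ _ f, OF _ Pd_grad[OF f]])
      (auto intro!: derivative_eq_intros)
  then have "(poly p has_real_derivative grad f (x + t *\<^sub>R h) \<bullet> h) (at t)"
    unfolding has_field_derivative_def p by (rule has_derivative_eq_rhs) (simp add: fun_eq_iff)
  with poly_DERIV[of p t] show ?thesis by (rule DERIV_unique)
qed

lemma monom_dvd_2: "poly p 0 = 0 \<Longrightarrow> poly (pderiv p) 0 = 0 \<Longrightarrow> \<exists>r::real poly. p = monom 1 2 * r"
  by (rule dvdE[of "monom 1 2" p])
    (auto simp: monom_1_dvd_iff' less_2_cases_iff poly_0_coeff_0 coeff_pderiv)

lemma van_2_iff: assumes "f \<in> Pd d" shows "van 2 f x \<longleftrightarrow> f x = 0 \<and> grad f x = 0"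
proof
  assume f: "f x = 0 \<and> grad f x = 0"
  show "van 2 f x" unfolding van_def
  proof
    fix h
    obtain p where p: "\<And>t. f (x + t *\<^sub>R h) = poly p t" using Pd_line[OF assms] by metis
    from p[of 0] f have 1: "poly p 0 = 0" by simp
    from van_directional[OF assms p, of 0] f have 2: "poly (pderiv p) 0 = 0" by simp
    from monom_dvd_2[OF 1 2] obtain r where "p = monom 1 2 * r" ..
    then show "\<exists>r. \<forall>t. f (x + t *\<^sub>R h) = t ^ 2 * poly r t"
      using p by (intro exI[of _ r]) (simp add: poly_monom)
  qed
next
  assume v: "van 2 f x"
  have "grad f x \<bullet> h = 0" for h
  proof -
    obtain r where r: "\<And>t. f (x + t *\<^sub>R h) = t ^ 2 * poly r t" using v unfolding van_def by meson
    then have "f (x + t *\<^sub>R h) = poly (monom 1 2 * r) t" for t by (simp add: poly_monom)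
    from van_directional[OF assms this, of 0] have "grad f x \<bullet> h = poly (pderiv (monom 1 2 * r)) 0"
      by simp
    also have "\<dots> = 0" by (simp add: pderiv_mult pderiv_monom poly_monom)
    finally show ?thesis .
  qed
  then have "grad f x = 0" by (metis inner_eq_zero_iff)
  then show "f x = 0 \<and> grad f x = 0" using v van_Suc_imp_zero[of 1] by (simp add: numeral_2_eq_2)
qed

text \<open>On a line through \<open>x\<close> the coefficients of degree 0, 1 and 2 are the value,
  the directional derivative and half of the second directional derivative, and the last one is read
  off from the derivative of \<open>grad f\<close>. This is how twice differentiability of a spline
  at a vertex enters the algebra.\<close>

lemma van_3I:
  assumes f: "f \<in> Pd d" and "f x = 0" "grad f x = 0" and der: "(grad f has_derivative (\<lambda>_. 0)) (at x)"
  shows "van 3 f x"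
  unfolding van_def
proof
  fix h
  obtain p where p: "\<And>t. f (x + t *\<^sub>R h) = poly p t" using Pd_line[OF f] by metis
  from p[of 0] assms have 1: "coeff p 0 = 0" by (simp add: poly_0_coeff_0)
  from van_directional[OF f p, of 0] assms have 2: "coeff p 1 = 0"
    by (simp add: poly_0_coeff_0 coeff_pderiv)
  have "((\<lambda>t. grad f (x + t *\<^sub>R h) \<bullet> h) has_derivative (\<lambda>s. 0 \<bullet> h)) (at 0)"
    by (rule has_derivative_inner_left, rule has_derivative_compose[of "\<lambda>t. x + t *\<^sub>R h" _ _ _ "grad f"])
     (use der in \<open>auto intro!: derivative_eq_intros\<close>)
  then have "(poly (pderiv p) has_real_derivative 0) (at 0)"
    unfolding has_field_derivative_def van_directional[OF f p, symmetric]
    by (rule has_derivative_eq_rhs) (simp add: fun_eq_iff)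
  with poly_DERIV have "poly (pderiv (pderiv p)) 0 = 0" by (rule DERIV_unique)
  then have 3: "coeff p 2 = 0" by (simp add: poly_0_coeff_0 coeff_pderiv numeral_2_eq_2)
  have "coeff p i = 0" if "i < 3" for i
  proof -
    from that have "i = 0 \<or> i = 1 \<or> i = 2" by auto
    with 1 2 3 show ?thesis by auto
  qed
  then have "monom 1 3 dvd p" by (simp add: monom_1_dvd_iff')
  then obtain r where "p = monom 1 3 * r" by (auto simp: dvd_def)
  then show "\<exists>r. \<forall>t. f (x + t *\<^sub>R h) = t ^ 3 * poly r t"
    using p by (intro exI[of _ r]) (simp add: poly_monom)
qed

section \<open>The Bernstein--Bezier form\<close>

definition bbpoly where
  "bbpoly d a b c coef = (\<lambda>x. \<Sum>\<alpha>\<in>indices d. coef \<alpha> * bernstein d a b c \<alpha> x)"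

text \<open>The barycentric coordinate that belongs to the first argument. Those of \<open>b\<close>
  and \<open>c\<close> are \<open>bary b a c\<close> and \<open>bary c a b\<close>, so one function
  and its lemmas serve all three.\<close>

definition bary :: "point \<Rightarrow> point \<Rightarrow> point \<Rightarrow> point \<Rightarrow> real" where
  "bary a b c x = area2 x b c / area2 a b c"

lemma area2_swap: "area2 b a c = - area2 a b c" "area2 a c b = - area2 a b c"
  "area2 b c a = area2 a b c"
  by (simp_all add: area2_def algebra_simps)

lemma bernstein_bary:
  "bernstein d a b c (i, j, k) x =
   fact d / (fact i * fact j * fact k) * bary a b c x ^ i * bary b a c x ^ j * bary c a b x ^ k"
proof -
  have "area2 a x c / area2 a b c = bary b a c x"
    unfolding bary_def using area2_swap(1)[of x a c] area2_swap(1)[of b a c] by simp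
  moreover have "area2 a b x / area2 a b c = bary c a b x"
    unfolding bary_def using area2_swap(3)[of a b x] area2_swap(3)[of a b c] area2_swap(3)[of x a b]
      area2_swap(3)[of c a b] by simp
  ultimately show ?thesis by (simp add: bernstein_def bary_def)
qed

lemma bary_forms:
  "bary b a c x = - area2 x a c / area2 a b c" "bary c a b x = area2 x a b / area2 a b c"
proof -
  have "area2 b a c = - area2 a b c" "area2 c a b = area2 a b c"
    by (simp_all add: area2_def algebra_simps)
  then show "bary b a c x = - area2 x a c / area2 a b c" "bary c a b x = area2 x a b / area2 a b c"
    unfolding bary_def by simp_all
qed

lemma bary_swap: "bary a c b x = bary a b c x"
  unfolding bary_def using area2_swap(2)[of x b c] area2_swap(2)[of a b c] by simp

lemma bary_sum:
  assumes "area2 a b c \<noteq> 0"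
  shows "bary a b c x + bary b a c x + bary c a b x = 1"
proof -
  have "area2 x b c + - area2 x a c + area2 x a b = area2 a b c"
    by (simp add: area2_def algebra_simps)
  then show ?thesis using assms unfolding bary_forms[where a=a and b=b and c=c] bary_def[of a b c]
    by (simp flip: add_divide_distrib diff_divide_distrib)
qed

lemma bary_expand:
  assumes "area2 a b c \<noteq> 0"
  shows "x = bary a b c x *\<^sub>R a + bary b a c x *\<^sub>R b + bary c a b x *\<^sub>R c"
proof -
  have "area2 a b c *\<^sub>R x = area2 x b c *\<^sub>R a + (- area2 x a c) *\<^sub>R b + area2 x a b *\<^sub>R c"
    by (simp add: area2_def vec_eq_iff forall_2 algebra_simps)
  moreover have "bary a b c x = inverse (area2 a b c) * area2 x b c"
    "bary b a c x = inverse (area2 a b c) * (- area2 x a c)"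
    "bary c a b x = inverse (area2 a b c) * area2 x a b"
    unfolding bary_forms[where a=a and b=b and c=c] bary_def[of a b c] by (simp_all add: divide_inverse mult.commute)
  then have "bary a b c x *\<^sub>R a + bary b a c x *\<^sub>R b + bary c a b x *\<^sub>R c =
    inverse (area2 a b c) *\<^sub>R (area2 x b c *\<^sub>R a + (- area2 x a c) *\<^sub>R b + area2 x a b *\<^sub>R c)"
    by (simp only: scaleR_add_right scaleR_scaleR)
  ultimately show ?thesis using assms by (metis scaleR_scaleR left_inverse scaleR_one)
qed

lemma bary_affine:
  "u + v = 1 \<Longrightarrow> bary a b c (u *\<^sub>R x + v *\<^sub>R y) = u * bary a b c x + v * bary a b c y"
proof -
  assume "u + v = 1"
  then have u: "u = 1 - v" by simp
  show ?thesis
    unfolding bary_def add_divide_distrib[symmetric] times_divide_eq_right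
    by (rule arg_cong[of _ _ "\<lambda>z. z / area2 a b c"]) (simp add: u area2_def algebra_simps)
qed

lemma bary_self: "area2 a b c \<noteq> 0 \<Longrightarrow> bary a b c a = 1"
  "bary a b c b = 0" "bary a b c c = 0"
  by (simp_all add: bary_def area2_def)

lemma bary_add: "bary a b c (x + t *\<^sub>R h) = bary a b c x + t * (bary a b c (x + h) - bary a b c x)"
  unfolding bary_def add_divide_distrib[symmetric] diff_divide_distrib[symmetric] times_divide_eq_right
  by (rule arg_cong[of _ _ "\<lambda>z. z / area2 a b c"]) (simp add: area2_def algebra_simps)

lemma bary_Pd: "bary a b c \<in> Pd 1"
proof -
  have "bary a b c x = ((b $ 1 * c $ 2 - b $ 2 * c $ 1) / area2 a b c +
     ((b $ 2 - c $ 2) / area2 a b c) * x $ 1) + ((c $ 1 - b $ 1) / area2 a b c) * x $ 2" for x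
    unfolding bary_def area2_def
    by (simp add: add_divide_distrib[symmetric] algebra_simps diff_divide_distrib[symmetric])
  then have "bary a b c = (\<lambda>x. ((b $ 1 * c $ 2 - b $ 2 * c $ 1) / area2 a b c +
     ((b $ 2 - c $ 2) / area2 a b c) * x $ 1) + ((c $ 1 - b $ 1) / area2 a b c) * x $ 2)" by blast
  also have "\<dots> \<in> Pd 1"
    by (intro Pd_add Pd_scale Pd_const Pd_coords)
  finally show ?thesis .
qed

lemma finite_indices: "finite (indices d)"
  by (rule finite_subset[of _ "{..d} \<times> {..d} \<times> {..d}"]) (auto simp: indices_def)

lemma bernstein_Pd: "\<alpha> \<in> indices d \<Longrightarrow> bernstein d a b c \<alpha> \<in> Pd d"
proof -
  assume "\<alpha> \<in> indices d"
  then obtain i j k where \<alpha>: "\<alpha> = (i, j, k)" "i + j + k = d" by (auto simp: indices_def)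
  have "(\<lambda>x. fact d / (fact i * fact j * fact k) *
    ((bary a b c x ^ i * bary b a c x ^ j) * bary c a b x ^ k)) \<in> Pd (1 * i + 1 * j + 1 * k)"
    by (intro Pd_scale Pd_mult Pd_power bary_Pd)
  then show ?thesis unfolding \<alpha>(1) bernstein_bary[abs_def] using \<alpha>(2) by (simp add: mult.assoc)
qed

lemma bbpoly_Pd: "bbpoly d a b c coef \<in> Pd d"
  unfolding bbpoly_def by (intro Pd_sum Pd_scale bernstein_Pd)

lemma bary_self_else:
  assumes "area2 a b c \<noteq> 0"
  shows "bary b a c b = 1" "bary c a b c = 1"
proof -
  have "- area2 b a c = area2 a b c" "area2 c a b = area2 a b c"
    by (simp_all add: area2_def algebra_simps)
  then show "bary b a c b = 1" "bary c a b c = 1"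
    unfolding bary_forms[where a=a and b=b and c=c] using assms by simp_all
qed

text \<open>Homogenisation: the coordinates of the plane are linear combinations of the barycentric
  ones, so monomials of degree \<open>n\<close> become forms of degree \<open>n\<close> in these;
  forms of too low degree are raised by multiplying with the sum of the barycentric coordinates,
  which is 1.\<close>

lemma Pd_bbpoly:
  assumes nc: "area2 a b c \<noteq> 0" and f: "f \<in> Pd d"
  shows "\<exists>coef. f = bbpoly d a b c coef"
proof -
  define m where "m = (\<lambda>(i, j, k) x. bary a b c x ^ i * bary b a c x ^ j * bary c a b x ^ k)"
  define H where "H d = {f. \<exists>coef. f = (\<lambda>x. \<Sum>\<alpha>\<in>indices d. coef \<alpha> * m \<alpha> x)}" for d
  have Hadd: "(\<lambda>x. f x + g x) \<in> H d" if fg: "f \<in> H d" "g \<in> H d" for f g d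
  proof -
    obtain u v where "f = (\<lambda>x. \<Sum>\<alpha>\<in>indices d. u \<alpha> * m \<alpha> x)" "g = (\<lambda>x. \<Sum>\<alpha>\<in>indices d. v \<alpha> * m \<alpha> x)"
      using fg unfolding H_def by auto
    then show ?thesis unfolding H_def
      by (intro CollectI exI[of _ "\<lambda>\<alpha>. u \<alpha> + v \<alpha>"]) (simp add: distrib_right sum.distrib)
  qed
  have Hscale: "(\<lambda>x. r * f x) \<in> H d" if f: "f \<in> H d" for f r d
  proof -
    obtain u where "f = (\<lambda>x. \<Sum>\<alpha>\<in>indices d. u \<alpha> * m \<alpha> x)"
      using f unfolding H_def by auto
    then show ?thesis unfolding H_def
      by (intro CollectI exI[of _ "\<lambda>\<alpha>. r * u \<alpha>"]) (simp add: sum_distrib_left mult.assoc)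
  qed
  have Hm: "m \<alpha> \<in> H d" if "\<alpha> \<in> indices d" for \<alpha> d
  proof -
    have "m \<alpha> = (\<lambda>x. \<Sum>\<beta>\<in>indices d. (if \<beta> = \<alpha> then 1 else 0) * m \<beta> x)"
      using that finite_indices by (auto simp: if_distrib[of "\<lambda>z. z * _"] sum.delta cong: if_cong)
    then show ?thesis unfolding H_def by (intro CollectI exI)
  qed
  have Hsum: "(\<lambda>x. \<Sum>\<alpha>\<in>A. g \<alpha> x) \<in> H d" if "\<And>\<alpha>. \<alpha> \<in> A \<Longrightarrow> g \<alpha> \<in> H d" "finite A"
    for A :: "(nat \<times> nat \<times> nat) set" and g d
    using that(2,1)
  proof (induction rule: finite_induct)
    case empty
    have "(\<lambda>x. 0) = (\<lambda>x. 0 * m (d, 0, 0) x)" by simp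
    also have "\<dots> \<in> H d" by (rule Hscale, rule Hm) (simp add: indices_def)
    finally show ?case by simp
  qed (auto intro: Hadd)
  have Hb: "(\<lambda>x. bary a b c x * f x) \<in> H (Suc d) \<and> (\<lambda>x. bary b a c x * f x) \<in> H (Suc d) \<and>
      (\<lambda>x. bary c a b x * f x) \<in> H (Suc d)" if f: "f \<in> H d" for f d
  proof -
    obtain u where u: "f = (\<lambda>x. \<Sum>\<alpha>\<in>indices d. u \<alpha> * m \<alpha> x)"
      using f unfolding H_def by auto
    have "(\<lambda>x. \<Sum>\<alpha>\<in>indices d. u \<alpha> * (bary a b c x * m \<alpha> x)) \<in> H (Suc d)"
    proof (intro Hsum Hscale finite_indices)
      fix \<alpha> assume "\<alpha> \<in> indices d"
      then obtain i j k where \<alpha>: "\<alpha> = (i, j, k)" "i + j + k = d" by (auto simp: indices_def)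
      then show "(\<lambda>x. bary a b c x * m \<alpha> x) \<in> H (Suc d)"
        using Hm[of "(Suc i, j, k)" "Suc d"] by (simp add: indices_def m_def mult_ac)
    qed
    moreover have "(\<lambda>x. \<Sum>\<alpha>\<in>indices d. u \<alpha> * (bary b a c x * m \<alpha> x)) \<in> H (Suc d)"
    proof (intro Hsum Hscale finite_indices)
      fix \<alpha> assume "\<alpha> \<in> indices d"
      then obtain i j k where \<alpha>: "\<alpha> = (i, j, k)" "i + j + k = d" by (auto simp: indices_def)
      then show "(\<lambda>x. bary b a c x * m \<alpha> x) \<in> H (Suc d)"
        using Hm[of "(i, Suc j, k)" "Suc d"] by (simp add: indices_def m_def mult_ac)
    qed
    moreover have "(\<lambda>x. \<Sum>\<alpha>\<in>indices d. u \<alpha> * (bary c a b x * m \<alpha> x)) \<in> H (Suc d)"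
    proof (intro Hsum Hscale finite_indices)
      fix \<alpha> assume "\<alpha> \<in> indices d"
      then obtain i j k where \<alpha>: "\<alpha> = (i, j, k)" "i + j + k = d" by (auto simp: indices_def)
      then show "(\<lambda>x. bary c a b x * m \<alpha> x) \<in> H (Suc d)"
        using Hm[of "(i, j, Suc k)" "Suc d"] by (simp add: indices_def m_def mult_ac)
    qed
    ultimately show ?thesis unfolding u by (simp add: sum_distrib_left mult_ac)
  qed
  \<comment> \<open>Degree elevation by the factor
    \<open>1 = bary a b c x + bary b a c x + bary c a b x\<close>.\<close>
  have Hup: "f \<in> H (Suc d)" if "f \<in> H d" for f d
  proof -
    have "(\<lambda>x. (bary a b c x * f x + bary b a c x * f x) + bary c a b x * f x) \<in> H (Suc d)"
      using Hb[OF that] by (intro Hadd) auto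
    moreover have "(\<lambda>x. (bary a b c x * f x + bary b a c x * f x) + bary c a b x * f x) = f"
      using bary_sum[OF nc] by (simp add: distrib_right[symmetric])
    ultimately show ?thesis by simp
  qed
  have Hups: "f \<in> H (d + n)" if "f \<in> H d" for f d n
    by (induction n) (auto simp: that intro: Hup)
  have Hx: "(\<lambda>x. x $ l * f x) \<in> H (Suc d)" if "f \<in> H d" for f d l
  proof -
    have "(\<lambda>x. (a $ l * (bary a b c x * f x) + b $ l * (bary b a c x * f x)) +
       c $ l * (bary c a b x * f x)) \<in> H (Suc d)"
      using Hb[OF that] by (intro Hadd Hscale) auto
    moreover have "(a $ l * (bary a b c x * f x) + b $ l * (bary b a c x * f x)) +
       c $ l * (bary c a b x * f x) = x $ l * f x" for x
    proof -
      have "x $ l = bary a b c x * a $ l + bary b a c x * b $ l + bary c a b x * c $ l"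
        using arg_cong[OF bary_expand[OF nc, of x], of "\<lambda>v. v $ l"] by simp
      then have "x $ l * f x = (bary a b c x * a $ l + bary b a c x * b $ l + bary c a b x * c $ l) * f x"
        by (rule arg_cong)
      then show ?thesis by (simp add: algebra_simps)
    qed
    ultimately show ?thesis by simp
  qed
  have Hmon: "(\<lambda>x. x $ 1 ^ i * x $ 2 ^ j) \<in> H (i + j)" for i j
  proof (induction i)
    case 0
    show ?case
    proof (induction j)
      case 0
      have "m (0, 0, 0) \<in> H 0" by (rule Hm) (simp add: indices_def)
      then show ?case by (simp add: m_def)
    next
      case (Suc j)
      from Hx[OF this, of 2] show ?case by simp
    qed
  next
    case (Suc i)
    from Hx[OF this, of 1] show ?case by (simp add: mult.assoc)
  qed
  have "f \<in> H d" using f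
  proof (induction rule: Pd_induct)
    case (monom i j)
    with Hups[OF Hmon[of i j], of "d - (i + j)"] show ?case by simp
  qed (auto intro: Hadd Hscale)
  then obtain u where u: "f = (\<lambda>x. \<Sum>\<alpha>\<in>indices d. u \<alpha> * m \<alpha> x)"
    unfolding H_def by auto
  \<comment> \<open>Passes from the plain products \<open>m\<close> to the Bernstein polynomials,
    which carry multinomial factors.\<close>
  define v where "v = (\<lambda>(i, j, k). u (i, j, k) * (fact i * fact j * fact k) / fact d)"
  have "u \<alpha> * m \<alpha> x = v \<alpha> * bernstein d a b c \<alpha> x" for \<alpha> x
    by (cases \<alpha>) (simp add: v_def bernstein_bary m_def field_simps)
  then show ?thesis unfolding u bbpoly_def by auto
qed

text \<open>The \<open>m\<close>-th summand starts with the power \<open>m\<close> of the variable,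
  with coefficient \<open>A m\<close>. The system is therefore triangular, and the coefficients
  below \<open>N\<close> vanish one after the other.\<close>

lemma triangular_zero:
  fixes A :: "nat \<Rightarrow> real"
  assumes "(\<Sum>m\<le>d. smult (A m) (monom 1 m * [:1, -\<sigma>:] ^ (d - m))) = monom 1 N * r"
  shows "m < N \<Longrightarrow> m \<le> d \<Longrightarrow> A m = 0"
proof (induction m rule: less_induct)
  case (less m)
  have "0 = coeff (monom 1 N * r) m" using less.prems by (simp add: coeff_monom_mult)
  also have "\<dots> = (\<Sum>m'\<le>d. A m' * coeff (monom 1 m' * [:1, -\<sigma>:] ^ (d - m')) m)"
    unfolding assms[symmetric] by (simp add: coeff_sum)
  also have "\<dots> = (\<Sum>m'\<le>d. if m' = m then A m else 0)"
  proof (rule sum.cong)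
    fix m' assume "m' \<in> {..d}"
    consider "m' < m" | "m' = m" | "m < m'" by linarith
    then show "A m' * coeff (monom 1 m' * [:1, -\<sigma>:] ^ (d - m')) m = (if m' = m then A m else 0)"
    proof cases
      case 1
      then have "A m' = 0" using less by auto
      with 1 show ?thesis by simp
    next
      case 2
      then show ?thesis by (simp add: coeff_monom_mult coeff_0_power)
    qed (simp add: coeff_monom_mult)
  qed simp
  also have "\<dots> = A m" using less.prems by simp
  finally show ?case by simp
qed

lemma triangular_zero':
  fixes A :: "nat \<Rightarrow> real"
  assumes "\<And>t. (\<Sum>m\<le>d. A m * (t ^ m * (1 - \<sigma> * t) ^ (d - m))) = t ^ N * poly r t"
  shows "m < N \<Longrightarrow> m \<le> d \<Longrightarrow> A m = 0"
proof (rule triangular_zero)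
  show "(\<Sum>m\<le>d. smult (A m) (monom 1 m * [:1, -\<sigma>:] ^ (d - m))) = monom 1 N * r"
    using assms by (intro poly_eq_poly_eq_iff[THEN iffD1] ext)
      (simp add: poly_sum poly_monom poly_power mult.commute)
qed auto

text \<open>Summation by rows, where row \<open>m\<close> consists of the domain points at distance
  \<open>m\<close> from the first vertex. The next lemma uses instead the rows parallel to the edge
  opposite to that vertex.\<close>

lemma sum_indices_corner:
  "(\<Sum>\<alpha>\<in>indices d. F \<alpha>) = (\<Sum>m\<le>d. \<Sum>j\<le>m. F (d - m, j, m - j))"
  for F :: "_ \<Rightarrow> 'b::comm_monoid_add"
  unfolding sum.Sigma[OF finite_atMost ballI[OF finite_atMost]]
  by (rule sum.reindex_bij_witness[of _ "\<lambda>(m, j). (d - m, j, m - j)" "\<lambda>(i, j, k). (j + k, j)"])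
    (auto simp: indices_def)

lemma sum_indices_edge:
  "(\<Sum>\<alpha>\<in>indices d. F \<alpha>) = (\<Sum>i\<le>d. \<Sum>k\<le>d - i. F (i, d - i - k, k))"
  for F :: "_ \<Rightarrow> 'b::comm_monoid_add"
  unfolding sum.Sigma[OF finite_atMost ballI[OF finite_atMost]]
  by (rule sum.reindex_bij_witness[of _ "\<lambda>(i, k). (i, d - i - k, k)" "\<lambda>(i, j, k). (i, k)"])
    (auto simp: indices_def)

lemma bary_comb:
  assumes "area2 a b c \<noteq> 0" "u + v + w = 1"
  defines "P \<equiv> u *\<^sub>R a + v *\<^sub>R b + w *\<^sub>R c"
  shows "bary a b c P = u" "bary b a c P = v" "bary c a b P = w"
proof -
  have u: "u = 1 - v - w" using assms by simp
  have "area2 P b c = u * area2 a b c" "- area2 P a c = v * area2 a b c" "area2 P a b = w * area2 a b c"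
    unfolding P_def u area2_def by (simp_all add: algebra_simps)
  then show "bary a b c P = u" "bary b a c P = v" "bary c a b P = w"
    using assms(1) unfolding bary_forms[where a=a and b=b and c=c] bary_def[of a b c] by simp_all
qed

definition multinom :: "nat \<times> nat \<times> nat \<Rightarrow> real" where
  "multinom = (\<lambda>(i, j, k). fact (i + j + k) / (fact i * fact j * fact k))"

lemma multinom_nz: "multinom \<alpha> \<noteq> 0"
  by (cases \<alpha>) (simp add: multinom_def)

lemma bbpoly_comb:
  assumes "area2 a b c \<noteq> 0" "u + v + w = 1"
  shows "bbpoly d a b c coef (u *\<^sub>R a + v *\<^sub>R b + w *\<^sub>R c) =
    (\<Sum>\<alpha>\<in>indices d. coef \<alpha> * multinom \<alpha> * (case \<alpha> of (i, j, k) \<Rightarrow> u ^ i * v ^ j * w ^ k))"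
  unfolding bbpoly_def
  by (rule sum.cong) (auto simp: bernstein_bary bary_comb[OF assms] indices_def multinom_def)

text \<open>On the line from \<open>a\<close> in direction
  \<open>\<beta> *\<^sub>R (b - a) + (c - a)\<close> the barycentric coordinates are
  \<open>1 - (\<beta> + 1) * t\<close>, \<open>\<beta> * t\<close> and \<open>t\<close>. Row
  \<open>m\<close> thus contributes \<open>t ^ m\<close> times a power of the first, with a factor
  \<open>A \<beta> m\<close> that is a polynomial in \<open>\<beta>\<close>. Triangularity makes
  this factor 0 for all \<open>\<beta>\<close>, hence all its coefficients.\<close>

lemma bbpoly_van_vertex:
  assumes nc: "area2 a b c \<noteq> 0" and van: "van N (bbpoly d a b c coef) a"
    and ijk: "i + j + k = d" "j + k < N"
  shows "coef (i, j, k) = 0"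
proof -
  define A where "A \<beta> m = (\<Sum>j\<le>m. coef (d - m, j, m - j) * multinom (d - m, j, m - j) * \<beta> ^ j)"
    for \<beta> :: real and m
  have A0: "A \<beta> m = 0" if "m < N" "m \<le> d" for \<beta> m
  proof -
    obtain r where r: "\<And>t. bbpoly d a b c coef (a + t *\<^sub>R (\<beta> *\<^sub>R (b - a) + (c - a))) = t ^ N * poly r t"
      using van unfolding van_def by meson
    have "(\<Sum>m\<le>d. A \<beta> m * (t ^ m * (1 - (\<beta> + 1) * t) ^ (d - m))) = t ^ N * poly r t" for t
    proof -
      have eq: "a + t *\<^sub>R (\<beta> *\<^sub>R (b - a) + (c - a)) = (1 - (\<beta> + 1) * t) *\<^sub>R a + (\<beta> * t) *\<^sub>R b + t *\<^sub>R c"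
        by (simp add: algebra_simps)
      then have "t ^ N * poly r t =
          bbpoly d a b c coef ((1 - (\<beta> + 1) * t) *\<^sub>R a + (\<beta> * t) *\<^sub>R b + t *\<^sub>R c)"
        using r[of t] unfolding eq by simp
      also have "\<dots> = (\<Sum>\<alpha>\<in>indices d. coef \<alpha> * multinom \<alpha> *
          (case \<alpha> of (i, j, k) \<Rightarrow> (1 - (\<beta> + 1) * t) ^ i * (\<beta> * t) ^ j * t ^ k))"
        by (rule bbpoly_comb[OF nc]) (simp add: algebra_simps)
      also have "\<dots> = (\<Sum>m\<le>d. A \<beta> m * (t ^ m * (1 - (\<beta> + 1) * t) ^ (d - m)))"
        unfolding sum_indices_corner A_def sum_distrib_right
      proof (intro sum.cong refl)
        fix m j assume "m \<in> {..d}" "j \<in> {..m}"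
        then have "t ^ m = t ^ j * t ^ (m - j)" by (simp flip: power_add)
        then show "coef (d - m, j, m - j) * multinom (d - m, j, m - j) *
          (case (d - m, j, m - j) of (i, j, k) \<Rightarrow> (1 - (\<beta> + 1) * t) ^ i * (\<beta> * t) ^ j * t ^ k) =
          coef (d - m, j, m - j) * multinom (d - m, j, m - j) * \<beta> ^ j *
            (t ^ m * (1 - (\<beta> + 1) * t) ^ (d - m))"
          by (simp add: power_mult_distrib)
      qed
      finally show ?thesis by simp
    qed
    from triangular_zero'[OF this that] show ?thesis .
  qed
  have "\<forall>\<beta>. (\<Sum>j'\<le>j + k. coef (d - (j + k), j', j + k - j') * multinom (d - (j + k), j', j + k - j')
     * \<beta> ^ j') = 0"
    using A0[of "j + k"] ijk unfolding A_def by auto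
  then have "\<forall>j'\<le>j + k. coef (d - (j + k), j', j + k - j') * multinom (d - (j + k), j', j + k - j') = 0"
    by (subst (asm) polyfun_eq_0)
  from this[rule_format, of j] have "coef (d - (j + k), j, j + k - j) = 0"
    using multinom_nz by simp
  moreover have "d - (j + k) = i" using ijk by simp
  ultimately show ?thesis by simp
qed

text \<open>On the line from the edge point with parameter \<open>s\<close> towards \<open>a\<close>
  the barycentric coordinates are \<open>t\<close>, \<open>(1 - t) * (1 - s)\<close> and
  \<open>(1 - t) * s\<close>. Triangularity in \<open>t\<close> kills the factor
  \<open>A s i\<close> of each of the first \<open>N\<close> rows for all \<open>s\<close> in the
  open interval, and triangularity in \<open>s\<close> then kills the single coefficients.\<close>

lemma bbpoly_van_edge:
  assumes nc: "area2 a b c \<noteq> 0" and van: "\<And>x. x \<in> open_segment b c \<Longrightarrow> van N (bbpoly d a b c coef) x"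
    and ijk: "i + j + k = d" "i < N"
  shows "coef (i, j, k) = 0"
proof -
  have bc: "b \<noteq> c" using nc by (auto simp: area2_def)
  define A where "A s i = (\<Sum>k\<le>d - i. coef (i, d - i - k, k) * multinom (i, d - i - k, k) *
    ((1 - s) ^ (d - i - k) * s ^ k))" for s :: real and i
  have A0: "A s i = 0" if s: "0 < s" "s < 1" and i: "i < N" "i \<le> d" for s i
  proof -
    define x where "x = (1 - s) *\<^sub>R b + s *\<^sub>R c"
    have "x \<in> open_segment b c" unfolding x_def in_segment using bc s by auto
    with van obtain r where r: "\<And>t. bbpoly d a b c coef (x + t *\<^sub>R (a - x)) = t ^ N * poly r t"
      unfolding van_def by meson
    have "(\<Sum>i\<le>d. A s i * (t ^ i * (1 - 1 * t) ^ (d - i))) = t ^ N * poly r t" for t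
    proof -
      have eq: "x + t *\<^sub>R (a - x) = t *\<^sub>R a + ((1 - t) * (1 - s)) *\<^sub>R b + ((1 - t) * s) *\<^sub>R c"
        by (simp add: x_def algebra_simps)
      then have "t ^ N * poly r t =
         bbpoly d a b c coef (t *\<^sub>R a + ((1 - t) * (1 - s)) *\<^sub>R b + ((1 - t) * s) *\<^sub>R c)"
        using r[of t] unfolding eq by simp
      also have "\<dots> = (\<Sum>\<alpha>\<in>indices d. coef \<alpha> * multinom \<alpha> *
          (case \<alpha> of (i, j, k) \<Rightarrow> t ^ i * ((1 - t) * (1 - s)) ^ j * ((1 - t) * s) ^ k))"
        by (rule bbpoly_comb[OF nc]) (simp add: algebra_simps)
      also have "\<dots> = (\<Sum>i\<le>d. A s i * (t ^ i * (1 - 1 * t) ^ (d - i)))"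
        unfolding sum_indices_edge A_def sum_distrib_right
      proof (intro sum.cong refl)
        fix i k assume "i \<in> {..d}" "k \<in> {..d - i}"
        then have "(1 - t) ^ (d - i) = (1 - t) ^ (d - i - k) * (1 - t) ^ k" by (simp flip: power_add)
        then show "coef (i, d - i - k, k) * multinom (i, d - i - k, k) *
          (case (i, d - i - k, k) of (i, j, k) \<Rightarrow> t ^ i * ((1 - t) * (1 - s)) ^ j * ((1 - t) * s) ^ k) =
          coef (i, d - i - k, k) * multinom (i, d - i - k, k) *
            ((1 - s) ^ (d - i - k) * s ^ k) * (t ^ i * (1 - 1 * t) ^ (d - i))"
          by (simp add: power_mult_distrib)
      qed
      finally show ?thesis by simp
    qed
    from triangular_zero'[OF this i] show ?thesis .
  qed
  have i: "i < N" "i \<le> d" using ijk by auto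
  define q where "q = (\<Sum>k\<le>d - i. smult (coef (i, d - i - k, k) * multinom (i, d - i - k, k))
     (monom 1 k * [:1, -1:] ^ (d - i - k)))"
  have "poly q s = A s i" for s
    unfolding q_def A_def by (simp add: poly_sum poly_monom poly_power mult_ac)
  then have "q = 0" by (intro poly_zero_interval[of 1]) (use A0[OF _ _ i] in auto)
  \<comment> \<open>The order \<open>Suc d\<close> exceeds every index that occurs, so that
    triangularity yields all coefficients at once.\<close>
  then have "(\<Sum>k\<le>d - i. smult (coef (i, d - i - k, k) * multinom (i, d - i - k, k))
     (monom 1 k * [:1, -1:] ^ (d - i - k))) = monom 1 (Suc d) * 0" unfolding q_def by simp
  from triangular_zero[OF this, of k] ijk have "coef (i, d - i - k, k) = 0"
    using multinom_nz by auto
  moreover have "d - i - k = j" using ijk by simp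
  ultimately show ?thesis by simp
qed

text \<open>The value 0 outside \<open>indices d\<close> makes the coefficient function unique; it
  is the same normalisation as in \<open>bb_coeffs\<close>.\<close>

definition bcoef :: "nat \<Rightarrow> point \<Rightarrow> point \<Rightarrow> point \<Rightarrow> (point \<Rightarrow> real) \<Rightarrow> nat \<times> nat \<times> nat \<Rightarrow> real" where
  "bcoef d a b c f = (THE coef. (\<forall>\<alpha>. \<alpha> \<notin> indices d \<longrightarrow> coef \<alpha> = 0) \<and> f = bbpoly d a b c coef)"

lemma bbpoly_diff:
  "bbpoly d a b c u x - bbpoly d a b c v x = bbpoly d a b c (\<lambda>\<alpha>. u \<alpha> - v \<alpha>) x"
  unfolding bbpoly_def by (simp add: left_diff_distrib sum_subtractf)

text \<open>The zero polynomial vanishes at \<open>a\<close> to order \<open>Suc d\<close>, and all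
  rows have a number below that.\<close>

lemma bbpoly_inj:
  assumes nc: "area2 a b c \<noteq> 0" and "bbpoly d a b c u = bbpoly d a b c v" "\<alpha> \<in> indices d"
  shows "u \<alpha> = v \<alpha>"
proof -
  obtain i j k where \<alpha>: "\<alpha> = (i, j, k)" "i + j + k = d" using assms(3) by (auto simp: indices_def)
  have "bbpoly d a b c (\<lambda>\<alpha>. u \<alpha> - v \<alpha>) = (\<lambda>x. 0)"
    using assms(2) bbpoly_diff[of d a b c u _ v] by auto
  then have "van (Suc d) (bbpoly d a b c (\<lambda>\<alpha>. u \<alpha> - v \<alpha>)) a" by (simp add: van_zero)
  from bbpoly_van_vertex[OF nc this \<alpha>(2)] \<alpha> show ?thesis by simp
qed

lemma bbpoly_cong: "(\<And>\<alpha>. \<alpha> \<in> indices d \<Longrightarrow> u \<alpha> = v \<alpha>) \<Longrightarrow> bbpoly d a b c u = bbpoly d a b c v"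
  unfolding bbpoly_def by auto

lemma bcoef_eqI:
  assumes nc: "area2 a b c \<noteq> 0" and "f = bbpoly d a b c coef" "\<And>\<alpha>. \<alpha> \<notin> indices d \<Longrightarrow> coef \<alpha> = 0"
  shows "bcoef d a b c f = coef"
  unfolding bcoef_def
proof (rule the_equality)
  fix v assume v: "(\<forall>\<alpha>. \<alpha> \<notin> indices d \<longrightarrow> v \<alpha> = 0) \<and> f = bbpoly d a b c v"
  show "v = coef"
  proof
    fix \<alpha> show "v \<alpha> = coef \<alpha>"
      using v assms(2) assms(3)[of \<alpha>] bbpoly_inj[OF nc, of d v coef \<alpha>]
      by (cases "\<alpha> \<in> indices d") (metis, metis)
  qed
qed (use assms in auto)

lemma bcoef_bbpoly:
  assumes nc: "area2 a b c \<noteq> 0"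
  shows "bcoef d a b c (bbpoly d a b c coef) \<alpha> = (if \<alpha> \<in> indices d then coef \<alpha> else 0)"
  by (subst bcoef_eqI[OF nc, of _ _ "\<lambda>\<alpha>. if \<alpha> \<in> indices d then coef \<alpha> else 0"])
    (auto intro: bbpoly_cong)

lemma bbpoly_bcoef:
  assumes nc: "area2 a b c \<noteq> 0" and f: "f \<in> Pd d"
  shows "bbpoly d a b c (bcoef d a b c f) = f"
proof -
  obtain v where v: "f = bbpoly d a b c v" using Pd_bbpoly[OF nc f] by blast
  show ?thesis unfolding v by (rule bbpoly_cong) (simp add: bcoef_bbpoly[OF nc])
qed

lemma bcoef_outside:
  assumes nc: "area2 a b c \<noteq> 0" and f: "f \<in> Pd d" and "\<alpha> \<notin> indices d"
  shows "bcoef d a b c f \<alpha> = 0"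
  using bcoef_bbpoly[OF nc, of d "bcoef d a b c f" \<alpha>] assms unfolding bbpoly_bcoef[OF nc f] by simp

lemma bcoef_add:
  assumes nc: "area2 a b c \<noteq> 0" and f: "f \<in> Pd d" "g \<in> Pd d"
  shows "bcoef d a b c (\<lambda>x. f x + g x) \<alpha> = bcoef d a b c f \<alpha> + bcoef d a b c g \<alpha>"
proof -
  have "(\<lambda>x. f x + g x) =
     (\<lambda>x. bbpoly d a b c (bcoef d a b c f) x + bbpoly d a b c (bcoef d a b c g) x)"
    using bbpoly_bcoef[OF nc] f by simp
  also have "\<dots> = bbpoly d a b c (\<lambda>\<alpha>. bcoef d a b c f \<alpha> + bcoef d a b c g \<alpha>)"
    unfolding bbpoly_def by (simp add: distrib_right sum.distrib)
  finally show ?thesis by (subst bcoef_eqI[OF nc]) (use bcoef_outside[OF nc] f in auto)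
qed

lemma bcoef_scale:
  assumes nc: "area2 a b c \<noteq> 0" and f: "f \<in> Pd d"
  shows "bcoef d a b c (\<lambda>x. r * f x) \<alpha> = r * bcoef d a b c f \<alpha>"
proof -
  have "(\<lambda>x. r * f x) = (\<lambda>x. r * bbpoly d a b c (bcoef d a b c f) x)"
    using bbpoly_bcoef[OF nc] f by simp
  also have "\<dots> = bbpoly d a b c (\<lambda>\<alpha>. r * bcoef d a b c f \<alpha>)"
    unfolding bbpoly_def by (simp add: sum_distrib_left mult.assoc)
  finally show ?thesis by (subst bcoef_eqI[OF nc]) (use bcoef_outside[OF nc] f in auto)
qed

lemma bcoef_diff:
  assumes nc: "area2 a b c \<noteq> 0" and f: "f \<in> Pd d" "g \<in> Pd d"
  shows "bcoef d a b c (\<lambda>x. f x - g x) \<alpha> = bcoef d a b c f \<alpha> - bcoef d a b c g \<alpha>"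
  using bcoef_add[OF nc f(1) Pd_scale[OF f(2), of "-1"]] bcoef_scale[OF nc f(2), of "-1"] by simp

lemma bcoef_zero: "area2 a b c \<noteq> 0 \<Longrightarrow> bcoef d a b c (\<lambda>x. 0) \<alpha> = 0"
  using bcoef_scale[OF _ Pd_const[of 0 d], of a b c 0 \<alpha>] by simp

lemma bcoef_zero_imp:
  assumes nc: "area2 a b c \<noteq> 0" and f: "f \<in> Pd d"
    and z: "\<And>i j k. i + j + k = d \<Longrightarrow> bcoef d a b c f (i, j, k) = 0"
  shows "f = (\<lambda>x. 0)"
proof -
  have "bbpoly d a b c (bcoef d a b c f) = bbpoly d a b c (\<lambda>\<alpha>. 0)"
    by (rule bbpoly_cong) (use z in \<open>auto simp: indices_def\<close>)
  then show ?thesis unfolding bbpoly_bcoef[OF nc f] by (simp add: bbpoly_def)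
qed

lemma bcoef_swap12:
  assumes nc: "area2 a b c \<noteq> 0" and f: "f \<in> Pd d"
  shows "bcoef d b a c f (j, i, k) = bcoef d a b c f (i, j, k)"
proof -
  have nc': "area2 b a c \<noteq> 0" using nc area2_swap(1)[of b a c] by simp
  let ?u = "bcoef d a b c f" and ?v = "\<lambda>(j, i, k). bcoef d a b c f (i, j, k)"
  have "f = bbpoly d a b c ?u" using bbpoly_bcoef[OF nc f] by simp
  also have "\<dots> = bbpoly d b a c ?v"
    unfolding bbpoly_def
  proof (rule ext, rule sum.reindex_bij_witness[of _ "\<lambda>(i, j, k). (j, i, k)" "\<lambda>(i, j, k). (j, i, k)"])
    fix x and \<alpha> :: "nat \<times> nat \<times> nat" assume "\<alpha> \<in> indices d"
    obtain i j k where "\<alpha> = (i, j, k)" by (cases \<alpha>)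
    then show "(case case \<alpha> of (i, j, k) \<Rightarrow> (j, i, k) of (j, i, k) \<Rightarrow> bcoef d a b c f (i, j, k)) *
         bernstein d b a c (case \<alpha> of (i, j, k) \<Rightarrow> (j, i, k)) x =
         bcoef d a b c f \<alpha> * bernstein d a b c \<alpha> x"
      by (simp add: bernstein_bary bary_swap[of c b a] mult_ac)
  qed (auto simp: indices_def)
  finally have "bcoef d b a c f = ?v"
    by (rule bcoef_eqI[OF nc']) (use bcoef_outside[OF nc f] in \<open>auto simp: indices_def\<close>)
  then show ?thesis by simp
qed

lemma bcoef_swap23:
  assumes nc: "area2 a b c \<noteq> 0" and f: "f \<in> Pd d"
  shows "bcoef d a c b f (i, k, j) = bcoef d a b c f (i, j, k)"
proof -
  have nc': "area2 a c b \<noteq> 0" using nc area2_swap(2)[of a b c] by simp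
  let ?u = "bcoef d a b c f" and ?v = "\<lambda>(i, k, j). bcoef d a b c f (i, j, k)"
  have "f = bbpoly d a b c ?u" using bbpoly_bcoef[OF nc f] by simp
  also have "\<dots> = bbpoly d a c b ?v"
    unfolding bbpoly_def
  proof (rule ext, rule sum.reindex_bij_witness[of _ "\<lambda>(i, j, k). (i, k, j)" "\<lambda>(i, j, k). (i, k, j)"])
    fix x and \<alpha> :: "nat \<times> nat \<times> nat" assume "\<alpha> \<in> indices d"
    obtain i j k where "\<alpha> = (i, j, k)" by (cases \<alpha>)
    then show "(case case \<alpha> of (i, j, k) \<Rightarrow> (i, k, j) of (i, k, j) \<Rightarrow> bcoef d a b c f (i, j, k)) *
         bernstein d a c b (case \<alpha> of (i, j, k) \<Rightarrow> (i, k, j)) x =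
         bcoef d a b c f \<alpha> * bernstein d a b c \<alpha> x"
      by (simp add: bernstein_bary bary_swap[of a c b] bary_swap[of b c a] bary_swap[of c b a] mult_ac)
  qed (auto simp: indices_def)
  finally have "bcoef d a c b f = ?v"
    by (rule bcoef_eqI[OF nc']) (use bcoef_outside[OF nc f] in \<open>auto simp: indices_def\<close>)
  then show ?thesis by simp
qed

lemma nc_perm:
  assumes "area2 a b c \<noteq> 0"
  shows "area2 b a c \<noteq> 0" "area2 a c b \<noteq> 0" "area2 c a b \<noteq> 0" "area2 b c a \<noteq> 0" "area2 c b a \<noteq> 0"
  using assms by (auto simp: area2_def algebra_simps)

lemma bcoef_rot:
  assumes nc: "area2 a b c \<noteq> 0" and f: "f \<in> Pd d"
  shows "bcoef d c a b f (k, i, j) = bcoef d a b c f (i, j, k)"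
  using bcoef_swap12[OF nc_perm(2)[OF nc] f, of k i j] bcoef_swap23[OF nc f, of i k j] by simp

subsection \<open>Vanishing at a vertex or along an edge in terms of coefficients\<close>

lemma van_bernstein_edge:
  assumes "bary a b c x = 0" "i + j + k = d"
  shows "van i (bernstein d a b c (i, j, k)) x"
proof -
  have "van (1 * i) (\<lambda>x. bary a b c x ^ i) x"
    using assms by (intro van_power) (simp add: van_1_iff[OF bary_Pd] del: One_nat_def)
  then have "van i (\<lambda>x. bary a b c x ^ i * (fact d / (fact i * fact j * fact k) *
      (bary b a c x ^ j * bary c a b x ^ k))) x"
    by (intro van_mult_left[OF _ Pd_scale[OF Pd_mult[OF Pd_power Pd_power]]])
      (auto intro: bary_Pd)
  then show ?thesis by (simp add: bernstein_bary[abs_def] mult_ac)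
qed

lemma van_bernstein_vertex:
  assumes "i + j + k = d"
  shows "van (j + k) (bernstein d a b c (i, j, k)) a"
proof -
  have "van (1 * j + 1 * k) (\<lambda>x. bary b a c x ^ j * bary c a b x ^ k) a"
    by (intro van_mult van_power) (simp_all add: van_1_iff[OF bary_Pd] bary_self del: One_nat_def)
  then have "van (j + k) (\<lambda>x. (bary b a c x ^ j * bary c a b x ^ k) *
       (fact d / (fact i * fact j * fact k) * bary a b c x ^ i)) a"
    by (intro van_mult_left[OF _ Pd_scale[OF Pd_power[OF bary_Pd]]]) simp
  then show ?thesis by (simp add: bernstein_bary[abs_def] mult_ac)
qed

text \<open>Contact of order \<open>N\<close> at a vertex concerns the first \<open>N\<close> rows
  of coefficients there. Conversely, the Bernstein polynomials of the other rows vanish at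
  \<open>a\<close> at least to order \<open>N\<close>, because they contain \<open>j + k\<close>
  factors that are 0 at \<open>a\<close>.\<close>

lemma vert_a:
  assumes nc: "area2 a b c \<noteq> 0" and f: "f \<in> Pd d" "g \<in> Pd d"
  shows "van N (\<lambda>x. f x - g x) a \<longleftrightarrow>
    (\<forall>i j k. i + j + k = d \<longrightarrow> j + k < N \<longrightarrow> bcoef d a b c f (i, j, k) = bcoef d a b c g (i, j, k))"
    (is "?L \<longleftrightarrow> ?R")
proof -
  let ?h = "\<lambda>x. f x - g x"
  let ?u = "bcoef d a b c ?h"
  have h: "?h \<in> Pd d" using f by (rule Pd_diff)
  have hu: "?h = bbpoly d a b c ?u" using bbpoly_bcoef[OF nc h] by simp
  have R: "?R \<longleftrightarrow> (\<forall>i j k. i + j + k = d \<longrightarrow> j + k < N \<longrightarrow> ?u (i, j, k) = 0)"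
    using bcoef_diff[OF nc f] by auto
  show ?thesis
  proof
    assume ?L
    then have "van N (bbpoly d a b c ?u) a" using hu by simp
    then show ?R unfolding R using bbpoly_van_vertex[OF nc] by blast
  next
    assume u: ?R
    have "van N (bbpoly d a b c ?u) a"
      unfolding bbpoly_def
    proof (rule van_sum)
      fix \<alpha> assume "\<alpha> \<in> indices d"
      then obtain i j k where \<alpha>: "\<alpha> = (i, j, k)" "i + j + k = d" by (auto simp: indices_def)
      show "van N (\<lambda>x. ?u \<alpha> * bernstein d a b c \<alpha> x) a"
      proof (cases "j + k < N")
        case True
        then show ?thesis using u \<alpha> unfolding R by (simp add: van_zero)
      next
        case False
        then show ?thesis unfolding \<alpha>(1)
          by (intro van_scale van_mono[OF van_bernstein_vertex[OF \<alpha>(2)]]) simp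
      qed
    qed
    then show ?L using hu by simp
  qed
qed

lemma bary_segment: "x \<in> closed_segment b c \<Longrightarrow> bary a b c x = 0"
  unfolding in_segment by (auto simp: bary_affine bary_self)

text \<open>Only the open edge is used: one end may lie on the boundary of the domain, where
  membership in the spline space says nothing about gradients.\<close>

lemma edge_a_open:
  assumes nc: "area2 a b c \<noteq> 0" and f: "f \<in> Pd d" "g \<in> Pd d"
    and van: "\<And>x. x \<in> open_segment b c \<Longrightarrow> van N (\<lambda>x. f x - g x) x"
    and ijk: "i + j + k = d" "i < N"
  shows "bcoef d a b c f (i, j, k) = bcoef d a b c g (i, j, k)"
proof -
  let ?h = "\<lambda>x. f x - g x"
  have h: "?h \<in> Pd d" using f by (rule Pd_diff)
  have "bcoef d a b c ?h (i, j, k) = 0"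
    by (rule bbpoly_van_edge[OF nc _ ijk]) (use van bbpoly_bcoef[OF nc h] in simp)
  then show ?thesis using bcoef_diff[OF nc f] by simp
qed

lemma edge_a_line:
  assumes nc: "area2 a b c \<noteq> 0" and f: "f \<in> Pd d" "g \<in> Pd d"
    and eq: "\<And>i j k. i + j + k = d \<Longrightarrow> i < N \<Longrightarrow> bcoef d a b c f (i, j, k) = bcoef d a b c g (i, j, k)"
    and x: "bary a b c x = 0"
  shows "van N (\<lambda>x. f x - g x) x"
proof -
  let ?h = "\<lambda>x. f x - g x"
  let ?u = "bcoef d a b c ?h"
  have h: "?h \<in> Pd d" using f by (rule Pd_diff)
  have "van N (bbpoly d a b c ?u) x"
    unfolding bbpoly_def
  proof (rule van_sum)
    fix \<alpha> assume "\<alpha> \<in> indices d"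
    then obtain i j k where \<alpha>: "\<alpha> = (i, j, k)" "i + j + k = d" by (auto simp: indices_def)
    show "van N (\<lambda>x. ?u \<alpha> * bernstein d a b c \<alpha> x) x"
    proof (cases "i < N")
      case True
      then have "?u \<alpha> = 0" using eq \<alpha> bcoef_diff[OF nc f] by simp
      then show ?thesis by (simp add: van_zero)
    next
      case False
      then show ?thesis unfolding \<alpha>(1)
        by (intro van_scale van_mono[OF van_bernstein_edge[OF x \<alpha>(2)]]) simp
    qed
  qed
  then show ?thesis using bbpoly_bcoef[OF nc h] by simp
qed

lemma edge_a:
  assumes nc: "area2 a b c \<noteq> 0" and f: "f \<in> Pd d" "g \<in> Pd d"
  shows "(\<forall>x\<in>closed_segment b c. van N (\<lambda>x. f x - g x) x) \<longleftrightarrow>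
    (\<forall>i j k. i + j + k = d \<longrightarrow> i < N \<longrightarrow> bcoef d a b c f (i, j, k) = bcoef d a b c g (i, j, k))"
proof
  assume "\<forall>x\<in>closed_segment b c. van N (\<lambda>x. f x - g x) x"
  then show "\<forall>i j k. i + j + k = d \<longrightarrow> i < N \<longrightarrow> bcoef d a b c f (i, j, k) = bcoef d a b c g (i, j, k)"
    using edge_a_open[OF nc f, of N] by (auto simp: open_segment_def)
qed (use edge_a_line[OF nc f] bary_segment in blast)

text \<open>The detour through the coefficients extends contact along the open edge to its ends. It
  replaces a limit argument at boundary vertices.\<close>

lemma edge_open_closed:
  assumes nc: "area2 a b c \<noteq> 0" and f: "f \<in> Pd d" "g \<in> Pd d"
    and "\<And>x. x \<in> open_segment b c \<Longrightarrow> van N (\<lambda>x. f x - g x) x" and x: "x \<in> closed_segment b c"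
  shows "van N (\<lambda>x. f x - g x) x"
  by (rule edge_a_line[OF nc f edge_a_open[OF nc f assms(4)] bary_segment[OF x]])

lemma all_swap: "(\<forall>j i k. j + i + k = (d::nat) \<longrightarrow> P i j k) \<longleftrightarrow> (\<forall>i j k. i + j + k = d \<longrightarrow> P i j k)"
proof (intro iffI allI impI)
  fix i j k assume "\<forall>j i k. j + i + k = d \<longrightarrow> P i j k" "i + j + k = d"
  moreover from this(2) have "j + i + k = d" by simp
  ultimately show "P i j k" by blast
next
  fix i j k assume "\<forall>i j k. i + j + k = d \<longrightarrow> P i j k" "j + i + k = d"
  moreover from this(2) have "i + j + k = d" by simp
  ultimately show "P i j k" by blast
qed

lemma all_rot: "(\<forall>k i j. k + i + j = (d::nat) \<longrightarrow> P i j k) \<longleftrightarrow> (\<forall>i j k. i + j + k = d \<longrightarrow> P i j k)"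
proof (intro iffI allI impI)
  fix i j k assume "\<forall>k i j. k + i + j = d \<longrightarrow> P i j k" "i + j + k = d"
  moreover from this(2) have "k + i + j = d" by simp
  ultimately show "P i j k" by blast
next
  fix i j k assume "\<forall>i j k. i + j + k = d \<longrightarrow> P i j k" "k + i + j = d"
  moreover from this(2) have "i + j + k = d" by simp
  ultimately show "P i j k" by blast
qed

lemma vert_b:
  assumes nc: "area2 a b c \<noteq> 0" and f: "f \<in> Pd d" "g \<in> Pd d"
  shows "van N (\<lambda>x. f x - g x) b \<longleftrightarrow>
    (\<forall>i j k. i + j + k = d \<longrightarrow> i + k < N \<longrightarrow> bcoef d a b c f (i, j, k) = bcoef d a b c g (i, j, k))"
  unfolding vert_a[OF nc_perm(1)[OF nc] f] bcoef_swap12[OF nc f(1)] bcoef_swap12[OF nc f(2)]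
  by (rule all_swap)

lemma vert_c:
  assumes nc: "area2 a b c \<noteq> 0" and f: "f \<in> Pd d" "g \<in> Pd d"
  shows "van N (\<lambda>x. f x - g x) c \<longleftrightarrow>
    (\<forall>i j k. i + j + k = d \<longrightarrow> i + j < N \<longrightarrow> bcoef d a b c f (i, j, k) = bcoef d a b c g (i, j, k))"
  unfolding vert_a[OF nc_perm(3)[OF nc] f] bcoef_rot[OF nc f(1)] bcoef_rot[OF nc f(2)]
  by (rule all_rot)

lemma edge_b:
  assumes nc: "area2 a b c \<noteq> 0" and f: "f \<in> Pd d" "g \<in> Pd d"
  shows "(\<forall>x\<in>closed_segment a c. van N (\<lambda>x. f x - g x) x) \<longleftrightarrow>
    (\<forall>i j k. i + j + k = d \<longrightarrow> j < N \<longrightarrow> bcoef d a b c f (i, j, k) = bcoef d a b c g (i, j, k))"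
  unfolding edge_a[OF nc_perm(1)[OF nc] f] bcoef_swap12[OF nc f(1)] bcoef_swap12[OF nc f(2)]
  by (rule all_swap)

lemma edge_c:
  assumes nc: "area2 a b c \<noteq> 0" and f: "f \<in> Pd d" "g \<in> Pd d"
  shows "(\<forall>x\<in>closed_segment a b. van N (\<lambda>x. f x - g x) x) \<longleftrightarrow>
    (\<forall>i j k. i + j + k = d \<longrightarrow> k < N \<longrightarrow> bcoef d a b c f (i, j, k) = bcoef d a b c g (i, j, k))"
  unfolding edge_a[OF nc_perm(3)[OF nc] f] bcoef_rot[OF nc f(1)] bcoef_rot[OF nc f(2)]
  by (rule all_rot)

lemma bcoef_corner:
  assumes nc: "area2 a b c \<noteq> 0" and f: "f \<in> Pd d"
  shows "bcoef d a b c f (d, 0, 0) = f a"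
proof -
  let ?u = "bcoef d a b c f"
  have "f a = bbpoly d a b c ?u (1 *\<^sub>R a + 0 *\<^sub>R b + 0 *\<^sub>R c)"
    by (simp add: bbpoly_bcoef[OF nc f])
  also have "\<dots> = (\<Sum>\<alpha>\<in>indices d. ?u \<alpha> * multinom \<alpha> * (case \<alpha> of (i, j, k) \<Rightarrow> 1 ^ i * 0 ^ j * 0 ^ k))"
    by (rule bbpoly_comb[OF nc]) simp
  also have "\<dots> = (\<Sum>\<alpha>\<in>indices d. if \<alpha> = (d, 0, 0) then ?u \<alpha> else 0)"
    by (rule sum.cong) (auto simp: indices_def multinom_def power_0_left split: if_splits)
  also have "\<dots> = ?u (d, 0, 0)"
    using finite_indices by (simp add: sum.delta indices_def)
  finally show ?thesis by simp
qed

lemma bcoef_corner_b: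
  assumes nc: "area2 a b c \<noteq> 0" and f: "f \<in> Pd d"
  shows "bcoef d a b c f (0, d, 0) = f b"
  using bcoef_swap12[OF nc f, of d 0 0] bcoef_corner[OF nc_perm(1)[OF nc] f] by simp

lemma bcoef_corner_c:
  assumes nc: "area2 a b c \<noteq> 0" and f: "f \<in> Pd d"
  shows "bcoef d a b c f (0, 0, d) = f c"
  using bcoef_rot[OF nc f, of d 0 0] bcoef_corner[OF nc_perm(3)[OF nc] f] by simp

section \<open>Interpolation on a single triangle\<close>

text \<open>A quintic has 21 coefficients: six at each vertex, given by the 2-jet there, and one
  more for each edge, which is the normal derivative datum. Edge data and vertex data overlap only
  in coefficients fixed by the 2-jets, where they agree by assumption.\<close>

lemma argyris_interpolation:
  assumes nc: "area2 a b c \<noteq> 0"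
    and Q: "Qa \<in> Pd 5" "Qb \<in> Pd 5" "Qc \<in> Pd 5" "Qab \<in> Pd 5" "Qbc \<in> Pd 5" "Qca \<in> Pd 5"
    and ab: "van 3 (\<lambda>x. Qab x - Qa x) a" "van 3 (\<lambda>x. Qab x - Qb x) b"
    and bc: "van 3 (\<lambda>x. Qbc x - Qb x) b" "van 3 (\<lambda>x. Qbc x - Qc x) c"
    and ca: "van 3 (\<lambda>x. Qca x - Qc x) c" "van 3 (\<lambda>x. Qca x - Qa x) a"
  obtains p where "p \<in> Pd 5"
    "van 3 (\<lambda>x. p x - Qa x) a" "van 3 (\<lambda>x. p x - Qb x) b" "van 3 (\<lambda>x. p x - Qc x) c"
    "\<forall>x\<in>closed_segment a b. van 2 (\<lambda>x. p x - Qab x) x"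
    "\<forall>x\<in>closed_segment b c. van 2 (\<lambda>x. p x - Qbc x) x"
    "\<forall>x\<in>closed_segment c a. van 2 (\<lambda>x. p x - Qca x) x"
proof -
  let ?B = "bcoef 5 a b c"
  \<comment> \<open>At most one entry of an index is 3 or larger. If none is, the index is (1,2,2),
    (2,1,2) or (2,2,1), and the entry 1 tells to which edge the coefficient belongs.\<close>
  define coef where "coef = (\<lambda>(i::nat, j::nat, k::nat).
    if i \<ge> 3 then ?B Qa (i, j, k) else if j \<ge> 3 then ?B Qb (i, j, k)
    else if k \<ge> 3 then ?B Qc (i, j, k)
    else if i = 1 then ?B Qbc (i, j, k) else if j = 1 then ?B Qca (i, j, k) else ?B Qab (i, j, k))"
  define p where "p = bbpoly 5 a b c coef"
  have p: "p \<in> Pd 5" unfolding p_def by (rule bbpoly_Pd)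
  have cp: "?B p (i, j, k) = coef (i, j, k)" if "i + j + k = 5" for i j k
    unfolding p_def bcoef_bbpoly[OF nc] using that by (simp add: indices_def)
  note ab' = ab[unfolded vert_a[OF nc Q(4,1)] vert_b[OF nc Q(4,2)]]
  note bc' = bc[unfolded vert_b[OF nc Q(5,2)] vert_c[OF nc Q(5,3)]]
  note ca' = ca[unfolded vert_c[OF nc Q(6,3)] vert_a[OF nc Q(6,1)]]
  have va: "van 3 (\<lambda>x. p x - Qa x) a"
    unfolding vert_a[OF nc p Q(1)] by (auto simp: cp coef_def)
  have vb: "van 3 (\<lambda>x. p x - Qb x) b"
    unfolding vert_b[OF nc p Q(2)] by (auto simp: cp coef_def)
  have vc: "van 3 (\<lambda>x. p x - Qc x) c"
    unfolding vert_c[OF nc p Q(3)] by (auto simp: cp coef_def)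
  have eab: "\<forall>x\<in>closed_segment a b. van 2 (\<lambda>x. p x - Qab x) x"
    unfolding edge_c[OF nc p Q(4)]
  proof (intro allI impI)
    fix i j k :: nat assume ijk: "i + j + k = 5" "k < 2"
    then consider "i \<ge> 3" "j + k < 3" | "j \<ge> 3" "i + k < 3" "i < 3" | "i = 2" "j = 2" "k = 1" by linarith
    then show "?B p (i, j, k) = ?B Qab (i, j, k)"
      using ijk ab' by cases (simp_all add: cp coef_def)
  qed
  have ebc: "\<forall>x\<in>closed_segment b c. van 2 (\<lambda>x. p x - Qbc x) x"
    unfolding edge_a[OF nc p Q(5)]
  proof (intro allI impI)
    fix i j k :: nat assume ijk: "i + j + k = 5" "i < 2"
    then consider "j \<ge> 3" "i + k < 3" | "k \<ge> 3" "i + j < 3" "j < 3" | "i = 1" "j = 2" "k = 2" by linarith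
    then show "?B p (i, j, k) = ?B Qbc (i, j, k)"
      using ijk bc' by cases (simp_all add: cp coef_def)
  qed
  have "\<forall>x\<in>closed_segment a c. van 2 (\<lambda>x. p x - Qca x) x"
    unfolding edge_b[OF nc p Q(6)]
  proof (intro allI impI)
    fix i j k :: nat assume ijk: "i + j + k = 5" "j < 2"
    then consider "i \<ge> 3" "j + k < 3" | "k \<ge> 3" "i + j < 3" "i < 3" | "i = 2" "j = 1" "k = 2" by linarith
    then show "?B p (i, j, k) = ?B Qca (i, j, k)"
      using ijk ca' by cases (simp_all add: cp coef_def)
  qed
  then have eca: "\<forall>x\<in>closed_segment c a. van 2 (\<lambda>x. p x - Qca x) x"
    by (simp add: closed_segment_commute)
  show thesis using that[OF p va vb vc eab ebc eca] .
qed

text \<open>Three entries with sum 5 cannot all be 2 or larger, so each coefficient lies in the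
  first two rows along some edge.\<close>

lemma argyris_zero:
  assumes nc: "area2 a b c \<noteq> 0" and p: "p \<in> Pd 5"
    and "\<forall>x\<in>closed_segment a b. van 2 p x" "\<forall>x\<in>closed_segment b c. van 2 p x"
      "\<forall>x\<in>closed_segment a c. van 2 p x"
  shows "p = (\<lambda>x. 0)"
proof (rule bcoef_zero_imp[OF nc p])
  fix i j k :: nat assume ijk: "i + j + k = 5"
  have z: "(\<lambda>x::point. 0::real) \<in> Pd 5" by (rule Pd_const)
  consider "i < 2" | "j < 2" | "k < 2" using ijk by linarith
  then show "bcoef 5 a b c p (i, j, k) = 0"
  proof cases
    case 1
    have "\<forall>x\<in>closed_segment b c. van 2 (\<lambda>x. p x - 0) x" using assms by simp
    from this[unfolded edge_a[OF nc p z]] 1 ijk show ?thesis by (simp add: bcoef_zero[OF nc])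
  next
    case 2
    have "\<forall>x\<in>closed_segment a c. van 2 (\<lambda>x. p x - 0) x" using assms by simp
    from this[unfolded edge_b[OF nc p z]] 2 ijk show ?thesis by (simp add: bcoef_zero[OF nc])
  next
    case 3
    have "\<forall>x\<in>closed_segment a b. van 2 (\<lambda>x. p x - 0) x" using assms by simp
    from this[unfolded edge_c[OF nc p z]] 3 ijk show ?thesis by (simp add: bcoef_zero[OF nc])
  qed
qed

lemma edge_interpolation:
  assumes nc: "area2 a b c \<noteq> 0" and Q: "Qb \<in> Pd 5" "Qc \<in> Pd 5"
  obtains p where "p \<in> Pd 5" "van 3 (\<lambda>x. p x - Qb x) b" "van 3 (\<lambda>x. p x - Qc x) c"
    "bcoef 5 a b c p (1, 2, 2) = y"
proof -
  let ?B = "bcoef 5 a b c"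
  \<comment> \<open>In the rows \<open>i < 2\<close>, which govern the first-order behaviour along
    the edge, (1,2,2) is the only index not covered by the two 2-jets. In the other rows
    \<open>y\<close> is an arbitrary filling.\<close>
  define coef where "coef = (\<lambda>(i::nat, j::nat, k::nat).
    if j \<ge> 3 then ?B Qb (i, j, k) else if k \<ge> 3 then ?B Qc (i, j, k) else y)"
  define p where "p = bbpoly 5 a b c coef"
  have p: "p \<in> Pd 5" unfolding p_def by (rule bbpoly_Pd)
  have cp: "?B p (i, j, k) = coef (i, j, k)" if "i + j + k = 5" for i j k
    unfolding p_def bcoef_bbpoly[OF nc] using that by (simp add: indices_def)
  have vb: "van 3 (\<lambda>x. p x - Qb x) b"
    unfolding vert_b[OF nc p Q(1)] by (auto simp: cp coef_def)
  have vc: "van 3 (\<lambda>x. p x - Qc x) c"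
    unfolding vert_c[OF nc p Q(2)] by (auto simp: cp coef_def)
  show thesis by (rule that[OF p vb vc]) (simp add: cp coef_def)
qed

lemma edge_zero:
  assumes nc: "area2 a b c \<noteq> 0" and p: "p \<in> Pd 5" and "van 3 p b" "van 3 p c"
    and m: "bcoef 5 a b c p (1, 2, 2) = 0"
  shows "\<forall>x\<in>closed_segment b c. van 2 p x"
proof -
  have z: "(\<lambda>x::point. 0::real) \<in> Pd 5" by (rule Pd_const)
  have "van 3 (\<lambda>x. p x - 0) b" "van 3 (\<lambda>x. p x - 0) c" using assms by simp_all
  note v = this[unfolded vert_b[OF nc p z] vert_c[OF nc p z]]
  have "\<forall>x\<in>closed_segment b c. van 2 (\<lambda>x. p x - 0) x"
    unfolding edge_a[OF nc p z] bcoef_zero[OF nc]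
  proof (intro allI impI)
    fix i j k :: nat assume ijk: "i + j + k = 5" "i < 2"
    then consider "j \<ge> 3" "i + k < 3" | "k \<ge> 3" "i + j < 3" | "i = 1" "j = 2" "k = 2" by linarith
    then show "bcoef 5 a b c p (i, j, k) = 0"
      using ijk v m by cases (simp_all add: bcoef_zero[OF nc])
  qed
  then show ?thesis by simp
qed

text \<open>Of the 28 coefficients of a sextic all but (2,2,2) lie in the first two rows along some
  edge, so the three neighbours prescribe them. What has to be checked is that neighbours agree
  where rows of two edges overlap: at \<open>a\<close> and \<open>b\<close> the 2-jets suffice for
  this, but at \<open>v\<close> only contact of first order is available.\<close>

lemma buffer_interpolation:
  assumes nc: "area2 v a b \<noteq> 0" and G: "G1 \<in> Pd 6" "G2 \<in> Pd 6" "Q \<in> Pd 6"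
    and v2: "van 2 (\<lambda>x. G1 x - G2 x) v"
    and c411: "bcoef 6 v a b G1 (4, 1, 1) = bcoef 6 v a b G2 (4, 1, 1)"
    and a: "van 3 (\<lambda>x. G1 x - Q x) a" and b: "van 3 (\<lambda>x. G2 x - Q x) b"
  obtains p where "p \<in> Pd 6"
    "\<forall>x\<in>closed_segment v a. van 2 (\<lambda>x. p x - G1 x) x"
    "\<forall>x\<in>closed_segment v b. van 2 (\<lambda>x. p x - G2 x) x"
    "\<forall>x\<in>closed_segment a b. van 2 (\<lambda>x. p x - Q x) x"
    "van 3 (\<lambda>x. p x - Q x) a" "van 3 (\<lambda>x. p x - Q x) b"
    "bcoef 6 v a b p (4, 1, 1) = bcoef 6 v a b G1 (4, 1, 1)" "bcoef 6 v a b p (2, 2, 2) = y"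
proof -
  let ?B = "bcoef 6 v a b"
  \<comment> \<open>The rows along \<open>[v,a]\<close> take precedence over those along
    \<open>[v,b]\<close>, and both over those along \<open>[a,b]\<close>; agreement on the overlaps
    is verified afterwards.\<close>
  define coef where "coef = (\<lambda>(i::nat, j::nat, k::nat).
    if k < 2 then ?B G1 (i, j, k) else if j < 2 then ?B G2 (i, j, k)
    else if i = 2 \<and> j = 2 \<and> k = 2 then y else ?B Q (i, j, k))"
  define p where "p = bbpoly 6 v a b coef"
  have p: "p \<in> Pd 6" unfolding p_def by (rule bbpoly_Pd)
  have cp: "?B p (i, j, k) = coef (i, j, k)" if "i + j + k = 6" for i j k
    unfolding p_def bcoef_bbpoly[OF nc] using that by (simp add: indices_def)
  note v2' = v2[unfolded vert_a[OF nc G(1,2)]]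
  note a' = a[unfolded vert_b[OF nc G(1,3)]]
  note b' = b[unfolded vert_c[OF nc G(2,3)]]
  have e1: "\<forall>x\<in>closed_segment v a. van 2 (\<lambda>x. p x - G1 x) x"
    unfolding edge_c[OF nc p G(1)] by (auto simp: cp coef_def)
  have e2: "\<forall>x\<in>closed_segment v b. van 2 (\<lambda>x. p x - G2 x) x"
    unfolding edge_b[OF nc p G(2)]
  proof (intro allI impI)
    fix i j k :: nat assume ijk: "i + j + k = 6" "j < 2"
    \<comment> \<open>The rows along the two edges at \<open>v\<close> overlap in four indices.
      Contact of order 2 at \<open>v\<close> covers three of them; (4,1,1) is the fourth, which is
      why its equality is a separate assumption.\<close>
    then consider "k \<ge> 2" | "j + k < 2" "k < 2" | "i = 4" "j = 1" "k = 1" by linarith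
    then show "?B p (i, j, k) = ?B G2 (i, j, k)"
      using ijk v2' c411 by cases (simp_all add: cp coef_def)
  qed
  have e3: "\<forall>x\<in>closed_segment a b. van 2 (\<lambda>x. p x - Q x) x"
    unfolding edge_a[OF nc p G(3)]
  proof (intro allI impI)
    fix i j k :: nat assume ijk: "i + j + k = 6" "i < 2"
    then consider "k < 2" "i + k < 3" | "j < 2" "i + j < 3" "k \<ge> 2" | "j \<ge> 2" "k \<ge> 2" "i \<noteq> 2" by linarith
    then show "?B p (i, j, k) = ?B Q (i, j, k)"
      using ijk a' b' by cases (simp_all add: cp coef_def)
  qed
  have va: "van 3 (\<lambda>x. p x - Q x) a"
    unfolding vert_b[OF nc p G(3)]
  proof (intro allI impI)
    fix i j k :: nat assume ijk: "i + j + k = 6" "i + k < 3"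
    then consider "k < 2" | "k = 2" "i = 0" "j = 4" by linarith
    then show "?B p (i, j, k) = ?B Q (i, j, k)"
      using ijk a' by cases (simp_all add: cp coef_def)
  qed
  have vb: "van 3 (\<lambda>x. p x - Q x) b"
    unfolding vert_c[OF nc p G(3)]
  proof (intro allI impI)
    fix i j k :: nat assume ijk: "i + j + k = 6" "i + j < 3"
    then consider "j < 2" "k \<ge> 2" | "j = 2" "i = 0" "k = 4" by linarith
    then show "?B p (i, j, k) = ?B Q (i, j, k)"
      using ijk b' by cases (simp_all add: cp coef_def)
  qed
  show thesis by (rule that[OF p e1 e2 e3 va vb]) (simp_all add: cp coef_def)
qed

lemma buffer_zero:
  assumes nc: "area2 v a b \<noteq> 0" and p: "p \<in> Pd 6"
    and "\<forall>x\<in>closed_segment v a. van 2 p x" "\<forall>x\<in>closed_segment v b. van 2 p x"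
      "\<forall>x\<in>closed_segment a b. van 2 p x"
    and va: "van 3 p a" and vb: "van 3 p b" and m: "bcoef 6 v a b p (2, 2, 2) = 0"
  shows "p = (\<lambda>x. 0)"
proof (rule bcoef_zero_imp[OF nc p])
  fix i j k :: nat assume ijk: "i + j + k = 6"
  have z: "(\<lambda>x::point. 0::real) \<in> Pd 6" by (rule Pd_const)
  consider "i < 2" | "j < 2" | "k < 2" | "i = 2 \<and> j = 2 \<and> k = 2" using ijk by linarith
  then show "bcoef 6 v a b p (i, j, k) = 0"
  proof cases
    case 1
    have "\<forall>x\<in>closed_segment a b. van 2 (\<lambda>x. p x - 0) x" using assms by simp
    from this[unfolded edge_a[OF nc p z]] 1 ijk show ?thesis by (simp add: bcoef_zero[OF nc])
  next
    case 2
    have "\<forall>x\<in>closed_segment v b. van 2 (\<lambda>x. p x - 0) x" using assms by simp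
    from this[unfolded edge_b[OF nc p z]] 2 ijk show ?thesis by (simp add: bcoef_zero[OF nc])
  next
    case 3
    have "\<forall>x\<in>closed_segment v a. van 2 (\<lambda>x. p x - 0) x" using assms by simp
    from this[unfolded edge_c[OF nc p z]] 3 ijk show ?thesis by (simp add: bcoef_zero[OF nc])
  qed (use m in simp)
qed

subsection \<open>Pie-shaped triangles\<close>

text \<open>The Taylor polynomial of degree 2: in coordinates centred at \<open>a\<close> the
  monomials of degree 3 or more vanish to order 3 at \<open>a\<close> and are dropped.\<close>

lemma Pd_truncate:
  assumes "f \<in> Pd n"
  obtains g where "g \<in> Pd 2" "van 3 (\<lambda>x. f x - g x) a"
proof -
  define X Y where "X = (\<lambda>x::point. x $ 1 - a $ 1)" and "Y = (\<lambda>x::point. x $ 2 - a $ 2)"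
  have XY: "X \<in> Pd 1" "Y \<in> Pd 1" unfolding X_def Y_def by (intro Pd_diff Pd_coords Pd_const)+
  have v: "van 1 X a" "van 1 Y a" unfolding van_1_iff[OF XY(1)] van_1_iff[OF XY(2)]
    by (simp_all add: X_def Y_def)
  have "(\<lambda>x. x $ 1) = (\<lambda>x. X x ^ 1 * Y x ^ 0 + a $ 1)" "(\<lambda>x. x $ 2) = (\<lambda>x. X x ^ 0 * Y x ^ 1 + a $ 2)"
    by (simp_all add: X_def Y_def)
  then have "(\<lambda>x. x $ 1) \<in> pspan X Y 1" "(\<lambda>x. x $ 2) \<in> pspan X Y 1"
    by (simp_all only:) (intro pspan_add pspan_const pspan_monom; simp)+
  then have "f \<in> pspan X Y n" using pspan_subst assms unfolding Pd_eq_pspan by blast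
  then have "\<exists>g\<in>Pd 2. van 3 (\<lambda>x. f x - g x) a"
  proof (induction rule: pspan_induct)
    case (add f1 f2)
    then obtain g1 g2 where "g1 \<in> Pd 2" "g2 \<in> Pd 2" "van 3 (\<lambda>x. f1 x - g1 x) a" "van 3 (\<lambda>x. f2 x - g2 x) a"
      by blast
    with van_add[OF this(3,4)] Pd_add[OF this(1,2)] show ?case
      by (intro bexI[of _ "\<lambda>x. g1 x + g2 x"]) (simp_all add: algebra_simps)
  next
    case (scale r f)
    then obtain g where "g \<in> Pd 2" "van 3 (\<lambda>x. f x - g x) a" by blast
    with van_scale[OF this(2), of r] Pd_scale[OF this(1), of r] show ?case
      by (intro bexI[of _ "\<lambda>x. r * g x"]) (simp_all add: algebra_simps)
  next
    case (monom i j)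
    show ?case
    proof (cases "i + j \<le> 2")
      case True
      then have "(\<lambda>x. X x ^ i * Y x ^ j) \<in> Pd 2"
        using Pd_mult[OF Pd_power[OF XY(1), of i] Pd_power[OF XY(2), of j]] by (auto intro: Pd_mono)
      then show ?thesis by (intro bexI[of _ "\<lambda>x. X x ^ i * Y x ^ j"]) (simp_all add: van_zero)
    next
      case False
      have "van (1 * i + 1 * j) (\<lambda>x. X x ^ i * Y x ^ j) a" by (intro van_mult van_power v)
      then have "van 3 (\<lambda>x. X x ^ i * Y x ^ j) a" by (rule van_mono) (use False in simp)
      then show ?thesis using Pd_const[of 0 2] by (intro bexI[of _ "\<lambda>x. 0"]) simp_all
    qed
  qed
  then show thesis using that by blast
qed

text \<open>If \<open>w a = 1\<close> and \<open>z = w - 1\<close>, then \<open>1 - z + z\<^sup>2\<close> inverts \<open>w\<close> up to \<open>z\<^sup>3\<close>, which vanishes to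
  order 3 at \<open>a\<close>.\<close>

lemma van_3_cancel:
  assumes w: "w \<in> Pd m" "w a = 1" and p: "p \<in> Pd n" and v: "van 3 (\<lambda>x. w x * p x) a"
  shows "van 3 p a"
proof -
  define z where "z = (\<lambda>x. w x - 1)"
  have z: "z \<in> Pd m" unfolding z_def by (intro Pd_diff w Pd_const)
  have "van 1 z a" unfolding van_1_iff[OF z] by (simp add: z_def w)
  from van_power[OF this, of 3] have z3: "van 3 (\<lambda>x. z x ^ 3) a" by simp
  have z2: "(\<lambda>x. 1 - z x + z x ^ 2) \<in> Pd (m * 2)"
    by (intro Pd_add Pd_diff Pd_const Pd_power z Pd_mono[OF z]) simp
  have "van 3 (\<lambda>x. (w x * p x) * (1 - z x + z x ^ 2) - z x ^ 3 * p x) a"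
    by (intro van_diff van_mult_left[OF v z2] van_mult_left[OF z3 p])
  moreover have "(w x * p x) * (1 - z x + z x ^ 2) - z x ^ 3 * p x = p x" for x
    by (simp add: z_def power2_eq_square power3_eq_cube algebra_simps)
  ultimately show ?thesis by simp
qed

text \<open>With the same approximate inverse, the product with \<open>Q\<close> solves the equation
  modulo terms of order 3. Truncation then brings the solution down to degree 2, which fits into the
  degree 4 of the conic factor.\<close>

lemma van_3_divide:
  assumes w: "w \<in> Pd m" "w a = 1" and Q: "Q \<in> Pd n"
  obtains R where "R \<in> Pd 2" "van 3 (\<lambda>x. w x * R x - Q x) a"
proof -
  define z where "z = (\<lambda>x. w x - 1)"
  have z: "z \<in> Pd m" unfolding z_def by (intro Pd_diff w Pd_const)
  have "van 1 z a" unfolding van_1_iff[OF z] by (simp add: z_def w)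
  from van_power[OF this, of 3] have z3: "van 3 (\<lambda>x. z x ^ 3) a" by simp
  have z2: "(\<lambda>x. 1 - z x + z x ^ 2) \<in> Pd (m * 2)"
    by (intro Pd_add Pd_diff Pd_const Pd_power z Pd_mono[OF z]) simp
  from Pd_truncate[OF Pd_mult[OF Q z2]] obtain R where R: "R \<in> Pd 2"
    "van 3 (\<lambda>x. Q x * (1 - z x + z x ^ 2) - R x) a" by blast
  have "van 3 (\<lambda>x. z x ^ 3 * Q x - (Q x * (1 - z x + z x ^ 2) - R x) * w x) a"
    by (intro van_diff van_mult_left[OF z3 Q] van_mult_left[OF R(2) w(1)])
  moreover have "z x ^ 3 * Q x - (Q x * (1 - z x + z x ^ 2) - R x) * w x = w x * R x - Q x" for x
    by (simp add: z_def power2_eq_square power3_eq_cube algebra_simps)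
  ultimately show thesis using that R(1) by simp
qed

text \<open>The product vanishes to order 1 + 2 at \<open>v\<close>, and (4,1,1) lies in the first
  three rows there. Consequently this coefficient, the mixed derivative along the two edges of the
  buffer triangle, depends only on the 1-jet of the conic factor at \<open>v\<close>.\<close>

lemma twist_zero:
  assumes nc: "area2 v a z \<noteq> 0" and w: "w \<in> Pd 2" "w v = 0" and p: "p \<in> Pd 4" and v: "van 2 p v"
  shows "bcoef 6 v a z (\<lambda>x. w x * p x) (4, 1, 1) = 0"
proof -
  have "van 1 w v" using w by (simp only: van_1_iff)
  from van_mult[OF this v] have "van 3 (\<lambda>x. w x * p x - 0) v" by (simp add: eval_nat_numeral)
  moreover have "(\<lambda>x. w x * p x) \<in> Pd 6" using Pd_mult[OF w(1) p] by simp
  ultimately show ?thesis using vert_a[OF nc _ Pd_const[of 0 6]] by (simp add: bcoef_zero[OF nc])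
qed

lemma bernstein_031:
  "bernstein 4 a v c (0, 3, 1) x = 4 * bary v a c x ^ 3 * bary c a v x"
  by (simp add: bernstein_bary fact_numeral)

text \<open>Near \<open>v\<close> the product is, to second order, the linear part of
  \<open>w\<close> times the linear part of the Bernstein polynomial, which vanishes along
  \<open>[v,a]\<close>. In direction \<open>(a - v) + \<rho> *\<^sub>R (z - v)\<close> this
  quadratic form has a term linear in \<open>\<rho>\<close>, whose factor is a multiple of
  \<open>grad w v \<bullet> (a - v)\<close>, and this term is the mixed coefficient. It cannot
  vanish, because the edge is not tangent to the conic and \<open>z\<close> is off the line through
  \<open>v\<close> and \<open>a\<close>.\<close>

lemma twist_nonzero:
  assumes nc: "area2 v a z \<noteq> 0" and nc': "area2 a v c \<noteq> 0"
    and w: "w \<in> Pd 2" "w v = 0" and g: "grad w v \<bullet> (a - v) \<noteq> 0"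
  shows "bcoef 6 v a z (\<lambda>x. w x * bernstein 4 a v c (0, 3, 1) x) (4, 1, 1) \<noteq> 0"
proof
  let ?f = "\<lambda>x. w x * bernstein 4 a v c (0, 3, 1) x"
  let ?B = "bcoef 6 v a z"
  assume c411: "?B ?f (4, 1, 1) = 0"
  have B: "bernstein 4 a v c (0, 3, 1) \<in> Pd 4" by (rule bernstein_Pd) (simp add: indices_def)
  have f: "?f \<in> Pd 6" using Pd_mult[OF w(1) B] by simp
  have zero: "(\<lambda>x::point. 0::real) \<in> Pd 6" by (rule Pd_const)
  have "van 1 (bary c a v) v" "van 1 w v"
    using w by (simp_all only: van_1_iff[OF bary_Pd] van_1_iff bary_self)
  from van_mult[OF this(2) van_mult_left[OF this(1) Pd_scale[OF Pd_power[OF bary_Pd[of v a c], of 3], of 4]]]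
  have "van 2 (\<lambda>x. ?f x - 0) v"
    unfolding bernstein_031 by (simp add: mult_ac numeral_2_eq_2)
  note v2 = this[unfolded vert_a[OF nc f zero] bcoef_zero[OF nc]]
  have "van 1 (\<lambda>x. ?f x - 0) x" if "x \<in> closed_segment v a" for x
  proof -
    have "van 1 (bary c a v) x"
      using that by (simp only: van_1_iff[OF bary_Pd] bary_segment closed_segment_commute)
    from van_mult_left[OF this Pd_mult[OF w(1) Pd_scale[OF Pd_power[OF bary_Pd[of v a c], of 3], of 4]]]
    show ?thesis unfolding bernstein_031 by (simp add: mult_ac)
  qed
  then have "\<forall>x\<in>closed_segment v a. van 1 (\<lambda>x. ?f x - 0) x" by blast
  note e1 = this[unfolded edge_c[OF nc f zero] bcoef_zero[OF nc]]
  \<comment> \<open>With (4,1,1) assumed to vanish, and (4,2,0) vanishing since \<open>?f\<close> is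
    0 on \<open>[v,a]\<close>, only (4,0,2) is left in the second row. Hence \<open>?g\<close> has
    the 2-jet of \<open>?f\<close> at \<open>v\<close>.\<close>
  define C where "C = ?B ?f (4, 0, 2)"
  let ?g = "\<lambda>x. C * bernstein 6 v a z (4, 0, 2) x"
  have g402: "bernstein 6 v a z (4, 0, 2) \<in> Pd 6" by (rule bernstein_Pd) (simp add: indices_def)
  have gP: "?g \<in> Pd 6" by (rule Pd_scale[OF g402])
  have "?g = bbpoly 6 v a z (\<lambda>\<alpha>. if \<alpha> = (4, 0, 2) then C else 0)"
    unfolding bbpoly_def using finite_indices[of 6]
    by (auto simp: if_distrib[of "\<lambda>z. z * _"] sum.delta indices_def cong: if_cong)
  then have cg: "?B ?g \<alpha> = (if \<alpha> = (4, 0, 2) then C else 0)" for \<alpha>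
    by (simp add: bcoef_bbpoly[OF nc] indices_def)
  have v3: "van 3 (\<lambda>x. ?f x - ?g x) v"
    unfolding vert_a[OF nc f gP]
  proof (intro allI impI)
    fix i j k :: nat assume ijk: "i + j + k = 6" "j + k < 3"
    then consider "j + k < 2" | "i = 4" "j = 1" "k = 1" | "i = 4" "j = 0" "k = 2" | "k < 1" "j = 2" "i = 4"
      by linarith
    then show "?B ?f (i, j, k) = ?B ?g (i, j, k)"
      using ijk v2 e1 c411 by cases (simp_all add: cg C_def[symmetric] del: One_nat_def)
  qed
  \<comment> \<open>The rate at which the coordinate belonging to \<open>c\<close> grows from
    \<open>v\<close> towards \<open>z\<close>.\<close>
  define \<kappa> where "\<kappa> = bary c a v z"
  have \<kappa>: "\<kappa> \<noteq> 0"
    using nc nc_perm[OF nc'] area2_swap(1)[of z a v] area2_swap(3)[of v a z] area2_swap(3)[of z v a]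
    unfolding \<kappa>_def bary_def by (auto simp: area2_def algebra_simps)
  have key: "4 * \<kappa> * \<rho> * (grad w v \<bullet> (a - v) + \<rho> * (grad w v \<bullet> (z - v))) = 15 * C * \<rho>\<^sup>2" for \<rho>
  proof -
    define h where "h = (a - v) + \<rho> *\<^sub>R (z - v)"
    obtain wp where wp: "\<And>t. w (v + t *\<^sub>R h) = poly wp t" using Pd_line[OF w(1)] by metis
    have wp0: "poly wp 0 = 0" using wp[of 0] w by simp
    then obtain r1 where r1: "wp = [:0, 1:] * r1" using poly_eq_0_iff_dvd[of wp 0] by (auto simp: dvd_def)
    have r1': "poly r1 0 = grad w v \<bullet> h"
      using van_directional[OF w(1) wp, of 0] unfolding r1 by (simp add: pderiv_pCons)
    obtain s where s: "\<And>t. bary v a c (v + t *\<^sub>R h) = poly s t" using Pd_line[OF bary_Pd] by metis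
    have s0: "poly s 0 = 1" using s[of 0] bary_self(1)[of v a c] nc_perm[OF nc'] by simp
    obtain r where r: "\<And>t. ?f (v + t *\<^sub>R h) - ?g (v + t *\<^sub>R h) = t ^ 3 * poly r t"
      using v3 unfolding van_def by meson
    have vh: "v + t *\<^sub>R h = (1 - (1 + \<rho>) * t) *\<^sub>R v + t *\<^sub>R a + (\<rho> * t) *\<^sub>R z" for t
      by (simp add: h_def algebra_simps)
    have bz: "bary z v a (v + t *\<^sub>R h) = \<rho> * t" "bary v a z (v + t *\<^sub>R h) = 1 - (1 + \<rho>) * t"
      "bary a v z (v + t *\<^sub>R h) = t" for t
      unfolding vh by (rule bary_comb[OF nc]; simp add: algebra_simps)+
    have bc: "bary c a v (v + t *\<^sub>R h) = t * (\<rho> * \<kappa>)" for t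
    proof -
      have "area2 (v + t *\<^sub>R h) a v = t * \<rho> * area2 z a v"
        unfolding vh area2_def by (simp add: algebra_simps)
      then show ?thesis unfolding \<kappa>_def bary_def by simp
    qed
    \<comment> \<open>Both functions carry a factor \<open>t ^ 2\<close> on the line, and
      \<open>?L\<close> is the difference of the cofactors. Contact of order 3 makes it divisible by
      \<open>t\<close>, and its value at 0 is the claimed identity. The number 15 is the multinomial
      coefficient of (4,0,2).\<close>
    let ?L = "smult (4 * \<rho> * \<kappa>) (r1 * s ^ 3) - smult (15 * C * \<rho>\<^sup>2) ([:1, -(1 + \<rho>):] ^ 4)"
    have "t ^ 2 * poly ?L t = t ^ 3 * poly r t" for t
    proof -
      have "?f (v + t *\<^sub>R h) = t ^ 2 * (4 * \<rho> * \<kappa> * (poly r1 t * poly s t ^ 3))"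
        unfolding bernstein_031 wp s bc r1 by (simp add: power2_eq_square)
      moreover have "?g (v + t *\<^sub>R h) = t ^ 2 * (15 * C * \<rho>\<^sup>2 * (1 - (1 + \<rho>) * t) ^ 4)"
        unfolding bernstein_bary bz by (simp add: fact_numeral power_mult_distrib)
      ultimately show ?thesis using r[of t] by (simp add: poly_power algebra_simps)
    qed
    moreover define L where "L = ?L"
    ultimately have "t ^ 2 * poly L t = t ^ 3 * poly r t" for t by blast
    then have "t ^ 2 * poly (L - [:0, 1:] * r) t = 0" for t
      by (simp add: power2_eq_square power3_eq_cube algebra_simps)
    then have "L - [:0, 1:] * r = 0"
      by (intro poly_zero_interval[of 1, OF zero_less_one]) (metis mult_eq_0_iff less_irrefl power_eq_0_iff)
    then have "poly L 0 = 0" by simp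
    then have "poly ?L 0 = 0" unfolding L_def .
    then have "4 * \<rho> * \<kappa> * (grad w v \<bullet> h) = 15 * C * \<rho>\<^sup>2"
      using r1' s0 by (simp add: poly_power)
    then show ?thesis by (simp add: h_def inner_add_right algebra_simps)
  qed
  \<comment> \<open>The difference of the cases 1 and -1 isolates the part of the identity that is
    odd in \<open>\<rho>\<close>.\<close>
  from key[of 1] key[of "-1"] have "8 * \<kappa> * (grad w v \<bullet> (a - v)) = 0" by (simp add: algebra_simps)
  with \<kappa> g show False by simp
qed

lemma bernstein_basis:
  assumes nc: "area2 a b c \<noteq> 0" and "\<beta> \<in> indices d"
  shows "bcoef d a b c (bernstein d a b c \<beta>) \<alpha> = (if \<alpha> = \<beta> then 1 else 0)"
proof -
  have "bernstein d a b c \<beta> = bbpoly d a b c (\<lambda>\<alpha>. if \<alpha> = \<beta> then 1 else 0)"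
    unfolding bbpoly_def using finite_indices[of d] assms(2)
    by (auto simp: if_distrib[of "\<lambda>z. z * _"] sum.delta cong: if_cong)
  then show ?thesis using assms by (auto simp: bcoef_bbpoly[OF nc])
qed

lemma bernstein_013: "bernstein 4 a b c (0, 1, 3) = bernstein 4 a c b (0, 3, 1)"
  by (simp add: bernstein_bary fun_eq_iff)

lemma bernstein_013_van_2: "van 2 (bernstein 4 a b c (0, 1, 3)) b"
proof -
  have "van 3 (\<lambda>x. bary c a b x ^ 3) b"
    using van_power[of 1 "bary c a b" b 3] by (simp add: van_1_iff[OF bary_Pd] bary_self del: One_nat_def)
  then have "van 3 (\<lambda>x. bary c a b x ^ 3 * (4 * bary b a c x)) b"
    by (rule van_mult_left[OF _ Pd_scale[OF bary_Pd]])
  then have "van 3 (bernstein 4 a b c (0, 1, 3)) b"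
    by (simp add: bernstein_bary[abs_def] fact_numeral mult_ac)
  then show ?thesis by (rule van_mono) simp
qed

text \<open>The 15 coefficients of the quartic factor: six at \<open>a\<close> come from the 2-jet
  of \<open>Q / w\<close>, five are prescribed, the two corner values are \<open>\<mu>b\<close> and
  \<open>\<mu>c\<close>, and (0,3,1) and (0,1,3) are left for the two mixed derivatives in the
  adjacent buffer triangles.\<close>

lemma pie_interpolation:
  assumes nc: "area2 a b c \<noteq> 0" "area2 b a zb \<noteq> 0" "area2 c a zc \<noteq> 0"
    and w: "w \<in> Pd 2" "w a = 1" "w b = 0" "w c = 0"
    and g: "grad w b \<bullet> (a - b) \<noteq> 0" "grad w c \<bullet> (a - c) \<noteq> 0" and Q: "Q \<in> Pd 5"
  obtains p where "p \<in> Pd 4" "van 3 (\<lambda>x. w x * p x - Q x) a"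
    "\<forall>\<alpha>\<in>{(1,3,0), (1,2,1), (1,1,2), (1,0,3), (0,2,2)}. bcoef 4 a b c p \<alpha> = X \<alpha>"
    "p b = \<mu>b" "p c = \<mu>c"
    "bcoef 6 b a zb (\<lambda>x. w x * p x) (4, 1, 1) = yb"
    "bcoef 6 c a zc (\<lambda>x. w x * p x) (4, 1, 1) = yc"
proof -
  let ?B = "bcoef 4 a b c"
  from van_3_divide[OF w(1,2) Q] obtain R where R: "R \<in> Pd 2" "van 3 (\<lambda>x. w x * R x - Q x) a" .
  have R4: "R \<in> Pd 4" using Pd_mono[OF R(1)] by simp
  define coef where "coef = (\<lambda>(i::nat, j::nat, k::nat).
    if i \<ge> 2 then ?B R (i, j, k) else if j = 4 then \<mu>b else if k = 4 then \<mu>c else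
    if j = 3 \<and> i = 0 \<or> k = 3 \<and> i = 0 then 0 else X (i, j, k))"
  define p0 where "p0 = bbpoly 4 a b c coef"
  let ?b1 = "bernstein 4 a b c (0, 3, 1)" and ?b2 = "bernstein 4 a b c (0, 1, 3)"
  let ?lb = "\<lambda>p. bcoef 6 b a zb (\<lambda>x. w x * p x) (4, 1, 1)"
  let ?lc = "\<lambda>p. bcoef 6 c a zc (\<lambda>x. w x * p x) (4, 1, 1)"
  \<comment> \<open>The mixed derivatives are linear in the factor, and \<open>p0\<close> has the
    coefficient 0 in both open positions. The two equations decouple, since each of the two
    Bernstein polynomials vanishes to second order at the other boundary vertex and does not
    contribute there.\<close>
  define u1 where "u1 = (yb - ?lb p0) / ?lb ?b1"
  define u2 where "u2 = (yc - ?lc p0) / ?lc ?b2"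
  define p where "p = (\<lambda>x. p0 x + (u1 * ?b1 x + u2 * ?b2 x))"
  have p0: "p0 \<in> Pd 4" unfolding p0_def by (rule bbpoly_Pd)
  have b12: "?b1 \<in> Pd 4" "?b2 \<in> Pd 4" by (auto intro!: bernstein_Pd simp: indices_def)
  have p: "p \<in> Pd 4" unfolding p_def by (intro Pd_add Pd_scale p0 b12)
  have cp: "?B p \<alpha> = ?B p0 \<alpha> + ((if \<alpha> = (0, 3, 1) then u1 else 0) + (if \<alpha> = (0, 1, 3) then u2 else 0))" for \<alpha>
    unfolding p_def
    by (simp add: bcoef_add[OF nc(1)] Pd_add Pd_scale p0 b12 bcoef_scale[OF nc(1)] bernstein_basis[OF nc(1)]
        indices_def del: One_nat_def)
  have cp0: "?B p0 (i, j, k) = coef (i, j, k)" if "i + j + k = 4" for i j k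
    unfolding p0_def bcoef_bbpoly[OF nc(1)] using that by (simp add: indices_def)
  have "van 3 (\<lambda>x. p x - R x) a"
    unfolding vert_a[OF nc(1) p R4] by (auto simp: cp cp0 coef_def)
  then have "van 3 (\<lambda>x. (p x - R x) * w x + (w x * R x - Q x)) a"
    by (intro van_add van_mult_left[OF _ w(1)] R(2))
  then have jet: "van 3 (\<lambda>x. w x * p x - Q x) a" by (simp add: algebra_simps)
  have five: "\<forall>\<alpha>\<in>{(1,3,0), (1,2,1), (1,1,2), (1,0,3), (0,2,2)}. ?B p \<alpha> = X \<alpha>"
    by (auto simp: cp cp0 coef_def)
  have pb: "p b = \<mu>b" unfolding bcoef_corner_b[OF nc(1) p, symmetric] by (simp add: cp cp0 coef_def)
  have pc: "p c = \<mu>c" unfolding bcoef_corner_c[OF nc(1) p, symmetric] by (simp add: cp cp0 coef_def)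
  have wP: "(\<lambda>x. w x * f x) \<in> Pd 6" if "f \<in> Pd 4" for f using Pd_mult[OF w(1) that] by simp
  have \<lambda>: "bcoef 6 v a z (\<lambda>x. w x * p x) \<alpha> = bcoef 6 v a z (\<lambda>x. w x * p0 x) \<alpha> +
      (u1 * bcoef 6 v a z (\<lambda>x. w x * ?b1 x) \<alpha> + u2 * bcoef 6 v a z (\<lambda>x. w x * ?b2 x) \<alpha>)"
    if "area2 v a z \<noteq> 0" for v z \<alpha>
  proof -
    have "(\<lambda>x. w x * p x) = (\<lambda>x. w x * p0 x + (u1 * (w x * ?b1 x) + u2 * (w x * ?b2 x)))"
      by (simp add: p_def algebra_simps)
    then show ?thesis
      by (simp add: bcoef_add[OF that] bcoef_scale[OF that] wP p0 b12 Pd_add Pd_scale del: One_nat_def)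
  qed
  have nzb: "?lb ?b1 \<noteq> 0" by (rule twist_nonzero[OF nc(2,1) w(1,3) g(1)])
  have nzc: "?lc ?b2 \<noteq> 0" unfolding bernstein_013
    by (rule twist_nonzero[OF nc(3) nc_perm(2)[OF nc(1)] w(1,4) g(2)])
  have zb: "?lb ?b2 = 0" by (rule twist_zero[OF nc(2) w(1,3) b12(2) bernstein_013_van_2])
  have "van 2 ?b1 c" unfolding bernstein_013[symmetric] by (rule bernstein_013_van_2)
  then have zc: "?lc ?b1 = 0" by (rule twist_zero[OF nc(3) w(1,4) b12(1)])
  have lb: "?lb p = yb" unfolding \<lambda>[OF nc(2)] zb using nzb by (simp add: u1_def)
  have lc: "?lc p = yc" unfolding \<lambda>[OF nc(3)] zc using nzc by (simp add: u2_def)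
  show thesis by (rule that[OF p jet five pb pc lb lc])
qed

text \<open>All coefficients in the two rows along \<open>[a,b]\<close> are known to be 0 except
  (0,3,1); this one is recovered from the mixed derivative in the buffer triangle, to which it
  contributes with a nonzero factor.\<close>

lemma pie_edge_zero:
  assumes nc: "area2 a b c \<noteq> 0" "area2 b a z \<noteq> 0"
    and w: "w \<in> Pd 2" "w a = 1" "w b = 0" and g: "grad w b \<bullet> (a - b) \<noteq> 0"
    and p: "p \<in> Pd 4" and v: "van 3 (\<lambda>x. w x * p x) a"
    and m: "bcoef 4 a b c p (1, 3, 0) = 0" "bcoef 4 a b c p (1, 2, 1) = 0"
    and pb: "p b = 0" and tw: "bcoef 6 b a z (\<lambda>x. w x * p x) (4, 1, 1) = 0"
  shows "\<forall>x\<in>closed_segment a b. van 2 p x"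
proof -
  let ?B = "bcoef 4 a b c"
  have z: "(\<lambda>x::point. 0::real) \<in> Pd 4" by (rule Pd_const)
  have "van 3 (\<lambda>x. p x - 0) a" using van_3_cancel[OF w(1,2) p v] by simp
  note v3 = this[unfolded vert_a[OF nc(1) p z] bcoef_zero[OF nc(1)]]
  have c040: "?B p (0, 4, 0) = 0" using bcoef_corner_b[OF nc(1) p] pb by simp
  let ?b1 = "bernstein 4 a b c (0, 3, 1)"
  define u where "u = ?B p (0, 3, 1)"
  have b1: "?b1 \<in> Pd 4" by (rule bernstein_Pd) (simp add: indices_def)
  have ub1: "(\<lambda>x. u * ?b1 x) \<in> Pd 4" by (rule Pd_scale[OF b1])
  \<comment> \<open>Without its (0,3,1) part the factor has a trivial 1-jet at \<open>b\<close>,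
    hence no mixed derivative. So the mixed derivative of the whole product is \<open>u\<close>
    times the one of \<open>?b1\<close>.\<close>
  have "van 2 (\<lambda>x. p x - u * ?b1 x) b"
    unfolding vert_b[OF nc(1) p ub1]
  proof (intro allI impI)
    fix i j k :: nat assume ijk: "i + j + k = 4" "i + k < 2"
    then consider "i = 0" "j = 4" "k = 0" | "i = 1" "j = 3" "k = 0" | "i = 0" "j = 3" "k = 1" by linarith
    then show "?B p (i, j, k) = ?B (\<lambda>x. u * ?b1 x) (i, j, k)"
      using m c040 by cases
        (simp_all add: bcoef_scale[OF nc(1) b1] bernstein_basis[OF nc(1)] indices_def u_def[symmetric]
            del: One_nat_def)
  qed
  from twist_zero[OF nc(2) w(1,3) Pd_diff[OF p ub1] this]
  have "0 = bcoef 6 b a z (\<lambda>x. w x * p x - u * (w x * ?b1 x)) (4, 1, 1)"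
    by (simp add: algebra_simps)
  also have "\<dots> = - (u * bcoef 6 b a z (\<lambda>x. w x * ?b1 x) (4, 1, 1))"
    using Pd_mult[OF w(1) p] Pd_mult[OF w(1) b1] tw
    by (simp add: bcoef_diff[OF nc(2)] bcoef_scale[OF nc(2)] Pd_scale del: One_nat_def)
  finally have "u = 0" using twist_nonzero[OF nc(2,1) w(1,3) g] by simp
  then have c031: "?B p (0, 3, 1) = 0" by (simp add: u_def)
  have "\<forall>x\<in>closed_segment a b. van 2 (\<lambda>x. p x - 0) x"
    unfolding edge_c[OF nc(1) p z] bcoef_zero[OF nc(1)]
  proof (intro allI impI)
    fix i j k :: nat assume ijk: "i + j + k = 4" "k < 2"
    then consider "j + k < 3" | "i = 1" "j = 3" "k = 0" | "i = 1" "j = 2" "k = 1" | "i = 0" "j = 4" "k = 0"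
      | "i = 0" "j = 3" "k = 1" by linarith
    then show "?B p (i, j, k) = 0" using ijk v3 m c040 c031 by cases simp_all
  qed
  then show ?thesis by simp
qed

lemma pie_zero:
  assumes nc: "area2 a b c \<noteq> 0" and p: "p \<in> Pd 4"
    and "\<forall>x\<in>closed_segment a b. van 2 p x" "\<forall>x\<in>closed_segment a c. van 2 p x"
    and m: "bcoef 4 a b c p (0, 2, 2) = 0"
  shows "p = (\<lambda>x. 0)"
proof (rule bcoef_zero_imp[OF nc p])
  fix i j k :: nat assume ijk: "i + j + k = 4"
  have z: "(\<lambda>x::point. 0::real) \<in> Pd 4" by (rule Pd_const)
  consider "j < 2" | "k < 2" | "i = 0 \<and> j = 2 \<and> k = 2" using ijk by linarith
  then show "bcoef 4 a b c p (i, j, k) = 0"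
  proof cases
    case 1
    have "\<forall>x\<in>closed_segment a c. van 2 (\<lambda>x. p x - 0) x" using assms by simp
    from this[unfolded edge_b[OF nc p z]] 1 ijk show ?thesis by (simp add: bcoef_zero[OF nc])
  next
    case 2
    have "\<forall>x\<in>closed_segment a b. van 2 (\<lambda>x. p x - 0) x" using assms by simp
    from this[unfolded edge_c[OF nc p z]] 2 ijk show ?thesis by (simp add: bcoef_zero[OF nc])
  qed (use m in simp)
qed

section \<open>Polynomials vanishing on an arc of an irreducible conic\<close>

lemma Pd_2_expand:
  assumes "q \<in> Pd 2"
  obtains a b c d e f where
    "\<And>x. q x = a + b * x $ 1 + c * x $ 2 + d * (x $ 1)\<^sup>2 + e * x $ 1 * x $ 2 + f * (x $ 2)\<^sup>2"
proof -
  obtain c where c: "\<And>x. q x = (\<Sum>i\<le>2. \<Sum>j\<le>2 - i. c i j * (x $ 1) ^ i * (x $ 2) ^ j)"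
    using assms unfolding Pd_def by blast
  show thesis
    by (rule that[of "c 0 0" "c 1 0" "c 0 1" "c 2 0" "c 1 1" "c 0 2"])
      (simp add: c eval_nat_numeral algebra_simps)
qed

text \<open>Linear coordinates \<open>(X, Y)\<close> in which the conic is monic of degree 2 in \<open>Y\<close>.\<close>

definition conic_coords where
  "conic_coords X Y q \<kappa> b c \<longleftrightarrow> X \<in> Pd 1 \<and> Y \<in> Pd 1 \<and>
     (\<lambda>x::point. x $ 1) \<in> pspan X Y 1 \<and> (\<lambda>x. x $ 2) \<in> pspan X Y 1 \<and>
     (\<exists>e. \<forall>x t. X (x + t *\<^sub>R e) = X x \<and> Y (x + t *\<^sub>R e) = Y x + t) \<and>
     \<kappa> \<noteq> 0 \<and> degree b \<le> 1 \<and> degree c \<le> 2 \<and>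
     (\<forall>x. q x = \<kappa> * (Y x ^ 2 + poly b (X x) * Y x + poly c (X x)))"

text \<open>A pure square in one of the coordinates can be made monic directly. If the mixed term is
  the only quadratic one, a shear produces a square.\<close>

lemma conic_coords_exist:
  assumes "q \<in> Pd 2" "q \<notin> Pd 1"
  shows "\<exists>X Y \<kappa> b c. conic_coords X Y q \<kappa> b c"
proof -
  obtain a b c d e f where q:
    "\<And>x. q x = a + b * x $ 1 + c * x $ 2 + d * (x $ 1)\<^sup>2 + e * x $ 1 * x $ 2 + f * (x $ 2)\<^sup>2"
    by (rule Pd_2_expand[OF assms(1)]) blast
  consider "f \<noteq> 0" | "d \<noteq> 0" | "d = 0" "f = 0" "e \<noteq> 0" | "d = 0" "f = 0" "e = 0" by blast
  then show ?thesis
  proof cases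
    case 1
    have "conic_coords (\<lambda>x. x $ 1) (\<lambda>x. x $ 2) q f [:c / f, e / f:] [:a / f, b / f, d / f:]"
      unfolding conic_coords_def
      using 1 by (intro conjI allI exI[of _ "axis 2 1"])
        (auto simp: Pd_coords Pd_coords[unfolded Pd_eq_pspan] axis_def q field_simps power2_eq_square
          simp del: One_nat_def)
    then show ?thesis by blast
  next
    case 2
    have "(\<lambda>x::point. x $ 1) \<in> pspan (\<lambda>x. x $ 2) (\<lambda>x. x $ 1) 1"
      "(\<lambda>x::point. x $ 2) \<in> pspan (\<lambda>x. x $ 2) (\<lambda>x. x $ 1) 1"
      using pspan_monom[of 0 1 1 "\<lambda>x::point. x $ 2" "\<lambda>x. x $ 1"]
        pspan_monom[of 1 0 1 "\<lambda>x::point. x $ 2" "\<lambda>x. x $ 1"] by simp_all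
    then have "conic_coords (\<lambda>x. x $ 2) (\<lambda>x. x $ 1) q d [:b / d, e / d:] [:a / d, c / d, f / d:]"
      unfolding conic_coords_def
      using 2 by (intro conjI allI exI[of _ "axis 1 1"])
        (auto simp: Pd_coords axis_def q field_simps power2_eq_square simp del: One_nat_def)
    then show ?thesis by blast
  next
    case 3
    \<comment> \<open>In these coordinates the product of \<open>x $ 1\<close> and
      \<open>x $ 2\<close> is \<open>(X + Y) * Y\<close>, which contains the square of
      \<open>Y\<close>.\<close>
    let ?X = "\<lambda>x::point. x $ 1 - x $ 2" and ?Y = "\<lambda>x::point. x $ 2"
    have "(\<lambda>x. ?X x ^ 1 * ?Y x ^ 0 + ?X x ^ 0 * ?Y x ^ 1) \<in> pspan ?X ?Y 1"
      by (intro pspan_add pspan_monom) simp_all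
    then have 1: "(\<lambda>x. x $ 1) \<in> pspan ?X ?Y 1" by simp
    have 2: "(\<lambda>x. x $ 2) \<in> pspan ?X ?Y 1"
      using pspan_monom[of 0 1 1 ?X ?Y] by simp
    have "conic_coords ?X ?Y q e [:(b + c) / e, 1:] [:a / e, b / e:]"
      unfolding conic_coords_def
      using 3 1 2 by (intro conjI allI exI[of _ "axis 1 1 + axis 2 1"])
        (auto simp: Pd_coords Pd_diff axis_def q field_simps power2_eq_square simp del: One_nat_def)
    then show ?thesis by blast
  next
    case 4
    have "(\<lambda>x. (a + b * x $ 1) + c * x $ 2) \<in> Pd 1"
      by (intro Pd_add Pd_scale Pd_const Pd_coords)
    moreover have "q = (\<lambda>x. (a + b * x $ 1) + c * x $ 2)" using q 4 by auto
    ultimately show ?thesis using assms by simp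
  qed
qed

text \<open>Division with remainder by a polynomial that is quadratic and, up to
  \<open>\<kappa>\<close>, monic in \<open>Y\<close>: squares of \<open>Y\<close> are replaced
  repeatedly. The bounds on the degrees of \<open>b\<close> and \<open>c\<close> ensure that no
  replacement raises the total degree, which is what bounds the degree of the quotient.\<close>

lemma conic_division:
  assumes co: "conic_coords X Y q \<kappa> b c" and f: "f \<in> pspan X Y n"
  shows "\<exists>h\<in>pspan X Y (n - 2). \<exists>r0 r1. \<forall>x. f x = q x * h x + poly r0 (X x) + poly r1 (X x) * Y x"
    (is "?P f")
proof -
  have \<kappa>: "\<kappa> \<noteq> 0" and deg: "degree b \<le> 1" "degree c \<le> 2"
    and q: "\<And>x. q x = \<kappa> * (Y x ^ 2 + poly b (X x) * Y x + poly c (X x))"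
    using co unfolding conic_coords_def by auto
  have add: "?P (\<lambda>x. f x + g x)" if fg: "?P f" "?P g" for f g
  proof -
    obtain h r0 r1 h' r0' r1' where "h \<in> pspan X Y (n - 2)" "h' \<in> pspan X Y (n - 2)"
      "\<forall>x. f x = q x * h x + poly r0 (X x) + poly r1 (X x) * Y x"
      "\<forall>x. g x = q x * h' x + poly r0' (X x) + poly r1' (X x) * Y x" using fg by blast
    then show ?thesis using pspan_add[of h X Y _ h']
      by (intro bexI[of _ "\<lambda>x. h x + h' x"] exI[of _ "r0 + r0'"] exI[of _ "r1 + r1'"])
        (auto simp: algebra_simps)
  qed
  have scale: "?P (\<lambda>x. r * f x)" if f: "?P f" for r f
  proof -
    obtain h r0 r1 where "h \<in> pspan X Y (n - 2)"
      "\<forall>x. f x = q x * h x + poly r0 (X x) + poly r1 (X x) * Y x" using f by blast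
    then show ?thesis using pspan_scale[of h X Y _ r]
      by (intro bexI[of _ "\<lambda>x. r * h x"] exI[of _ "smult r r0"] exI[of _ "smult r r1"])
        (auto simp: algebra_simps)
  qed
  have monom: "?P (\<lambda>x. X x ^ i * Y x ^ j)" if "i + j \<le> n" for i j
    using that
  proof (induction j arbitrary: i rule: less_induct)
    case (less j)
    consider "j = 0" | "j = 1" | k where "j = k + 2" by (metis One_nat_def add_2_eq_Suc' not0_implies_Suc)
    then show ?case
    proof cases
      case 1
      then show ?thesis
        by (intro bexI[of _ "\<lambda>x. 0"] exI[of _ "monom 1 i"] exI[of _ 0]) (auto simp: poly_monom pspan_zero)
    next
      case 2
      then show ?thesis
        by (intro bexI[of _ "\<lambda>x. 0"] exI[of _ 0] exI[of _ "monom 1 i"]) (auto simp: poly_monom pspan_zero)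
    next
      case 3
      note IH = less.IH[of "k + 1"] less.IH[of k]
      obtain b0 b1 where b: "b = [:b0, b1:]"
      proof (rule that[of "coeff b 0" "coeff b 1"], rule poly_eqI)
        fix m show "coeff b m = coeff [:coeff b 0, coeff b 1:] m"
          using deg(1) coeff_eq_0[of b m]
          by (cases "m \<le> 1") (auto simp: coeff_pCons eval_nat_numeral le_Suc_eq split: nat.splits)
      qed
      obtain c0 c1 c2 where c: "c = [:c0, c1, c2:]"
      proof (rule that[of "coeff c 0" "coeff c 1" "coeff c 2"], rule poly_eqI)
        fix m show "coeff c m = coeff [:coeff c 0, coeff c 1, coeff c 2:] m"
          using deg(2) coeff_eq_0[of c m]
          by (cases "m \<le> 2") (auto simp: coeff_pCons eval_nat_numeral le_Suc_eq split: nat.splits)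
      qed
      have m1: "?P (\<lambda>x. X x ^ i * Y x ^ (k + 1))" "?P (\<lambda>x. X x ^ (i + 1) * Y x ^ (k + 1))"
        "?P (\<lambda>x. X x ^ i * Y x ^ k)" "?P (\<lambda>x. X x ^ (i + 1) * Y x ^ k)" "?P (\<lambda>x. X x ^ (i + 2) * Y x ^ k)"
        using less.prems 3 by (intro IH; simp)+
      have m0: "?P (\<lambda>x. (1 / \<kappa>) * (q x * (X x ^ i * Y x ^ k)))"
        using less.prems 3
        by (intro scale bexI[of _ "\<lambda>x. X x ^ i * Y x ^ k"] exI[of _ 0] pspan_monom) auto
      have "?P (\<lambda>x. (1 / \<kappa>) * (q x * (X x ^ i * Y x ^ k)) +
         ((- b0) * (X x ^ i * Y x ^ (k + 1)) + ((- b1) * (X x ^ (i + 1) * Y x ^ (k + 1)) +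
         ((- c0) * (X x ^ i * Y x ^ k) + ((- c1) * (X x ^ (i + 1) * Y x ^ k) +
         (- c2) * (X x ^ (i + 2) * Y x ^ k))))))"
        by (intro add[OF m0] add[OF scale[OF m1(1)]] add[OF scale[OF m1(2)]] add[OF scale[OF m1(3)]]
           add[OF scale[OF m1(4)] scale[OF m1(5)]])
      moreover have "(1 / \<kappa>) * (q x * (X x ^ i * Y x ^ k)) +
         ((- b0) * (X x ^ i * Y x ^ (k + 1)) + ((- b1) * (X x ^ (i + 1) * Y x ^ (k + 1)) +
         ((- c0) * (X x ^ i * Y x ^ k) + ((- c1) * (X x ^ (i + 1) * Y x ^ k) +
         (- c2) * (X x ^ (i + 2) * Y x ^ k))))) = X x ^ i * Y x ^ j" for x
        using \<kappa> unfolding q b c 3 by (simp add: algebra_simps power2_eq_square)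
      ultimately show ?thesis by (simp only:)
    qed
  qed
  show ?thesis using f
    by (induction rule: pspan_induct) (blast intro: add scale monom)+
qed

lemma poly_comp_Pd: assumes "X \<in> Pd 1" shows "(\<lambda>x. poly p (X x)) \<in> (\<Union>d. Pd d)"
proof (induction p)
  case 0
  show ?case using Pd_const by auto
next
  case (pCons a p)
  then obtain d where "(\<lambda>x. poly p (X x)) \<in> Pd d" by blast
  then have "(\<lambda>x. a + X x * poly p (X x)) \<in> Pd (1 + d)"
    by (intro Pd_add Pd_const Pd_mult assms)
  then show ?case by auto
qed

lemma Pd_0_const: "f \<in> Pd 0 \<Longrightarrow> f x = f y"
  by (auto simp: Pd_def)

text \<open>The remainder \<open>r0(X) + r1(X) Y\<close> vanishes on \<open>A\<close>. Each value of
  \<open>X\<close> is taken at finitely many points of the conic, so \<open>X\<close> takes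
  infinitely many values on \<open>A\<close>, and univariate identities in \<open>X\<close> can be
  tested there. If \<open>r1\<close> were not 0, eliminating \<open>Y\<close> would show the
  discriminant of the conic to be a square, and the conic would split into two factors.\<close>

lemma conic_dvd:
  assumes q: "q \<in> Pd 2" "q \<notin> Pd 1" "irreducible_Pd q"
    and A: "infinite A" "\<And>x. x \<in> A \<Longrightarrow> q x = 0" "\<And>x. x \<in> A \<Longrightarrow> f x = 0"
    and f: "f \<in> Pd n" "2 \<le> n"
  shows "\<exists>h\<in>Pd (n - 2). \<forall>x. f x = q x * h x"
proof -
  obtain X Y \<kappa> b c where co: "conic_coords X Y q \<kappa> b c" using conic_coords_exist[OF q(1,2)] by blast
  then have XY: "X \<in> Pd 1" "Y \<in> Pd 1" and x12: "(\<lambda>x::point. x $ 1) \<in> pspan X Y 1" "(\<lambda>x. x $ 2) \<in> pspan X Y 1"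
    and \<kappa>: "\<kappa> \<noteq> 0" and qx: "\<And>x. q x = \<kappa> * (Y x ^ 2 + poly b (X x) * Y x + poly c (X x))"
    unfolding conic_coords_def by auto
  obtain e where e: "\<And>x t. X (x + t *\<^sub>R e) = X x" "\<And>x t. Y (x + t *\<^sub>R e) = Y x + t"
    using co unfolding conic_coords_def by blast
  have fXY: "f \<in> pspan X Y n" using pspan_subst[OF f(1)[unfolded Pd_eq_pspan] x12] .
  obtain h r0 r1 where h: "h \<in> pspan X Y (n - 2)"
    and fx: "\<And>x. f x = q x * h x + poly r0 (X x) + poly r1 (X x) * Y x"
    using conic_division[OF co fXY] by blast
  have hP: "h \<in> Pd (n - 2)" using pspan_subst[OF h XY[unfolded Pd_eq_pspan]] by (simp add: Pd_eq_pspan)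
  have inj: "x = y" if "X x = X y" "Y x = Y y" for x y
  proof -
    have "x $ 1 = y $ 1" "x $ 2 = y $ 2"
      using x12 that unfolding pspan_def by auto
    then show ?thesis by (simp add: vec_eq_iff forall_2)
  qed
  have fib: "finite {x \<in> A. X x = \<xi>}" for \<xi>
  proof (rule finite_imageD)
    have "Y ` {x \<in> A. X x = \<xi>} \<subseteq> {y. poly [:poly c \<xi>, poly b \<xi>, 1:] y = 0}"
    proof safe
      fix x assume "x \<in> A"
      then have "Y x ^ 2 + poly b (X x) * Y x + poly c (X x) = 0" using A(2)[of x] qx[of x] \<kappa> by simp
      then show "poly [:poly c (X x), poly b (X x), 1:] (Y x) = 0"
        by (simp add: power2_eq_square algebra_simps)
    qed
    moreover have "finite {y. poly [:poly c \<xi>, poly b \<xi>, 1:] y = 0}" by (rule poly_roots_finite) simp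
    ultimately show "finite (Y ` {x \<in> A. X x = \<xi>})" by (rule finite_subset)
    show "inj_on Y {x \<in> A. X x = \<xi>}" using inj by (auto simp: inj_on_def)
  qed
  have infX: "infinite (X ` A)"
  proof
    assume "finite (X ` A)"
    then have "finite (\<Union>\<xi>\<in>X ` A. {x \<in> A. X x = \<xi>})" using fib by blast
    moreover have "A \<subseteq> (\<Union>\<xi>\<in>X ` A. {x \<in> A. X x = \<xi>})" by blast
    ultimately show False using A(1) finite_subset by blast
  qed
  have pz: "p = 0" if "\<And>x. x \<in> A \<Longrightarrow> poly p (X x) = 0" for p
  proof (rule ccontr)
    assume "p \<noteq> 0"
    then have "finite {t. poly p t = 0}" by (rule poly_roots_finite)
    moreover have "X ` A \<subseteq> {t. poly p t = 0}" using that by auto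
    ultimately show False using infX finite_subset by blast
  qed
  have onA: "poly r0 (X x) + poly r1 (X x) * Y x = 0" "Y x ^ 2 + poly b (X x) * Y x + poly c (X x) = 0"
    if "x \<in> A" for x
    using A(2,3)[OF that] fx[of x] qx[of x] \<kappa> by auto
  have "r1 = 0"
  proof (rule ccontr)
    assume r1: "r1 \<noteq> 0"
    \<comment> \<open>Elimination by completing the square: on \<open>A\<close> both
      \<open>S\<close> and \<open>r1 * (2 * Y + b)\<close> add up to 0, and the square of
      \<open>2 * Y + b\<close> is the discriminant \<open>\<Delta>\<close>.\<close>
    define S \<Delta> where "S = smult 2 r0 - b * r1" and "\<Delta> = b\<^sup>2 - smult 4 c"
    have "S\<^sup>2 - r1\<^sup>2 * \<Delta> = 0"
    proof (rule pz)
      fix x assume "x \<in> A"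
      define u v y B C where "u = poly r0 (X x)" "v = poly r1 (X x)" "y = Y x" "B = poly b (X x)" "C = poly c (X x)"
      note d = this
      have u: "u = - (v * y)" and y: "y\<^sup>2 = - B * y - C"
        using onA[OF \<open>x \<in> A\<close>] unfolding d by (simp_all add: algebra_simps)
      have "(2 * u - B * v)\<^sup>2 - v\<^sup>2 * (B\<^sup>2 - 4 * C) = v\<^sup>2 * (4 * y\<^sup>2 + 4 * B * y + 4 * C)"
        unfolding u by (simp add: power2_eq_square algebra_simps)
      also have "\<dots> = 0" unfolding y by (simp add: algebra_simps)
      finally show "poly (S\<^sup>2 - r1\<^sup>2 * \<Delta>) (X x) = 0"
        by (simp add: S_def \<Delta>_def d)
    qed
    then have S: "S\<^sup>2 = r1\<^sup>2 * \<Delta>" by simp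
    then have "r1\<^sup>2 dvd S\<^sup>2" by simp
    \<comment> \<open>Divisibility of squares descends to the bases because real polynomials in one
      variable form a factorial ring. The quotient \<open>T\<close> is then a polynomial square root
      of the discriminant.\<close>
    then have "r1 dvd S" by (simp add: pow_divides_pow_iff)
    then obtain T where "S = r1 * T" by (auto simp: dvd_def)
    with S r1 have T: "T\<^sup>2 = \<Delta>" by (simp add: power_mult_distrib)
    let ?F = "\<lambda>x. \<kappa> * (Y x + poly (smult (1/2) (b - T)) (X x))"
    let ?G = "\<lambda>x. Y x + poly (smult (1/2) (b + T)) (X x)"
    have FG: "q x = ?F x * ?G x" for x
    proof -
      have "(poly T (X x))\<^sup>2 = (poly b (X x))\<^sup>2 - 4 * poly c (X x)"
        using T by (metis \<Delta>_def poly_diff poly_power poly_smult)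
      then have "4 * poly c (X x) = (poly b (X x))\<^sup>2 - (poly T (X x))\<^sup>2" by simp
      then have "\<kappa> * (4 * poly c (X x)) = \<kappa> * ((poly b (X x))\<^sup>2 - (poly T (X x))\<^sup>2)" by simp
      then have "4 * q x = 4 * (?F x * ?G x)"
        unfolding qx by (simp add: power2_eq_square algebra_simps)
      then show ?thesis by simp
    qed
    have U: "(\<lambda>x. Y x + poly p (X x)) \<in> (\<Union>d. Pd d)" for p
    proof -
      obtain d where "(\<lambda>x. poly p (X x)) \<in> Pd d" using poly_comp_Pd[OF XY(1)] by blast
      then have "(\<lambda>x. Y x + poly p (X x)) \<in> Pd (max 1 d)"
        by (intro Pd_add) (auto intro: Pd_mono Pd_mono[OF XY(2)])
      then show ?thesis by blast
    qed
    then have FU: "?F \<in> (\<Union>d. Pd d)" using Pd_scale by blast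
    have "?F \<in> Pd 0 \<or> ?G \<in> Pd 0"
      using q(3)[unfolded irreducible_Pd_def, THEN conjunct2, THEN conjunct2, rule_format, OF FU U FG] .
    \<comment> \<open>Neither factor is constant: moving along \<open>e\<close> keeps
      \<open>X\<close> and changes \<open>Y\<close>.\<close>
    then have "?F 0 = ?F (0 + 1 *\<^sub>R e) \<or> ?G 0 = ?G (0 + 1 *\<^sub>R e)" using Pd_0_const by blast
    then show False unfolding e using \<kappa> by auto
  qed
  then have "r0 = 0" using onA by (intro pz) auto
  with \<open>r1 = 0\<close> hP fx show ?thesis by auto
qed

text \<open>Divided in degree 2, the quotient is a constant, so the polynomial is a multiple of
  \<open>q\<close>; since \<open>q\<close> has true degree 2, the multiple is 0. For lines this says
  that they meet the conic in finitely many points.\<close>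

lemma conic_infinite_zero:
  assumes q: "q \<in> Pd 2" "q \<notin> Pd 1" "irreducible_Pd q"
    and A: "infinite A" "\<And>x. x \<in> A \<Longrightarrow> q x = 0" "\<And>x. x \<in> A \<Longrightarrow> f x = 0"
    and f: "f \<in> Pd 1"
  shows "f = (\<lambda>x. 0)"
proof -
  have "f \<in> Pd 2" using Pd_mono[OF f] by simp
  from conic_dvd[OF q A this] obtain h where h: "h \<in> Pd 0" "\<And>x. f x = q x * h x" by auto
  have f0: "f x = h 0 * q x" for x using h Pd_0_const[OF h(1), of x 0] by (simp add: mult.commute)
  show ?thesis
  proof (cases "h 0 = 0")
    case False
    then have "q = (\<lambda>x. (1 / h 0) * f x)" using f0 by auto
    with Pd_scale[OF f] q(2) show ?thesis by metis
  qed (use f0 in auto)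
qed

section \<open>Planar topology\<close>

text \<open>The comparison goes through the circle in the complex plane and ends at the sphere of
  \<open>real^2\<close>, the form in which the Jordan-Brouwer theorems are applied.\<close>

lemma simple_loop_homeomorphic_circle:
  fixes g :: "real \<Rightarrow> point"
  assumes "simple_path g" "pathfinish g = pathstart g"
  shows "path_image g homeomorphic sphere (0::point) 1"
proof -
  have "path_image g homeomorphic sphere (0::complex) 1"
    using assms by (intro homeomorphic_simple_path_image_circle) auto
  moreover have "sphere (0::complex) 1 homeomorphic sphere (0::point) 1"
    by (rule homeomorphic_spheres_gen) auto
  ultimately show ?thesis by (rule homeomorphic_trans)
qed

text \<open>By Jordan-Brouwer every component of the complement has the whole loop as its frontier.
  The outside is one component, and as the loop separates the plane there is another one, which is
  contained in the inside.\<close>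

lemma jordan_loop:
  fixes g :: "real \<Rightarrow> point"
  assumes g: "simple_path g" "pathfinish g = pathstart g"
  defines "F \<equiv> path_image g"
  shows "F \<subseteq> closure (inside F)" "frontier (outside F) = F" "frontier (F \<union> inside F) = F"
    "connected (outside F)" "\<not> bounded (outside F)" "compact F" "open (inside F)" "F \<subseteq> closure (outside F)"
proof -
  have hom: "F homeomorphic sphere (0::point) 1"
    unfolding F_def using simple_loop_homeomorphic_circle[OF g] .
  show cF: "compact F" unfolding F_def using g by (simp add: compact_simple_path_image)
  then have bF: "bounded F" "closed F" by (simp_all add: compact_imp_bounded compact_imp_closed)
  show con: "connected (outside F)" using bF(1) by (rule connected_outside) simp
  show ub: "\<not> bounded (outside F)" using bF(1) by (simp add: unbounded_outside)
  then have ne: "outside F \<noteq> {}" by auto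
  have comp: "frontier K = F" if "K \<in> components (- F)" for K
    using Jordan_Brouwer_frontier[OF hom that] by simp
  have "outside F \<in> components (- F)" using con ne by (simp add: outside_in_components)
  then show fo: "frontier (outside F) = F" by (rule comp)
  then show "F \<subseteq> closure (outside F)" by (auto simp: frontier_def)
  show "open (inside F)" using bF(2) by (rule open_inside)
  show "frontier (F \<union> inside F) = F"
    using fo by (simp add: union_with_inside frontier_complement)
  have "\<not> connected (- F)" using Jordan_Brouwer_separation[OF hom] by simp
  then have "inside F \<noteq> {}" using con inside_Un_outside[of F] by (metis sup_bot_left)
  then obtain x where x: "x \<in> inside F" by blast
  then have xF: "x \<in> - F" using inside_no_overlap[of F] by blast
  let ?K = "connected_component_set (- F) x"
  have "?K \<in> components (- F)" using xF by (auto simp: components_def)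
  then have "frontier ?K = F" by (rule comp)
  then have "F \<subseteq> closure ?K" by (auto simp: frontier_def)
  moreover have "?K \<subseteq> inside F"
  proof
    fix y assume y: "y \<in> ?K"
    then have "connected_component_set (- F) y = ?K" by (simp add: connected_component_eq)
    moreover have "y \<in> - F" using y connected_component_in by blast
    ultimately show "y \<in> inside F" using x by (simp add: inside_def)
  qed
  ultimately show "F \<subseteq> closure (inside F)" using closure_mono by blast
qed

text \<open>A boundary point in the interior of the closure would be approached from the outside of
  the loop by points that belong to \<open>R\<close>. The outside is connected and avoids the
  frontier, so it would lie in \<open>R\<close>, which is bounded. This excludes slits and is the
  means to show that points near which cells fill everything belong to the domain.\<close>

lemma jordan_domain_interior_closure:
  fixes g :: "real \<Rightarrow> point"
  assumes g: "simple_path g" "pathfinish g = pathstart g"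
    and R: "open R" "bounded R" "frontier R = path_image g"
  shows "interior (closure R) = R"
proof
  note J = jordan_loop[OF g, folded R(3)]
  have "interior (closure R) \<inter> frontier R = {}"
  proof (rule ccontr)
    assume "interior (closure R) \<inter> frontier R \<noteq> {}"
    then obtain x where x: "x \<in> interior (closure R)" "x \<in> frontier R" by blast
    then have "x \<in> closure (outside (frontier R))" using J(8) by blast
    then obtain y where y: "y \<in> interior (closure R)" "y \<in> outside (frontier R)"
      using x(1) open_interior[of "closure R"] by (metis closure_iff_nhds_not_empty disjoint_iff order_refl)
    then have "y \<notin> frontier R" using outside_no_overlap[of "frontier R"] by blast
    then have "y \<in> R" using y(1) interior_subset[of "closure R"] R(1) by (auto simp: frontier_def interior_open)
    have "outside (frontier R) \<subseteq> R"
    proof (rule ccontr)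
      assume "\<not> outside (frontier R) \<subseteq> R"
      then have "outside (frontier R) \<inter> frontier R \<noteq> {}"
        using connected_Int_frontier[OF J(4), of R] \<open>y \<in> R\<close> y(2) by blast
      then show False using outside_no_overlap[of "frontier R"] by blast
    qed
    then show False using J(5) R(2) bounded_subset by blast
  qed
  then show "interior (closure R) \<subseteq> R"
    using interior_subset[of "closure R"] R(1) by (auto simp: frontier_def interior_open)
  show "R \<subseteq> interior (closure R)" using R(1) by (simp add: closure_subset interior_maximal)
qed

section \<open>Signed areas and straight triangles\<close>

lemma collinear_area2: "collinear {a, b, c} \<longleftrightarrow> area2 a b c = 0"
proof (cases "a = c")
  case True
  then show ?thesis by (auto simp: area2_def insert_commute)
next
  case False
  show ?thesis
  proof
    assume "collinear {a, b, c}"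
    with False obtain u where b: "b = u *\<^sub>R a + (1 - u) *\<^sub>R c" unfolding collinear_3_expand by blast
    show "area2 a b c = 0" unfolding b by (simp add: area2_def algebra_simps)
  next
    assume ar: "area2 a b c = 0"
    from False have "a $ 1 \<noteq> c $ 1 \<or> a $ 2 \<noteq> c $ 2" by (auto simp: vec_eq_iff forall_2)
    moreover have cross: "(b $ 1 - c $ 1) * (a $ 2 - c $ 2) = (b $ 2 - c $ 2) * (a $ 1 - c $ 1)"
      using ar by (simp add: area2_def algebra_simps)
    ultimately obtain u where u: "u * (a $ 1 - c $ 1) = b $ 1 - c $ 1" "u * (a $ 2 - c $ 2) = b $ 2 - c $ 2"
    proof (elim disjE)
      assume n: "a $ 1 \<noteq> c $ 1"
      show thesis
        by (rule that[of "(b $ 1 - c $ 1) / (a $ 1 - c $ 1)"]) (use n cross in simp_all)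
    next
      assume n: "a $ 2 \<noteq> c $ 2"
      show thesis
        by (rule that[of "(b $ 2 - c $ 2) / (a $ 2 - c $ 2)"]) (use n cross in \<open>simp_all flip: cross\<close>)
    qed
    then have "b = u *\<^sub>R a + (1 - u) *\<^sub>R c"
      by (simp add: vec_eq_iff forall_2 algebra_simps)
    then have "\<exists>u. b = u *\<^sub>R a + (1 - u) *\<^sub>R c" ..
    then show "collinear {a, b, c}" unfolding collinear_3_expand by blast
  qed
qed

lemma area2_Pd: "area2 a b \<in> Pd 1"
proof -
  have "area2 a b = (\<lambda>x. ((a $ 1 * (b $ 2 - a $ 2) * 1 - a $ 2 * (b $ 1 - a $ 1)) + (a $ 2 - b $ 2) * x $ 1) +
     (b $ 1 - a $ 1) * x $ 2)"
    by (simp add: area2_def fun_eq_iff algebra_simps)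
  also have "\<dots> \<in> Pd 1" by (intro Pd_add Pd_scale Pd_const Pd_coords)
  finally show ?thesis .
qed

lemma area2_segment: "x \<in> closed_segment a b \<Longrightarrow> area2 a b x = 0"
proof -
  assume "x \<in> closed_segment a b"
  then obtain u where x: "x = (1 - u) *\<^sub>R a + u *\<^sub>R b" unfolding in_segment by blast
  show ?thesis unfolding x by (simp add: area2_def algebra_simps)
qed

lemma area2_nonzero_exists: "a \<noteq> b \<Longrightarrow> \<exists>x. area2 a b x \<noteq> 0"
proof -
  assume "a \<noteq> b"
  then have "(b $ 1 - a $ 1)\<^sup>2 + (b $ 2 - a $ 2)\<^sup>2 \<noteq> 0"
    by (auto simp: vec_eq_iff forall_2 sum_power2_eq_zero_iff)
  moreover have "area2 a b (vector [a $ 1 - (b $ 2 - a $ 2), a $ 2 + (b $ 1 - a $ 1)]) =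
     (b $ 1 - a $ 1)\<^sup>2 + (b $ 2 - a $ 2)\<^sup>2"
    by (simp add: area2_def power2_eq_square algebra_simps)
  ultimately show ?thesis by metis
qed

lemma conic_segment_finite:
  assumes q: "q \<in> Pd 2" "q \<notin> Pd 1" "irreducible_Pd q" and "u \<noteq> w"
  shows "finite {x \<in> closed_segment u w. q x = 0}"
proof (rule ccontr)
  assume inf: "infinite {x \<in> closed_segment u w. q x = 0}"
  have "area2 u w = (\<lambda>x. 0)"
    by (rule conic_infinite_zero[OF q inf _ _ area2_Pd]) (auto simp: area2_segment)
  then show False using area2_nonzero_exists[OF assms(4)] by simp
qed

lemma straight_tri_area2: "straight_tri T a b c \<Longrightarrow> area2 a b c \<noteq> 0"
  by (simp add: straight_tri_def collinear_area2)

lemma straight_tri_perm: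
  "straight_tri T a b c \<Longrightarrow> straight_tri T b a c" "straight_tri T a b c \<Longrightarrow> straight_tri T a c b"
  by (simp_all add: straight_tri_def insert_commute)

lemma straight_tri_frontier:
  "straight_tri T a b c \<Longrightarrow> frontier T = closed_segment a b \<union> closed_segment b c \<union> closed_segment c a"
  by (simp add: straight_tri_def frontier_of_triangle)

lemma straight_tri_interior_bary:
  assumes "straight_tri T a b c"
  shows "interior T = {x. bary a b c x > 0 \<and> bary b a c x > 0 \<and> bary c a b x > 0}"
    "T = {x. bary a b c x \<ge> 0 \<and> bary b a c x \<ge> 0 \<and> bary c a b x \<ge> 0}"
proof -
  have nc: "area2 a b c \<noteq> 0" using assms by (rule straight_tri_area2)
  have T: "T = {u *\<^sub>R a + v *\<^sub>R b + w *\<^sub>R c |u v w. 0 \<le> u \<and> 0 \<le> v \<and> 0 \<le> w \<and> u + v + w = 1}"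
    using assms by (simp add: straight_tri_def convex_hull_3)
  show Tb: "T = {x. bary a b c x \<ge> 0 \<and> bary b a c x \<ge> 0 \<and> bary c a b x \<ge> 0}"
  proof safe
    fix x assume "x \<in> T"
    then obtain u v w where x: "x = u *\<^sub>R a + v *\<^sub>R b + w *\<^sub>R c" "0 \<le> u" "0 \<le> v" "0 \<le> w" "u + v + w = 1"
      unfolding T by blast
    then show "bary a b c x \<ge> 0" "bary b a c x \<ge> 0" "bary c a b x \<ge> 0"
      using bary_comb[OF nc x(5)] by simp_all
  next
    fix x assume "bary a b c x \<ge> 0" "bary b a c x \<ge> 0" "bary c a b x \<ge> 0"
    then show "x \<in> T" unfolding T using bary_expand[OF nc, of x] bary_sum[OF nc, of x] by blast
  qed
  let ?I = "{x. bary a b c x > 0 \<and> bary b a c x > 0 \<and> bary c a b x > 0}"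
  have co: "continuous_on UNIV (bary a b c)" for a b c using Pd_continuous[OF bary_Pd] .
  have "open ?I"
    by (intro open_Collect_conj open_Collect_less continuous_on_const co)
  then have 1: "?I \<subseteq> interior T" by (rule interior_maximal[rotated]) (auto simp: Tb)
  have "x \<in> ?I" if x: "x \<in> interior T" for x
  proof (rule ccontr)
    assume "x \<notin> ?I"
    moreover have "x \<in> T" using x interior_subset by blast
    ultimately consider "bary a b c x = 0" | "bary b a c x = 0" | "bary c a b x = 0"
      unfolding Tb by fastforce
    \<comment> \<open>If a barycentric coordinate \<open>w\<close> is 0 at \<open>x\<close>, a small
      step away from the vertex \<open>v\<close> at which it is 1 makes it negative and so leaves
      the triangle.\<close>
    then obtain v w where vw: "v \<in> {a, b, c}" "(w = bary a b c \<and> w v = 1) \<or> (w = bary b a c \<and> w v = 1) \<or>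
       (w = bary c a b \<and> w v = 1)" "w x = 0"
      using bary_self(1)[OF nc] bary_self_else[OF nc] by cases blast+
    obtain e where e: "e > 0" "ball x e \<subseteq> T" using x by (auto simp: mem_interior)
    define t where "t = e / 2 / (norm (v - x) + 1)"
    have t: "t > 0" using e by (simp add: t_def add_nonneg_pos)
    have "t * norm (v - x) < e"
    proof -
      have "t * norm (v - x) \<le> t * (norm (v - x) + 1)" using t by simp
      also have "\<dots> = e / 2"
      proof -
        have "norm (v - x) + 1 \<noteq> 0" using norm_ge_zero[of "v - x"] by linarith
        then show ?thesis unfolding t_def by (metis nonzero_eq_divide_eq)
      qed
      also have "\<dots> < e" using e by simp
      finally show ?thesis .
    qed
    then have "x + (- t) *\<^sub>R (v - x) \<in> T" using t e(2) by (intro subsetD[OF e(2)]) (simp add: dist_norm)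
    moreover have "w (x + (- t) *\<^sub>R (v - x)) = - t"
      using vw(2,3) by (elim disjE conjE) (simp_all only: bary_add, simp_all)
    ultimately show False using vw(2) t unfolding Tb by auto
  qed
  with 1 show "interior T = ?I" by blast
qed

lemma straight_tri_fat: "straight_tri T a b c \<Longrightarrow> interior T \<noteq> {} \<and> closed T \<and> closure (interior T) = T"
proof -
  assume st: "straight_tri T a b c"
  then have nc: "area2 a b c \<noteq> 0" by (rule straight_tri_area2)
  have "(1/3) *\<^sub>R a + (1/3) *\<^sub>R b + (1/3) *\<^sub>R c \<in> interior T"
    unfolding straight_tri_interior_bary(1)[OF st]
    using bary_comb[OF nc, of "1/3" "1/3" "1/3"] by simp
  then have ne: "interior T \<noteq> {}" by blast
  have "convex T" "closed T" using st
    by (auto simp: straight_tri_def intro: compact_imp_closed compact_convex_hull finite_imp_compact)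
  then show ?thesis using ne convex_closure_interior closure_closed by metis
qed

text \<open>The vertices are recovered from the point set as its extreme points.\<close>

lemma straight_tri_unique:
  assumes "straight_tri T a b c" "straight_tri T a' b' c'"
  shows "{a, b, c} = {a', b', c'}"
proof -
  have "x extreme_point_of T \<longleftrightarrow> x \<in> {a, b, c}" if "straight_tri T a b c" for a b c x
    using that collinear_3_eq_affine_dependent[of a b c]
    by (simp add: straight_tri_def extreme_point_of_convex_hull_affine_independent)
  from this[OF assms(1)] this[OF assms(2)] show ?thesis by blast
qed

section \<open>Cells of an admissible triangulation\<close>

locale pie_triangulation =
  fixes D :: cdomain and \<Delta> :: "point set set"
    and TI TB :: "point \<Rightarrow> point set" and TE :: "point set \<Rightarrow> point set"
  assumes polygon: "curvilinear_polygon D"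
    and admissible: "admissible_triangulation D \<Delta>"
    and choice: "M_choice D \<Delta> TI TE TB"
begin

abbreviation "\<Omega> \<equiv> region D"
abbreviation "\<Gamma> \<equiv> frontier (region D)"

lemma loop: "simple_path (bdry D)" "pathfinish (bdry D) = pathstart (bdry D)"
  and bdry_image: "path_image (bdry D) = \<Gamma>"
  and open_region: "open \<Omega>" and bounded_region: "bounded \<Omega>"
  and knots: "knot D 0 = 0" "knot D (nsides D) = 1" "\<And>j. j < nsides D \<Longrightarrow> knot D j < knot D (Suc j)"
  using polygon unfolding curvilinear_polygon_def by auto

lemma side_facts:
  assumes "j < nsides D"
  shows "\<And>u. u \<in> {knot D j .. knot D (Suc j)} \<Longrightarrow> (bdry D has_vector_derivative tangent D j u)
      (at u within {knot D j .. knot D (Suc j)})"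
    "\<And>u. u \<in> {knot D j .. knot D (Suc j)} \<Longrightarrow> tangent D j u \<noteq> 0"
    "internal_angle D j > 0"
    "qpol D j \<in> Pd 1 \<or> qpol D j \<in> Pd 2 - Pd 1 \<and> irreducible_Pd (qpol D j)"
    "\<And>x. x \<in> side D j \<Longrightarrow> qpol D j x = 0"
  using polygon assms unfolding curvilinear_polygon_def by auto

lemma interior_closure_region: "interior (closure \<Omega>) = \<Omega>"
  by (rule jordan_domain_interior_closure[OF loop open_region bounded_region bdry_image[symmetric]])

lemma closure_region: "closure \<Omega> = \<Omega> \<union> \<Gamma>" "\<Omega> \<inter> \<Gamma> = {}"
  using open_region by (auto simp: frontier_def interior_open closure_subset[THEN subsetD])

lemma knot_mono: "i \<le> j \<Longrightarrow> j \<le> nsides D \<Longrightarrow> knot D i \<le> knot D j"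
proof (induction j rule: dec_induct)
  case (step m)
  then show ?case using knots(3)[of m] by simp
qed simp

lemma knot_range: "j \<le> nsides D \<Longrightarrow> 0 \<le> knot D j \<and> knot D j \<le> 1"
  using knot_mono[of 0 j] knot_mono[of j "nsides D"] knots by simp

lemma bdry_inj:
  assumes "u \<in> {0..1}" "v \<in> {0..1}" "bdry D u = bdry D v"
  shows "u = v \<or> u = 0 \<and> v = 1 \<or> u = 1 \<and> v = 0"
  using loop(1) assms unfolding simple_path_def loop_free_def by blast

lemma adm:
  shows fin: "finite \<Delta>" and union: "\<Union>\<Delta> = closure \<Omega>"
    and cells: "\<And>T. T \<in> \<Delta> \<Longrightarrow> \<exists>a b c. is_cell D T a b c"
    and cell_Int: "\<And>T T'. T \<in> \<Delta> \<Longrightarrow> T' \<in> \<Delta> \<Longrightarrow> T \<noteq> T' \<Longrightarrow>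
        T \<inter> T' = {} \<or> (\<exists>v \<in> vertices D T \<inter> vertices D T'. T \<inter> T' = {v}) \<or>
        T \<inter> T' \<in> straight_edges D T \<inter> straight_edges D T'"
    and EI_ends: "\<And>a b. closed_segment a b \<in> EI D \<Delta> \<Longrightarrow> \<not> (a \<in> \<Gamma> \<and> b \<in> \<Gamma>)"
    and pies_edges: "\<And>T T'. T \<in> pies D \<Delta> \<Longrightarrow> T' \<in> pies D \<Delta> \<Longrightarrow> T \<noteq> T' \<Longrightarrow>
        straight_edges D T \<inter> straight_edges D T' = {}"
    and pie_pos: "\<And>T j a b c C z. T \<in> pies D \<Delta> \<Longrightarrow> pie D T j a b c C \<Longrightarrow>
        z \<in> T - closure (side D j) \<Longrightarrow> qpol D j z > 0"
    and EB_curved: "\<And>e. e \<in> EB D \<Delta> \<Longrightarrow> \<exists>T\<in>\<Delta>. e \<in> curved_edges D T"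
    and buffers_edges: "\<And>T T'. T \<in> buffers D \<Delta> \<Longrightarrow> T' \<in> buffers D \<Delta> \<Longrightarrow> T \<noteq> T' \<Longrightarrow>
        straight_edges D T \<inter> straight_edges D T' = {}"
    and buffer_unique: "\<And>v T T'. v \<in> VB D \<Delta> \<Longrightarrow> T \<in> buffers D \<Delta> \<Longrightarrow> T' \<in> buffers D \<Delta> \<Longrightarrow>
        v \<in> vertices D T \<Longrightarrow> v \<in> vertices D T' \<Longrightarrow> T = T'"
proof -
  note A = admissible[unfolded admissible_triangulation_def subdivision_def]
  show "finite \<Delta>" using A by (elim conjE)
  show "\<Union>\<Delta> = closure \<Omega>" using A by (elim conjE)
  have "\<forall>T\<in>\<Delta>. \<exists>a b c. is_cell D T a b c" using A by (elim conjE)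
  then show "\<And>T. T \<in> \<Delta> \<Longrightarrow> \<exists>a b c. is_cell D T a b c" by blast
  have "\<forall>T\<in>\<Delta>. \<forall>T'\<in>\<Delta>. T \<noteq> T' \<longrightarrow> T \<inter> T' = {} \<or>
      (\<exists>v \<in> vertices D T \<inter> vertices D T'. T \<inter> T' = {v}) \<or>
      T \<inter> T' \<in> straight_edges D T \<inter> straight_edges D T'" using A by (elim conjE)
  then show "\<And>T T'. T \<in> \<Delta> \<Longrightarrow> T' \<in> \<Delta> \<Longrightarrow> T \<noteq> T' \<Longrightarrow>
        T \<inter> T' = {} \<or> (\<exists>v \<in> vertices D T \<inter> vertices D T'. T \<inter> T' = {v}) \<or>
        T \<inter> T' \<in> straight_edges D T \<inter> straight_edges D T'" by simp
  have "\<forall>a b. closed_segment a b \<in> EI D \<Delta> \<longrightarrow> \<not> (a \<in> \<Gamma> \<and> b \<in> \<Gamma>)" using A by (elim conjE)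
  then show "\<And>a b. closed_segment a b \<in> EI D \<Delta> \<Longrightarrow> \<not> (a \<in> \<Gamma> \<and> b \<in> \<Gamma>)" by simp
  have "\<forall>T\<in>pies D \<Delta>. \<forall>T'\<in>pies D \<Delta>. T \<noteq> T' \<longrightarrow> straight_edges D T \<inter> straight_edges D T' = {}"
    using A by (elim conjE)
  then show "\<And>T T'. T \<in> pies D \<Delta> \<Longrightarrow> T' \<in> pies D \<Delta> \<Longrightarrow> T \<noteq> T' \<Longrightarrow>
        straight_edges D T \<inter> straight_edges D T' = {}" by simp
  have "\<forall>T\<in>pies D \<Delta>. \<forall>j a b c C. pie D T j a b c C \<longrightarrow>
        (\<forall>x\<in>T. closed_segment a x \<subseteq> T) \<and> (\<forall>z \<in> T - closure (side D j). qpol D j z > 0)"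
    using A by (elim conjE)
  then show "\<And>T j a b c C z. T \<in> pies D \<Delta> \<Longrightarrow> pie D T j a b c C \<Longrightarrow>
        z \<in> T - closure (side D j) \<Longrightarrow> qpol D j z > 0" by blast
  have "\<forall>e\<in>EB D \<Delta>. \<exists>T\<in>\<Delta>. e \<in> curved_edges D T" using A by (elim conjE)
  then show "\<And>e. e \<in> EB D \<Delta> \<Longrightarrow> \<exists>T\<in>\<Delta>. e \<in> curved_edges D T" by simp
  have "\<forall>T\<in>buffers D \<Delta>. \<forall>T'\<in>buffers D \<Delta>. T \<noteq> T' \<longrightarrow>
      straight_edges D T \<inter> straight_edges D T' = {}"
    using A by (elim conjE)
  then show "\<And>T T'. T \<in> buffers D \<Delta> \<Longrightarrow> T' \<in> buffers D \<Delta> \<Longrightarrow> T \<noteq> T' \<Longrightarrow>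
        straight_edges D T \<inter> straight_edges D T' = {}" by simp
  have "\<forall>v\<in>VB D \<Delta>. \<forall>T\<in>buffers D \<Delta>. \<forall>T'\<in>buffers D \<Delta>.
        v \<in> vertices D T \<and> v \<in> vertices D T' \<longrightarrow> T = T'" using A by (elim conjE)
  then show "\<And>v T T'. v \<in> VB D \<Delta> \<Longrightarrow> T \<in> buffers D \<Delta> \<Longrightarrow> T' \<in> buffers D \<Delta> \<Longrightarrow>
        v \<in> vertices D T \<Longrightarrow> v \<in> vertices D T' \<Longrightarrow> T = T'" by simp
qed

lemma chosen:
  shows TI: "\<And>v. v \<in> VI D \<Delta> \<Longrightarrow> TI v \<in> ordinary D \<Delta> \<and> v \<in> vertices D (TI v)"
    and TE: "\<And>e. e \<in> EI0 D \<Delta> \<Longrightarrow> TE e \<in> ordinary D \<Delta> \<and> e \<in> straight_edges D (TE e)"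
    and TB: "\<And>v. v \<in> VB1 D \<Delta> \<Longrightarrow> TB v \<in> pies D \<Delta> \<and> v \<in> vertices D (TB v)"
  using choice unfolding M_choice_def by auto

lemma pie_swap: "pie D T j a b c C \<Longrightarrow> pie D T j a c b C"
proof -
  have 1: "{a, c, b} = {a, b, c}" "{c, b} = {b, c}" by auto
  have 2: "closed_segment a c \<union> closed_segment a b \<union> C = closed_segment a b \<union> closed_segment a c \<union> C"
    by auto
  show "pie D T j a b c C \<Longrightarrow> pie D T j a c b C"
    unfolding pie_def Let_def 1 2 by (elim exE conjE, intro exI conjI, assumption+)
qed

lemma pie_param:
  assumes "pie D T j a b c C"
  obtains s t where "0 \<le> s" "knot D j \<le> s" "s < t" "t \<le> knot D (Suc j)" "t \<le> 1"
    "C = bdry D ` {s..t}" "{b, c} = {bdry D s, bdry D t}" "j < nsides D"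
proof -
  from assms obtain s t where "knot D j \<le> s" "s < t" "t \<le> knot D (Suc j)" "j < nsides D"
    "C = bdry D ` {s..t}" "{b, c} = {bdry D s, bdry D t}" unfolding pie_def by blast
  with that knot_range[of j] knot_range[of "Suc j"] show thesis by force
qed

lemma pie_conic:
  assumes "pie D T j a b c C"
  shows "qpol D j \<in> Pd 2" "qpol D j \<notin> Pd 1" "irreducible_Pd (qpol D j)"
  using assms side_facts(4)[of j] unfolding pie_def by auto

lemma pie_area2: "pie D T j a b c C \<Longrightarrow> area2 a b c \<noteq> 0"
  unfolding pie_def collinear_area2 by blast

text \<open>Assumed on the open arc only. Vertices of pie-shaped triangles may be corners, so
  continuity is used to reach the ends.\<close>

lemma q_zero_arc:
  assumes "j < nsides D" "u \<in> {knot D j .. knot D (Suc j)}"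
  shows "qpol D j (bdry D u) = 0"
proof -
  let ?K = "{knot D j <..< knot D (Suc j)}"
  have cl: "closure ?K = {knot D j .. knot D (Suc j)}"
    using knots(3)[OF assms(1)] by (rule closure_greaterThanLessThan)
  have "{knot D j .. knot D (Suc j)} \<subseteq> {0..1}"
    using knot_range[of j] knot_range[of "Suc j"] assms by auto
  then have "continuous_on {knot D j .. knot D (Suc j)} (bdry D)"
    by (rule continuous_on_subset[OF simple_path_imp_path[OF loop(1), unfolded path_def]])
  moreover obtain d where "qpol D j \<in> Pd d" using side_facts(4)[OF assms(1)] by auto
  ultimately have "continuous_on (closure ?K) (\<lambda>u. qpol D j (bdry D u))"
    unfolding cl using continuous_on_compose2[OF Pd_continuous[of "qpol D j" d UNIV]] by blast
  moreover have "qpol D j (bdry D u) = 0" if "u \<in> ?K" for u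
    using side_facts(5)[OF assms(1), of "bdry D u"] that by (auto simp: side_def)
  ultimately show ?thesis
    using continuous_constant_on_closure[of ?K "\<lambda>u. qpol D j (bdry D u)" 0 u] assms(2) cl by blast
qed

text \<open>Besides collecting simple facts, this provides that an arc is infinite and is recovered
  from its points outside any finite set. The latter allows arcs and straight edges, which meet in
  finitely many points, to be told apart inside a common frontier.\<close>

lemma pie_C:
  assumes "pie D T j a b c C"
  shows "C \<subseteq> \<Gamma>" "\<And>x. x \<in> C \<Longrightarrow> qpol D j x = 0" "infinite C" "b \<in> C" "c \<in> C"
    "\<And>A. finite A \<Longrightarrow> C \<subseteq> closure (C - A)" "closed C"
proof -
  obtain s t where st: "0 \<le> s" "knot D j \<le> s" "s < t" "t \<le> knot D (Suc j)" "t \<le> 1"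
    "C = bdry D ` {s..t}" "{b, c} = {bdry D s, bdry D t}" "j < nsides D" using pie_param[OF assms] .
  have "bdry D ` {s..t} \<subseteq> path_image (bdry D)" using st unfolding path_image_def by auto
  then show "C \<subseteq> \<Gamma>" using st bdry_image by simp
  show "qpol D j x = 0" if "x \<in> C" for x using q_zero_arc[OF st(8)] st that by auto
  show "b \<in> C" "c \<in> C" using st(3,6,7) by (auto simp: doubleton_eq_iff)
  have co: "continuous_on {s..t} (bdry D)"
    using simple_path_imp_path[OF loop(1)] continuous_on_subset[of "{0..1}" "bdry D" "{s..t}"] st
    by (auto simp: path_def)
  then show "closed C" unfolding st(6) by (intro compact_imp_closed compact_continuous_image) auto
  have inj: "inj_on (bdry D) {s<..<t}"
  proof (rule inj_onI)
    fix u v assume uv: "u \<in> {s<..<t}" "v \<in> {s<..<t}" "bdry D u = bdry D v"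
    then have "u \<in> {0..1}" "v \<in> {0..1}" using st by auto
    from bdry_inj[OF this uv(3)] show "u = v" using uv st by auto
  qed
  show "C \<subseteq> closure (C - A)" if A: "finite A" for A
  proof -
    let ?U = "{s<..<t} - {u \<in> {s<..<t}. bdry D u \<in> A}"
    have fin: "finite {u \<in> {s<..<t}. bdry D u \<in> A}"
      using finite_vimage_IntI[OF A inj] by (rule rev_finite_subset) auto
    have "{s..t} \<subseteq> closure ?U"
    proof -
      have "closure {s<..<t} = {s..t}" using st(3) by (rule closure_greaterThanLessThan)
      moreover have "{s<..<t} \<subseteq> closure ?U"
      proof
        fix u assume u: "u \<in> {s<..<t}"
        have "u islimpt {s<..<t}" using u by (intro interior_limit_point) (simp add: interior_open)
        moreover have "{s<..<t} = {u \<in> {s<..<t}. bdry D u \<in> A} \<union> ?U" by blast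
        ultimately have "u islimpt ?U" using islimpt_Un_finite[OF fin, of u ?U] by argo
        then show "u \<in> closure ?U" by (simp add: closure_def)
      qed
      then have "closure {s<..<t} \<subseteq> closure ?U" by (simp add: closure_minimal)
      ultimately show ?thesis by simp
    qed
    then have cl: "closure ?U = {s..t}"
      using closure_minimal[of ?U "{s..t}"] by force
    then have "bdry D ` closure ?U \<subseteq> closure (bdry D ` ?U)"
      using co by (intro image_closure_subset) (auto simp: closure_subset)
    moreover have "bdry D ` ?U \<subseteq> C - A" unfolding st(6) by auto
    then have "closure (bdry D ` ?U) \<subseteq> closure (C - A)" by (rule closure_mono)
    ultimately show ?thesis unfolding cl st(6) by blast
  qed
  show "infinite C"
  proof
    assume "finite C"
    moreover have "bdry D ` {s<..<t} \<subseteq> C" unfolding st(6) by auto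
    ultimately have "finite {s<..<t}" using inj finite_subset finite_imageD by metis
    then show False using st(3) by (simp add: infinite_Ioo)
  qed
qed

lemma pie_segment_finite:
  assumes "pie D T j a b c C" "u \<noteq> w" shows "finite (closed_segment u w \<inter> C)"
  by (rule finite_subset[OF _ conic_segment_finite[OF pie_conic[OF assms(1)] assms(2)]])
    (use pie_C(2)[OF assms(1)] in auto)

definition pie_boundary where
  "pie_boundary a b c C = closed_segment a b \<union> closed_segment a c \<union> C"

lemma pie_loop:
  assumes "pie D T j a b c C"
  obtains g where "simple_path g" "pathfinish g = pathstart g" "path_image g = pie_boundary a b c C"
proof -
  obtain s t where st: "0 \<le> s" "knot D j \<le> s" "s < t" "t \<le> knot D (Suc j)" "t \<le> 1"
    "C = bdry D ` {s..t}" "{b, c} = {bdry D s, bdry D t}" "j < nsides D" using pie_param[OF assms] .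
  have nc: "\<not> collinear {a, b, c}" and seg: "closed_segment a b \<inter> C = {b}" "closed_segment a c \<inter> C = {c}"
    using assms unfolding pie_def by blast+
  then have ne: "a \<noteq> b" "a \<noteq> c" "b \<noteq> c" by (auto simp: collinear_2 insert_commute)
  note goal = that
  \<comment> \<open>The arc may run from \<open>b\<close> to \<open>c\<close> or from
    \<open>c\<close> to \<open>b\<close>; \<open>b'\<close> and \<open>c'\<close> name its ends in
    the order of the parameter.\<close>
  have go: thesis if bc: "b' = bdry D s" "c' = bdry D t" "{b', c'} = {b, c}" for b' c'
  proof -
    let ?g1 = "subpath s t (bdry D)" and ?g2 = "linepath c' a +++ linepath a b'"
    have b'c': "a \<noteq> b'" "a \<noteq> c'" "b' \<noteq> c'" "\<not> collinear {a, b', c'}"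
      using ne nc bc(3) by (auto simp: doubleton_eq_iff insert_commute)
    have seg': "closed_segment a b' \<inter> C = {b'}" "closed_segment a c' \<inter> C = {c'}"
      using seg bc(3) by (auto simp: doubleton_eq_iff)
    have a1: "arc ?g1" by (rule arc_simple_path_subpath[OF loop(1)]) (use st bc b'c' in auto)
    have i1: "path_image ?g1 = C" using st by (simp add: path_image_subpath)
    have "closed_segment c' a \<inter> closed_segment a b' = {a}"
      by (rule Int_closed_segment) (use b'c' in \<open>auto simp: insert_commute\<close>)
    then have a2: "arc ?g2" using b'c' by (intro arc_join) (auto intro: arc_linepath)
    have i2: "path_image ?g2 = closed_segment a c' \<union> closed_segment a b'"
      by (simp add: path_image_join closed_segment_commute)
    have "path_image ?g1 \<inter> path_image ?g2 \<subseteq> {pathstart ?g1, pathstart ?g2}"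
      unfolding i1 i2 using seg' by (auto simp: bc(1,2)[symmetric])
    then have "simple_path (?g1 +++ ?g2)"
      by (intro simple_path_join_loop[OF a1 a2]) (use bc in auto)
    moreover have "pathfinish (?g1 +++ ?g2) = pathstart (?g1 +++ ?g2)" using bc by simp
    moreover have "path_image (?g1 +++ ?g2) = pie_boundary a b c C"
      using bc by (auto simp: path_image_join i1 i2 pie_boundary_def doubleton_eq_iff
          closed_segment_commute[of "bdry D t" a])
    ultimately show thesis by (rule goal)
  qed
  show thesis using go[of "bdry D s" "bdry D t"] st(7) by simp
qed

lemma pie_T: "pie D T j a b c C \<Longrightarrow> T = pie_boundary a b c C \<union> inside (pie_boundary a b c C)"
  unfolding pie_def pie_boundary_def Let_def by blast

lemma pie_topology:
  assumes "pie D T j a b c C"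
  shows "frontier T = pie_boundary a b c C" "closed T" "interior T = inside (pie_boundary a b c C)"
    "closure (interior T) = T" "interior T \<noteq> {}" "compact (pie_boundary a b c C)"
    "pie_boundary a b c C \<subseteq> closure (inside (pie_boundary a b c C))"
proof -
  let ?F = "pie_boundary a b c C"
  obtain g where g: "simple_path g" "pathfinish g = pathstart g" "path_image g = ?F"
    using pie_loop[OF assms] .
  note J = jordan_loop[OF g(1,2), unfolded g(3)] and T = pie_T[OF assms]
  show fT: "frontier T = ?F" using J(3) T by simp
  show "compact ?F" using J(6) .
  show cl: "?F \<subseteq> closure (inside ?F)" using J(1) .
  have "open (outside ?F)" using J(6) by (simp add: compact_imp_closed open_outside)
  then show clT: "closed T" unfolding T union_with_inside by (simp add: closed_def)
  have "T = interior T \<union> frontier T" "interior T \<inter> frontier T = {}"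
    using clT interior_subset[of T] by (auto simp: frontier_def closure_closed)
  then show iT: "interior T = inside ?F" using T fT inside_no_overlap[of ?F] by blast
  show cT: "closure (interior T) = T"
  proof
    show "closure (interior T) \<subseteq> T" using clT by (simp add: closure_minimal interior_subset)
    show "T \<subseteq> closure (interior T)" unfolding iT using T cl closure_subset[of "inside ?F"] by blast
  qed
  have "b \<in> T" unfolding T pie_boundary_def by simp
  then show "interior T \<noteq> {}" using cT by (metis closure_empty empty_iff)
qed

lemma cell_fat:
  assumes "is_cell D T a b c"
  shows "closed T" "closure (interior T) = T" "interior T \<noteq> {}"
  using assms straight_tri_fat pie_topology unfolding is_cell_def by metis+

lemma cell_area2: "is_cell D T a b c \<Longrightarrow> area2 a b c \<noteq> 0"
  unfolding is_cell_def using straight_tri_area2 pie_area2 by blast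

lemma cell_ne: "is_cell D T a b c \<Longrightarrow> a \<noteq> b \<and> a \<noteq> c \<and> b \<noteq> c"
  using cell_area2[of T a b c] by (auto simp: area2_def)

lemma cell_edge: "is_cell D T a b c \<Longrightarrow> closed_segment a b \<subseteq> T"
  unfolding is_cell_def
proof (elim disjE exE)
  assume "straight_tri T a b c"
  then show ?thesis unfolding straight_tri_def segment_convex_hull by (simp add: hull_mono)
next
  fix j C assume "pie D T j a b c C"
  from pie_T[OF this] show ?thesis by (auto simp: pie_boundary_def)
qed

lemma cell_subset: "T \<in> \<Delta> \<Longrightarrow> T \<subseteq> closure \<Omega>" using union by blast

lemma cell_interior: "T \<in> \<Delta> \<Longrightarrow> interior T \<subseteq> \<Omega>"
  using cell_subset interior_mono interior_closure_region by blast

text \<open>A segment in the boundary would be a boundary edge and hence a conic arc, but a segment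
  has only finitely many points in common with such an arc.\<close>

lemma edge_EI:
  assumes T: "T \<in> \<Delta>" and c: "is_cell D T a b c"
  shows "closed_segment a b \<in> EI D \<Delta>" "\<not> closed_segment a b \<subseteq> \<Gamma>" "\<not> (a \<in> \<Gamma> \<and> b \<in> \<Gamma>)"
proof -
  have e: "closed_segment a b \<in> edges D \<Delta>"
    using assms unfolding edges_def straight_edges_def by blast
  show nb: "\<not> closed_segment a b \<subseteq> \<Gamma>"
  proof
    assume "closed_segment a b \<subseteq> \<Gamma>"
    then have "closed_segment a b \<in> EB D \<Delta>" using e by (simp add: EB_def)
    then obtain T' j a' b' c' where "pie D T' j a' b' c' (closed_segment a b)"
      using EB_curved unfolding curved_edges_def by blast
    from pie_segment_finite[OF this, of a b] cell_ne[OF c]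
    show False by simp
  qed
  show ei: "closed_segment a b \<in> EI D \<Delta>" using e nb by (simp add: EI_def EB_def)
  show "\<not> (a \<in> \<Gamma> \<and> b \<in> \<Gamma>)" using EI_ends[OF ei] .
qed

lemma cell_vertex_in: "is_cell D T a b c \<Longrightarrow> a \<in> T \<and> b \<in> T"
  using cell_edge[of T a b c] by auto

lemma pie_is_cell: "pie D T j a b c C \<Longrightarrow> is_cell D T a b c" unfolding is_cell_def by blast

lemma pie_a_region:
  assumes T: "T \<in> \<Delta>" and p: "pie D T j a b c C"
  shows "a \<in> \<Omega>" "b \<in> \<Gamma>" "c \<in> \<Gamma>"
proof -
  show b: "b \<in> \<Gamma>" "c \<in> \<Gamma>" using pie_C[OF p] by auto
  then have "a \<notin> \<Gamma>" using edge_EI(3)[OF T pie_is_cell[OF p]] by blast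
  moreover have "a \<in> closure \<Omega>" using cell_vertex_in[OF pie_is_cell[OF p]] cell_subset[OF T] by blast
  ultimately show "a \<in> \<Omega>" using closure_region by blast
qed

lemma pie_not_straight:
  assumes p: "pie D T j a b c C" shows "\<not> straight_tri T x y z"
proof
  assume st: "straight_tri T x y z"
  then have ne: "x \<noteq> y" "y \<noteq> z" "z \<noteq> x" using straight_tri_area2[OF st] by (auto simp: area2_def)
  have "C \<subseteq> closed_segment x y \<union> closed_segment y z \<union> closed_segment z x"
    using pie_topology(1)[OF p] straight_tri_frontier[OF st] by (auto simp: pie_boundary_def)
  then have "C \<subseteq> (closed_segment x y \<inter> C) \<union> (closed_segment y z \<inter> C) \<union> (closed_segment z x \<inter> C)" by blast
  then have "finite C" by (rule finite_subset) (use pie_segment_finite[OF p] ne in auto)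
  then show False using pie_C(3)[OF p] by simp
qed

lemma segment_closure_minus:
  fixes a b :: point
  assumes "a \<noteq> b" "finite A" shows "closed_segment a b \<subseteq> closure (closed_segment a b - A)"
proof
  fix x assume x: "x \<in> closed_segment a b"
  have "x islimpt closed_segment a b"
    using x assms(1) by (intro connected_imp_perfect) (auto dest: arg_cong[of _ _ "\<lambda>S. a \<in> S \<and> b \<in> S"])
  then have "x islimpt (closed_segment a b - A)"
    using islimpt_Un_finite[of "closed_segment a b \<inter> A" x "closed_segment a b - A"] assms(2)
    by (metis Int_Diff_Un finite_Int)
  then show "x \<in> closure (closed_segment a b - A)" by (simp add: closure_def)
qed

text \<open>The functionals and the sets of vertices and edges range over all descriptions of a
  cell, so a description must be determined by the set. Equal cells have equal frontiers; up to
  finitely many points, one arc lies in the other arc and the straight edges of one lie in those of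
  the other, and taking closures gives equality. The arc determines the parameter interval and with
  it \<open>j\<close>; the two straight edges determine the vertex \<open>a\<close> in which they
  meet.\<close>

lemma pie_unique:
  assumes p: "pie D T j a b c C" and p': "pie D T j' a' b' c' C'"
  shows "j = j'" "a = a'" "C = C'" "{b, c} = {b', c'}"
proof -
  have F: "pie_boundary a b c C = pie_boundary a' b' c' C'"
    using pie_topology(1)[OF p] pie_topology(1)[OF p'] by simp
  have sub: "C' \<subseteq> C" if p: "pie D T j a b c C" and p': "pie D T j' a' b' c' C'"
    and F: "pie_boundary a b c C = pie_boundary a' b' c' C'" for j a b c C j' a' b' c' C'
  proof -
    let ?A = "(closed_segment a b \<inter> C') \<union> (closed_segment a c \<inter> C')"
    have fin: "finite ?A" using pie_segment_finite[OF p'] cell_ne[OF pie_is_cell[OF p]] by auto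
    have "C' - ?A \<subseteq> C" using F unfolding pie_boundary_def by blast
    then have "closure (C' - ?A) \<subseteq> C" using pie_C(7)[OF p] by (rule closure_minimal)
    then show ?thesis using pie_C(6)[OF p' fin] by blast
  qed
  show C: "C = C'" using sub[OF p p' F] sub[OF p' p F[symmetric]] by blast
  obtain s t where st: "0 \<le> s" "knot D j \<le> s" "s < t" "t \<le> knot D (Suc j)" "t \<le> 1"
    "C = bdry D ` {s..t}" "{b, c} = {bdry D s, bdry D t}" "j < nsides D" using pie_param[OF p] .
  obtain s' t' where st': "0 \<le> s'" "knot D j' \<le> s'" "s' < t'" "t' \<le> knot D (Suc j')" "t' \<le> 1"
    "C' = bdry D ` {s'..t'}" "{b', c'} = {bdry D s', bdry D t'}" "j' < nsides D" using pie_param[OF p'] .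
  have int: "s' \<le> s \<and> t \<le> t'" if st: "0 \<le> s" "s < t" "t \<le> 1" and st': "0 \<le> s'" "s' < t'" "t' \<le> 1"
    and sub: "bdry D ` {s..t} \<subseteq> bdry D ` {s'..t'}" for s t s' t'
  proof -
    have "{s<..<t} \<subseteq> {s'..t'}"
    proof
      fix u assume u: "u \<in> {s<..<t}"
      then have "bdry D u \<in> bdry D ` {s'..t'}" using sub by auto
      then obtain v where v: "v \<in> {s'..t'}" "bdry D u = bdry D v" by blast
      with bdry_inj[of u v] u st st' have "u = v" by auto
      with v show "u \<in> {s'..t'}" by simp
    qed
    then have "closure {s<..<t} \<subseteq> {s'..t'}" by (rule closure_minimal) simp
    then show ?thesis using st by (simp add: closure_greaterThanLessThan)
  qed
  have eq: "s = s'" "t = t'"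
    using int[OF st(1,3,5) st'(1,3,5)] int[OF st'(1,3,5) st(1,3,5)] C[unfolded st(6) st'(6)] by auto
  show bc: "{b, c} = {b', c'}" using st(7) st'(7) eq by simp
  show "j = j'"
  proof (rule linorder_cases[of j j'])
    assume "j < j'"
    then have "knot D (Suc j) \<le> knot D j'" using st'(8) by (intro knot_mono) auto
    then show ?thesis using st st' eq by auto
  next
    assume "j' < j"
    then have "knot D (Suc j') \<le> knot D j" using st(8) by (intro knot_mono) auto
    then show ?thesis using st st' eq by auto
  qed
  let ?S = "closed_segment a b \<union> closed_segment a c" and ?S' = "closed_segment a' b' \<union> closed_segment a' c'"
  have ne: "a \<noteq> b" "a \<noteq> c" "b \<noteq> c" using cell_ne[OF pie_is_cell[OF p]] by auto
  have ne': "a' \<noteq> b'" "a' \<noteq> c'" using cell_ne[OF pie_is_cell[OF p']] by auto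
  have subS: "closed_segment a b \<union> closed_segment a c \<subseteq> closed_segment a' b' \<union> closed_segment a' c'" if p: "pie D T j a b c C" and p': "pie D T j' a' b' c' C" and
     F: "pie_boundary a b c C = pie_boundary a' b' c' C" for j a b c j' a' b' c'
  proof -
    let ?S = "closed_segment a b \<union> closed_segment a c" and ?S' = "closed_segment a' b' \<union> closed_segment a' c'"
    have ne: "a \<noteq> b" "a \<noteq> c" using cell_ne[OF pie_is_cell[OF p]] by auto
    have fin: "finite (closed_segment a b \<inter> C)" "finite (closed_segment a c \<inter> C)"
      using pie_segment_finite[OF p] ne by auto
    have cS: "closed ?S'" by (intro closed_Un closed_segment)
    have "closed_segment a b - (closed_segment a b \<inter> C) \<subseteq> ?S'"
      "closed_segment a c - (closed_segment a c \<inter> C) \<subseteq> ?S'"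
      using F unfolding pie_boundary_def by blast+
    then have c: "closure (closed_segment a b - (closed_segment a b \<inter> C)) \<subseteq> ?S'"
      "closure (closed_segment a c - (closed_segment a c \<inter> C)) \<subseteq> ?S'"
      using cS by (simp_all only: closure_minimal)
    have "closed_segment a b \<subseteq> ?S'"
      by (rule subset_trans[OF segment_closure_minus[OF ne(1) fin(1)] c(1)])
    moreover have "closed_segment a c \<subseteq> ?S'"
      by (rule subset_trans[OF segment_closure_minus[OF ne(2) fin(2)] c(2)])
    ultimately show ?thesis by (rule Un_least)
  qed
  have S: "?S = ?S'"
    using subS[OF p p'[folded C] F[folded C]] subS[OF p'[folded C] p F[folded C, symmetric]] by blast
  have S'': "?S = closed_segment a' b \<union> closed_segment a' c"
    using S bc by (auto simp: doubleton_eq_iff)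
  have nc: "area2 a b c \<noteq> 0" using pie_area2[OF p] .
  \<comment> \<open>The midpoint of \<open>a'\<close> and \<open>c\<close> lies on one of the two
    edges. On \<open>[a,b]\<close> it would force \<open>c\<close> onto the line through
    \<open>a\<close> and \<open>b\<close>; on \<open>[a,c]\<close> it puts \<open>a'\<close> on both
    lines, which meet only in \<open>a\<close>.\<close>
  have key: "a = a'" if nc: "area2 a b c \<noteq> 0"
    and S: "closed_segment a b \<union> closed_segment a c = closed_segment a' b \<union> closed_segment a' c"
    and a': "a' \<in> closed_segment a b" for b c
  proof -
    let ?m = "midpoint a' c"
    have "?m \<in> closed_segment a' c" by simp
    then consider "?m \<in> closed_segment a b" | "?m \<in> closed_segment a c" using S by blast
    then show ?thesis
    proof cases
      case 1
      have "area2 a b ?m = (area2 a b a' + area2 a b c) / 2"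
        by (simp add: area2_def midpoint_def field_simps)
      with area2_segment[OF 1] area2_segment[OF a'] nc show ?thesis by simp
    next
      case 2
      obtain u where u: "a' = (1 - u) *\<^sub>R a + u *\<^sub>R b" using a' unfolding in_segment by blast
      have "2 * area2 a c ?m = area2 a c a' + area2 a c c"
        by (simp add: area2_def midpoint_def field_simps)
      also have "area2 a c c = 0" by (simp add: area2_def)
      also have "area2 a c a' = - u * area2 a b c" unfolding u area2_def by (simp add: algebra_simps)
      finally have "u = 0" using area2_segment[OF 2] nc by simp
      then show ?thesis using u by simp
    qed
  qed
  have "a' \<in> ?S" unfolding S'' by simp
  then show "a = a'"
  proof
    assume "a' \<in> closed_segment a b"
    from key[OF nc S'' this] show ?thesis .
  next
    assume *: "a' \<in> closed_segment a c"
    have "area2 a c b \<noteq> 0" using nc_perm(2)[OF nc] .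
    from key[OF this _ *] S'' show ?thesis by (simp add: Un_commute)
  qed
qed

end

section \<open>Both sides of a straight edge\<close>

lemma area2_shift:
  assumes "a \<noteq> b" obtains n where "\<And>y t. area2 a b (y + t *\<^sub>R n) = area2 a b y + t"
proof -
  define p q where "p = b $ 1 - a $ 1" and "q = b $ 2 - a $ 2"
  define N where "N = p * p + q * q"
  have "p \<noteq> 0 \<or> q \<noteq> 0" using assms by (auto simp: p_def q_def vec_eq_iff forall_2)
  then have N: "N \<noteq> 0" unfolding N_def by (simp add: sum_squares_eq_zero_iff)
  define n :: point where "n = vector [- q / N, p / N]"
  have "p * n $ 2 - q * n $ 1 = N / N"
    unfolding n_def by (simp flip: add_divide_distrib N_def)
  then have one: "p * n $ 2 - q * n $ 1 = 1" using N by simp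
  have "area2 a b (y + t *\<^sub>R n) = area2 a b y + t * (p * n $ 2 - q * n $ 1)"
    for y t by (simp add: area2_def p_def q_def algebra_simps)
  then show thesis by (intro that[of n]) (simp add: one)
qed

text \<open>A small step in a normal direction leaves the line towards the prescribed side. The sign
  \<open>\<sigma>\<close> encodes the side throughout.\<close>

lemma off_line_near:
  assumes "a \<noteq> b" "open S" "y \<in> S" "\<sigma> \<in> {1, -1}" "\<sigma> * area2 a b y \<ge> 0"
  shows "\<exists>z\<in>S. \<sigma> * area2 a b z > 0"
proof -
  obtain n where n: "\<And>y t. area2 a b (y + t *\<^sub>R n) = area2 a b y + t" using area2_shift[OF assms(1)] by blast
  obtain e where e: "e > 0" "ball y e \<subseteq> S" using assms(2,3) openE by blast
  define t where "t = e / 2 / (norm n + 1)"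
  have pos: "norm n + 1 > 0" by (simp add: add_nonneg_pos)
  have t: "t > 0" using e pos by (simp add: t_def)
  have "t * norm n \<le> t * (norm n + 1)" using t by simp
  also have "\<dots> = e / 2" using pos unfolding t_def by (metis nonzero_eq_divide_eq less_irrefl)
  also have "\<dots> < e" using e by simp
  finally have "norm ((\<sigma> * t) *\<^sub>R n) < e" using t assms(4) by (auto simp: abs_mult)
  then have "y + (\<sigma> * t) *\<^sub>R n \<in> S" by (intro subsetD[OF e(2)]) (simp add: dist_norm)
  moreover have "\<sigma> * area2 a b (y + (\<sigma> * t) *\<^sub>R n) > 0"
  proof -
    have "\<sigma> * \<sigma> = 1" using assms(4) by auto
    then have "\<sigma> * area2 a b (y + (\<sigma> * t) *\<^sub>R n) = \<sigma> * area2 a b y + t"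
      unfolding n by (simp add: distrib_left flip: mult.assoc)
    then show ?thesis using assms(5) t by simp
  qed
  ultimately show ?thesis by blast
qed

lemma open_not_on_line:
  assumes "a \<noteq> b" "open S" "S \<noteq> {}" shows "\<exists>z\<in>S. area2 a b z \<noteq> 0"
proof -
  obtain y where y: "y \<in> S" using assms by blast
  have "1 * area2 a b y \<ge> 0 \<or> (-1) * area2 a b y \<ge> 0" by linarith
  then show ?thesis
  proof
    assume "1 * area2 a b y \<ge> 0"
    with off_line_near[OF assms(1,2) y, of 1] show ?thesis by force
  next
    assume "(-1) * area2 a b y \<ge> 0"
    with off_line_near[OF assms(1,2) y, of "-1"] show ?thesis by force
  qed
qed

lemma area2_continuous: "continuous_on A (area2 a b)"
  using Pd_continuous[OF area2_Pd] .

lemma half_ball_connected: "connected (ball x \<epsilon> \<inter> {y. \<sigma> * area2 a b y > 0})"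
proof (rule convex_connected, rule convex_Int)
  show "convex (ball x \<epsilon>)" by simp
  show "convex {y. \<sigma> * area2 a b y > 0}"
  proof (rule convexI)
    fix x y and u v :: real
    assume *: "x \<in> {y. \<sigma> * area2 a b y > 0}" "y \<in> {y. \<sigma> * area2 a b y > 0}" "0 \<le> u" "0 \<le> v" "u + v = 1"
    have u: "u = 1 - v" using * by simp
    have "area2 a b (u *\<^sub>R x + v *\<^sub>R y) = u * area2 a b x + v * area2 a b y"
      unfolding u by (simp add: area2_def algebra_simps)
    then have "\<sigma> * area2 a b (u *\<^sub>R x + v *\<^sub>R y) = u * (\<sigma> * area2 a b x) + v * (\<sigma> * area2 a b y)"
      by (simp add: algebra_simps)
    also have "\<dots> > 0"
    proof (cases "u = 0")
      case False
      then have "u * (\<sigma> * area2 a b x) > 0" using * by (intro mult_pos_pos[of u]) auto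
      moreover have "v * (\<sigma> * area2 a b y) \<ge> 0" using * by (intro mult_nonneg_nonneg[of v]) auto
      ultimately show ?thesis by (rule add_pos_nonneg)
    qed (use * in auto)
    finally show "u *\<^sub>R x + v *\<^sub>R y \<in> {y. \<sigma> * area2 a b y > 0}" by simp
  qed
qed

lemma area2_segment_iff_vertex:
  assumes nc: "area2 a b c \<noteq> 0"
  shows "x \<in> open_segment a b \<Longrightarrow> x \<notin> closed_segment a c"
    "x \<in> open_segment a b \<Longrightarrow> x \<notin> closed_segment b c"
    "x \<in> open_segment a b \<Longrightarrow> x \<noteq> a \<and> x \<noteq> b \<and> x \<noteq> c"
proof -
  have 1: "area2 a c x = - (u * area2 a b c) \<and> area2 b c x = (1 - u) * area2 a b c" if "x = (1 - u) *\<^sub>R a + u *\<^sub>R b" for u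
    unfolding that by (simp add: area2_def algebra_simps)
  have 2: "x \<notin> closed_segment a c \<and> x \<notin> closed_segment b c \<and> x \<noteq> a \<and> x \<noteq> b \<and> x \<noteq> c"
    if x: "x \<in> open_segment a b"
  proof -
    obtain u where u: "0 < u" "u < 1" "x = (1 - u) *\<^sub>R a + u *\<^sub>R b" using x unfolding in_segment by blast
    from 1[OF u(3)] u nc have "area2 a c x \<noteq> 0" "area2 b c x \<noteq> 0" by simp_all
    moreover have "a \<notin> open_segment a b" "b \<notin> open_segment a b" by (auto simp: open_segment_def)
    moreover have "area2 a c c = 0" by (simp add: area2_def)
    ultimately show ?thesis using area2_segment x by metis
  qed
  show "x \<in> open_segment a b \<Longrightarrow> x \<notin> closed_segment a c"
    "x \<in> open_segment a b \<Longrightarrow> x \<notin> closed_segment b c"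
    "x \<in> open_segment a b \<Longrightarrow> x \<noteq> a \<and> x \<noteq> b \<and> x \<noteq> c" using 2 by blast+
qed

context pie_triangulation
begin

lemma pie_vertices:
  assumes p: "pie D T j a b c C"
  shows "vertices D T = {a, b, c}" "straight_edges D T = {closed_segment a b, closed_segment a c}"
proof -
  have cell: "is_cell D T x y z \<longleftrightarrow> (\<exists>j C. pie D T j x y z C)" for x y z
    unfolding is_cell_def using pie_not_straight[OF p] by blast
  have xyz: "x = a \<and> {y, z} = {b, c}" if "is_cell D T x y z" for x y z
  proof -
    from that obtain j' C' where p': "pie D T j' x y z C'" unfolding cell by blast
    show ?thesis using pie_unique(2,4)[OF p p'] by simp
  qed
  have c1: "is_cell D T a b c" "is_cell D T a c b" using p pie_swap[OF p] cell by blast+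
  show "vertices D T = {a, b, c}"
  proof
    show "{a, b, c} \<subseteq> vertices D T" unfolding vertices_def using c1(1) by blast
    show "vertices D T \<subseteq> {a, b, c}"
    proof
      fix v assume "v \<in> vertices D T"
      then obtain x y z where "is_cell D T x y z" "v \<in> {x, y, z}" unfolding vertices_def by blast
      then show "v \<in> {a, b, c}" using xyz[of x y z] by simp
    qed
  qed
  show "straight_edges D T = {closed_segment a b, closed_segment a c}"
  proof
    show "{closed_segment a b, closed_segment a c} \<subseteq> straight_edges D T"
      unfolding straight_edges_def using c1 by blast
    show "straight_edges D T \<subseteq> {closed_segment a b, closed_segment a c}"
    proof
      fix e assume "e \<in> straight_edges D T"
      then obtain x y z where e: "is_cell D T x y z" "e = closed_segment x y"
        unfolding straight_edges_def by blast
      then have "x = a" "y \<in> {b, c}" using xyz[OF e(1)] by blast+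
      then show "e \<in> {closed_segment a b, closed_segment a c}" using e(2) by auto
    qed
  qed
qed

lemma straight_vertices:
  assumes s: "straight_tri T a b c"
  shows "vertices D T = {a, b, c}"
    "straight_edges D T = {closed_segment a b, closed_segment b c, closed_segment a c}"
    "is_cell D T x y z \<longleftrightarrow> straight_tri T x y z"
proof -
  have cell: "is_cell D T x y z \<longleftrightarrow> straight_tri T x y z" for x y z
    unfolding is_cell_def using pie_not_straight s by blast
  then show "is_cell D T x y z \<longleftrightarrow> straight_tri T x y z" .
  have xyz: "x \<in> {a, b, c} \<and> y \<in> {a, b, c} \<and> z \<in> {a, b, c} \<and> x \<noteq> y" if "is_cell D T x y z" for x y z
    using that cell_ne[OF that] straight_tri_unique[OF s, of x y z] unfolding cell by blast
  have c1: "is_cell D T a b c" "is_cell D T b c a" "is_cell D T a c b"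
    unfolding cell using s straight_tri_perm by blast+
  show "vertices D T = {a, b, c}"
  proof
    show "{a, b, c} \<subseteq> vertices D T" unfolding vertices_def using c1(1) by blast
    show "vertices D T \<subseteq> {a, b, c}"
      unfolding vertices_def using xyz by blast
  qed
  show "straight_edges D T = {closed_segment a b, closed_segment b c, closed_segment a c}"
  proof
    show "straight_edges D T \<subseteq> {closed_segment a b, closed_segment b c, closed_segment a c}"
    proof
      fix e assume "e \<in> straight_edges D T"
      then obtain x y z where e: "is_cell D T x y z" "e = closed_segment x y"
        unfolding straight_edges_def by blast
      then have "x \<in> {a, b, c}" "y \<in> {a, b, c}" "x \<noteq> y" using xyz[OF e(1)] by blast+
      then show "e \<in> {closed_segment a b, closed_segment b c, closed_segment a c}"
        unfolding e(2) by (elim insertE emptyE) (simp_all add: closed_segment_commute)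
    qed
    show "{closed_segment a b, closed_segment b c, closed_segment a c} \<subseteq> straight_edges D T"
      unfolding straight_edges_def using c1 by blast
  qed
qed

lemma cell_vertices: "is_cell D T a b c \<Longrightarrow> vertices D T = {a, b, c}"
  using pie_vertices(1) straight_vertices(1) unfolding is_cell_def by metis

lemma edge_cell:
  assumes "closed_segment a b \<in> straight_edges D T"
  shows "\<exists>c. is_cell D T a b c \<or> is_cell D T b a c"
  using assms unfolding straight_edges_def by (auto simp: closed_segment_eq doubleton_eq_iff)

lemma edge_unique:
  assumes c: "is_cell D T a b c" and x: "x \<in> open_segment a b"
    and e: "e \<in> straight_edges D T" "x \<in> e"
  shows "e = closed_segment a b"
proof -
  have nc: "area2 a b c \<noteq> 0" using cell_area2[OF c] .
  have "straight_edges D T \<subseteq> {closed_segment a b, closed_segment b c, closed_segment a c}"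
  proof
    fix e assume "e \<in> straight_edges D T"
    then obtain x y z where xyz: "is_cell D T x y z" "e = closed_segment x y"
      unfolding straight_edges_def by blast
    then have "x \<in> {a, b, c}" "y \<in> {a, b, c}" "x \<noteq> y"
      using cell_vertices[OF c] cell_vertices[OF xyz(1)] cell_ne[OF xyz(1)] by auto
    then show "e \<in> {closed_segment a b, closed_segment b c, closed_segment a c}"
      unfolding xyz by (auto simp: closed_segment_commute)
  qed
  then show ?thesis using e area2_segment_iff_vertex[OF nc] x by blast
qed

text \<open>Near an inner point of the edge the rest \<open>K\<close> of the frontier is out of
  reach. The half ball on the side of some interior point of the cell is connected and free of
  frontier points, hence contained in the cell.\<close>

lemma half_disc:
  assumes c: "is_cell D T a b c" and x: "x \<in> open_segment a b"
  obtains \<epsilon> \<sigma> where "\<epsilon> > 0" "\<sigma> \<in> {1, -1}" "\<And>y. y \<in> ball x \<epsilon> \<Longrightarrow> \<sigma> * area2 a b y \<ge> 0 \<Longrightarrow> y \<in> T"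
proof -
  have nc: "area2 a b c \<noteq> 0" and ne: "a \<noteq> b" using cell_area2[OF c] cell_ne[OF c] by auto
  note fat = cell_fat[OF c]
  have xab: "x \<in> closed_segment a b" using x by (simp add: open_segment_def)
  obtain K where K: "closed K" "x \<notin> K" "frontier T \<subseteq> closed_segment a b \<union> K"
  proof -
    from c show thesis unfolding is_cell_def
    proof (elim disjE exE)
      assume s: "straight_tri T a b c"
      show thesis
        by (rule that[of "closed_segment b c \<union> closed_segment c a"])
          (use straight_tri_frontier[OF s] area2_segment_iff_vertex[OF nc] x in
            \<open>auto simp: closed_segment_commute[of c a]\<close>)
    next
      fix j C assume p: "pie D T j a b c C"
      have "closed_segment a b \<inter> C = {b}" using p unfolding pie_def by blast
      then have "x \<notin> C" using xab area2_segment_iff_vertex(3)[OF nc x] by blast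
      then show thesis
        by (intro that[of "closed_segment a c \<union> C"])
          (use pie_topology(1)[OF p] pie_C(7)[OF p] area2_segment_iff_vertex[OF nc] x in
            \<open>auto simp: pie_boundary_def\<close>)
    qed
  qed
  then obtain \<epsilon> where \<epsilon>: "\<epsilon> > 0" "ball x \<epsilon> \<inter> K = {}"
    using open_Compl[OF K(1)] openE[of "- K" x] by (metis ComplI disjoint_eq_subset_Compl)
  have xT: "x \<in> T" using cell_edge[OF c] xab by blast
  then have "ball x \<epsilon> \<inter> interior T \<noteq> {}"
    using fat(2) \<epsilon>(1) by (metis Int_commute centre_in_ball closure_iff_nhds_not_empty open_ball order_refl)
  then obtain z where z: "z \<in> ball x \<epsilon>" "z \<in> interior T" "area2 a b z \<noteq> 0"
    using open_not_on_line[OF ne, of "ball x \<epsilon> \<inter> interior T"] by (metis IntE open_Int open_ball open_interior)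
  define \<sigma> where "\<sigma> = sgn (area2 a b z)"
  have \<sigma>: "\<sigma> \<in> {1, -1}" "\<sigma> * area2 a b z > 0" using z(3) by (auto simp: \<sigma>_def sgn_if)
  let ?H = "ball x \<epsilon> \<inter> {y. \<sigma> * area2 a b y > 0}"
  have "?H \<inter> frontier T = {}" using K(3) \<epsilon>(2) area2_segment by fastforce
  moreover have "?H \<inter> T \<noteq> {}" using z \<sigma> interior_subset by blast
  ultimately have HT: "?H \<subseteq> T" using connected_Int_frontier[OF half_ball_connected, of x \<epsilon> \<sigma> a b T] by blast
  show thesis
  proof (rule that[OF \<epsilon>(1) \<sigma>(1)])
    fix y assume y: "y \<in> ball x \<epsilon>" "\<sigma> * area2 a b y \<ge> 0"
    have "y \<in> closure ?H"
    proof (subst closure_iff_nhds_not_empty, intro allI impI)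
      fix A S assume "S \<subseteq> A" "open S" "y \<in> S"
      then have "\<exists>z\<in>S \<inter> ball x \<epsilon>. \<sigma> * area2 a b z > 0"
        using y by (intro off_line_near[OF ne _ _ \<sigma>(1) y(2)]) auto
      then show "?H \<inter> A \<noteq> {}" using \<open>S \<subseteq> A\<close> by blast
    qed
    then show "y \<in> T" using HT fat(1) closure_minimal by blast
  qed
qed

text \<open>Each cell contains a half disc at \<open>x\<close>. If both lay on the same side, the
  intersection of the cells would contain an open set, whereas it is at most a point or a segment;
  so they lie on opposite sides and fill a disc.\<close>

lemma shared_edge_nbhd:
  assumes T: "T \<in> \<Delta>" "T' \<in> \<Delta>" "T \<noteq> T'" and c: "is_cell D T a b c"
    and e: "closed_segment a b \<in> straight_edges D T'" and x: "x \<in> open_segment a b"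
  shows "x \<in> interior (T \<union> T')"
proof -
  have ne: "a \<noteq> b" using cell_ne[OF c] by auto
  obtain \<epsilon> \<sigma> where h: "\<epsilon> > 0" "\<sigma> \<in> {1, -1}" "\<And>y. y \<in> ball x \<epsilon> \<Longrightarrow> \<sigma> * area2 a b y \<ge> 0 \<Longrightarrow> y \<in> T"
    using half_disc[OF c x] by blast
  obtain \<epsilon>' \<sigma>' where h': "\<epsilon>' > 0" "\<sigma>' \<in> {1, -1}" "\<And>y. y \<in> ball x \<epsilon>' \<Longrightarrow> \<sigma>' * area2 a b y \<ge> 0 \<Longrightarrow> y \<in> T'"
  proof -
    from edge_cell[OF e] obtain c' where "is_cell D T' a b c' \<or> is_cell D T' b a c'" by blast
    then show thesis
    proof
      assume "is_cell D T' a b c'"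
      from half_disc[OF this x] show thesis using that by blast
    next
      assume c': "is_cell D T' b a c'"
      have x': "x \<in> open_segment b a" using x by (simp add: open_segment_commute)
      have sw: "area2 b a y = - area2 a b y" for y by (simp add: area2_def algebra_simps)
      obtain \<epsilon>' \<sigma>' where "\<epsilon>' > 0" "\<sigma>' \<in> {1, -1}" "\<And>y. y \<in> ball x \<epsilon>' \<Longrightarrow> \<sigma>' * area2 b a y \<ge> 0 \<Longrightarrow> y \<in> T'"
        using half_disc[OF c' x'] by blast
      then show thesis by (intro that[of \<epsilon>' "- \<sigma>'"]) (auto simp: sw)
    qed
  qed
  let ?B = "ball x (min \<epsilon> \<epsilon>')"
  have "\<sigma>' = - \<sigma>"
  proof (rule ccontr)
    assume "\<sigma>' \<noteq> - \<sigma>"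
    then have eq: "\<sigma>' = \<sigma>" using h(2) h'(2) by auto
    let ?H = "?B \<inter> {y. \<sigma> * area2 a b y > 0}"
    have "open {y. \<sigma> * area2 a b y > 0}"
      by (intro open_Collect_less continuous_on_mult continuous_on_const area2_continuous)
    then have oH: "open ?H" by (intro open_Int) auto
    have "\<exists>z\<in>?B. \<sigma> * area2 a b z > 0"
      by (rule off_line_near[OF ne, of _ x])
        (use h h' x area2_segment[of x a b] in \<open>auto simp: open_segment_def\<close>)
    then have neH: "?H \<noteq> {}" by blast
    have sub: "?H \<subseteq> T \<inter> T'" using h(3) h'(3) eq by auto
    have "T \<inter> T' = {} \<or> (\<exists>v. T \<inter> T' = {v}) \<or> (\<exists>x y. x \<noteq> y \<and> T \<inter> T' = closed_segment x y)"
      using cell_Int[OF T] cell_ne unfolding straight_edges_def by blast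
    then show False
    proof (elim disjE exE conjE)
      assume "T \<inter> T' = {}" then show False using sub neH by blast
    next
      fix v assume "T \<inter> T' = {v}"
      then have "finite ?H" using sub finite_subset by auto
      then show False using oH neH by (simp add: finite_imp_not_open)
    next
      fix u w assume "u \<noteq> w" "T \<inter> T' = closed_segment u w"
      with open_not_on_line[OF _ oH neH, of u w] sub area2_segment show False by blast
    qed
  qed
  then have "?B \<subseteq> T \<union> T'"
  proof (intro subsetI)
    fix y assume "\<sigma>' = - \<sigma>" "y \<in> ?B"
    moreover have "\<sigma> * area2 a b y \<ge> 0 \<or> (- \<sigma>) * area2 a b y \<ge> 0" by linarith
    ultimately show "y \<in> T \<union> T'" using h(3)[of y] h'(3)[of y] by auto
  qed
  moreover have "x \<in> ?B" using h h' by simp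
  ultimately show ?thesis by (meson interiorI open_ball)
qed

lemma nonpie_straight: "T \<in> \<Delta> \<Longrightarrow> T \<notin> pies D \<Delta> \<Longrightarrow> is_cell D T a b c \<Longrightarrow> straight_tri T a b c"
  unfolding pies_def is_cell_def by blast

lemma ordinary_straight: "T \<in> ordinary D \<Delta> \<Longrightarrow> T \<in> \<Delta> \<and> T \<notin> pies D \<Delta> \<and> T \<notin> buffers D \<Delta> \<and> (\<exists>a b c. straight_tri T a b c)"
  using cells nonpie_straight unfolding ordinary_def by blast

lemma buffer_straight: "T \<in> buffers D \<Delta> \<Longrightarrow> T \<in> \<Delta> \<and> T \<notin> pies D \<Delta> \<and> (\<exists>a b c. straight_tri T a b c)"
  using cells nonpie_straight unfolding buffers_def by blast

definition pie_edge where "pie_edge e \<longleftrightarrow> (\<exists>P\<in>pies D \<Delta>. e \<in> straight_edges D P)"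

lemma nonpie_pie_edge_buffer:
  "T \<in> \<Delta> \<Longrightarrow> T \<notin> pies D \<Delta> \<Longrightarrow> e \<in> straight_edges D T \<Longrightarrow> pie_edge e \<Longrightarrow> T \<in> buffers D \<Delta>"
  unfolding buffers_def pie_edge_def by blast

lemma ordinary_no_pie_edge: "T \<in> ordinary D \<Delta> \<Longrightarrow> e \<in> straight_edges D T \<Longrightarrow> \<not> pie_edge e"
  using nonpie_pie_edge_buffer ordinary_straight by blast

lemma cell_edge_in: "is_cell D T a b c \<Longrightarrow> closed_segment a b \<in> straight_edges D T"
  unfolding straight_edges_def by blast

lemma EPB_pie_edge: "e \<in> EPB D \<Delta> \<Longrightarrow> pie_edge e"
  unfolding EPB_def pie_edge_def by blast

text \<open>One direction rests on the chosen triangles: \<open>TE\<close> attaches an ordinary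
  triangle to each edge of \<open>EI0\<close>, and an ordinary triangle has no edge in common with a
  pie-shaped one.\<close>

lemma EI0_iff:
  assumes "T \<in> \<Delta>" "is_cell D T a b c"
  shows "closed_segment a b \<in> EI0 D \<Delta> \<longleftrightarrow> \<not> pie_edge (closed_segment a b)"
proof
  assume "closed_segment a b \<in> EI0 D \<Delta>"
  from TE[OF this] show "\<not> pie_edge (closed_segment a b)" using ordinary_no_pie_edge by blast
next
  assume "\<not> pie_edge (closed_segment a b)"
  then show "closed_segment a b \<in> EI0 D \<Delta>" using edge_EI(1)[OF assms] EPB_pie_edge unfolding EI0_def by blast
qed

text \<open>The edge is interior but does not belong to \<open>EI0\<close>. It is therefore in
  \<open>EPB\<close>, and that set only contains edges of buffer triangles.\<close>

lemma pie_edge_buffer: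
  assumes P: "P \<in> pies D \<Delta>" "closed_segment a b \<in> straight_edges D P"
  obtains B where "B \<in> buffers D \<Delta>" "closed_segment a b \<in> straight_edges D B" "B \<noteq> P"
proof -
  have PD: "P \<in> \<Delta>" using P by (simp add: pies_def)
  have pe: "pie_edge (closed_segment a b)" using P unfolding pie_edge_def by blast
  obtain c where c: "is_cell D P a b c \<or> is_cell D P b a c" using edge_cell[OF P(2)] by blast
  then have "closed_segment a b \<in> EI D \<Delta> - EI0 D \<Delta>"
  proof
    assume c: "is_cell D P a b c"
    then show ?thesis using edge_EI(1)[OF PD c] EI0_iff[OF PD c] pe by blast
  next
    assume c: "is_cell D P b a c"
    then show ?thesis using edge_EI(1)[OF PD c] EI0_iff[OF PD c] pe by (simp add: closed_segment_commute)
  qed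
  then have "closed_segment a b \<in> EPB D \<Delta>" unfolding EI0_def by blast
  then obtain P' B where B: "P' \<in> pies D \<Delta>" "B \<in> buffers D \<Delta>" "closed_segment a b \<in> straight_edges D B"
    unfolding EPB_def by blast
  moreover have "B \<noteq> P" using B(2) P(1) buffer_straight by blast
  ultimately show thesis using that by blast
qed

text \<open>For edges of pie-shaped triangles the other cell is a buffer triangle, and for the
  others it may be \<open>TE e\<close>. If \<open>TE e\<close> is \<open>T\<close> itself, then
  \<open>T\<close> is straight and lies on one side of the edge; points of the domain on the other
  side accumulate at a point \<open>x\<close> of the edge and are covered by finitely many further
  closed cells, one of which contains \<open>x\<close>.\<close>

lemma edge_shared:
  assumes T: "T \<in> \<Delta>" and c: "is_cell D T a b c"
  shows "\<exists>T'\<in>\<Delta>. T' \<noteq> T \<and> closed_segment a b \<in> straight_edges D T'"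
proof (cases "pie_edge (closed_segment a b)")
  case True
  then obtain P where P: "P \<in> pies D \<Delta>" "closed_segment a b \<in> straight_edges D P"
    unfolding pie_edge_def by blast
  from pie_edge_buffer[OF P] obtain B where B: "B \<in> buffers D \<Delta>" "closed_segment a b \<in> straight_edges D B" "B \<noteq> P" .
  have "P \<in> \<Delta>" "B \<in> \<Delta>" using P(1) B(1) by (auto simp: pies_def buffers_def)
  then show ?thesis using P B by metis
next
  case False
  let ?e = "closed_segment a b"
  have eEI0: "?e \<in> EI0 D \<Delta>" using False EI0_iff[OF T c] by blast
  note TE' = TE[OF eEI0]
  show ?thesis
  proof (cases "TE ?e = T")
    case False
    then show ?thesis using TE' ordinary_straight by blast
  next
    case TT: True
    have st: "straight_tri T a b c" using nonpie_straight[OF T _ c] TE' TT ordinary_straight by blast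
    have nc: "area2 a b c \<noteq> 0" and ne: "a \<noteq> b" using cell_area2[OF c] cell_ne[OF c] by auto
    define \<sigma> where "\<sigma> = sgn (area2 a b c)"
    have \<sigma>: "\<sigma> \<in> {1, -1}" using nc by (auto simp: \<sigma>_def sgn_if)
    have side: "\<sigma> * area2 a b y \<ge> 0" if "y \<in> T" for y
    proof -
      have "bary c a b y \<ge> 0" using that straight_tri_interior_bary(2)[OF st] by blast
      moreover have "area2 y a b = area2 a b y" by (simp add: area2_def algebra_simps)
      ultimately have "area2 a b y / area2 a b c \<ge> 0" unfolding bary_forms[where a=a and b=b and c=c] by simp
      then show ?thesis by (auto simp: \<sigma>_def sgn_if zero_le_divide_iff)
    qed
    obtain y where y: "y \<in> ?e" "y \<notin> \<Gamma>" using edge_EI(2)[OF T c] by blast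
    then have "y \<in> \<Omega>" using cell_edge[OF c] cell_subset[OF T] closure_region by blast
    moreover have "y \<in> closure (open_segment a b)" using y ne by simp
    ultimately obtain x where x: "x \<in> \<Omega>" "x \<in> open_segment a b"
      using open_region by (metis closure_iff_nhds_not_empty disjoint_iff order_refl)
    let ?N = "\<Omega> \<inter> {y. \<sigma> * area2 a b y < 0}"
    have "x \<in> closure ?N"
    proof (subst closure_iff_nhds_not_empty, intro allI impI)
      fix A S assume S: "S \<subseteq> A" "open S" "x \<in> S"
      have "\<exists>z\<in>S \<inter> \<Omega>. (- \<sigma>) * area2 a b z > 0"
        by (rule off_line_near[OF ne, of _ x])
          (use S x open_region \<sigma> area2_segment[of x a b] in \<open>auto simp: open_segment_def\<close>)
      then show "?N \<inter> A \<noteq> {}" using S(1) by force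
    qed
    moreover have "?N \<subseteq> \<Union>(\<Delta> - {T})"
    proof
      fix y assume y: "y \<in> ?N"
      then have "y \<in> \<Union>\<Delta>" using union closure_subset[of \<Omega>] by blast
      then obtain T' where "T' \<in> \<Delta>" "y \<in> T'" by blast
      moreover have "y \<notin> T" using side[of y] y by auto
      ultimately show "y \<in> \<Union>(\<Delta> - {T})" by blast
    qed
    moreover have "closed (\<Union>(\<Delta> - {T}))"
      using fin cells cell_fat(1) by (intro closed_Union) blast+
    ultimately have "x \<in> \<Union>(\<Delta> - {T})" using closure_minimal by blast
    then obtain T' where T': "T' \<in> \<Delta>" "T' \<noteq> T" "x \<in> T'" by blast
    have xT: "x \<in> T" using cell_edge[OF c] x(2) by (auto simp: open_segment_def)
    have "x \<notin> vertices D T"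
      using cell_vertices[OF c] area2_segment_iff_vertex(3)[OF nc x(2)] by blast
    \<comment> \<open>As \<open>x\<close> is not a vertex, the two cells have more in common than a
      vertex.\<close>
    then have e: "T \<inter> T' \<in> straight_edges D T \<inter> straight_edges D T'"
      using cell_Int[OF T T'(1) T'(2)[symmetric]] T'(3) xT by (metis Int_iff empty_iff singletonD)
    have "T \<inter> T' = closed_segment a b"
      by (rule edge_unique[OF c x(2)]) (use e T'(3) xT in simp_all)
    then show ?thesis using e T'(1,2) by (intro bexI[of _ T']) simp_all
  qed
qed

text \<open>The cells on the two sides fill a neighbourhood inside the closure of the domain, and
  the interior of this closure is the domain.\<close>

lemma open_edge_region:
  assumes T: "T \<in> \<Delta>" and c: "is_cell D T a b c" shows "open_segment a b \<subseteq> \<Omega>"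
proof
  fix x assume x: "x \<in> open_segment a b"
  obtain T' where T': "T' \<in> \<Delta>" "T' \<noteq> T" "closed_segment a b \<in> straight_edges D T'"
    using edge_shared[OF T c] by blast
  have "x \<in> interior (T \<union> T')" by (rule shared_edge_nbhd[OF T T'(1) T'(2)[symmetric] c T'(3) x])
  moreover have "T \<union> T' \<subseteq> closure \<Omega>" using cell_subset[OF T] cell_subset[OF T'(1)] by (rule Un_least)
  then have "interior (T \<union> T') \<subseteq> interior (closure \<Omega>)" by (rule interior_mono)
  then have "interior (T \<union> T') \<subseteq> \<Omega>" by (simp only: interior_closure_region)
  ultimately show "x \<in> \<Omega>" by blast
qed

end

section \<open>Cells at a boundary vertex\<close>

lemma slit_ball_connected:
  fixes v h :: point
  assumes "h \<noteq> 0" "\<epsilon> > 0"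
  shows "connected (ball v \<epsilon> - {v + t *\<^sub>R h | t. t \<ge> 0})"
proof (rule starlike_imp_connected)
  let ?W = "ball v \<epsilon> - {v + t *\<^sub>R h | t. t \<ge> 0}"
  define \<kappa> where "\<kappa> = \<epsilon> / 2 / norm h"
  have \<kappa>: "\<kappa> > 0" using assms by (simp add: \<kappa>_def)
  \<comment> \<open>A point on the ray opposite to the slit; the slit ball is star-shaped with
    respect to it.\<close>
  define p where "p = v + (- \<kappa>) *\<^sub>R h"
  have pb: "p \<in> ball v \<epsilon>" using assms by (simp add: p_def \<kappa>_def dist_norm)
  have inj: "s = t" if "s *\<^sub>R h = t *\<^sub>R h" for s t using that assms(1) by simp
  have "p \<in> ?W"
  proof -
    have "\<not> (\<exists>t\<ge>0. p = v + t *\<^sub>R h)"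
    proof
      assume "\<exists>t\<ge>0. p = v + t *\<^sub>R h"
      then obtain t where t: "t \<ge> 0" "(- \<kappa>) *\<^sub>R h = t *\<^sub>R h" unfolding p_def by auto
      then show False using inj[OF t(2)] \<kappa> by simp
    qed
    then show ?thesis using pb by blast
  qed
  moreover have "closed_segment p y \<subseteq> ?W" if y: "y \<in> ?W" for y
  proof
    fix z assume z: "z \<in> closed_segment p y"
    then obtain s where s: "0 \<le> s" "s \<le> 1" "z = (1 - s) *\<^sub>R p + s *\<^sub>R y" unfolding in_segment by blast
    have "closed_segment p y \<subseteq> ball v \<epsilon>"
      using pb y by (intro closed_segment_subset) auto
    then have zb: "z \<in> ball v \<epsilon>" using z by blast
    have "\<not> (\<exists>t\<ge>0. z = v + t *\<^sub>R h)"
    proof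
      assume "\<exists>t\<ge>0. z = v + t *\<^sub>R h"
      then obtain t where t: "t \<ge> 0" "z = v + t *\<^sub>R h" by blast
      have eq: "s *\<^sub>R (y - v) = (t + (1 - s) * \<kappa>) *\<^sub>R h"
        using t(2) unfolding s(3) p_def by (simp add: algebra_simps)
      have "s \<noteq> 0"
      proof
        assume "s = 0"
        then have "t + \<kappa> = 0" using eq assms(1) by simp
        then show False using t \<kappa> by simp
      qed
      then have "y - v = ((t + (1 - s) * \<kappa>) / s) *\<^sub>R h"
        using arg_cong[OF eq, of "\<lambda>x. (1 / s) *\<^sub>R x"] by simp
      then have "y = v + ((t + (1 - s) * \<kappa>) / s) *\<^sub>R h" by (simp add: algebra_simps)
      moreover have "(t + (1 - s) * \<kappa>) / s \<ge> 0" using s t \<kappa> by simp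
      ultimately show False using y by blast
    qed
    then show "z \<in> ?W" using zb by blast
  qed
  ultimately show "starlike ?W" unfolding starlike_def by blast
qed

lemma ray_on_line: "x \<in> {v + t *\<^sub>R h | t. t \<ge> 0} \<Longrightarrow> area2 v (v + h) x = 0"
  by (auto simp: area2_def algebra_simps)

context pie_triangulation
begin

lemma VB_I: "T \<in> \<Delta> \<Longrightarrow> is_cell D T a b c \<Longrightarrow> x \<in> {a, b, c} \<Longrightarrow> x \<in> \<Gamma> \<Longrightarrow> x \<in> VB D \<Delta>"
  and VI_I: "T \<in> \<Delta> \<Longrightarrow> is_cell D T a b c \<Longrightarrow> x \<in> {a, b, c} \<Longrightarrow> x \<in> \<Omega> \<Longrightarrow> x \<in> VI D \<Delta>"
  using cell_vertices unfolding VB_def VI_def by blast+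

text \<open>The straight cells at a boundary vertex \<open>v\<close> that are not enclosed by two pie-shaped
  ones have at most one edge at \<open>v\<close> in common with a pie-shaped triangle. Crossing the other edges
  stays among these cells, so that they fill a disc around \<open>v\<close> slit along one ray.\<close>

lemma fan:
  assumes v: "v \<in> \<Gamma>" and T0: "T0 \<in> \<Delta>" "T0 \<notin> pies D \<Delta>" "straight_tri T0 v b0 c0"
  shows "pie_edge (closed_segment v b0) \<and> pie_edge (closed_segment v c0)"
proof (rule ccontr)
  assume not: "\<not> (pie_edge (closed_segment v b0) \<and> pie_edge (closed_segment v c0))"
  define Y where "Y = {T \<in> \<Delta> - pies D \<Delta>. \<exists>b c. straight_tri T v b c \<and>
     \<not> (pie_edge (closed_segment v b) \<and> pie_edge (closed_segment v c))}"
  have T0Y: "T0 \<in> Y" using T0 not unfolding Y_def by blast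
  have vVB: "v \<in> VB D \<Delta>" using VB_I[OF T0(1) _ _ v] T0(3) unfolding is_cell_def by blast
  have Yrep: "\<not> (pie_edge (closed_segment v b) \<and> pie_edge (closed_segment v c))"
    if Y: "T \<in> Y" "straight_tri T v b c" for T b c
  proof -
    obtain b' c' where bc': "straight_tri T v b' c'"
      "\<not> (pie_edge (closed_segment v b') \<and> pie_edge (closed_segment v c'))"
      using Y(1) unfolding Y_def by blast
    have "{v, b, c} = {v, b', c'}" using straight_tri_unique[OF Y(2) bc'(1)] .
    moreover have "v \<noteq> b" "v \<noteq> c" "v \<noteq> b'" "v \<noteq> c'"
      using straight_tri_area2[OF Y(2)] straight_tri_area2[OF bc'(1)] by (auto simp: area2_def)
    ultimately have "{b, c} = {b', c'}" using insert_ident[of v "{b, c}" "{b', c'}"] by simp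
    then show ?thesis using bc'(2) by (auto simp: doubleton_eq_iff)
  qed
  have Yin: "T' \<in> Y" if "T' \<in> \<Delta>" "T' \<notin> pies D \<Delta>" "straight_tri T' v b c" "\<not> pie_edge (closed_segment v b)"
    for T' b c using that unfolding Y_def by blast
  \<comment> \<open>A cell of \<open>Y\<close> with a pie edge at \<open>v\<close> is a buffer
    triangle. Only one buffer triangle is attached to \<open>v\<close>, and by the definition of
    \<open>Y\<close> it has just one such edge, so a single ray is enough.\<close>
  obtain h where h: "h \<noteq> 0" and ray: "\<And>T b c. T \<in> Y \<Longrightarrow> straight_tri T v b c \<Longrightarrow>
     pie_edge (closed_segment v b) \<Longrightarrow> closed_segment v b \<subseteq> {v + t *\<^sub>R h | t. t \<ge> 0}"
  proof (cases "\<exists>T b c. T \<in> Y \<and> straight_tri T v b c \<and> pie_edge (closed_segment v b)")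
    case False
    \<comment> \<open>With no such edge at all, the slit may have any direction.\<close>
    show thesis by (rule that[of "axis 1 1"]) (use False in \<open>auto simp: axis_eq_0_iff\<close>)
  next
    case True
    then obtain T1 b1 c1 where T1: "T1 \<in> Y" "straight_tri T1 v b1 c1" "pie_edge (closed_segment v b1)" by blast
    have buf: "T \<in> buffers D \<Delta>" if "T \<in> Y" "straight_tri T v b c" "pie_edge (closed_segment v b)" for T b c
      using that nonpie_pie_edge_buffer[of T "closed_segment v b"] straight_vertices(2)[OF that(2)]
      unfolding Y_def by blast
    show thesis
    proof (rule that[of "b1 - v"])
      show "b1 - v \<noteq> 0" using straight_tri_area2[OF T1(2)] by (auto simp: area2_def)
      fix T b c assume T: "T \<in> Y" "straight_tri T v b c" "pie_edge (closed_segment v b)"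
      have "T = T1"
        using buffer_unique[OF vVB buf[OF T] buf[OF T1]] straight_vertices(1)[OF T(2)]
          straight_vertices(1)[OF T1(2)] by simp
      then have "{v, b, c} = {v, b1, c1}" "v \<noteq> b" using straight_tri_unique T(2) T1(2)
         straight_tri_area2[OF T(2)] by (blast, auto simp: area2_def)
      moreover have "b \<noteq> c1" using Yrep[OF T1(1,2)] T1(3) T(3) by blast
      moreover from calculation(1) have "b \<in> {v, b1, c1}" by (metis insertI1 insertI2)
      ultimately have "b = b1" by simp
      show "closed_segment v b \<subseteq> {v + t *\<^sub>R (b1 - v) | t. t \<ge> 0}"
      proof
        fix x assume "x \<in> closed_segment v b"
        then obtain u where "0 \<le> u" "x = (1 - u) *\<^sub>R v + u *\<^sub>R b" unfolding in_segment by blast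
        then have "x = v + u *\<^sub>R (b1 - v)" using \<open>b = b1\<close> by (simp add: algebra_simps)
        then show "x \<in> {v + t *\<^sub>R (b1 - v) | t. t \<ge> 0}" using \<open>0 \<le> u\<close> by blast
      qed
    qed
  qed
  define R where "R = {v + t *\<^sub>R h | t. t \<ge> 0}"
  have finY: "finite Y" using fin unfolding Y_def by simp
  have "\<forall>T\<in>Y. \<exists>b c. straight_tri T v b c" unfolding Y_def by blast
  then obtain \<beta> \<gamma> where \<beta>\<gamma>: "\<And>T. T \<in> Y \<Longrightarrow> straight_tri T v (\<beta> T) (\<gamma> T)" by metis
  \<comment> \<open>The edges opposite to \<open>v\<close>; a small ball around \<open>v\<close>
    avoids them, so that inside it only edges ending at \<open>v\<close> have to be crossed.\<close>
  define K where "K = (\<Union>T\<in>Y. closed_segment (\<beta> T) (\<gamma> T))"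
  have "closed K" unfolding K_def using finY by (intro closed_UN) auto
  moreover have "v \<notin> K"
  proof
    assume "v \<in> K"
    then obtain T where T: "T \<in> Y" "v \<in> closed_segment (\<beta> T) (\<gamma> T)" unfolding K_def by blast
    have "area2 (\<beta> T) (\<gamma> T) v = 0" using area2_segment[OF T(2)] .
    moreover have "area2 (\<beta> T) (\<gamma> T) v = area2 v (\<beta> T) (\<gamma> T)" by (simp add: area2_def algebra_simps)
    ultimately show False using straight_tri_area2[OF \<beta>\<gamma>[OF T(1)]] by simp
  qed
  ultimately obtain \<epsilon> where \<epsilon>: "\<epsilon> > 0" "ball v \<epsilon> \<inter> K = {}"
    using open_Compl[of K] openE[of "- K" v] by (metis ComplI disjoint_eq_subset_Compl)
  define W where "W = ball v \<epsilon> - R"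
  define U where "U = \<Union>Y"
  have "closed T" if "T \<in> Y" for T using straight_tri_fat[OF \<beta>\<gamma>[OF that]] by blast
  then have clU: "closed U" unfolding U_def using finY by (intro closed_Union) auto
  have vR: "v \<in> R" unfolding R_def by (auto intro: exI[of _ 0])
  have conW: "connected W" unfolding W_def R_def using slit_ball_connected[OF h \<epsilon>(1)] .
  have off: "\<exists>z\<in>S. z \<notin> R" if "open S" "S \<noteq> {}" for S
    using open_not_on_line[of v "v + h" S] h that ray_on_line unfolding R_def by fastforce
  have edge: "y \<in> interior U" if T: "T \<in> Y" "straight_tri T v b c" and y: "y \<in> open_segment v b" "y \<notin> R" for T b c y
  proof -
    have TD: "T \<in> \<Delta>" using T(1) unfolding Y_def by blast
    have c: "is_cell D T v b c" using T(2) unfolding is_cell_def by blast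
    have "\<not> pie_edge (closed_segment v b)"
      using ray[OF T] y unfolding R_def by (auto simp: open_segment_def)
    moreover obtain T' where T': "T' \<in> \<Delta>" "T' \<noteq> T" "closed_segment v b \<in> straight_edges D T'"
      using edge_shared[OF TD c] by blast
    ultimately have T'p: "T' \<notin> pies D \<Delta>" unfolding pie_edge_def by blast
    obtain c' where "is_cell D T' v b c' \<or> is_cell D T' b v c'" using edge_cell[OF T'(3)] by blast
    then have "straight_tri T' v b c'"
      using nonpie_straight[OF T'(1) T'p] straight_tri_perm(1) by blast
    then have "T' \<in> Y" using Yin[OF T'(1) T'p] \<open>\<not> pie_edge (closed_segment v b)\<close> by blast
    then have "T \<union> T' \<subseteq> U" using T(1) unfolding U_def by blast
    then show ?thesis
      using shared_edge_nbhd[OF TD T'(1) T'(2)[symmetric] c T'(3) y(1)] interior_mono by blast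
  qed
  \<comment> \<open>Every point of the slit disc is interior to the union of these cells or outside
    of it. As the slit disc is connected, one of the two alternatives holds throughout.\<close>
  have "W \<subseteq> interior U \<union> - U"
  proof
    fix y assume y: "y \<in> W"
    show "y \<in> interior U \<union> - U"
    proof (cases "y \<in> U")
      case True
      then obtain T where T: "T \<in> Y" "y \<in> T" unfolding U_def by blast
      note st = \<beta>\<gamma>[OF T(1)]
      have yv: "y \<noteq> v" "y \<notin> R" using y vR unfolding W_def by auto
      have yK: "y \<notin> closed_segment (\<beta> T) (\<gamma> T)" using y \<epsilon>(2) T(1) unfolding W_def K_def by blast
      have "y \<in> interior T \<or> y \<in> frontier T"
        using T(2) straight_tri_fat[OF st] by (auto simp: frontier_def)
      then have "y \<in> interior U"
      proof
        assume "y \<in> interior T"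
        then show ?thesis using T(1) interior_mono[of T U] unfolding U_def by blast
      next
        assume "y \<in> frontier T"
        then consider "y \<in> closed_segment v (\<beta> T)" | "y \<in> closed_segment v (\<gamma> T)"
          using yK unfolding straight_tri_frontier[OF st] by (auto simp: closed_segment_commute)
        then show ?thesis
        proof cases
          case 1
          then have "y \<in> open_segment v (\<beta> T)" using yv yK by (auto simp: open_segment_def)
          from edge[OF T(1) st this yv(2)] show ?thesis .
        next
          case 2
          then have "y \<in> open_segment v (\<gamma> T)" using yv yK by (auto simp: open_segment_def)
          from edge[OF T(1) straight_tri_perm(2)[OF st] this yv(2)] show ?thesis .
        qed
      qed
      then show ?thesis by blast
    qed simp
  qed
  moreover have "interior U \<inter> W \<noteq> {}"
  proof -
    note fat = straight_tri_fat[OF T0(3)]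
    have "v \<in> T0" using T0(3) by (simp add: straight_tri_def hull_inc)
    then have "ball v \<epsilon> \<inter> interior T0 \<noteq> {}"
      using fat \<epsilon>(1) by (metis Int_commute centre_in_ball closure_iff_nhds_not_empty open_ball order_refl)
    then obtain z where "z \<in> ball v \<epsilon> \<inter> interior T0" "z \<notin> R"
      using off[of "ball v \<epsilon> \<inter> interior T0"] by (metis open_Int open_ball open_interior)
    moreover have "interior T0 \<subseteq> interior U" using T0Y unfolding U_def by (intro interior_mono) blast
    ultimately show ?thesis unfolding W_def by blast
  qed
  moreover have "interior U \<inter> - U \<inter> W = {}" using interior_subset by blast
  moreover have "open (- U)" using clU by (simp add: open_Compl)
  ultimately have "- U \<inter> W = {}"
    using connectedD[OF conW open_interior[of U], of "- U"] by (metis)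
  then have WU: "W \<subseteq> U" by blast
  \<comment> \<open>The union is closed and therefore also contains the slit. A full disc inside the
    closure of the domain makes \<open>v\<close> a point of the domain, which is absurd.\<close>
  have "ball v \<epsilon> \<subseteq> U"
  proof
    fix y assume y: "y \<in> ball v \<epsilon>"
    have "y \<in> closure W"
    proof (subst closure_iff_nhds_not_empty, intro allI impI)
      fix A S assume S: "S \<subseteq> A" "open S" "y \<in> S"
      then have "open (S \<inter> ball v \<epsilon>)" "S \<inter> ball v \<epsilon> \<noteq> {}" using y by auto
      from off[OF this] obtain z where "z \<in> S \<inter> ball v \<epsilon>" "z \<notin> R" by blast
      then show "W \<inter> A \<noteq> {}" using S(1) unfolding W_def by blast
    qed
    then show "y \<in> U" using WU clU closure_minimal by blast
  qed
  moreover have "U \<subseteq> closure \<Omega>" unfolding U_def Y_def using cell_subset by blast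
  ultimately have "ball v \<epsilon> \<subseteq> interior (closure \<Omega>)" by (intro interior_maximal) auto
  then have "v \<in> \<Omega>" using \<epsilon>(1) unfolding interior_closure_region by auto
  then show False using v closure_region(2) by blast
qed

lemma vertex_cases:
  assumes "T \<in> \<Delta>" "is_cell D T a b c" "x \<in> {a, b, c}" shows "x \<in> \<Omega> \<or> x \<in> \<Gamma>"
proof -
  have "x \<in> vertices D T" using cell_vertices[OF assms(2)] assms(3) by blast
  then have "x \<in> T" unfolding vertices_def using cell_vertex_in
    by (smt (verit) is_cell_def pie_swap straight_tri_perm insertE mem_Collect_eq singletonD)
  then show ?thesis using cell_subset[OF assms(1)] closure_region by blast
qed

lemma straight_cell: "straight_tri T a b c \<Longrightarrow> is_cell D T a b c" unfolding is_cell_def by blast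

lemma ordinary_vertex:
  assumes T: "T \<in> ordinary D \<Delta>" "straight_tri T a b c" shows "a \<in> \<Omega>"
proof (rule ccontr)
  assume "a \<notin> \<Omega>"
  note o = ordinary_straight[OF T(1)]
  have "a \<in> \<Gamma>" using vertex_cases[of T a b c a] o straight_cell[OF T(2)] \<open>a \<notin> \<Omega>\<close> by blast
  from fan[OF this _ _ T(2)] o have "pie_edge (closed_segment a b)" by blast
  then show False using ordinary_no_pie_edge[OF T(1)] straight_vertices(2)[OF T(2)] by blast
qed

lemma ordinary_vertices:
  assumes T: "T \<in> ordinary D \<Delta>" "straight_tri T a b c"
  shows "{a, b, c} \<subseteq> \<Omega>" "{a, b, c} \<subseteq> VI D \<Delta>"
proof -
  show "{a, b, c} \<subseteq> \<Omega>"
    using ordinary_vertex[OF T(1)] T(2) straight_tri_perm by blast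
  then show "{a, b, c} \<subseteq> VI D \<Delta>"
    using VI_I[of T a b c] ordinary_straight[OF T(1)] straight_cell[OF T(2)] by blast
qed

lemma ordinary_edge:
  assumes T: "T \<in> ordinary D \<Delta>" "straight_tri T a b c"
  shows "closed_segment a b \<in> EI0 D \<Delta>"
  using EI0_iff[of T a b c] ordinary_straight[OF T(1)] straight_cell[OF T(2)]
    ordinary_no_pie_edge[OF T(1)] cell_edge_in by blast

lemma pie_edge_at_vertex:
  assumes v: "v \<in> \<Gamma>" and pe: "pie_edge (closed_segment v a)" and a: "a \<noteq> v"
  obtains P j c C where "P \<in> pies D \<Delta>" "pie D P j a v c C" "a \<in> \<Omega>"
proof -
  obtain P where P: "P \<in> pies D \<Delta>" "closed_segment v a \<in> straight_edges D P"
    using pe unfolding pie_edge_def by blast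
  then obtain j a' b' c' C where p: "pie D P j a' b' c' C" "P \<in> \<Delta>" unfolding pies_def by blast
  have "closed_segment v a = closed_segment a' b' \<or> closed_segment v a = closed_segment a' c'"
    using P(2) pie_vertices(2)[OF p(1)] by blast
  then have "{v, a} = {a', b'} \<or> {v, a} = {a', c'}" by (simp add: closed_segment_eq)
  moreover have "a' \<in> \<Omega>" using pie_a_region(1)[OF p(2,1)] .
  moreover have "v \<noteq> a'" using v \<open>a' \<in> \<Omega>\<close> closure_region(2) by blast
  ultimately have a': "a = a'" and "v = b' \<or> v = c'" using a by (auto simp: doubleton_eq_iff)
  then have "(\<exists>c. pie D P j a v c C)" using p(1) pie_swap[OF p(1)] by blast
  then show thesis using that P(1) \<open>a' \<in> \<Omega>\<close> a' by blast
qed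

text \<open>The edge shared with a pie-shaped triangle ends at a boundary vertex \<open>v\<close>.
  By \<open>fan\<close> the other edge at \<open>v\<close> is a pie edge too, and pie edges lead
  from the boundary to interior vertices.\<close>

lemma buffer_structure:
  assumes B: "B \<in> buffers D \<Delta>"
  obtains v a1 a2 where "straight_tri B v a1 a2" "v \<in> \<Gamma>" "a1 \<in> \<Omega>" "a2 \<in> \<Omega>"
proof -
  note b = buffer_straight[OF B]
  then obtain x y z where st: "straight_tri B x y z" by blast
  obtain P e where P: "P \<in> pies D \<Delta>" "e \<in> straight_edges D P" "e \<in> straight_edges D B"
    using B unfolding buffers_def by blast
  obtain j a b' c C where p: "pie D P j a b' c C" "P \<in> \<Delta>" using P(1) unfolding pies_def by blast
  then obtain b where eb: "e = closed_segment a b" "b \<in> {b', c}" using P(2) pie_vertices(2)[OF p(1)] by blast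
  have bG: "b \<in> \<Gamma>" using eb(2) pie_a_region[OF p(2,1)] by blast
  obtain c' where "is_cell D B a b c' \<or> is_cell D B b a c'" using edge_cell P(3) eb by blast
  then have "straight_tri B b a c'"
    using nonpie_straight b straight_tri_perm(1) by blast
  then have s: "straight_tri B b a c'" .
  have "pie_edge (closed_segment b a)" "pie_edge (closed_segment b c')" using fan[OF bG _ _ s] b by blast+
  moreover have "a \<noteq> b" "c' \<noteq> b" using straight_tri_area2[OF s] by (auto simp: area2_def)
  ultimately have "a \<in> \<Omega>" "c' \<in> \<Omega>" using pie_edge_at_vertex[OF bG] by metis+
  then show thesis using that s bG by blast
qed

lemma buffer_pies:
  assumes B: "B \<in> buffers D \<Delta>" and s: "straight_tri B v a1 a2" and v: "v \<in> \<Gamma>"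
  shows "a1 \<in> \<Omega>" "a2 \<in> \<Omega>" "v \<in> VB D \<Delta>" "closed_segment a1 a2 \<in> EI0 D \<Delta>"
    "\<exists>P\<in>pies D \<Delta>. \<exists>j c C. pie D P j a1 v c C" "\<exists>P\<in>pies D \<Delta>. \<exists>j c C. pie D P j a2 v c C"
proof -
  note b = buffer_straight[OF B]
  have pe: "pie_edge (closed_segment v a1)" "pie_edge (closed_segment v a2)" using fan[OF v _ _ s] b by blast+
  have ne: "a1 \<noteq> v" "a2 \<noteq> v" "a1 \<noteq> a2" using straight_tri_area2[OF s] by (auto simp: area2_def)
  show a1: "a1 \<in> \<Omega>" using pie_edge_at_vertex[OF v pe(1) ne(1)] by metis
  show a2: "a2 \<in> \<Omega>" using pie_edge_at_vertex[OF v pe(2) ne(2)] by metis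
  show "\<exists>P\<in>pies D \<Delta>. \<exists>j c C. pie D P j a1 v c C" using pie_edge_at_vertex[OF v pe(1) ne(1)] by metis
  show "\<exists>P\<in>pies D \<Delta>. \<exists>j c C. pie D P j a2 v c C" using pie_edge_at_vertex[OF v pe(2) ne(2)] by metis
  show "v \<in> VB D \<Delta>" using VB_I[of B v a1 a2 v] b straight_cell[OF s] v by blast
  have "\<not> pie_edge (closed_segment a1 a2)"
  proof
    assume "pie_edge (closed_segment a1 a2)"
    then obtain P where P: "P \<in> pies D \<Delta>" "closed_segment a1 a2 \<in> straight_edges D P" unfolding pie_edge_def by blast
    then obtain j a b' c' C where p: "pie D P j a b' c' C" "P \<in> \<Delta>" unfolding pies_def by blast
    have "closed_segment a1 a2 = closed_segment a b' \<or> closed_segment a1 a2 = closed_segment a c'"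
      using P(2) pie_vertices(2)[OF p(1)] by blast
    then have "b' \<in> {a1, a2} \<or> c' \<in> {a1, a2}" by (auto simp: closed_segment_eq doubleton_eq_iff)
    then show False using pie_a_region[OF p(2,1)] a1 a2 closure_region(2) by blast
  qed
  moreover have "is_cell D B a1 a2 v" using s straight_tri_perm straight_cell by blast
  ultimately show "closed_segment a1 a2 \<in> EI0 D \<Delta>" using EI0_iff b by blast
qed

lemma pie_buffer:
  assumes P: "P \<in> pies D \<Delta>" and p: "pie D P j a b c C"
  obtains B z where "B \<in> buffers D \<Delta>" "straight_tri B b a z"
proof -
  have "closed_segment b a \<in> straight_edges D P"
    using pie_vertices(2)[OF p] by (simp add: closed_segment_commute)
  from pie_edge_buffer[OF P this] obtain B where B: "B \<in> buffers D \<Delta>" "closed_segment b a \<in> straight_edges D B" .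
  obtain z where "is_cell D B b a z \<or> is_cell D B a b z" using edge_cell[OF B(2)] by blast
  then have "straight_tri B b a z"
    using nonpie_straight buffer_straight[OF B(1)] straight_tri_perm(1) by blast
  then show thesis using that B(1) by blast
qed

lemma pie_edge_same:
  assumes "P \<in> pies D \<Delta>" "P' \<in> pies D \<Delta>" "pie D P j a v c C" "pie D P' j' a v c' C'"
  shows "P = P'"
  using pies_edges[OF assms(1,2)] pie_vertices(2)[OF assms(3)] pie_vertices(2)[OF assms(4)] by blast

text \<open>The interiors of cells and their open straight edges lie in the domain, which leaves
  only vertices and arcs for the boundary. This turns the boundary condition into a condition on
  single pieces.\<close>

lemma cell_region_boundary:
  assumes T: "T \<in> \<Delta>"
  shows "T \<in> ordinary D \<Delta> \<Longrightarrow> T \<inter> \<Gamma> = {}"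
    "T \<in> buffers D \<Delta> \<Longrightarrow> straight_tri T v a1 a2 \<Longrightarrow> v \<in> \<Gamma> \<Longrightarrow> T \<inter> \<Gamma> = {v}"
    "pie D T j a b c C \<Longrightarrow> T \<inter> \<Gamma> = C"
proof -
  have segs: "closed_segment a b \<inter> \<Gamma> \<subseteq> {a, b}" if "is_cell D T a b c" for a b c
  proof -
    have "closed_segment a b \<subseteq> open_segment a b \<union> {a, b}" by (auto simp: open_segment_def)
    then show ?thesis using open_edge_region[OF T that] closure_region(2) by blast
  qed
  have str: "T \<inter> \<Gamma> \<subseteq> {x, y, z}" if s: "straight_tri T x y z" for x y z
  proof -
    have "T \<subseteq> interior T \<union> frontier T" using closure_subset[of T] by (auto simp: frontier_def)
    then have "T \<inter> \<Gamma> \<subseteq> (closed_segment x y \<union> closed_segment y z \<union> closed_segment z x) \<inter> \<Gamma>"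
      using cell_interior[OF T] closure_region(2) straight_tri_frontier[OF s] by blast
    moreover have "is_cell D T x y z" "is_cell D T y z x" "is_cell D T z x y"
      using s straight_tri_perm straight_cell by blast+
    ultimately show ?thesis using segs by blast
  qed
  show "T \<inter> \<Gamma> = {}" if o: "T \<in> ordinary D \<Delta>"
  proof -
    obtain x y z where s: "straight_tri T x y z" using ordinary_straight[OF o] by blast
    show ?thesis using str[OF s] ordinary_vertices(1)[OF o s] closure_region(2) by blast
  qed
  show "T \<inter> \<Gamma> = {v}" if B: "T \<in> buffers D \<Delta>" "straight_tri T v a1 a2" "v \<in> \<Gamma>"
  proof -
    have "v \<in> T" using cell_vertex_in[OF straight_cell[OF B(2)]] by blast
    then show ?thesis using str[OF B(2)] buffer_pies(1,2)[OF B] closure_region(2) B(3) by blast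
  qed
  show "T \<inter> \<Gamma> = C" if p: "pie D T j a b c C"
  proof
    show "C \<subseteq> T \<inter> \<Gamma>" using pie_C(1)[OF p] pie_T[OF p] by (auto simp: pie_boundary_def)
    have "T \<inter> \<Gamma> \<subseteq> pie_boundary a b c C"
      using pie_topology(3)[OF p] pie_T[OF p] cell_interior[OF T] closure_region(2) by blast
    moreover have "closed_segment a b \<inter> \<Gamma> \<subseteq> C" "closed_segment a c \<inter> \<Gamma> \<subseteq> C"
      using segs[OF pie_is_cell[OF p]] segs[OF pie_is_cell[OF pie_swap[OF p]]] pie_C(4,5)[OF p]
        pie_a_region(1)[OF T p] closure_region(2) by blast+
    ultimately show "T \<inter> \<Gamma> \<subseteq> C" unfolding pie_boundary_def by blast
  qed
qed

end

section \<open>Tangents of the boundary and normals of the conics at a vertex\<close>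

definition cross2 :: "point \<Rightarrow> point \<Rightarrow> real" where
  "cross2 x y = x $ 1 * y $ 2 - x $ 2 * y $ 1"

lemma cross2_swap: "cross2 x y = - cross2 y x"
  by (simp add: cross2_def algebra_simps)

text \<open>In the plane a nonzero vector orthogonal to \<open>\<tau>\<close> is a nonzero multiple
  of \<open>\<tau>\<close> turned by a right angle, and turning both vectors does not change the
  determinant.\<close>

lemma cross2_perp:
  assumes "g \<bullet> \<tau> = 0" "g' \<bullet> \<tau>' = 0" "\<tau> \<noteq> 0" "\<tau>' \<noteq> 0" "g \<noteq> 0" "g' \<noteq> 0"
  shows "cross2 g g' = 0 \<longleftrightarrow> cross2 \<tau> \<tau>' = 0"
proof -
  have perp: "\<exists>k. k \<noteq> 0 \<and> g $ 1 = - k * \<tau> $ 2 \<and> g $ 2 = k * \<tau> $ 1"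
    if g: "g \<bullet> \<tau> = 0" "\<tau> \<noteq> 0" "g \<noteq> 0" for g \<tau> :: point
  proof -
    have dot: "g $ 1 * \<tau> $ 1 + g $ 2 * \<tau> $ 2 = 0" using g(1) by (simp add: inner_vec_def sum_2)
    have "\<tau> $ 1 \<noteq> 0 \<or> \<tau> $ 2 \<noteq> 0" using g(2) by (auto simp: vec_eq_iff forall_2)
    then obtain k where k: "g $ 1 = - k * \<tau> $ 2" "g $ 2 = k * \<tau> $ 1"
    proof
      assume n: "\<tau> $ 1 \<noteq> 0"
      show thesis
        by (rule that[of "g $ 2 / \<tau> $ 1"]) (use n dot in \<open>simp_all add: field_simps eq_neg_iff_add_eq_0\<close>)
    next
      assume n: "\<tau> $ 2 \<noteq> 0"
      show thesis
        by (rule that[of "- g $ 1 / \<tau> $ 2"]) (use n dot in \<open>simp_all add: field_simps eq_neg_iff_add_eq_0\<close>)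
    qed
    moreover have "k \<noteq> 0" using k g(3) by (auto simp: vec_eq_iff forall_2)
    ultimately show ?thesis by blast
  qed
  obtain k where k: "k \<noteq> 0" "g $ 1 = - k * \<tau> $ 2" "g $ 2 = k * \<tau> $ 1" using perp[OF assms(1,3,5)] by blast
  obtain k' where k': "k' \<noteq> 0" "g' $ 1 = - k' * \<tau>' $ 2" "g' $ 2 = k' * \<tau>' $ 1"
    using perp[OF assms(2,4,6)] by blast
  have "cross2 g g' = k * k' * cross2 \<tau> \<tau>'" unfolding cross2_def k k' by (simp add: algebra_simps)
  then show ?thesis using k(1) k'(1) by simp
qed

lemma cross2_zero_scale:
  assumes "cross2 g g' = 0" "g' \<noteq> 0" obtains \<mu> where "g = \<mu> *\<^sub>R g'"
proof -
  have c: "g $ 1 * g' $ 2 = g $ 2 * g' $ 1" using assms(1) by (simp add: cross2_def)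
  have "g' $ 1 \<noteq> 0 \<or> g' $ 2 \<noteq> 0" using assms(2) by (auto simp: vec_eq_iff forall_2)
  then show thesis
  proof
    assume n: "g' $ 1 \<noteq> 0"
    show thesis by (rule that[of "g $ 1 / g' $ 1"]) (use n c in \<open>simp add: vec_eq_iff forall_2 field_simps\<close>)
  next
    assume n: "g' $ 2 \<noteq> 0"
    show thesis by (rule that[of "g $ 2 / g' $ 2"]) (use n c in \<open>simp add: vec_eq_iff forall_2 field_simps\<close>)
  qed
qed

lemma cross2_nonzero_indep:
  assumes "cross2 g g' \<noteq> 0" "x *\<^sub>R g = y *\<^sub>R g'" shows "x = 0" "y = 0"
proof -
  have "x * cross2 g g' = cross2 (x *\<^sub>R g) g'" by (simp add: cross2_def algebra_simps)
  also have "\<dots> = 0" unfolding assms(2) by (simp add: cross2_def)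
  finally show "x = 0" using assms(1) by simp
  have "y * cross2 g g' = cross2 g (y *\<^sub>R g')" by (simp add: cross2_def algebra_simps)
  also have "\<dots> = 0" unfolding assms(2)[symmetric] by (simp add: cross2_def)
  finally show "y = 0" using assms(1) by simp
qed

lemma cplx_quotient_real:
  assumes "y \<noteq> 0" shows "cplx (- x) / cplx y \<in> \<real> \<longleftrightarrow> cross2 x y = 0"
proof -
  have y: "y $ 1 \<noteq> 0 \<or> y $ 2 \<noteq> 0" using assms by (auto simp: vec_eq_iff forall_2)
  then have n: "(y $ 1)\<^sup>2 + (y $ 2)\<^sup>2 \<noteq> 0" by (auto simp: sum_power2_eq_zero_iff)
  have "cplx (- x) / cplx y \<in> \<real> \<longleftrightarrow> Im (cplx (- x) / cplx y) = 0" by (simp add: complex_is_Real_iff)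
  also have "Im (cplx (- x) / cplx y) = cross2 x y / ((y $ 1)\<^sup>2 + (y $ 2)\<^sup>2)"
    by (simp add: Im_divide cplx_def cross2_def algebra_simps)
  finally show ?thesis using y by auto
qed

context pie_triangulation
begin

text \<open>The conic polynomial is constant along its arc. Differentiating within the parameter
  interval covers the one-sided tangents at corners as well.\<close>

lemma grad_tangent:
  assumes j: "j < nsides D" and u: "u \<in> {knot D j .. knot D (Suc j)}"
  shows "grad (qpol D j) (bdry D u) \<bullet> tangent D j u = 0"
proof -
  let ?I = "{knot D j .. knot D (Suc j)}" and ?q = "qpol D j"
  obtain d where q: "?q \<in> Pd d" using side_facts(4)[OF j] by auto
  have "(bdry D has_derivative (\<lambda>h. h *\<^sub>R tangent D j u)) (at u within ?I)"
    using side_facts(1)[OF j u] by (simp add: has_vector_derivative_def)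
  from has_derivative_compose[OF this Pd_grad[OF q]]
  have "((\<lambda>u. ?q (bdry D u)) has_vector_derivative (grad ?q (bdry D u) \<bullet> tangent D j u)) (at u within ?I)"
    by (simp add: has_vector_derivative_def)
  moreover have "((\<lambda>u. ?q (bdry D u)) has_vector_derivative 0) (at u within ?I)"
    by (rule has_vector_derivative_transform[OF u _ has_vector_derivative_const[of 0]])
      (use q_zero_arc[OF j] in auto)
  ultimately show ?thesis
    using vector_derivative_unique_within_closed_interval[OF knots(3)[OF j], unfolded cbox_interval, OF u]
    by blast
qed

lemma knot_strict: "i < j \<Longrightarrow> j \<le> nsides D \<Longrightarrow> knot D i < knot D j"
  using knots(3)[of i] knot_mono[of "Suc i" j] by simp

lemma pie_at_vertex:
  assumes p: "pie D P j a v c C"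
  shows "grad (qpol D j) v \<noteq> 0" "j < nsides D"
    "\<exists>s t. 0 \<le> s \<and> knot D j \<le> s \<and> s < t \<and> t \<le> knot D (Suc j) \<and> t \<le> 1 \<and> C = bdry D ` {s..t} \<and>
       (v = bdry D s \<or> v = bdry D t)"
proof -
  have "grad (qpol D j) v \<bullet> (a - v) \<noteq> 0" using p unfolding pie_def by blast
  then show "grad (qpol D j) v \<noteq> 0" by auto
  show "j < nsides D" using p unfolding pie_def by blast
  show "\<exists>s t. 0 \<le> s \<and> knot D j \<le> s \<and> s < t \<and> t \<le> knot D (Suc j) \<and> t \<le> 1 \<and> C = bdry D ` {s..t} \<and>
       (v = bdry D s \<or> v = bdry D t)"
    by (rule pie_param[OF p]) (metis doubleton_eq_iff)
qed

text \<open>A corner is the start of its own arc or the end of the preceding one. The wrap-around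
  comes from corner 0, which is reached at both parameters 0 and 1, the only failure of
  injectivity.\<close>

lemma corner_param:
  assumes i: "i < nsides D" and j: "j < nsides D" and u: "u \<in> {knot D j .. knot D (Suc j)}"
    and eq: "bdry D u = corner D i"
  shows "(j = i \<and> u = knot D i) \<or> (j = (i + nsides D - 1) mod nsides D \<and> u = knot D (Suc j))"
proof -
  have ki: "knot D i < 1" using knot_strict[of i "nsides D"] i knots(2) by simp
  have "u \<in> {0..1}" "knot D i \<in> {0..1}"
    using u knot_range[of j] knot_range[of "Suc j"] knot_range[of i] i j by auto
  from bdry_inj[OF this] eq have "u = knot D i \<or> u = 1 \<and> knot D i = 0" using ki by (auto simp: corner_def)
  then show ?thesis
  proof
    assume u': "u = knot D i"
    have "\<not> i < j" using knot_strict[of i j] j u u' by auto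
    moreover have "\<not> Suc j < i" using knot_strict[of "Suc j" i] i u u' by auto
    ultimately have "i = j \<or> i = Suc j" by linarith
    then show ?thesis using u' j by auto
  next
    assume u': "u = 1 \<and> knot D i = 0"
    have i0: "i = 0" using knot_strict[of 0 i] i knots(1) u' by (cases i) auto
    have "Suc j = nsides D"
    proof (rule ccontr)
      assume "Suc j \<noteq> nsides D"
      then have "knot D (Suc j) < 1" using knot_strict[of "Suc j" "nsides D"] j knots(2) by simp
      then show False using u u' by simp
    qed
    then show ?thesis using i0 u' knots(2) j by auto
  qed
qed

text \<open>Parallel tangents mean a real quotient, hence an angle of 0 or \<open>pi\<close>; the
  angle 0, a cusp, is excluded by assumption.\<close>

lemma tangents_at_corner:
  assumes i: "i < nsides D"
  defines "p \<equiv> (i + nsides D - 1) mod nsides D"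
  shows "internal_angle D i = pi \<longleftrightarrow> cross2 (tangent D p (knot D (Suc p))) (tangent D i (knot D i)) = 0"
proof -
  let ?z = "cplx (- tangent D p (knot D (Suc p))) / cplx (tangent D i (knot D i))"
  have "tangent D i (knot D i) \<noteq> 0" using side_facts(2)[OF i] knots(3)[OF i] by simp
  note real = cplx_quotient_real[OF this, of "tangent D p (knot D (Suc p))"]
  have ang: "internal_angle D i = Arg2pi ?z" unfolding internal_angle_def p_def Let_def ..
  have "Arg2pi ?z > 0" using side_facts(3)[OF i] ang by simp
  then have "\<not> (?z \<in> \<real> \<and> 0 \<le> Re ?z)" using Arg2pi_eq_0[of ?z] by simp
  then show ?thesis unfolding ang Arg2pi_eq_pi real[symmetric] by auto
qed

text \<open>Away from corners both pie-shaped triangles have their arcs on the same side of the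
  polygon, so the two gradients coincide. At a corner with angle \<open>pi\<close> the two arcs have
  parallel tangents and therefore parallel normals.\<close>

lemma pies_at_VB1:
  assumes v: "v \<in> VB1 D \<Delta>" and p: "pie D P j a v c C" and p': "pie D P' j' a' v c' C'"
  shows "cross2 (grad (qpol D j) v) (grad (qpol D j') v) = 0"
proof -
  obtain s t where st: "0 \<le> s" "knot D j \<le> s" "s < t" "t \<le> knot D (Suc j)" "t \<le> 1"
    "v = bdry D s \<or> v = bdry D t" using pie_at_vertex(3)[OF p] by blast
  then have "s \<in> {knot D j .. knot D (Suc j)}" "t \<in> {knot D j .. knot D (Suc j)}" by auto
  with st(6) obtain u where u: "u \<in> {knot D j .. knot D (Suc j)}" "v = bdry D u" by blast
  obtain s' t' where st': "0 \<le> s'" "knot D j' \<le> s'" "s' < t'" "t' \<le> knot D (Suc j')" "t' \<le> 1"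
    "v = bdry D s' \<or> v = bdry D t'" using pie_at_vertex(3)[OF p'] by blast
  then have "s' \<in> {knot D j' .. knot D (Suc j')}" "t' \<in> {knot D j' .. knot D (Suc j')}" by auto
  with st'(6) obtain u' where u': "u' \<in> {knot D j' .. knot D (Suc j')}" "v = bdry D u'" by blast
  have j: "j < nsides D" "j' < nsides D" using pie_at_vertex(2)[OF p] pie_at_vertex(2)[OF p'] .
  from v consider "v \<notin> corners D" | i where "i < nsides D" "v = corner D i" "internal_angle D i = pi"
    unfolding VB1_def by blast
  then show ?thesis
  proof cases
    case 1
    have inner: "knot D j < u \<and> u < knot D (Suc j)"
      if "u \<in> {knot D j .. knot D (Suc j)}" "v = bdry D u" "j < nsides D" for u j
    proof -
      have "u \<noteq> knot D j" using that 1 by (auto simp: corners_def corner_def)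
      moreover have "u \<noteq> knot D (Suc j)"
      proof
        assume eq: "u = knot D (Suc j)"
        show False
        proof (cases "Suc j < nsides D")
          case True
          then show ?thesis using 1 that(2) eq by (auto simp: corners_def corner_def)
        next
          case False
          then have "Suc j = nsides D" using that(3) by simp
          then have "v = bdry D 1" using that(2) eq knots(2) by simp
          also have "\<dots> = corner D 0" using loop(2) knots(1) by (simp add: pathfinish_def pathstart_def corner_def)
          finally show False using 1 that(3) by (auto simp: corners_def)
        qed
      qed
      ultimately show ?thesis using that(1) by auto
    qed
    note I = inner[OF u j(1)] inner[OF u' j(2)]
    have r: "0 \<le> knot D j" "knot D (Suc j) \<le> 1" "0 \<le> knot D j'" "knot D (Suc j') \<le> 1"
      using knot_range[of j] knot_range[of "Suc j"] knot_range[of j'] knot_range[of "Suc j'"] j by auto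
    then have "u = u'" using bdry_inj[of u u'] u u' I by auto
    have "j = j'"
    proof (rule linorder_cases[of j j'])
      assume "j < j'"
      then have "knot D (Suc j) \<le> knot D j'" using j by (intro knot_mono) auto
      then show ?thesis using I \<open>u = u'\<close> by auto
    next
      assume "j' < j"
      then have "knot D (Suc j') \<le> knot D j" using j by (intro knot_mono) auto
      then show ?thesis using I \<open>u = u'\<close> by auto
    qed
    then show ?thesis by (simp add: cross2_def)
  next
    case 2
    let ?p = "(i + nsides D - 1) mod nsides D"
    have par: "cross2 (tangent D ?p (knot D (Suc ?p))) (tangent D i (knot D i)) = 0"
      using tangents_at_corner[OF 2(1)] 2(3) by simp
    then have par': "cross2 (tangent D i (knot D i)) (tangent D ?p (knot D (Suc ?p))) = 0"
      using cross2_swap[of "tangent D i (knot D i)" "tangent D ?p (knot D (Suc ?p))"] by simp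
    have "cross2 (tangent D j u) (tangent D j' u') = 0"
      using corner_param[OF 2(1) j(1) u(1)] corner_param[OF 2(1) j(2) u'(1)] u(2) u'(2) 2(2) par par'
      by (auto simp: cross2_def)
    then show ?thesis
      using cross2_perp[OF grad_tangent[OF j(1) u(1)] grad_tangent[OF j(2) u'(1)]
          side_facts(2)[OF j(1) u(1)] side_facts(2)[OF j(2) u'(1)]]
        pie_at_vertex(1)[OF p] pie_at_vertex(1)[OF p'] u(2) u'(2) by simp
  qed
qed

text \<open>Two different pie-shaped triangles at a corner have their arcs before and after it.
  Hence their normals are independent, like the two tangents.\<close>

lemma pies_at_corner:
  assumes v: "v \<in> VB D \<Delta>" "v \<notin> VB1 D \<Delta>" and PP: "P \<in> pies D \<Delta>" "P' \<in> pies D \<Delta>" "P \<noteq> P'"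
    and p: "pie D P j a v c C" and p': "pie D P' j' a' v c' C'"
  shows "cross2 (grad (qpol D j) v) (grad (qpol D j') v) \<noteq> 0"
proof -
  obtain i where i: "i < nsides D" "v = corner D i" "internal_angle D i \<noteq> pi"
    using v unfolding VB1_def corners_def by blast
  let ?p = "(i + nsides D - 1) mod nsides D"
  have ind: "cross2 (tangent D ?p (knot D (Suc ?p))) (tangent D i (knot D i)) \<noteq> 0"
    using tangents_at_corner[OF i(1)] i(3) by simp
  have j: "j < nsides D" "j' < nsides D" using pie_at_vertex(2)[OF p] pie_at_vertex(2)[OF p'] .
  have "P \<inter> P' = {} \<or> (\<exists>x. P \<inter> P' = {x})"
    using cell_Int[of P P'] PP pies_edges[OF PP] unfolding pies_def by blast
  then have fin: "finite (P \<inter> P')" by auto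
  have sub: "C \<subseteq> P" "C' \<subseteq> P'" using pie_T[OF p] pie_T[OF p'] unfolding pie_boundary_def by blast+
  \<comment> \<open>Two pie-shaped triangles share no edge and meet in at most one point, so their
    arcs cannot have a parameter interval in common.\<close>
  have overlap: False if "0 \<le> l" "l < m" "m \<le> 1" "bdry D ` {l..m} \<subseteq> C \<inter> C'" for l m
  proof -
    have "inj_on (bdry D) {l<..<m}"
    proof (rule inj_onI)
      fix u v assume uv: "u \<in> {l<..<m}" "v \<in> {l<..<m}" "bdry D u = bdry D v"
      then have "u \<in> {0..1}" "v \<in> {0..1}" using that by auto
      from bdry_inj[OF this uv(3)] show "u = v" using uv that by auto
    qed
    moreover have "bdry D ` {l<..<m} \<subseteq> P \<inter> P'" using that(4) sub by force
    then have "finite (bdry D ` {l<..<m})" using fin finite_subset by blast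
    ultimately have "finite {l<..<m}" using finite_imageD by blast
    then show False using that(2) by (simp add: infinite_Ioo)
  qed
  obtain s t where st: "0 \<le> s" "knot D j \<le> s" "s < t" "t \<le> knot D (Suc j)" "t \<le> 1" "C = bdry D ` {s..t}"
    "v = bdry D s \<or> v = bdry D t" using pie_at_vertex(3)[OF p] by blast
  obtain s' t' where st': "0 \<le> s'" "knot D j' \<le> s'" "s' < t'" "t' \<le> knot D (Suc j')" "t' \<le> 1"
    "C' = bdry D ` {s'..t'}" "v = bdry D s' \<or> v = bdry D t'" using pie_at_vertex(3)[OF p'] by blast
  have type: "(j = i \<and> s = knot D i \<and> v = bdry D s) \<or> (j = ?p \<and> t = knot D (Suc j) \<and> v = bdry D t)"
    if "j < nsides D" "knot D j \<le> s" "s < t" "t \<le> knot D (Suc j)" "v = bdry D s \<or> v = bdry D t" for j s t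
    using that(5)
  proof
    assume e: "v = bdry D s"
    have "s \<in> {knot D j .. knot D (Suc j)}" using that by simp
    from corner_param[OF i(1) that(1) this] e i(2) that(3,4) show ?thesis by auto
  next
    assume e: "v = bdry D t"
    have "t \<in> {knot D j .. knot D (Suc j)}" using that by simp
    from corner_param[OF i(1) that(1) this] e i(2) that(2,3) show ?thesis by auto
  qed
  have case1: "cross2 (tangent D j u) (tangent D j' u') \<noteq> 0 \<Longrightarrow> v = bdry D u \<Longrightarrow> v = bdry D u' \<Longrightarrow>
     u \<in> {knot D j .. knot D (Suc j)} \<Longrightarrow> u' \<in> {knot D j' .. knot D (Suc j')} \<Longrightarrow> ?thesis" for u u'
    using cross2_perp[OF grad_tangent[OF j(1), of u] grad_tangent[OF j(2), of u']
        side_facts(2)[OF j(1), of u] side_facts(2)[OF j(2), of u']]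
      pie_at_vertex(1)[OF p] pie_at_vertex(1)[OF p'] by simp
  from type[OF j(1) st(2,3,4,7)] type[OF j(2) st'(2,3,4,7)]
  consider "j = i" "j' = i" "s = s'" | "j = ?p" "j' = ?p" "t = t'"
    | "j = i" "s = knot D i" "v = bdry D s" "j' = ?p" "t' = knot D (Suc j')" "v = bdry D t'"
    | "j' = i" "s' = knot D i" "v = bdry D s'" "j = ?p" "t = knot D (Suc j)" "v = bdry D t"
    by (elim disjE conjE) simp_all
  then show ?thesis
  proof cases
    case 1
    have False by (rule overlap[of s "min t t'"]) (use 1 st st' in auto)
    then show ?thesis ..
  next
    case 2
    have False by (rule overlap[of "max s s'" t]) (use 2 st st' in auto)
    then show ?thesis ..
  next
    case 3
    have "cross2 (tangent D j s) (tangent D j' t') \<noteq> 0"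
      using ind 3(1,2,4,5) cross2_swap[of "tangent D j s" "tangent D j' t'"] by simp
    then show ?thesis by (rule case1[OF _ 3(3,6)]) (use st st' in auto)
  next
    case 4
    have "cross2 (tangent D j t) (tangent D j' s') \<noteq> 0" using ind 4 by simp
    then show ?thesis by (rule case1[OF _ 4(6,3)]) (use st st' in auto)
  qed
qed

end

section \<open>Splines on single cells\<close>

lemma grad_cong_open:
  assumes "open U" "x \<in> U" "\<And>y. y \<in> U \<Longrightarrow> f y = g y" "g differentiable (at x)"
  shows "grad f x = grad g x"
proof -
  have "(f has_derivative (\<lambda>h. grad g x \<bullet> h)) (at x)"
    by (rule has_derivative_transform_within_open[OF differentiable_grad[OF assms(4)] assms(1,2)])
      (simp add: assms(3))
  then show ?thesis by (rule grad_eqI)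
qed

lemma derivative_along_zero:
  fixes F :: "point \<Rightarrow> point"
  assumes "(F has_derivative F') (at v)" "\<And>t. 0 \<le> t \<Longrightarrow> t < 1 \<Longrightarrow> F (v + t *\<^sub>R h) = 0"
  shows "F' h = 0"
proof -
  let ?I = "{0..1/2::real}"
  have "((\<lambda>t. v + t *\<^sub>R h) has_derivative (\<lambda>t. t *\<^sub>R h)) (at 0 within ?I)"
    by (auto intro!: derivative_eq_intros)
  from has_derivative_compose[OF this, of F F'] assms(1)
  have "((\<lambda>t. F (v + t *\<^sub>R h)) has_derivative (\<lambda>t. F' (t *\<^sub>R h))) (at 0 within ?I)" by simp
  then have "((\<lambda>t. F (v + t *\<^sub>R h)) has_vector_derivative F' h) (at 0 within ?I)"
    unfolding has_vector_derivative_def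
    using linear_scale[OF has_derivative_linear[OF assms(1)]] by (simp add: scaleR_conv_of_real[symmetric])
  moreover have "((\<lambda>t. F (v + t *\<^sub>R h)) has_vector_derivative 0) (at 0 within ?I)"
    by (rule has_vector_derivative_transform[OF _ _ has_vector_derivative_const[of 0]]) (use assms(2) in auto)
  ultimately show ?thesis
    using vector_derivative_unique_within_closed_interval[of 0 "1/2", unfolded cbox_interval, of 0] by auto
qed

lemma linear_zero_two:
  fixes L :: "point \<Rightarrow> point"
  assumes "linear L" "L (b - a) = 0" "L (c - a) = 0" "area2 a b c \<noteq> 0"
  shows "L x = 0"
proof -
  have "x = (a + x) - a" by simp
  also have "a + x = bary a b c (a + x) *\<^sub>R a + bary b a c (a + x) *\<^sub>R b + bary c a b (a + x) *\<^sub>R c"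
    using bary_expand[OF assms(4)] .
  also have "\<dots> - a = bary b a c (a + x) *\<^sub>R (b - a) + bary c a b (a + x) *\<^sub>R (c - a)
      + (bary a b c (a + x) + bary b a c (a + x) + bary c a b (a + x) - 1) *\<^sub>R a"
    by (simp add: algebra_simps)
  finally have "x = bary b a c (a + x) *\<^sub>R (b - a) + bary c a b (a + x) *\<^sub>R (c - a)"
    using bary_sum[OF assms(4), of "a + x"] by simp
  then have "L x = L (bary b a c (a + x) *\<^sub>R (b - a) + bary c a b (a + x) *\<^sub>R (c - a))" by (rule arg_cong)
  also have "\<dots> = 0" using assms by (simp add: linear_add linear_scale)
  finally show ?thesis .
qed

text \<open>Uniqueness needs an open part of the cell on which the weight has no zero: there the
  weight cancels, and polynomials that agree on an open set are equal.\<close>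

lemma bb_coeffs_eq:
  assumes nc: "area2 a b c \<noteq> 0" and p: "p \<in> Pd d" and s: "\<And>x. x \<in> T \<Longrightarrow> s x = w x * p x"
    and U: "open U" "U \<noteq> {}" "U \<subseteq> T" "\<And>x. x \<in> U \<Longrightarrow> w x \<noteq> 0"
  shows "bb_coeffs w d T a b c s = bcoef d a b c p"
  unfolding bb_coeffs_def
proof (rule the_equality)
  have "(\<Sum>\<alpha>\<in>indices d. bcoef d a b c p \<alpha> * bernstein d a b c \<alpha> x) = p x" for x
    using fun_cong[OF bbpoly_bcoef[OF nc p], of x] by (simp add: bbpoly_def)
  then show "(\<forall>\<alpha>. \<alpha> \<notin> indices d \<longrightarrow> bcoef d a b c p \<alpha> = 0) \<and>
     (\<forall>x\<in>T. s x = w x * (\<Sum>\<alpha>\<in>indices d. bcoef d a b c p \<alpha> * bernstein d a b c \<alpha> x))"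
    using s bcoef_outside[OF nc p] by simp
next
  fix coef assume c: "(\<forall>\<alpha>. \<alpha> \<notin> indices d \<longrightarrow> coef \<alpha> = 0) \<and>
     (\<forall>x\<in>T. s x = w x * (\<Sum>\<alpha>\<in>indices d. coef \<alpha> * bernstein d a b c \<alpha> x))"
  have "p = bbpoly d a b c coef"
  proof (rule Pd_eq_open[OF p bbpoly_Pd U(1,2)])
    fix x assume x: "x \<in> U"
    then have "w x * p x = w x * bbpoly d a b c coef x" using c s U(3) by (auto simp: bbpoly_def)
    then show "p x = bbpoly d a b c coef x" using U(4)[OF x] by simp
  qed
  then show "coef = bcoef d a b c p" using bcoef_eqI[OF nc, of p d coef] c by auto
qed

context pie_triangulation
begin

abbreviation "S \<equiv> spline_space D \<Delta>"

lemma in_spline: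
  assumes "s \<in> S"
  shows "\<And>x. x \<in> \<Omega> \<Longrightarrow> s differentiable (at x)" "continuous_on \<Omega> (grad s)"
    "\<And>v. v \<in> VI D \<Delta> \<Longrightarrow> grad s differentiable (at v)" "\<And>x. x \<in> \<Gamma> \<Longrightarrow> s x = 0"
    "\<And>x. x \<notin> closure \<Omega> \<Longrightarrow> s x = 0"
    "\<And>T. T \<in> ordinary D \<Delta> \<Longrightarrow> \<exists>p\<in>Pd 5. \<forall>x\<in>T. s x = p x"
    "\<And>T. T \<in> pies D \<Delta> \<union> buffers D \<Delta> \<Longrightarrow> \<exists>p\<in>Pd 6. \<forall>x\<in>T. s x = p x"
  using assms unfolding spline_space_def by auto

lemma cell_kinds: "T \<in> \<Delta> \<Longrightarrow> T \<in> ordinary D \<Delta> \<or> T \<in> pies D \<Delta> \<or> T \<in> buffers D \<Delta>"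
  unfolding ordinary_def by blast

lemma spline_poly:
  assumes "s \<in> S" "T \<in> \<Delta>" obtains p where "p \<in> Pd 6" "\<And>x. x \<in> T \<Longrightarrow> s x = p x"
proof -
  have "\<exists>p\<in>Pd 6. \<forall>x\<in>T. s x = p x"
    using in_spline(6,7)[OF assms(1), of T] cell_kinds[OF assms(2)] Pd_mono[of _ 5 6] by auto
  then show thesis using that by blast
qed

text \<open>Cells are closures of their interiors, where the gradients agree trivially; continuity
  of both gradients carries this to edges and vertices inside the domain.\<close>

lemma grad_on_cell:
  assumes s: "s \<in> S" and T: "T \<in> \<Delta>" and p: "p \<in> Pd d" "\<And>x. x \<in> T \<Longrightarrow> s x = p x"
    and x: "x \<in> T" "x \<in> \<Omega>"
  shows "grad s x = grad p x"
proof -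
  obtain a b c where "is_cell D T a b c" using cells[OF T] by blast
  then have "x \<in> closure (interior T)" using cell_fat(2) x(1) by simp
  then obtain X where X: "\<And>n. X n \<in> interior T" "X \<longlonglongrightarrow> x" by (auto simp: closure_sequential)
  have eq: "grad s y = grad p y" if "y \<in> interior T" for y
    by (rule grad_cong_open[OF open_interior that _ Pd_differentiable[OF p(1)]])
      (use p(2) interior_subset in blast)
  have "continuous_on \<Omega> (grad p)"
    by (intro continuous_at_imp_continuous_on ballI differentiable_imp_continuous_within
        Pd_grad_differentiable[OF p(1)])
  then have "(\<lambda>n. grad p (X n)) \<longlonglongrightarrow> grad p x"
    using X cell_interior[OF T] x(2) by (auto simp: continuous_on_sequentially o_def)
  moreover have "(\<lambda>n. grad s (X n)) \<longlonglongrightarrow> grad s x"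
    using in_spline(2)[OF s] X cell_interior[OF T] x(2) by (auto simp: continuous_on_sequentially o_def)
  then have "(\<lambda>n. grad p (X n)) \<longlonglongrightarrow> grad s x" using eq X(1) by simp
  ultimately show ?thesis using LIMSEQ_unique by blast
qed

lemma van_2_common:
  assumes s: "s \<in> S" and T: "T \<in> \<Delta>" "T' \<in> \<Delta>" and p: "p \<in> Pd d" "\<And>x. x \<in> T \<Longrightarrow> s x = p x"
    and p': "p' \<in> Pd d" "\<And>x. x \<in> T' \<Longrightarrow> s x = p' x" and x: "x \<in> T" "x \<in> T'" "x \<in> \<Omega>"
  shows "van 2 (\<lambda>x. p x - p' x) x"
  unfolding van_2_iff[OF Pd_diff[OF p(1) p'(1)]]
    grad_diff[OF Pd_differentiable[OF p(1)] Pd_differentiable[OF p'(1)]]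
  using p(2)[OF x(1)] p'(2)[OF x(2)] grad_on_cell[OF s T(1) p x(1,3)] grad_on_cell[OF s T(2) p' x(2,3)]
  by simp

lemma interior_vertex_cell:
  assumes T: "T \<in> \<Delta>" and v: "v \<in> vertices D T" "v \<in> \<Omega>"
  obtains b c where "is_cell D T v b c"
proof -
  obtain x y z where c: "is_cell D T x y z" "v \<in> {x, y, z}" using v(1) unfolding vertices_def by blast
  show thesis
  proof (cases "\<exists>j C. pie D T j x y z C")
    case True
    then obtain j C where p: "pie D T j x y z C" by blast
    then have "v = x" using pie_a_region[OF T p] c(2) v(2) closure_region(2) by blast
    then show thesis using that c(1) by blast
  next
    case False
    then have "straight_tri T x y z" using c(1) unfolding is_cell_def by blast
    then have "\<exists>b c. straight_tri T v b c" using c(2) straight_tri_perm by (metis insertE singletonD)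
    then show thesis using that straight_cell by blast
  qed
qed

text \<open>Along both straight edges at \<open>v\<close> the gradients of the spline and of its
  piece coincide, except perhaps at the far ends, which may lie on the boundary. So the derivative
  of their difference at \<open>v\<close> vanishes in two independent directions.\<close>

lemma grad_derivative_vertex:
  assumes s: "s \<in> S" and T: "T \<in> \<Delta>" and p: "p \<in> Pd d" "\<And>x. x \<in> T \<Longrightarrow> s x = p x"
    and v: "v \<in> vertices D T" "v \<in> \<Omega>" and H: "(grad s has_derivative H) (at v)"
  shows "(grad p has_derivative H) (at v)"
proof -
  obtain b c where c: "is_cell D T v b c" using interior_vertex_cell[OF T v] .
  have c': "is_cell D T v c b"
    using c pie_swap straight_tri_perm(2) unfolding is_cell_def by blast
  obtain H' where H': "(grad p has_derivative H') (at v)"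
    using Pd_grad_differentiable[OF p(1)] differentiable_def by blast
  have diff: "((\<lambda>x. grad s x - grad p x) has_derivative (\<lambda>h. H h - H' h)) (at v)"
    by (rule has_derivative_diff[OF H H'])
  have z: "H (b - v) - H' (b - v) = 0" if c: "is_cell D T v b c" for b c
  proof (rule derivative_along_zero[OF diff])
    fix t :: real assume t: "0 \<le> t" "t < 1"
    have eq: "v + t *\<^sub>R (b - v) = (1 - t) *\<^sub>R v + t *\<^sub>R b" by (simp add: algebra_simps)
    have cs: "v + t *\<^sub>R (b - v) \<in> closed_segment v b" unfolding eq in_segment using t by auto
    then have "v + t *\<^sub>R (b - v) \<in> T" using cell_edge[OF c] by blast
    moreover have "v + t *\<^sub>R (b - v) \<noteq> b"
    proof
      assume "v + t *\<^sub>R (b - v) = b"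
      moreover have "(1 - t) *\<^sub>R (b - v) = b - (v + t *\<^sub>R (b - v))" by (simp add: algebra_simps)
      ultimately have "(1 - t) *\<^sub>R (b - v) = 0" by simp
      then show False using t cell_ne[OF c] by auto
    qed
    then have "v + t *\<^sub>R (b - v) \<in> \<Omega>"
      using cs v(2) open_edge_region[OF T c] by (auto simp: open_segment_def)
    ultimately show "grad s (v + t *\<^sub>R (b - v)) - grad p (v + t *\<^sub>R (b - v)) = 0"
      using grad_on_cell[OF s T p] by simp
  qed
  have "linear (\<lambda>h. H h - H' h)" using has_derivative_linear[OF diff] .
  from linear_zero_two[OF this z[OF c] z[OF c'] cell_area2[OF c]] have "H = H'" by auto
  then show ?thesis using H' by simp
qed

lemma van_3_common:
  assumes s: "s \<in> S" and T: "T \<in> \<Delta>" "T' \<in> \<Delta>" and p: "p \<in> Pd d" "\<And>x. x \<in> T \<Longrightarrow> s x = p x"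
    and p': "p' \<in> Pd d" "\<And>x. x \<in> T' \<Longrightarrow> s x = p' x"
    and v: "v \<in> vertices D T" "v \<in> vertices D T'" "v \<in> VI D \<Delta>"
  shows "van 3 (\<lambda>x. p x - p' x) v"
proof -
  have v\<Omega>: "v \<in> \<Omega>" using v(3) by (simp add: VI_def)
  obtain H where H: "(grad s has_derivative H) (at v)"
    using in_spline(3)[OF s v(3)] differentiable_def by blast
  have "v \<in> T" "v \<in> T'"
    using interior_vertex_cell[OF T(1) v(1) v\<Omega>] interior_vertex_cell[OF T(2) v(2) v\<Omega>] cell_vertex_in by metis+
  from van_2_common[OF s T p p' this v\<Omega>]
  have 2: "p v - p' v = 0 \<and> grad (\<lambda>x. p x - p' x) v = 0" unfolding van_2_iff[OF Pd_diff[OF p(1) p'(1)]] .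
  have gr: "grad (\<lambda>x. p x - p' x) = (\<lambda>x. grad p x - grad p' x)"
    using grad_diff[OF Pd_differentiable[OF p(1)] Pd_differentiable[OF p'(1)]] by blast
  have "((\<lambda>x. grad p x - grad p' x) has_derivative (\<lambda>h. H h - H h)) (at v)"
    by (intro has_derivative_diff grad_derivative_vertex[OF s T(1) p v(1) v\<Omega> H]
        grad_derivative_vertex[OF s T(2) p' v(2) v\<Omega> H])
  then show ?thesis
    using 2 by (intro van_3I[OF Pd_diff[OF p(1) p'(1)]]) (simp_all add: gr)
qed

lemma spline_add: assumes s: "s \<in> S" and t: "t \<in> S" shows "(\<lambda>x. s x + t x) \<in> S"
proof -
  have g: "grad (\<lambda>x. s x + t x) x = grad s x + grad t x" if "x \<in> \<Omega>" for x
    by (rule grad_eqI, rule has_derivative_eq_rhs,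
        rule has_derivative_add[OF differentiable_grad differentiable_grad])
      (use in_spline(1)[OF s that] in_spline(1)[OF t that] in \<open>simp_all add: inner_add_left\<close>)
  have 1: "continuous_on \<Omega> (grad (\<lambda>x. s x + t x))"
    using continuous_on_add[OF in_spline(2)[OF s] in_spline(2)[OF t]] g by (simp cong: continuous_on_cong)
  have 2: "grad (\<lambda>x. s x + t x) differentiable (at v)" if v: "v \<in> VI D \<Delta>" for v
  proof -
    have "v \<in> \<Omega>" using v by (simp add: VI_def)
    obtain H H' where "(grad s has_derivative H) (at v)" "(grad t has_derivative H') (at v)"
      using in_spline(3)[OF s v] in_spline(3)[OF t v] differentiable_def by blast
    then have "((\<lambda>x. grad s x + grad t x) has_derivative (\<lambda>h. H h + H' h)) (at v)"
      by (rule has_derivative_add)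
    then have "(grad (\<lambda>x. s x + t x) has_derivative (\<lambda>h. H h + H' h)) (at v)"
      by (rule has_derivative_transform_within_open[OF _ open_region \<open>v \<in> \<Omega>\<close>]) (simp add: g)
    then show ?thesis using differentiable_def by blast
  qed
  have 3: "\<exists>p\<in>Pd 5. \<forall>x\<in>T. s x + t x = p x" if "T \<in> ordinary D \<Delta>" for T
    using in_spline(6)[OF s that] in_spline(6)[OF t that] Pd_add by fastforce
  have 4: "\<exists>p\<in>Pd 6. \<forall>x\<in>T. s x + t x = p x" if "T \<in> pies D \<Delta> \<union> buffers D \<Delta>" for T
    using in_spline(7)[OF s that] in_spline(7)[OF t that] Pd_add by fastforce
  show ?thesis unfolding spline_space_def
    using 1 2 3 4 in_spline(1,4,5)[OF s] in_spline(1,4,5)[OF t] by (auto intro: differentiable_add)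
qed

lemma spline_scale: assumes s: "s \<in> S" shows "(\<lambda>x. r * s x) \<in> S"
proof -
  have g: "grad (\<lambda>x. r * s x) x = r *\<^sub>R grad s x" if "x \<in> \<Omega>" for x
    by (rule grad_eqI, rule has_derivative_eq_rhs, rule has_derivative_mult_right[OF differentiable_grad])
      (use in_spline(1)[OF s that] in simp_all)
  have 1: "continuous_on \<Omega> (grad (\<lambda>x. r * s x))"
    using continuous_on_scaleR[OF continuous_on_const in_spline(2)[OF s], of r] g
    by (simp cong: continuous_on_cong)
  have 2: "grad (\<lambda>x. r * s x) differentiable (at v)" if v: "v \<in> VI D \<Delta>" for v
  proof -
    have "v \<in> \<Omega>" using v by (simp add: VI_def)
    obtain H where "(grad s has_derivative H) (at v)" using in_spline(3)[OF s v] differentiable_def by blast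
    then have "((\<lambda>x. r *\<^sub>R grad s x) has_derivative (\<lambda>h. r *\<^sub>R H h)) (at v)"
      by (rule has_derivative_scaleR_right)
    then have "(grad (\<lambda>x. r * s x) has_derivative (\<lambda>h. r *\<^sub>R H h)) (at v)"
      by (rule has_derivative_transform_within_open[OF _ open_region \<open>v \<in> \<Omega>\<close>]) (simp add: g)
    then show ?thesis using differentiable_def by blast
  qed
  have 3: "\<exists>p\<in>Pd 5. \<forall>x\<in>T. r * s x = p x" if "T \<in> ordinary D \<Delta>" for T
    using in_spline(6)[OF s that] Pd_scale by fastforce
  have 4: "\<exists>p\<in>Pd 6. \<forall>x\<in>T. r * s x = p x" if "T \<in> pies D \<Delta> \<union> buffers D \<Delta>" for T
    using in_spline(7)[OF s that] Pd_scale by fastforce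
  have 5: "(\<lambda>x. r * s x) differentiable (at x)" if "x \<in> \<Omega>" for x
    using in_spline(1)[OF s that] by (intro differentiable_mult) auto
  show ?thesis unfolding spline_space_def
    using 1 2 3 4 5 in_spline(4,5)[OF s] by auto
qed

subsection \<open>Evaluating the functionals\<close>

definition pw where "pw j a x = qpol D j x / qpol D j a"

lemma pw:
  assumes T: "T \<in> \<Delta>" and p: "pie D T j a b c C"
  shows "pw j a \<in> Pd 2" "pw j a a = 1" "pw j a b = 0" "pw j a c = 0" "\<And>x. x \<in> C \<Longrightarrow> pw j a x = 0"
    "grad (pw j a) x = (1 / qpol D j a) *\<^sub>R grad (qpol D j) x" "qpol D j a > 0"
    "grad (pw j a) b \<bullet> (a - b) \<noteq> 0" "grad (pw j a) c \<bullet> (a - c) \<noteq> 0"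
proof -
  have "closure (side D j) \<subseteq> \<Gamma>"
  proof -
    have "side D j \<subseteq> path_image (bdry D)"
      using knot_range[of j] knot_range[of "Suc j"] pie_at_vertex(2)[OF p]
      unfolding side_def path_image_def by force
    then show ?thesis unfolding bdry_image by (rule closure_minimal) simp
  qed
  then have "a \<in> T - closure (side D j)"
    using pie_a_region(1)[OF T p] closure_region(2) cell_vertex_in[OF pie_is_cell[OF p]] by blast
  moreover have "T \<in> pies D \<Delta>" using T p unfolding pies_def by blast
  ultimately show pos: "qpol D j a > 0" using pie_pos p by blast
  have eq: "pw j a = (\<lambda>x. (1 / qpol D j a) * qpol D j x)" by (auto simp: pw_def)
  show "pw j a \<in> Pd 2" unfolding eq by (rule Pd_scale[OF pie_conic(1)[OF p]])
  show "pw j a a = 1" using pos by (simp add: pw_def)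
  show 0: "pw j a x = 0" if "x \<in> C" for x using pie_C(2)[OF p that] by (simp add: pw_def)
  show "pw j a b = 0" "pw j a c = 0" using 0 pie_C(4,5)[OF p] by blast+
  show g: "grad (pw j a) x = (1 / qpol D j a) *\<^sub>R grad (qpol D j) x" for x
    unfolding eq
    by (rule grad_eqI, rule has_derivative_eq_rhs,
       rule has_derivative_mult_right[OF Pd_grad[OF pie_conic(1)[OF p]]]) simp
  have "grad (qpol D j) b \<bullet> (a - b) \<noteq> 0" "grad (qpol D j) c \<bullet> (a - c) \<noteq> 0" using p unfolding pie_def by blast+
  then show "grad (pw j a) b \<bullet> (a - b) \<noteq> 0" "grad (pw j a) c \<bullet> (a - c) \<noteq> 0" unfolding g using pos by simp_all
qed

text \<open>The boundary condition makes the piece vanish on an arc with infinitely many points, so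
  the irreducible conic divides it; the normalising constant is absorbed into the quotient.\<close>

lemma pie_factor:
  assumes s: "s \<in> S" and T: "T \<in> \<Delta>" and p: "pie D T j a b c C"
  obtains h where "h \<in> Pd 4" "\<And>x. x \<in> T \<Longrightarrow> s x = pw j a x * h x"
proof -
  obtain f where f: "f \<in> Pd 6" "\<And>x. x \<in> T \<Longrightarrow> s x = f x" by (rule spline_poly[OF s T]) blast
  have C: "C \<subseteq> T" using pie_T[OF p] unfolding pie_boundary_def by blast
  have "f x = 0" if "x \<in> C" for x
    using f(2)[of x] in_spline(4)[OF s, of x] that C pie_C(1)[OF p] by (metis subsetD)
  from conic_dvd[OF pie_conic[OF p] pie_C(3)[OF p] pie_C(2)[OF p] this f(1)]
  obtain h where h: "h \<in> Pd 4" "\<And>x. f x = qpol D j x * h x" by auto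
  show thesis
  proof (rule that[of "\<lambda>x. qpol D j a * h x"])
    show "(\<lambda>x. qpol D j a * h x) \<in> Pd 4" by (rule Pd_scale[OF h(1)])
    fix x assume "x \<in> T"
    then show "s x = pw j a x * (qpol D j a * h x)"
      using f(2) h(2) pw(7)[OF T p] by (simp add: pw_def)
  qed
qed

lemma pie_functional_eval:
  assumes s: "s \<in> S" and T: "T \<in> \<Delta>" and p: "pie D T j a b c C"
    and h: "h \<in> Pd 4" "\<And>x. x \<in> T \<Longrightarrow> s x = pw j a x * h x"
  shows "pie_functional D S T j a b c \<alpha> s = bcoef 4 a b c h \<alpha>"
proof -
  have co: "continuous_on UNIV (pw j a)" using Pd_continuous[OF pw(1)[OF T p]] .
  have op: "open {x. pw j a x \<noteq> 0}" by (intro open_Collect_neq co continuous_on_const)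
  \<comment> \<open>The weight is 1 at \<open>a\<close>, hence nonzero on an open part of the cell,
    as required for the uniqueness of the coefficients.\<close>
  have "a \<in> closure (interior T)"
    using pie_topology(4)[OF p] cell_vertex_in[OF pie_is_cell[OF p]] by simp
  moreover have "a \<in> {x. pw j a x \<noteq> 0}" using pw(2)[OF T p] by simp
  ultimately have ne: "interior T \<inter> {x. pw j a x \<noteq> 0} \<noteq> {}"
    using op by (metis closure_iff_nhds_not_empty order_refl)
  have "bb_coeffs (pw j a) 4 T a b c s = bcoef 4 a b c h"
    by (rule bb_coeffs_eq[OF pie_area2[OF p] h _ ne])
      (use op interior_subset in \<open>auto intro: open_Int\<close>)
  then show ?thesis using s unfolding pie_functional_def pw_def[abs_def] by simp
qed

lemma tri_functional_eval:
  assumes s: "s \<in> S" and st: "straight_tri T a b c" and p: "p \<in> Pd d" "\<And>x. x \<in> T \<Longrightarrow> s x = p x"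
  shows "tri_functional S d T a b c \<alpha> s = bcoef d a b c p \<alpha>"
proof -
  have "bb_coeffs (\<lambda>x. 1) d T a b c s = bcoef d a b c p"
    by (rule bb_coeffs_eq[OF straight_tri_area2[OF st] p(1) _ open_interior])
      (use straight_tri_fat[OF st] interior_subset p(2) in auto)
  then show ?thesis using s unfolding tri_functional_def by simp
qed

end

lemma straight_tri_rot: "straight_tri T b c a \<Longrightarrow> straight_tri T a b c"
  by (simp add: straight_tri_def insert_commute)

context pie_triangulation
begin

text \<open>Each functional is paired with the triangle in which it is evaluated, which serves as its
  supporting set.\<close>

definition LM :: "(point set \<times> ((point \<Rightarrow> real) \<Rightarrow> real)) set" where
  "LM = (\<Union>v\<in>VI D \<Delta>. {TI v} \<times> Mv S (TI v) v) \<union> (\<Union>e\<in>EI0 D \<Delta>. {TE e} \<times> Me S (TE e) e) \<union>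
     (\<Union>v\<in>VB1 D \<Delta>. {TB v} \<times> MvP D S (TB v) v) \<union> (\<Union>T\<in>pies D \<Delta>. {T} \<times> MTP D S T) \<union>
     (\<Union>T\<in>buffers D \<Delta>. {T} \<times> MTB D S T)"

lemma LM_snd: "snd ` LM = M_set D \<Delta> TI TE TB"
  unfolding LM_def M_set_def Let_def image_Un image_UN by (auto simp: image_iff)

text \<open>Inside the edge this is continuity of the gradient. At an end on the boundary it follows
  only because the pieces are polynomials.\<close>

lemma common_edge:
  assumes s: "s \<in> S" and T: "T \<in> \<Delta>" "T' \<in> \<Delta>" and c: "is_cell D T a b c"
    and e: "closed_segment a b \<in> straight_edges D T'"
    and p: "p \<in> Pd 6" "\<And>x. x \<in> T \<Longrightarrow> s x = p x" and p': "p' \<in> Pd 6" "\<And>x. x \<in> T' \<Longrightarrow> s x = p' x"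
    and x: "x \<in> closed_segment a b"
  shows "van 2 (\<lambda>x. p x - p' x) x"
proof (rule edge_open_closed[OF nc_perm(3)[OF cell_area2[OF c]] p(1) p'(1) _ x])
  fix y assume y: "y \<in> open_segment a b"
  obtain c' where "is_cell D T' a b c' \<or> is_cell D T' b a c'" using edge_cell[OF e] by blast
  then have "closed_segment a b \<subseteq> T'" using cell_edge by (metis closed_segment_commute)
  moreover have "closed_segment a b \<subseteq> T" using cell_edge[OF c] .
  moreover have "y \<in> closed_segment a b" using y by (simp add: open_segment_def)
  moreover have "y \<in> \<Omega>" using open_edge_region[OF T(1) c] y by blast
  ultimately show "van 2 (\<lambda>x. p x - p' x) y" using van_2_common[OF s T p p'] by blast
qed

lemma ordinary_rep:
  assumes T: "T \<in> ordinary D \<Delta>" and v: "v \<in> vertices D T"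
  obtains b c where "straight_tri T v b c"
proof -
  obtain x y z where s: "straight_tri T x y z" using ordinary_straight[OF T] by blast
  then have "v \<in> {x, y, z}" using v straight_vertices(1) by blast
  then have "\<exists>b c. straight_tri T v b c"
    using s straight_tri_perm(1)[OF s] straight_tri_rot[OF s] by blast
  then show thesis using that by blast
qed

lemma ordinary_edge_rep:
  assumes T: "T \<in> ordinary D \<Delta>" and e: "closed_segment b c \<in> straight_edges D T"
  obtains a where "straight_tri T a b c"
proof -
  obtain a where "is_cell D T b c a \<or> is_cell D T c b a" using edge_cell[OF e] by blast
  moreover have "T \<in> \<Delta>" "T \<notin> pies D \<Delta>" using ordinary_straight[OF T] by simp_all
  ultimately have "straight_tri T b c a \<or> straight_tri T c b a"
    using nonpie_straight[of T b c a] nonpie_straight[of T c b a] by argo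
  then have "straight_tri T b c a" using straight_tri_perm(1)[of T c b a] by argo
  from that[OF straight_tri_rot[OF this]] show thesis .
qed

lemma pie_rep:
  assumes P: "P \<in> pies D \<Delta>" and v: "v \<in> vertices D P" "v \<in> \<Gamma>"
  obtains j a c C where "pie D P j a v c C"
proof -
  obtain j a b c C where p: "pie D P j a b c C" "P \<in> \<Delta>" using P unfolding pies_def by blast
  have "v \<in> {a, b, c}" using v(1) pie_vertices(1)[OF p(1)] by simp
  moreover have "v \<noteq> a" using v(2) pie_a_region(1)[OF p(2,1)] closure_region(2) by (auto simp: disjoint_iff)
  ultimately have "v = b \<or> v = c" by simp
  then have "\<exists>c. pie D P j a v c C" using p(1) pie_swap[OF p(1)] by (elim disjE) auto
  then show thesis using that by blast
qed

lemma VI_region: "v \<in> VI D \<Delta> \<Longrightarrow> v \<in> \<Omega>" and VB_boundary: "v \<in> VB D \<Delta> \<Longrightarrow> v \<in> \<Gamma>"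
  by (auto simp: VI_def VB_def)

section \<open>Consequences of vanishing functionals\<close>

lemma vertex_jet_zero:
  assumes s: "s \<in> S" and v: "v \<in> VI D \<Delta>" and M: "\<forall>l\<in>Mv S (TI v) v. l s = 0"
    and T: "T \<in> \<Delta>" "v \<in> vertices D T" and p: "p \<in> Pd 6" "\<And>x. x \<in> T \<Longrightarrow> s x = p x"
  shows "van 3 p v"
proof -
  have o: "TI v \<in> ordinary D \<Delta>" "v \<in> vertices D (TI v)" using TI[OF v] by auto
  obtain b c where st: "straight_tri (TI v) v b c" using ordinary_rep[OF o] .
  note nc = straight_tri_area2[OF st]
  obtain p0 where p0: "p0 \<in> Pd 5" "\<And>x. x \<in> TI v \<Longrightarrow> s x = p0 x" using in_spline(6)[OF s o(1)] by blast
  have z: "(\<lambda>x::point. 0::real) \<in> Pd 5" by (rule Pd_const)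
  have "bcoef 5 v b c p0 \<alpha> = 0" if "\<alpha> \<in> {(5,0,0), (4,1,0), (4,0,1), (3,2,0), (3,0,2), (3,1,1)}" for \<alpha>
  proof -
    have "tri_functional S 5 (TI v) v b c \<alpha> \<in> Mv S (TI v) v" unfolding Mv_def using st that by blast
    then show ?thesis using M by (auto simp: tri_functional_eval[OF s st p0])
  qed
  note z6 = this
  \<comment> \<open>The six indices of \<open>Mv\<close> are exactly those of the first three rows
    at \<open>v\<close>.\<close>
  have "van 3 (\<lambda>x. p0 x - 0) v"
    unfolding vert_a[OF nc p0(1) z] bcoef_zero[OF nc]
  proof (intro allI impI)
    fix i j k :: nat assume ijk: "i + j + k = 5" "j + k < 3"
    then have "j = 0 \<or> j = 1 \<or> j = 2" "k = 0 \<or> k = 1 \<or> k = 2" by linarith+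
    then have "(i, j, k) \<in> {(5,0,0), (4,1,0), (4,0,1), (3,2,0), (3,0,2), (3,1,1)}"
      using ijk by (elim disjE) simp_all
    then show "bcoef 5 v b c p0 (i, j, k) = 0" by (rule z6)
  qed
  moreover have "p0 \<in> Pd 6" using Pd_mono[OF p0(1)] by simp
  then have "van 3 (\<lambda>x. p x - p0 x) v"
    using van_3_common[OF s T(1) _ p _ p0(2) T(2) o(2) v] ordinary_straight[OF o(1)] by blast
  ultimately show ?thesis using van_trans[of 3 p p0 v "\<lambda>x. 0"] by simp
qed

text \<open>On \<open>TE e\<close> the 2-jets at both ends and the coefficient (1,2,2) control the
  first two rows along the edge; contact of the pieces along the edge transfers the result to every
  other cell there.\<close>

lemma edge_jet_zero:
  assumes s: "s \<in> S" and e: "closed_segment b c \<in> EI0 D \<Delta>"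
    and M: "\<forall>l\<in>Me S (TE (closed_segment b c)) (closed_segment b c). l s = 0"
      "\<forall>l\<in>Mv S (TI b) b. l s = 0" "\<forall>l\<in>Mv S (TI c) c. l s = 0"
    and T: "T \<in> \<Delta>" "closed_segment b c \<in> straight_edges D T"
    and p: "p \<in> Pd 6" "\<And>x. x \<in> T \<Longrightarrow> s x = p x" and x: "x \<in> closed_segment b c"
  shows "van 2 p x"
proof -
  let ?e = "closed_segment b c"
  have o: "TE ?e \<in> ordinary D \<Delta>" "?e \<in> straight_edges D (TE ?e)" using TE[OF e] by auto
  have TD: "TE ?e \<in> \<Delta>" using ordinary_straight[OF o(1)] by blast
  obtain a where st: "straight_tri (TE ?e) a b c" using ordinary_edge_rep[OF o] .
  note nc = straight_tri_area2[OF st]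
  obtain p0 where p0: "p0 \<in> Pd 5" "\<And>x. x \<in> TE ?e \<Longrightarrow> s x = p0 x" using in_spline(6)[OF s o(1)] by blast
  have p06: "p0 \<in> Pd 6" using Pd_mono[OF p0(1)] by simp
  have VI: "b \<in> VI D \<Delta>" "c \<in> VI D \<Delta>" using ordinary_vertices(2)[OF o(1) st] by auto
  have vs: "b \<in> vertices D (TE ?e)" "c \<in> vertices D (TE ?e)" using straight_vertices(1)[OF st] by auto
  have "tri_functional S 5 (TE ?e) a b c (1, 2, 2) \<in> Me S (TE ?e) ?e" unfolding Me_def using st by blast
  then have m: "bcoef 5 a b c p0 (1, 2, 2) = 0" using M(1) by (auto simp: tri_functional_eval[OF s st p0])
  have "van 2 p0 x"
    using edge_zero[OF nc p0(1) vertex_jet_zero[OF s VI(1) M(2) TD vs(1) p06 p0(2)]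
        vertex_jet_zero[OF s VI(2) M(3) TD vs(2) p06 p0(2)] m] x by blast
  moreover have "is_cell D (TE ?e) b c a"
    by (rule straight_cell[OF straight_tri_rot[OF straight_tri_rot[OF st]]])
  from common_edge[OF s TD T(1) this T(2) p06 p0(2) p x] have "van 2 (\<lambda>x. p0 x - p x) x" .
  ultimately have "van 2 (\<lambda>x. p0 x - (p0 x - p x)) x" by (rule van_diff)
  then show ?thesis by simp
qed

lemma pie_buffer_common:
  assumes s: "s \<in> S" and P: "P \<in> pies D \<Delta>" and p: "pie D P j a v c C"
    and h: "h \<in> Pd 4" "\<And>x. x \<in> P \<Longrightarrow> s x = pw j a x * h x"
    and B: "B \<in> buffers D \<Delta>" "straight_tri B v a z"
    and q: "q \<in> Pd 6" "\<And>x. x \<in> B \<Longrightarrow> s x = q x" and x: "x \<in> closed_segment v a"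
  shows "van 2 (\<lambda>x. q x - pw j a x * h x) x"
proof -
  have PD: "P \<in> \<Delta>" using P by (simp add: pies_def)
  have w6: "(\<lambda>x. pw j a x * h x) \<in> Pd 6" using Pd_mult[OF pw(1)[OF PD p] h(1)] by simp
  have "closed_segment v a \<in> straight_edges D P"
    using pie_vertices(2)[OF p] by (simp add: closed_segment_commute)
  then show ?thesis
    using common_edge[OF s _ PD straight_cell[OF B(2)] _ q w6 h(2) x] buffer_straight[OF B(1)] by blast
qed

lemma buffer_at_vertex_unique:
  assumes "B \<in> buffers D \<Delta>" "straight_tri B v a z" "B' \<in> buffers D \<Delta>" "straight_tri B' v a' z'" "v \<in> \<Gamma>"
  shows "B = B'"
  using buffer_unique[OF buffer_pies(3)[OF assms(1,2,5)] assms(1,3)] straight_vertices(1)[OF assms(2)]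
    straight_vertices(1)[OF assms(4)] by blast

lemma grad_pie_product:
  assumes P: "P \<in> \<Delta>" and p: "pie D P j a v c C" and h: "h \<in> Pd 4"
  shows "grad (\<lambda>x. pw j a x * h x) v = h v *\<^sub>R grad (pw j a) v"
  using grad_mult[OF Pd_differentiable[OF pw(1)[OF P p]] Pd_differentiable[OF h]] pw(3)[OF P p] by simp

text \<open>Both pie-shaped triangles share an edge with the one buffer triangle at
  \<open>v\<close>, and each has first-order contact with it up to \<open>v\<close>. In this way a
  common gradient makes sense at a boundary point.\<close>

lemma pies_gradient_eq:
  assumes s: "s \<in> S" and P: "P \<in> pies D \<Delta>" and p: "pie D P j a v c C"
    and h: "h \<in> Pd 4" "\<And>x. x \<in> P \<Longrightarrow> s x = pw j a x * h x"
    and P': "P' \<in> pies D \<Delta>" and p': "pie D P' j' a' v c' C'"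
    and h': "h' \<in> Pd 4" "\<And>x. x \<in> P' \<Longrightarrow> s x = pw j' a' x * h' x"
  shows "h v *\<^sub>R grad (pw j a) v = h' v *\<^sub>R grad (pw j' a') v"
proof -
  have PD: "P \<in> \<Delta>" "P' \<in> \<Delta>" using P P' by (simp_all add: pies_def)
  have v: "v \<in> \<Gamma>" using pie_a_region(2)[OF PD(1) p] .
  obtain B z where B: "B \<in> buffers D \<Delta>" "straight_tri B v a z" using pie_buffer[OF P p] .
  obtain B' z' where B': "B' \<in> buffers D \<Delta>" "straight_tri B' v a' z'" using pie_buffer[OF P' p'] .
  have BB: "B' = B" using buffer_at_vertex_unique[OF B' B v] .
  have BD: "B \<in> \<Delta>" using buffer_straight[OF B(1)] by blast
  obtain q where q: "q \<in> Pd 6" "\<And>x. x \<in> B \<Longrightarrow> s x = q x" by (rule spline_poly[OF s BD]) blast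
  have w6: "(\<lambda>x. pw j a x * h x) \<in> Pd 6" "(\<lambda>x. pw j' a' x * h' x) \<in> Pd 6"
    using Pd_mult[OF pw(1)[OF PD(1) p] h(1)] Pd_mult[OF pw(1)[OF PD(2) p'] h'(1)] by simp_all
  have "van 2 (\<lambda>x. q x - pw j a x * h x) v" "van 2 (\<lambda>x. q x - pw j' a' x * h' x) v"
    using pie_buffer_common[OF s P p h B q] pie_buffer_common[OF s P' p' h' B'[unfolded BB] q] by simp_all
  then have "van 2 (\<lambda>x. pw j a x * h x - pw j' a' x * h' x) v"
    by (rule van_trans[OF van_sym])
  then have "grad (\<lambda>x. pw j a x * h x - pw j' a' x * h' x) v = 0"
    using van_2_iff[OF Pd_diff[OF w6]] by blast
  then show ?thesis
    unfolding grad_diff[OF Pd_differentiable[OF w6(1)] Pd_differentiable[OF w6(2)]]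
      grad_pie_product[OF PD(1) p h(1)] grad_pie_product[OF PD(2) p' h'(1)] by simp
qed

lemma cross2_pw:
  assumes "P \<in> \<Delta>" "pie D P j a v c C" "P' \<in> \<Delta>" "pie D P' j' a' v c' C'"
  shows "cross2 (grad (pw j a) v) (grad (pw j' a') v) = 0 \<longleftrightarrow>
    cross2 (grad (qpol D j) v) (grad (qpol D j') v) = 0"
proof -
  have "cross2 (grad (pw j a) v) (grad (pw j' a') v) =
     (1 / qpol D j a) * (1 / qpol D j' a') * cross2 (grad (qpol D j) v) (grad (qpol D j') v)"
    unfolding pw(6)[OF assms(1,2)] pw(6)[OF assms(3,4)] by (simp add: cross2_def right_diff_distrib)
  then show ?thesis using pw(7)[OF assms(1,2)] pw(7)[OF assms(3,4)] by simp
qed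

lemma grad_pw_nonzero: "P \<in> \<Delta> \<Longrightarrow> pie D P j a v c C \<Longrightarrow> grad (pw j a) v \<noteq> 0"
  using pw(8) by fastforce

lemma two_pies:
  assumes B: "B \<in> buffers D \<Delta>" "straight_tri B v a1 a2" and v: "v \<in> \<Gamma>"
  obtains P1 j1 c1 C1 P2 j2 c2 C2 where "P1 \<in> pies D \<Delta>" "pie D P1 j1 a1 v c1 C1"
    "P2 \<in> pies D \<Delta>" "pie D P2 j2 a2 v c2 C2" "P1 \<noteq> P2"
proof -
  obtain P1 j1 c1 C1 where 1: "P1 \<in> pies D \<Delta>" "pie D P1 j1 a1 v c1 C1" using buffer_pies(5)[OF B v] by blast
  obtain P2 j2 c2 C2 where 2: "P2 \<in> pies D \<Delta>" "pie D P2 j2 a2 v c2 C2" using buffer_pies(6)[OF B v] by blast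
  have "a1 \<noteq> a2" using straight_tri_area2[OF B(2)] by (auto simp: area2_def)
  then have "P1 \<noteq> P2" using pie_unique(2)[OF 1(2)] 2(2) by blast
  then show thesis using that 1 2 by blast
qed

text \<open>On \<open>VB1\<close> the functional at \<open>v\<close> annihilates the factor of the
  chosen triangle and with it the common gradient. At the other vertices the common gradient would
  be a multiple of two independent normals.\<close>

lemma boundary_value_zero:
  assumes s: "s \<in> S" and P: "P \<in> pies D \<Delta>" and p: "pie D P j a v c C"
    and h: "h \<in> Pd 4" "\<And>x. x \<in> P \<Longrightarrow> s x = pw j a x * h x"
    and M: "v \<in> VB1 D \<Delta> \<longrightarrow> (\<forall>l\<in>MvP D S (TB v) v. l s = 0)"
  shows "h v = 0"
proof -
  have PD: "P \<in> \<Delta>" using P by (simp add: pies_def)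
  have v: "v \<in> \<Gamma>" "v \<in> VB D \<Delta>"
    using pie_a_region(2)[OF PD p] VB_I[OF PD pie_is_cell[OF p]] by auto
  show ?thesis
  proof (cases "v \<in> VB1 D \<Delta>")
    case True
    have P': "TB v \<in> pies D \<Delta>" "v \<in> vertices D (TB v)" using TB[OF True] by auto
    then have PD': "TB v \<in> \<Delta>" by (simp add: pies_def)
    obtain j' a' c' C' where p': "pie D (TB v) j' a' v c' C'" using pie_rep[OF P' v(1)] .
    obtain h' where h': "h' \<in> Pd 4" "\<And>x. x \<in> TB v \<Longrightarrow> s x = pw j' a' x * h' x"
      by (rule pie_factor[OF s PD' p']) blast
    have "pie_functional D S (TB v) j' a' v c' (0, 4, 0) \<in> MvP D S (TB v) v"
      unfolding MvP_def using p' by blast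
    then have "bcoef 4 a' v c' h' (0, 4, 0) = 0"
      using M True by (auto simp: pie_functional_eval[OF s PD' p' h'])
    then have "h' v = 0" unfolding bcoef_corner_b[OF pie_area2[OF p'] h'(1)] .
    then have "h v *\<^sub>R grad (pw j a) v = 0" using pies_gradient_eq[OF s P p h P'(1) p' h'] by simp
    then show ?thesis using grad_pw_nonzero[OF PD p] by simp
  next
    case False
    obtain B z where B: "B \<in> buffers D \<Delta>" "straight_tri B v a z" using pie_buffer[OF P p] .
    obtain P1 j1 c1 C1 P2 j2 c2 C2 where PP: "P1 \<in> pies D \<Delta>" "pie D P1 j1 a v c1 C1"
      "P2 \<in> pies D \<Delta>" "pie D P2 j2 z v c2 C2" "P1 \<noteq> P2" using two_pies[OF B v(1)] .
    have "a \<noteq> z" using straight_tri_area2[OF B(2)] by (auto simp: area2_def)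
    then have ne: "P \<noteq> P2" using pie_unique(2)[OF p] PP(4) by blast
    have PD2: "P2 \<in> \<Delta>" using PP(3) by (simp add: pies_def)
    obtain h2 where h2: "h2 \<in> Pd 4" "\<And>x. x \<in> P2 \<Longrightarrow> s x = pw j2 z x * h2 x"
      by (rule pie_factor[OF s PD2 PP(4)]) blast
    have "cross2 (grad (pw j a) v) (grad (pw j2 z) v) \<noteq> 0"
      unfolding cross2_pw[OF PD p PD2 PP(4)] by (rule pies_at_corner[OF v(2) False P PP(3) ne p PP(4)])
    from cross2_nonzero_indep(1)[OF this pies_gradient_eq[OF s P p h PP(3,4) h2]] show ?thesis .
  qed
qed

lemma pie_edge_jet_zero:
  assumes s: "s \<in> S" and P: "P \<in> pies D \<Delta>" and p: "pie D P j a v c C"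
    and h: "h \<in> Pd 4" "\<And>x. x \<in> P \<Longrightarrow> s x = pw j a x * h x"
    and M: "v \<in> VB1 D \<Delta> \<longrightarrow> (\<forall>l\<in>MvP D S (TB v) v. l s = 0)"
      "\<forall>l\<in>Mv S (TI a) a. l s = 0" "\<forall>l\<in>MTP D S P. l s = 0"
      "\<forall>B\<in>buffers D \<Delta>. v \<in> B \<longrightarrow> (\<forall>l\<in>MTB D S B. l s = 0)"
  shows "\<forall>x\<in>closed_segment a v. van 2 h x"
proof -
  have PD: "P \<in> \<Delta>" using P by (simp add: pies_def)
  have v: "v \<in> \<Gamma>" using pie_a_region(2)[OF PD p] .
  obtain B z where B: "B \<in> buffers D \<Delta>" "straight_tri B v a z" using pie_buffer[OF P p] .
  have BD: "B \<in> \<Delta>" using buffer_straight[OF B(1)] by blast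
  have vB: "v \<in> B" using cell_vertex_in[OF straight_cell[OF B(2)]] by blast
  obtain q where q: "q \<in> Pd 6" "\<And>x. x \<in> B \<Longrightarrow> s x = q x" by (rule spline_poly[OF s BD]) blast
  have w6: "(\<lambda>x. pw j a x * h x) \<in> Pd 6" using Pd_mult[OF pw(1)[OF PD p] h(1)] by simp
  note ncB = straight_tri_area2[OF B(2)]
  have VI: "a \<in> VI D \<Delta>" using VI_I[OF PD pie_is_cell[OF p]] pie_a_region(1)[OF PD p] by blast
  have aP: "a \<in> vertices D P" using pie_vertices(1)[OF p] by blast
  have jet: "van 3 (\<lambda>x. pw j a x * h x) a"
    by (rule vertex_jet_zero[OF s VI M(2) PD aP w6 h(2)])
  have five: "bcoef 4 a v c h \<alpha> = 0" if "\<alpha> \<in> {(1,3,0), (1,2,1), (1,1,2), (1,0,3), (0,2,2)}" for \<alpha>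
  proof -
    have "pie_functional D S P j a v c \<alpha> \<in> MTP D S P" unfolding MTP_def using p that by blast
    then show ?thesis using M(3) by (auto simp: pie_functional_eval[OF s PD p h])
  qed
  have "\<forall>x\<in>closed_segment v a. van 2 (\<lambda>x. q x - pw j a x * h x) x"
    using pie_buffer_common[OF s P p h B q] by blast
  \<comment> \<open>The index (4,1,1) lies in the second row along the common edge, so the mixed
    derivative of the product is the coefficient evaluated by a functional of the buffer
    triangle.\<close>
  from this[unfolded edge_c[OF ncB q(1) w6], rule_format, of 4 1 1]
  have "bcoef 6 v a z (\<lambda>x. pw j a x * h x) (4, 1, 1) = bcoef 6 v a z q (4, 1, 1)" by simp
  also have "\<dots> = 0"
  proof -
    have "tri_functional S 6 B v a z (4, 1, 1) \<in> MTB D S B" unfolding MTB_def using B(2) v by blast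
    then have "tri_functional S 6 B v a z (4, 1, 1) s = 0" using M(4) B(1) vB by blast
    then show ?thesis by (simp add: tri_functional_eval[OF s B(2) q])
  qed
  finally have tw: "bcoef 6 v a z (\<lambda>x. pw j a x * h x) (4, 1, 1) = 0" .
  have hv: "h v = 0" by (rule boundary_value_zero[OF s P p h M(1)])
  show ?thesis
    by (rule pie_edge_zero[OF pie_area2[OF p] ncB pw(1,2,3)[OF PD p] pw(8)[OF PD p] h(1) jet five five hv tw])
      simp_all
qed

text \<open>Everything used belongs to a vertex of \<open>T\<close>, to an edge at such a vertex, or
  to a pie-shaped or buffer triangle that is \<open>T\<close> or meets it in such a vertex. So the
  triangles in which the needed functionals are evaluated all meet \<open>T\<close>.\<close>

theorem local_determination:
  assumes s: "s \<in> S" and T: "T \<in> \<Delta>" and M: "\<forall>(K, l)\<in>LM. K \<inter> T \<noteq> {} \<longrightarrow> l s = 0"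
    and x: "x \<in> T"
  shows "s x = 0"
proof -
  have M': "l s = 0" if "(K, l) \<in> LM" "K \<inter> T \<noteq> {}" for K l using M that by blast
  have Mv: "\<forall>l\<in>Mv S (TI v) v. l s = 0" if v: "v \<in> VI D \<Delta>" "v \<in> T" for v
  proof
    fix l assume l: "l \<in> Mv S (TI v) v"
    have o: "TI v \<in> ordinary D \<Delta>" "v \<in> vertices D (TI v)" using TI[OF v(1)] by auto
    obtain b c where "straight_tri (TI v) v b c" using ordinary_rep[OF o] .
    then have "TI v \<inter> T \<noteq> {}" using v(2) cell_vertex_in straight_cell by blast
    moreover have "(TI v, l) \<in> LM" using v l unfolding LM_def by blast
    ultimately show "l s = 0" using M' by blast
  qed
  have Me: "\<forall>l\<in>Me S (TE (closed_segment b c)) (closed_segment b c). l s = 0"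
    if e: "closed_segment b c \<in> EI0 D \<Delta>" "b \<in> T" for b c
  proof
    fix l assume l: "l \<in> Me S (TE (closed_segment b c)) (closed_segment b c)"
    have o: "TE (closed_segment b c) \<in> ordinary D \<Delta>" "closed_segment b c \<in> straight_edges D (TE (closed_segment b c))"
      using TE[OF e(1)] by auto
    obtain a where "straight_tri (TE (closed_segment b c)) a b c" using ordinary_edge_rep[OF o] .
    then have "TE (closed_segment b c) \<inter> T \<noteq> {}" using e(2) cell_vertex_in straight_cell by blast
    moreover have "(TE (closed_segment b c), l) \<in> LM" using e l unfolding LM_def by blast
    ultimately show "l s = 0" using M' by blast
  qed
  have MvP: "v \<in> VB1 D \<Delta> \<longrightarrow> (\<forall>l\<in>MvP D S (TB v) v. l s = 0)" if v: "v \<in> T" for v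
  proof (intro impI ballI)
    fix l assume v1: "v \<in> VB1 D \<Delta>" and l: "l \<in> MvP D S (TB v) v"
    have "TB v \<in> pies D \<Delta>" "v \<in> vertices D (TB v)" using TB[OF v1] by auto
    moreover have "v \<in> \<Gamma>" using v1 VB_boundary unfolding VB1_def by blast
    ultimately obtain j a c C where "pie D (TB v) j a v c C" using pie_rep by metis
    then have "TB v \<inter> T \<noteq> {}" using v cell_vertex_in[OF pie_is_cell] by blast
    moreover have "(TB v, l) \<in> LM" using v1 l unfolding LM_def by blast
    ultimately show "l s = 0" using M' by blast
  qed
  have MTP: "\<forall>l\<in>MTP D S P. l s = 0" if "P \<in> pies D \<Delta>" "P \<inter> T \<noteq> {}" for P
    using M'[of P] that unfolding LM_def by blast
  have MTB: "\<forall>l\<in>MTB D S B. l s = 0" if "B \<in> buffers D \<Delta>" "B \<inter> T \<noteq> {}" for B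
    using M'[of B] that unfolding LM_def by blast
  have MTB': "\<forall>B\<in>buffers D \<Delta>. v \<in> B \<longrightarrow> (\<forall>l\<in>MTB D S B. l s = 0)" if "v \<in> T" for v
    using MTB that by blast
  from cell_kinds[OF T] show ?thesis
  proof (elim disjE)
    assume o: "T \<in> ordinary D \<Delta>"
    obtain a b c where st: "straight_tri T a b c" using ordinary_straight[OF o] by blast
    obtain p where p: "p \<in> Pd 5" "\<And>x. x \<in> T \<Longrightarrow> s x = p x" using in_spline(6)[OF s o] by blast
    have p6: "p \<in> Pd 6" using Pd_mono[OF p(1)] by simp
    have e: "\<forall>x\<in>closed_segment a b. van 2 p x" if st: "straight_tri T a b c" for a b c
    proof
      fix x assume x: "x \<in> closed_segment a b"
      have VI: "a \<in> VI D \<Delta>" "b \<in> VI D \<Delta>" using ordinary_vertices(2)[OF o st] by auto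
      have ab: "a \<in> T" "b \<in> T" using cell_vertex_in[OF straight_cell[OF st]] by auto
      have e: "closed_segment a b \<in> straight_edges D T" using cell_edge_in[OF straight_cell[OF st]] .
      have e0: "closed_segment a b \<in> EI0 D \<Delta>" by (rule ordinary_edge[OF o st])
      show "van 2 p x"
        by (rule edge_jet_zero[OF s e0 Me[OF e0 ab(1)] Mv[OF VI(1) ab(1)] Mv[OF VI(2) ab(2)] T e p6 p(2) x])
    qed
    have "p = (\<lambda>x. 0)"
      using argyris_zero[OF straight_tri_area2[OF st] p(1)] e[OF st]
        e[OF straight_tri_rot[OF straight_tri_rot[OF st]]] e[OF straight_tri_perm(2)[OF st]] by blast
    then show ?thesis using p(2) x by simp
  next
    assume P: "T \<in> pies D \<Delta>"
    then obtain j a b c C where p: "pie D T j a b c C" unfolding pies_def by blast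
    obtain h where h: "h \<in> Pd 4" "\<And>x. x \<in> T \<Longrightarrow> s x = pw j a x * h x"
      by (rule pie_factor[OF s T p]) blast
    have e: "\<forall>x\<in>closed_segment a b. van 2 h x" if p: "pie D T j a b c C" for b c
    proof -
      have ab: "a \<in> T" "b \<in> T" using cell_vertex_in[OF pie_is_cell[OF p]] by auto
      have VI: "a \<in> VI D \<Delta>" using VI_I[OF T pie_is_cell[OF p]] pie_a_region(1)[OF T p] by blast
      have PT: "T \<inter> T \<noteq> {}" using ab by blast
      show ?thesis
        by (rule pie_edge_jet_zero[OF s P p h MvP[OF ab(2)] Mv[OF VI ab(1)] MTP[OF P PT] MTB'[OF ab(2)]])
    qed
    have "pie_functional D S T j a b c (0, 2, 2) \<in> MTP D S T" unfolding MTP_def using p by blast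
    then have "pie_functional D S T j a b c (0, 2, 2) s = 0" using MTP[OF P] x by blast
    then have "bcoef 4 a b c h (0, 2, 2) = 0" by (simp add: pie_functional_eval[OF s T p h])
    then have "h = (\<lambda>x. 0)"
      using pie_zero[OF pie_area2[OF p] h(1) e[OF p] e[OF pie_swap[OF p]]] by blast
    then show ?thesis using h(2) x by simp
  next
    assume B: "T \<in> buffers D \<Delta>"
    obtain v a1 a2 where st: "straight_tri T v a1 a2" and v: "v \<in> \<Gamma>" using buffer_structure[OF B] .
    obtain q where q: "q \<in> Pd 6" "\<And>x. x \<in> T \<Longrightarrow> s x = q x" by (rule spline_poly[OF s T]) blast
    have half: "(\<forall>x\<in>closed_segment v a. van 2 q x) \<and> van 3 q a \<and> a \<in> VI D \<Delta> \<and> a \<in> T"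
      if st: "straight_tri T v a z" for a z
    proof (intro conjI)
      have a\<Omega>: "a \<in> \<Omega>" using buffer_pies(1)[OF B st v] .
      show VI: "a \<in> VI D \<Delta>" using VI_I[OF T straight_cell[OF st]] a\<Omega> by blast
      have va: "v \<in> T" "a \<in> T" using cell_vertex_in[OF straight_cell[OF st]] by auto
      then show "a \<in> T" by simp
      have "a \<in> vertices D T" using straight_vertices(1)[OF st] by blast
      from vertex_jet_zero[OF s VI Mv[OF VI va(2)] T this q] show "van 3 q a" .
      obtain P j c C where P: "P \<in> pies D \<Delta>" "pie D P j a v c C" using buffer_pies(5)[OF B st v] by blast
      have PD: "P \<in> \<Delta>" using P by (simp add: pies_def)
      have vP: "v \<in> P" using cell_vertex_in[OF pie_is_cell[OF P(2)]] by blast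
      have PT: "P \<inter> T \<noteq> {}" using va(1) vP by blast
      obtain h where h: "h \<in> Pd 4" "\<And>x. x \<in> P \<Longrightarrow> s x = pw j a x * h x"
        by (rule pie_factor[OF s PD P(2)]) blast
      have hz: "\<forall>x\<in>closed_segment a v. van 2 h x"
        by (rule pie_edge_jet_zero[OF s P h MvP[OF va(1)] Mv[OF VI va(2)] MTP[OF P(1) PT] MTB'[OF va(1)]])
      show "\<forall>x\<in>closed_segment v a. van 2 q x"
      proof
        fix x assume x: "x \<in> closed_segment v a"
        then have "van 2 h x" using hz by (simp add: closed_segment_commute)
        then have "van 2 (\<lambda>x. pw j a x * h x) x" by (rule van_mult_right[OF _ pw(1)[OF PD P(2)]])
        from van_add[OF pie_buffer_common[OF s P h B st q x] this] show "van 2 q x" by simp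
      qed
    qed
    note h1 = half[OF st] and h2 = half[OF straight_tri_perm(2)[OF st]]
    have e3: "\<forall>x\<in>closed_segment a1 a2. van 2 q x"
    proof
      fix x assume x: "x \<in> closed_segment a1 a2"
      have e0: "closed_segment a1 a2 \<in> EI0 D \<Delta>" using buffer_pies(4)[OF B st v] .
      have e: "closed_segment a1 a2 \<in> straight_edges D T" using straight_vertices(2)[OF st] by blast
      show "van 2 q x"
        by (rule edge_jet_zero[OF s e0 Me[OF e0] Mv Mv T e q x]) (use h1 h2 in auto)
    qed
    have "tri_functional S 6 T v a1 a2 (2, 2, 2) \<in> MTB D S T" unfolding MTB_def using st v by blast
    then have "tri_functional S 6 T v a1 a2 (2, 2, 2) s = 0" using MTB[OF B] x by blast
    then have "bcoef 6 v a1 a2 q (2, 2, 2) = 0" by (simp add: tri_functional_eval[OF s st q])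
    then have "q = (\<lambda>x. 0)"
      using buffer_zero[OF straight_tri_area2[OF st] q(1)] h1 h2 e3 by blast
    then show ?thesis using q(2) x by simp
  qed
qed

end

section \<open>Pasting polynomial pieces\<close>

lemma tendsto_within_Union:
  assumes "finite \<T>" "\<And>T. T \<in> \<T> \<Longrightarrow> (f \<longlongrightarrow> l) (at x within T)"
  shows "(f \<longlongrightarrow> l) (at x within \<Union>\<T>)"
  using assms by (induction rule: finite_induct) (auto simp: at_within_union filterlim_sup)

lemma has_derivative_within_Union:
  assumes "finite \<T>" "\<T> \<noteq> {}" "\<And>T. T \<in> \<T> \<Longrightarrow> (f has_derivative f') (at x within T)"
  shows "(f has_derivative f') (at x within \<Union>\<T>)"
proof -
  obtain T where "T \<in> \<T>" using assms(2) by blast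
  then have "bounded_linear f'" using assms(3) has_derivative_bounded_linear by blast
  moreover have "((\<lambda>y. (1 / norm (y - x)) *\<^sub>R (f y - (f x + f' (y - x)))) \<longlongrightarrow> 0) (at x within \<Union>\<T>)"
    using assms(3) by (intro tendsto_within_Union assms(1)) (simp add: has_derivative_within)
  ultimately show ?thesis by (simp add: has_derivative_within)
qed

text \<open>The property \<open>Z\<close> says that both partial derivatives vanish to second order.
  By the product rule it holds for a factor vanishing to order 1 times a factor vanishing to order
  2, and every Bernstein polynomial with \<open>j + k\<close> at least 3 splits in this way.\<close>

lemma van_3_grad_derivative:
  assumes f: "f \<in> Pd d" and v: "van 3 f a"
  shows "(grad f has_derivative (\<lambda>_. 0)) (at a)"
proof -
  \<comment> \<open>An auxiliary triangle with vertex \<open>a\<close>; only its being nondegenerate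
    matters.\<close>
  define b c where "b = a + axis 1 1" and "c = a + axis 2 (1::real)"
  have nc: "area2 a b c \<noteq> 0" by (simp add: area2_def b_def c_def axis_def)
  have z: "(\<lambda>x::point. 0::real) \<in> Pd d" by (rule Pd_const)
  define Z where "Z g \<longleftrightarrow> (\<exists>n. g \<in> Pd n) \<and> (\<forall>k. van 2 (\<lambda>x. grad g x $ k) a)" for g
  have Zmult: "Z (\<lambda>x. u x * g x)" if u: "u \<in> Pd m" "van 1 u a" and g: "g \<in> Pd n" "van 2 g a" for u g m n
  proof -
    have "grad (\<lambda>x. u x * g x) x $ k = u x * grad g x $ k + g x * grad u x $ k" for x k
      unfolding grad_mult[OF Pd_differentiable[OF u(1)] Pd_differentiable[OF g(1)]] by simp
    moreover have "van (1 + 1) (\<lambda>x. u x * grad g x $ k) a" for k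
    proof (rule van_mult[OF u(2)])
      have "grad g a = 0" using g(2) van_2_iff[OF g(1)] by blast
      then show "van 1 (\<lambda>x. grad g x $ k) a" using van_1_iff[OF Pd_grad_nth[OF g(1)]] by simp
    qed
    moreover have "van 2 (\<lambda>x. g x * grad u x $ k) a" for k
      by (rule van_mult_left[OF g(2) Pd_grad_nth[OF u(1)]])
    ultimately have "\<forall>k. van 2 (\<lambda>x. grad (\<lambda>x. u x * g x) x $ k) a"
      using van_add[of 2] by (simp add: numeral_2_eq_2)
    then show ?thesis using Pd_mult[OF u(1) g(1)] unfolding Z_def by blast
  qed
  have Zscale: "Z (\<lambda>x. r * g x)" if Zg: "Z g" for r g
  proof -
    obtain n where g: "g \<in> Pd n" using Zg unfolding Z_def by blast
    have "grad (\<lambda>x. r * g x) x = r *\<^sub>R grad g x" for x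
      by (rule grad_eqI, rule has_derivative_eq_rhs, rule has_derivative_mult_right[OF Pd_grad[OF g]]) simp
    then show ?thesis using Zg Pd_scale[OF g] van_scale unfolding Z_def by auto
  qed
  have Zadd: "Z (\<lambda>x. g x + h x)" if gh: "Z g" "Z h" for g h
  proof -
    obtain n m where n: "g \<in> Pd n" "h \<in> Pd m" using gh unfolding Z_def by blast
    have "grad (\<lambda>x. g x + h x) x = grad g x + grad h x" for x
      by (rule grad_eqI, rule has_derivative_eq_rhs, rule has_derivative_add[OF Pd_grad[OF n(1)] Pd_grad[OF n(2)]])
        (simp add: inner_add_left)
    moreover have "(\<lambda>x. g x + h x) \<in> Pd (max n m)"
      using Pd_add[OF Pd_mono[OF n(1)] Pd_mono[OF n(2)]] by simp
    ultimately show ?thesis using gh van_add unfolding Z_def by auto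
  qed
  have Zsum: "Z (\<lambda>x. \<Sum>\<alpha>\<in>A. F \<alpha> x)" if "finite A" "\<And>\<alpha>. \<alpha> \<in> A \<Longrightarrow> Z (F \<alpha>)" for A :: "(nat \<times> nat \<times> nat) set" and F
    using that
  proof (induction rule: finite_induct)
    case empty
    have "Z (\<lambda>x. (\<lambda>x. 0) x * (\<lambda>x. 0) x)"
      by (rule Zmult[OF Pd_const[of 0 0] van_zero Pd_const[of 0 0] van_zero])
    then show ?case by simp
  qed (auto intro: Zadd)
  have Zb: "Z (bernstein d a b c (i, j, k))" if ijk: "i + j + k = d" "3 \<le> j + k" for i j k
  proof -
    let ?C = "fact d / (fact i * fact j * fact k) :: real"
    have b: "van 1 (bary b a c) a" "van 1 (bary c a b) a"
      by (simp_all only: van_1_iff[OF bary_Pd] bary_self)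
    have P: "(\<lambda>x. ?C * (bary a b c x ^ i * (bary b a c x ^ j' * bary c a b x ^ k'))) \<in> Pd (1 * i + (1 * j' + 1 * k'))"
      for j' k' by (intro Pd_scale Pd_mult Pd_power bary_Pd)
    have V: "van 2 (\<lambda>x. ?C * (bary a b c x ^ i * (bary b a c x ^ j' * bary c a b x ^ k'))) a" if "2 \<le> j' + k'" for j' k'
    proof -
      have "van (1 * j' + 1 * k') (\<lambda>x. bary b a c x ^ j' * bary c a b x ^ k') a"
        by (intro van_mult van_power b)
      then have "van 2 (\<lambda>x. bary b a c x ^ j' * bary c a b x ^ k') a" by (rule van_mono) (use that in simp)
      then have "van 2 (\<lambda>x. bary a b c x ^ i * (bary b a c x ^ j' * bary c a b x ^ k')) a"
        by (rule van_mult_right[where g="\<lambda>x. bary a b c x ^ i", OF _ Pd_power[OF bary_Pd]])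
      then show ?thesis by (rule van_scale)
    qed
    show ?thesis
    proof (cases j)
      case 0
      then obtain k' where k': "k = Suc k'" using ijk by (cases k) auto
      have "Z (\<lambda>x. bary c a b x * (?C * (bary a b c x ^ i * (bary b a c x ^ j * bary c a b x ^ k'))))"
        by (rule Zmult[OF bary_Pd b(2) P V]) (use ijk k' in simp)
      then show ?thesis unfolding bernstein_bary[abs_def] k' by (simp add: mult_ac)
    next
      case (Suc j')
      have "Z (\<lambda>x. bary b a c x * (?C * (bary a b c x ^ i * (bary b a c x ^ j' * bary c a b x ^ k))))"
        by (rule Zmult[OF bary_Pd b(1) P V]) (use ijk Suc in simp)
      then show ?thesis unfolding bernstein_bary[abs_def] Suc by (simp add: mult_ac)
    qed
  qed
  have "van 3 (\<lambda>x. f x - 0) a" using v by simp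
  note v' = this[unfolded vert_a[OF nc f z] bcoef_zero[OF nc]]
  have "Z (bbpoly d a b c (bcoef d a b c f))"
    unfolding bbpoly_def
  proof (rule Zsum[OF finite_indices])
    fix \<alpha> assume "\<alpha> \<in> indices d"
    then obtain i j k where \<alpha>: "\<alpha> = (i, j, k)" "i + j + k = d" by (auto simp: indices_def)
    show "Z (\<lambda>x. bcoef d a b c f \<alpha> * bernstein d a b c \<alpha> x)"
    proof (cases "j + k < 3")
      case True
      then have "bcoef d a b c f \<alpha> = 0" using v' \<alpha> by blast
      then have "(\<lambda>x. bcoef d a b c f \<alpha> * bernstein d a b c \<alpha> x) = (\<lambda>x. \<Sum>\<alpha>\<in>{}. f \<alpha>)" by simp
      then show ?thesis using Zsum[of "{}" "\<lambda>_. f"] by simp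
    next
      case False
      then show ?thesis unfolding \<alpha>(1) by (intro Zscale Zb[OF \<alpha>(2)]) simp
    qed
  qed
  then have "\<forall>k. van 2 (\<lambda>x. grad f x $ k) a" unfolding bbpoly_bcoef[OF nc f] Z_def by blast
  then have "grad (\<lambda>x. grad f x $ k) a = 0" for k using van_2_iff[OF Pd_grad_nth[OF f]] by blast
  then show ?thesis
    using Pd_grad[OF Pd_grad_nth[OF f], of _ a] by (intro has_derivative_vecI) simp
qed

context pie_triangulation
begin

lemma cells_closed: "T \<in> \<Delta> \<Longrightarrow> closed T"
  using cells cell_fat(1) by blast

text \<open>Removing the finitely many closed cells that miss \<open>x\<close> leaves a
  neighbourhood covered by the cells through \<open>x\<close>.\<close>

lemma cells_near:
  assumes x: "x \<in> \<Omega>"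
  obtains N where "open N" "x \<in> N" "N \<subseteq> \<Omega>" "N \<subseteq> \<Union>{T \<in> \<Delta>. x \<in> T}" "{T \<in> \<Delta>. x \<in> T} \<noteq> {}"
proof -
  let ?N = "\<Omega> - \<Union>{T \<in> \<Delta>. x \<notin> T}"
  have "closed (\<Union>{T \<in> \<Delta>. x \<notin> T})" using fin cells_closed by (intro closed_Union) auto
  then have "open ?N" using open_region by (rule open_Diff[rotated])
  moreover have sub: "?N \<subseteq> \<Union>{T \<in> \<Delta>. x \<in> T}"
  proof
    fix y assume y: "y \<in> ?N"
    then have "y \<in> \<Union>\<Delta>" using union closure_subset[of \<Omega>] by blast
    then show "y \<in> \<Union>{T \<in> \<Delta>. x \<in> T}" using y by blast
  qed
  moreover have "x \<in> ?N" using x by blast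
  ultimately show thesis using that[of ?N] by blast
qed

text \<open>All pieces through \<open>x\<close> have the same derivative there, so the pasted
  function has it relative to each cell, and finitely many of these cells cover a
  neighbourhood.\<close>

lemma paste_derivative:
  fixes s :: "point \<Rightarrow> 'a::real_normed_vector"
  assumes x: "x \<in> \<Omega>"
    and f: "\<And>T. T \<in> \<Delta> \<Longrightarrow> x \<in> T \<Longrightarrow> (f T has_derivative L) (at x)"
    and s: "\<And>T y. T \<in> \<Delta> \<Longrightarrow> x \<in> T \<Longrightarrow> y \<in> T \<Longrightarrow> y \<in> \<Omega> \<Longrightarrow> s y = f T y"
  shows "(s has_derivative L) (at x)"
proof -
  obtain N where N: "open N" "x \<in> N" "N \<subseteq> \<Omega>" "N \<subseteq> \<Union>{T \<in> \<Delta>. x \<in> T}" "{T \<in> \<Delta>. x \<in> T} \<noteq> {}"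
    using cells_near[OF x] .
  let ?\<T> = "(\<lambda>T. T \<inter> \<Omega>) ` {T \<in> \<Delta>. x \<in> T}"
  have "(s has_derivative L) (at x within \<Union>?\<T>)"
  proof (rule has_derivative_within_Union)
    fix T' assume "T' \<in> ?\<T>"
    then obtain T where T: "T' = T \<inter> \<Omega>" "T \<in> \<Delta>" "x \<in> T" by blast
    have "(f T has_derivative L) (at x within T \<inter> \<Omega>)" using f[OF T(2,3)] by (rule has_derivative_at_withinI)
    then show "(s has_derivative L) (at x within T')" unfolding T(1)
      by (rule has_derivative_transform[rotated 2]) (use s[OF T(2,3)] T(3) x in auto)
  qed (use fin N(5) in auto)
  then have "(s has_derivative L) (at x within N)"
    by (rule has_derivative_subset) (use N(3,4) in blast)
  then show ?thesis using at_within_open[OF N(2,1)] by simp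
qed

lemma paste_continuous:
  fixes s :: "point \<Rightarrow> 'a::real_normed_vector"
  assumes s: "\<And>T y. T \<in> \<Delta> \<Longrightarrow> y \<in> T \<Longrightarrow> y \<in> \<Omega> \<Longrightarrow> s y = f T y"
    and f: "\<And>T. T \<in> \<Delta> \<Longrightarrow> continuous_on UNIV (f T)"
  shows "continuous_on \<Omega> s"
  unfolding continuous_on_def
proof
  fix x assume x: "x \<in> \<Omega>"
  obtain N where N: "open N" "x \<in> N" "N \<subseteq> \<Omega>" "N \<subseteq> \<Union>{T \<in> \<Delta>. x \<in> T}" "{T \<in> \<Delta>. x \<in> T} \<noteq> {}"
    using cells_near[OF x] .
  let ?\<T> = "(\<lambda>T. T \<inter> \<Omega>) ` {T \<in> \<Delta>. x \<in> T}"
  have "(s \<longlongrightarrow> s x) (at x within \<Union>?\<T>)"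
  proof (rule tendsto_within_Union)
    fix T' assume "T' \<in> ?\<T>"
    then obtain T where T: "T' = T \<inter> \<Omega>" "T \<in> \<Delta>" "x \<in> T" by blast
    have "continuous_on (T \<inter> \<Omega>) (f T)" using f[OF T(2)] continuous_on_subset by blast
    then have lim: "(f T \<longlongrightarrow> f T x) (at x within T \<inter> \<Omega>)"
      using T(3) x unfolding continuous_on_def by blast
    have "eventually (\<lambda>y. f T y = s y) (at x within T \<inter> \<Omega>)"
      unfolding eventually_at_filter using s[OF T(2)] by (intro always_eventually) auto
    from Lim_transform_eventually[OF lim this] show "(s \<longlongrightarrow> s x) (at x within T')"
      unfolding T(1) s[OF T(2,3) x] .
  qed (use fin in auto)
  then have "(s \<longlongrightarrow> s x) (at x within N)"
    by (rule tendsto_within_subset) (use N(3,4) in blast)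
  then show "(s \<longlongrightarrow> s x) (at x within \<Omega>)"
    using at_within_open[OF N(2,1)] at_within_open[OF x open_region] by simp
qed

text \<open>Pieces need contact of order 2 only across common straight edges, since other
  intersections are single vertices. Second-order smoothness at a vertex is measured against one
  polynomial \<open>Q v\<close> common to all its cells, so the derivative of the pasted gradient is
  the one of \<open>grad (Q v)\<close>. On the boundary the pieces agree because they are all
  0.\<close>

lemma spline_from_pieces:
  assumes F6: "\<And>T. T \<in> \<Delta> \<Longrightarrow> F T \<in> Pd 6" and F5: "\<And>T. T \<in> ordinary D \<Delta> \<Longrightarrow> F T \<in> Pd 5"
    and edge: "\<And>T T' e x. T \<in> \<Delta> \<Longrightarrow> T' \<in> \<Delta> \<Longrightarrow> T \<noteq> T' \<Longrightarrow> e \<in> straight_edges D T \<Longrightarrow>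
      e \<in> straight_edges D T' \<Longrightarrow> x \<in> e \<Longrightarrow> van 2 (\<lambda>x. F T x - F T' x) x"
    and vert: "\<And>T v. T \<in> \<Delta> \<Longrightarrow> v \<in> VI D \<Delta> \<Longrightarrow> v \<in> vertices D T \<Longrightarrow> van 3 (\<lambda>x. F T x - Q v x) v"
    and Q: "\<And>v. v \<in> VI D \<Delta> \<Longrightarrow> Q v \<in> Pd 6"
    and zero: "\<And>T x. T \<in> \<Delta> \<Longrightarrow> x \<in> T \<Longrightarrow> x \<in> \<Gamma> \<Longrightarrow> F T x = 0"
  shows "\<exists>s\<in>S. \<forall>T\<in>\<Delta>. \<forall>x\<in>T. s x = F T x"
proof -
  have c2: "van 2 (\<lambda>x. F T x - F T' x) x" if T: "T \<in> \<Delta>" "T' \<in> \<Delta>" and x: "x \<in> T" "x \<in> T'" "x \<in> \<Omega>" for T T' x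
  proof (cases "T = T'")
    case True
    then show ?thesis by (simp add: van_zero)
  next
    case False
    from cell_Int[OF T False] x consider v where "v \<in> vertices D T" "v \<in> vertices D T'" "T \<inter> T' = {v}"
      | "T \<inter> T' \<in> straight_edges D T" "T \<inter> T' \<in> straight_edges D T'" by blast
    then show ?thesis
    proof cases
      case 1
      then have v: "x = v" using x by blast
      then have VI: "x \<in> VI D \<Delta>" using 1(1) T(1) x(3) unfolding VI_def by blast
      have "van 3 (\<lambda>x. F T x - F T' x) x"
        using van_trans[OF vert[OF T(1) VI] van_sym[OF vert[OF T(2) VI]]] 1 v by blast
      then show ?thesis by (rule van_mono) simp
    next
      case 2
      then show ?thesis using edge[OF T False] x by blast
    qed
  qed
  have c0: "F T x = F T' x" if T: "T \<in> \<Delta>" "T' \<in> \<Delta>" and x: "x \<in> T" "x \<in> T'" for T T' x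
  proof (cases "x \<in> \<Omega>")
    case True
    then show ?thesis using c2[OF T x] van_Suc_imp_zero[of 1 "\<lambda>x. F T x - F T' x" x] by (simp add: numeral_2_eq_2)
  next
    case False
    then have "x \<in> \<Gamma>" using cell_subset[OF T(1)] x(1) closure_region(1) by blast
    then show ?thesis using zero T x by simp
  qed
  define s where "s x = (if x \<in> closure \<Omega> then F (SOME T. T \<in> \<Delta> \<and> x \<in> T) x else 0)" for x
  have sF: "s x = F T x" if T: "T \<in> \<Delta>" "x \<in> T" for T x
  proof -
    have "(SOME T. T \<in> \<Delta> \<and> x \<in> T) \<in> \<Delta> \<and> x \<in> (SOME T. T \<in> \<Delta> \<and> x \<in> T)"
      by (rule someI[of "\<lambda>T. T \<in> \<Delta> \<and> x \<in> T" T]) (use T in simp)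
    then have "F (SOME T. T \<in> \<Delta> \<and> x \<in> T) x = F T x" using c0 T by blast
    then show ?thesis unfolding s_def using T cell_subset by auto
  qed
  have gF: "grad (F T) x = grad (F T') x" if T: "T \<in> \<Delta>" "T' \<in> \<Delta>" "x \<in> T" "x \<in> T'" "x \<in> \<Omega>" for T T' x
  proof -
    have "grad (\<lambda>x. F T x - F T' x) x = 0"
      using c2[OF T] unfolding van_2_iff[OF Pd_diff[OF F6[OF T(1)] F6[OF T(2)]]] by blast
    then show ?thesis
      unfolding grad_diff[OF Pd_differentiable[OF F6[OF T(1)]] Pd_differentiable[OF F6[OF T(2)]]] by simp
  qed
  have ds: "(s has_derivative (\<lambda>h. grad (F T) x \<bullet> h)) (at x)" if T: "T \<in> \<Delta>" "x \<in> T" "x \<in> \<Omega>" for T x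
  proof (rule paste_derivative[OF T(3), of F])
    fix T' assume T': "T' \<in> \<Delta>" "x \<in> T'"
    show "(F T' has_derivative (\<lambda>h. grad (F T) x \<bullet> h)) (at x)"
      unfolding gF[OF T(1) T'(1) T(2) T'(2) T(3)] by (rule Pd_grad[OF F6[OF T'(1)]])
  qed (use sF in blast)
  have gs: "grad s x = grad (F T) x" if "T \<in> \<Delta>" "x \<in> T" "x \<in> \<Omega>" for T x
    by (rule grad_eqI[OF ds[OF that]])
  have in_cell: "\<exists>T\<in>\<Delta>. x \<in> T" if "x \<in> closure \<Omega>" for x using that union by blast
  have 1: "s differentiable (at x)" if x: "x \<in> \<Omega>" for x
  proof -
    obtain T where "T \<in> \<Delta>" "x \<in> T" using in_cell[of x] x closure_subset by blast
    then show ?thesis using ds x differentiable_def by blast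
  qed
  have 2: "continuous_on \<Omega> (grad s)"
  proof (rule paste_continuous[of "grad s" "\<lambda>T. grad (F T)"])
    show "continuous_on UNIV (grad (F T))" if "T \<in> \<Delta>" for T
      by (intro continuous_at_imp_continuous_on ballI differentiable_imp_continuous_within
        Pd_grad_differentiable[OF F6[OF that]])
  qed (use gs in blast)
  have 3: "grad s differentiable (at v)" if v: "v \<in> VI D \<Delta>" for v
  proof -
    have v\<Omega>: "v \<in> \<Omega>" using VI_region[OF v] .
    obtain T0 where T0: "T0 \<in> \<Delta>" "v \<in> vertices D T0" using v unfolding VI_def by blast
    obtain H where H: "(grad (Q v) has_derivative H) (at v)"
      using Pd_grad_differentiable[OF Q[OF v]] differentiable_def by blast
    have v0: "v \<in> T0" using interior_vertex_cell[OF T0 v\<Omega>] cell_vertex_in by metis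
    have "(grad s has_derivative H) (at v)"
    proof (rule paste_derivative[OF v\<Omega>, of "\<lambda>T. grad (F T)"])
      fix T assume T: "T \<in> \<Delta>" "v \<in> T"
      show "(grad (F T) has_derivative H) (at v)"
      proof -
        \<comment> \<open>A cell through an interior vertex \<open>v\<close> has \<open>v\<close> as
          a vertex of its own: it meets \<open>T0\<close> in one of its vertices or in a common
          edge, and \<open>v\<close> is no inner point of an edge of \<open>T0\<close>.\<close>
        have "v \<in> vertices D T"
        proof (cases "T = T0")
          case False
          from cell_Int[OF T(1) T0(1) False] T(2) v0 consider w where "w \<in> vertices D T" "T \<inter> T0 = {w}"
            | "T \<inter> T0 \<in> straight_edges D T" "T \<inter> T0 \<in> straight_edges D T0" by blast
          then show ?thesis
          proof cases
            case 1
            then have "v = w" using T(2) v0 by (metis IntI singletonD)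
            then show ?thesis using 1(1) by simp
          next
            case 2
            obtain x y z where c: "is_cell D T0 x y z" "T \<inter> T0 = closed_segment x y"
              using 2(2) unfolding straight_edges_def by blast
            have "v \<in> {x, y, z}" using T0(2) cell_vertices[OF c(1)] by blast
            moreover have "v \<notin> open_segment x y"
              using area2_segment_iff_vertex(3)[OF cell_area2[OF c(1)]] \<open>v \<in> {x, y, z}\<close> by blast
            moreover have "v \<in> closed_segment x y" using c(2) T(2) v0 by blast
            ultimately have "v = x \<or> v = y" by (auto simp: open_segment_def)
            obtain z' where "is_cell D T x y z' \<or> is_cell D T y x z'"
              using edge_cell 2(1) unfolding c(2) by blast
            then show ?thesis using \<open>v = x \<or> v = y\<close> cell_vertices by blast
          qed
        qed (use T0 in simp)
        from van_3_grad_derivative[OF Pd_diff[OF F6[OF T(1)] Q[OF v]] vert[OF T(1) v this]]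
        moreover have "grad (\<lambda>x. F T x - Q v x) = (\<lambda>x. grad (F T) x - grad (Q v) x)"
          using grad_diff[OF Pd_differentiable[OF F6[OF T(1)]] Pd_differentiable[OF Q[OF v]]] by blast
        ultimately have "((\<lambda>x. grad (F T) x - grad (Q v) x) has_derivative (\<lambda>_. 0)) (at v)" by simp
        from has_derivative_add[OF this H] show ?thesis by simp
      qed
    qed (use gs in blast)
    then show ?thesis using differentiable_def by blast
  qed
  have "s \<in> S" unfolding spline_space_def
  proof (intro CollectI conjI ballI allI impI)
    show "s x = 0" if "x \<notin> closure \<Omega>" for x using that by (simp add: s_def)
    show "\<exists>p\<in>Pd 5. \<forall>x\<in>T. s x = p x" if "T \<in> ordinary D \<Delta>" for T
      using F5[OF that] sF ordinary_straight[OF that] by blast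
    show "\<exists>p\<in>Pd 6. \<forall>x\<in>T. s x = p x" if "T \<in> pies D \<Delta> \<union> buffers D \<Delta>" for T
    proof -
      have "T \<in> \<Delta>" using that by (auto simp: pies_def buffers_def)
      then show ?thesis using F6 sF by blast
    qed
    show "s x = 0" if x: "x \<in> \<Gamma>" for x
    proof -
      have "x \<in> closure \<Omega>" using x closure_region(1) by simp
      then obtain T where T: "T \<in> \<Delta>" "x \<in> T" using in_cell by blast
      from sF[OF T] zero[OF T x] show ?thesis by simp
    qed
    show "s differentiable (at x)" if "x \<in> \<Omega>" for x by (rule 1[OF that])
    show "grad s differentiable (at v)" if "v \<in> VI D \<Delta>" for v by (rule 3[OF that])
  qed (rule 2)
  then show ?thesis using sF by blast
qed

subsection \<open>Independence of the ordering of the vertices\<close>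

text \<open>The sets of functionals are taken over all orderings of the vertices, so one functional
  has several descriptions. Values prescribed for a functional must be met under each of
  them.\<close>

lemma tri_functional_swap:
  assumes st: "straight_tri T a b c" and T: "\<And>s. s \<in> S \<Longrightarrow> \<exists>p\<in>Pd d. \<forall>x\<in>T. s x = p x"
  shows "tri_functional S d T a c b (i, k, j) = tri_functional S d T a b c (i, j, k)"
proof
  fix s
  show "tri_functional S d T a c b (i, k, j) s = tri_functional S d T a b c (i, j, k) s"
  proof (cases "s \<in> S")
    case True
    then obtain p where p: "p \<in> Pd d" "\<And>x. x \<in> T \<Longrightarrow> s x = p x" using T by blast
    show ?thesis
      by (simp only: tri_functional_eval[OF True st p] tri_functional_eval[OF True straight_tri_perm(2)[OF st] p]
          bcoef_swap23[OF straight_tri_area2[OF st] p(1)])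
  qed (simp add: tri_functional_def)
qed

lemma pie_functional_swap:
  assumes T: "T \<in> \<Delta>" and p: "pie D T j a b c C"
  shows "pie_functional D S T j a c b (i, k, l) = pie_functional D S T j a b c (i, l, k)"
proof
  fix s
  show "pie_functional D S T j a c b (i, k, l) s = pie_functional D S T j a b c (i, l, k) s"
  proof (cases "s \<in> S")
    case True
    obtain h where h: "h \<in> Pd 4" "\<And>x. x \<in> T \<Longrightarrow> s x = pw j a x * h x"
      by (rule pie_factor[OF True T p]) blast
    show ?thesis
      by (simp only: pie_functional_eval[OF True T p h] pie_functional_eval[OF True T pie_swap[OF p] h]
          bcoef_swap23[OF pie_area2[OF p] h(1)])
  qed (simp add: pie_functional_def)
qed

end

lemma straight_tri_pair:
  assumes "straight_tri T v b c" "straight_tri T v b' c'"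
  shows "(b = b' \<and> c = c') \<or> (b = c' \<and> c = b')"
proof -
  have "insert v {b, c} = insert v {b', c'}" using straight_tri_unique[OF assms] .
  moreover have "v \<notin> {b, c}" "v \<notin> {b', c'}"
    using straight_tri_area2[OF assms(1)] straight_tri_area2[OF assms(2)] by (auto simp: area2_def)
  ultimately have "{b, c} = {b', c'}" using insert_ident by metis
  then show ?thesis by (simp add: doubleton_eq_iff)
qed

context pie_triangulation
begin

section \<open>Interpolation by splines\<close>

text \<open>\<open>X (K, l)\<close> is the value prescribed for the functional \<open>l\<close> on \<open>K\<close>. All data are stated for
  every ordering of the vertices of \<open>K\<close>, because the functionals do not come with a chosen one.\<close>

definition jet_data where
  "jet_data X v q \<longleftrightarrow> q \<in> Pd 5 \<and> (\<forall>b c. straight_tri (TI v) v b c \<longrightarrow>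
     (\<forall>\<alpha>\<in>indices 5. bcoef 5 v b c q \<alpha> = X (TI v, tri_functional S 5 (TI v) v b c \<alpha>)))"

lemma jet_exists:
  assumes v: "v \<in> VI D \<Delta>" shows "\<exists>q. jet_data X v q"
proof -
  have o: "TI v \<in> ordinary D \<Delta>" "v \<in> vertices D (TI v)" using TI[OF v] by auto
  obtain b c where st: "straight_tri (TI v) v b c" using ordinary_rep[OF o] .
  note nc = straight_tri_area2[OF st]
  define q where "q = bbpoly 5 v b c (\<lambda>\<alpha>. X (TI v, tri_functional S 5 (TI v) v b c \<alpha>))"
  have q: "q \<in> Pd 5" unfolding q_def by (rule bbpoly_Pd)
  have cq: "bcoef 5 v b c q \<alpha> = X (TI v, tri_functional S 5 (TI v) v b c \<alpha>)" if "\<alpha> \<in> indices 5" for \<alpha>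
    unfolding q_def bcoef_bbpoly[OF nc] using that by simp
  have "bcoef 5 v b' c' q \<alpha> = X (TI v, tri_functional S 5 (TI v) v b' c' \<alpha>)"
    if st': "straight_tri (TI v) v b' c'" and \<alpha>: "\<alpha> \<in> indices 5" for b' c' \<alpha>
    using straight_tri_pair[OF st' st]
  proof (elim disjE conjE)
    assume "b' = b" "c' = c" then show ?thesis using cq[OF \<alpha>] by simp
  next
    assume bc: "b' = c" "c' = b"
    obtain i j k where ijk: "\<alpha> = (i, j, k)" by (cases \<alpha>)
    have \<alpha>': "(i, k, j) \<in> indices 5" using \<alpha> ijk by (simp add: indices_def)
    show ?thesis unfolding bc ijk
      by (simp only: bcoef_swap23[OF nc q] cq[OF \<alpha>'] tri_functional_swap[OF st in_spline(6)[OF _ o(1)]])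
  qed
  then show ?thesis using q unfolding jet_data_def by blast
qed

text \<open>A quintic that merely stands for the values and gradients on the edge, to be matched by
  the pieces on both sides. Contact at the second end is included, since \<open>b\<close> and
  \<open>c\<close> may be exchanged.\<close>

definition edge_data where
  "edge_data X Q e q \<longleftrightarrow> q \<in> Pd 5 \<and> (\<forall>b c. e = closed_segment b c \<longrightarrow> van 3 (\<lambda>x. q x - Q b x) b) \<and>
     (\<forall>a b c. e = closed_segment b c \<longrightarrow> straight_tri (TE e) a b c \<longrightarrow>
        bcoef 5 a b c q (1, 2, 2) = X (TE e, tri_functional S 5 (TE e) a b c (1, 2, 2)))"

lemma edge_data_exists:
  assumes Q: "\<And>v. v \<in> VI D \<Delta> \<Longrightarrow> Q v \<in> Pd 5" and e: "e \<in> EI0 D \<Delta>"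
  shows "\<exists>q. edge_data X Q e q"
proof -
  have o: "TE e \<in> ordinary D \<Delta>" "e \<in> straight_edges D (TE e)" using TE[OF e] by auto
  then obtain b c where bc: "e = closed_segment b c" unfolding straight_edges_def by blast
  obtain a where st: "straight_tri (TE e) a b c" using ordinary_edge_rep[OF o(1)] o(2) bc by blast
  note nc = straight_tri_area2[OF st]
  have VI: "b \<in> VI D \<Delta>" "c \<in> VI D \<Delta>" using ordinary_vertices(2)[OF o(1) st] by auto
  obtain q where q: "q \<in> Pd 5" "van 3 (\<lambda>x. q x - Q b x) b" "van 3 (\<lambda>x. q x - Q c x) c"
    "bcoef 5 a b c q (1, 2, 2) = X (TE e, tri_functional S 5 (TE e) a b c (1, 2, 2))"
    using edge_interpolation[OF nc Q[OF VI(1)] Q[OF VI(2)]] .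
  have ends: "(b' = b \<and> c' = c) \<or> (b' = c \<and> c' = b)" if "e = closed_segment b' c'" for b' c'
    using that unfolding bc closed_segment_eq by (auto simp: doubleton_eq_iff)
  have "bcoef 5 a' b' c' q (1, 2, 2) = X (TE e, tri_functional S 5 (TE e) a' b' c' (1, 2, 2))"
    if e': "e = closed_segment b' c'" and st': "straight_tri (TE e) a' b' c'" for a' b' c'
    using ends[OF e']
  proof (elim disjE conjE)
    assume eq: "b' = b" "c' = c"
    have "straight_tri (TE e) b c a'" "straight_tri (TE e) b c a"
      using straight_tri_rot[OF straight_tri_rot[OF st']] straight_tri_rot[OF straight_tri_rot[OF st]] eq by simp_all
    then have "a' = a" using straight_tri_pair by blast
    then show ?thesis using q(4) eq by simp
  next
    assume eq: "b' = c" "c' = b"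
    have "straight_tri (TE e) b c a'" "straight_tri (TE e) b c a"
      using straight_tri_perm(1)[OF straight_tri_rot[OF straight_tri_rot[OF st']]]
        straight_tri_rot[OF straight_tri_rot[OF st]] eq by simp_all
    then have "a' = a" using straight_tri_pair by blast
    then show ?thesis unfolding eq
      by (simp only: bcoef_swap23[OF nc q(1)] q(4) tri_functional_swap[OF st in_spline(6)[OF _ o(1)]])
  qed
  moreover have "van 3 (\<lambda>x. q x - Q b' x) b'" if "e = closed_segment b' c'" for b' c'
    using ends[OF that] q(2,3) by (elim disjE conjE) simp_all
  ultimately show ?thesis unfolding edge_data_def using q(1) by blast
qed

definition ordinary_data where
  "ordinary_data Q E T p \<longleftrightarrow> p \<in> Pd 5 \<and> (\<forall>v\<in>vertices D T. van 3 (\<lambda>x. p x - Q v x) v) \<and>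
     (\<forall>e\<in>straight_edges D T. \<forall>x\<in>e. van 2 (\<lambda>x. p x - E e x) x)"

lemma ordinary_data_exists:
  assumes Q: "\<And>v. v \<in> VI D \<Delta> \<Longrightarrow> Q v \<in> Pd 5" and E: "\<And>e. e \<in> EI0 D \<Delta> \<Longrightarrow> edge_data X Q e (E e)"
    and T: "T \<in> ordinary D \<Delta>"
  shows "\<exists>p. ordinary_data Q E T p"
proof -
  obtain a b c where st: "straight_tri T a b c" using ordinary_straight[OF T] by blast
  have VI: "a \<in> VI D \<Delta>" "b \<in> VI D \<Delta>" "c \<in> VI D \<Delta>" using ordinary_vertices(2)[OF T st] by auto
  have st2: "straight_tri T b c a" "straight_tri T c a b"
    using straight_tri_rot[OF st] straight_tri_rot[OF straight_tri_rot[OF st]] by simp_all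
  have E': "E (closed_segment a b) \<in> Pd 5 \<and> van 3 (\<lambda>x. E (closed_segment a b) x - Q a x) a \<and>
      van 3 (\<lambda>x. E (closed_segment a b) x - Q b x) b" if "straight_tri T a b c" for a b c
    using E[OF ordinary_edge[OF T that]] closed_segment_commute[of a b] unfolding edge_data_def by blast
  note e = E'[OF st] E'[OF st2(1)] E'[OF st2(2)]
  obtain p where p: "p \<in> Pd 5"
    "van 3 (\<lambda>x. p x - Q a x) a" "van 3 (\<lambda>x. p x - Q b x) b" "van 3 (\<lambda>x. p x - Q c x) c"
    "\<forall>x\<in>closed_segment a b. van 2 (\<lambda>x. p x - E (closed_segment a b) x) x"
    "\<forall>x\<in>closed_segment b c. van 2 (\<lambda>x. p x - E (closed_segment b c) x) x"
    "\<forall>x\<in>closed_segment c a. van 2 (\<lambda>x. p x - E (closed_segment c a) x) x"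
    by (rule argyris_interpolation[OF straight_tri_area2[OF st], of "Q a" "Q b" "Q c" "E (closed_segment a b)"
        "E (closed_segment b c)" "E (closed_segment c a)"]) (use Q VI e in blast)+
  have "ordinary_data Q E T p"
    unfolding ordinary_data_def straight_vertices(1)[OF st] straight_vertices(2)[OF st]
    using p closed_segment_commute[of c a] by auto
  then show ?thesis by blast
qed

text \<open>The vector \<open>g\<close> is the gradient that the spline is to have at the boundary
  vertex. It must be a multiple of the conic normal of every pie-shaped triangle there; on
  \<open>VB1\<close> the chosen triangle prescribes the multiple.\<close>

definition gradient_data where
  "gradient_data X v g \<longleftrightarrow> (\<forall>P\<in>pies D \<Delta>. \<forall>j a c C. pie D P j a v c C \<longrightarrow> (\<exists>\<mu>. \<mu> *\<^sub>R grad (pw j a) v = g)) \<and>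
     (v \<in> VB1 D \<Delta> \<longrightarrow> (\<forall>j a c C. pie D (TB v) j a v c C \<longrightarrow>
        X (TB v, pie_functional D S (TB v) j a v c (0, 4, 0)) *\<^sub>R grad (pw j a) v = g))"

text \<open>Off \<open>VB1\<close> the zero gradient serves all triangles. On \<open>VB1\<close> the
  normals of all pie-shaped triangles at \<open>v\<close> are parallel, so the value prescribed in
  one of them can be realised in the others.\<close>

lemma gradient_data_exists: "\<exists>g. gradient_data X v g"
proof (cases "v \<in> VB1 D \<Delta>")
  case False
  have "gradient_data X v 0" unfolding gradient_data_def using False by (auto intro: exI[of _ 0])
  then show ?thesis ..
next
  case True
  have P: "TB v \<in> pies D \<Delta>" "v \<in> vertices D (TB v)" using TB[OF True] by auto
  then have PD: "TB v \<in> \<Delta>" by (simp add: pies_def)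
  have "v \<in> \<Gamma>" using True VB_boundary unfolding VB1_def by blast
  then obtain j a c C where p: "pie D (TB v) j a v c C" using pie_rep[OF P] by blast
  let ?X = "X (TB v, pie_functional D S (TB v) j a v c (0, 4, 0))"
  have "gradient_data X v (?X *\<^sub>R grad (pw j a) v)"
    unfolding gradient_data_def
  proof (intro conjI impI ballI allI)
    fix P' j' a' c' C' assume P': "P' \<in> pies D \<Delta>" and p': "pie D P' j' a' v c' C'"
    have PD': "P' \<in> \<Delta>" using P' by (simp add: pies_def)
    have "cross2 (grad (pw j a) v) (grad (pw j' a') v) = 0"
      unfolding cross2_pw[OF PD p PD' p'] by (rule pies_at_VB1[OF True p p'])
    then obtain \<mu> where "grad (pw j a) v = \<mu> *\<^sub>R grad (pw j' a') v"
      using cross2_zero_scale grad_pw_nonzero[OF PD' p'] by blast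
    then show "\<exists>\<mu>. \<mu> *\<^sub>R grad (pw j' a') v = ?X *\<^sub>R grad (pw j a) v"
      by (intro exI[of _ "?X * \<mu>"]) simp
  next
    fix j' a' c' C' assume p': "pie D (TB v) j' a' v c' C'"
    have "j' = j" "a' = a" "{v, c'} = {v, c}" using pie_unique[OF p' p] by auto
    moreover from this(3) have "c' = c" by (auto simp: doubleton_eq_iff)
    ultimately show "X (TB v, pie_functional D S (TB v) j' a' v c' (0, 4, 0)) *\<^sub>R grad (pw j' a') v =
       ?X *\<^sub>R grad (pw j a) v" by simp
  qed
  then show ?thesis ..
qed

text \<open>The conditions at boundary vertices are stated for \<open>b\<close> only, because
  \<open>b\<close> and \<open>c\<close> may be exchanged in the description.\<close>

definition pie_data where
  "pie_data X Q g P h \<longleftrightarrow> h \<in> Pd 4 \<and> (\<forall>j a b c C. pie D P j a b c C \<longrightarrow>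
     van 3 (\<lambda>x. pw j a x * h x - Q a x) a \<and>
     (\<forall>\<alpha>\<in>{(1,3,0), (1,2,1), (1,1,2), (1,0,3), (0,2,2)}. bcoef 4 a b c h \<alpha> = X (P, pie_functional D S P j a b c \<alpha>)) \<and>
     h b *\<^sub>R grad (pw j a) b = g b \<and>
     (\<forall>B\<in>buffers D \<Delta>. \<forall>z. straight_tri B b a z \<longrightarrow>
        bcoef 6 b a z (\<lambda>x. pw j a x * h x) (4, 1, 1) = X (B, tri_functional S 6 B b a z (4, 1, 1))))"

lemma pie_data_exists:
  assumes Q: "\<And>v. v \<in> VI D \<Delta> \<Longrightarrow> Q v \<in> Pd 5" and g: "\<And>v. gradient_data X v (g v)"
    and P: "P \<in> pies D \<Delta>"
  shows "\<exists>h. pie_data X Q g P h"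
proof -
  obtain j a b c C where p: "pie D P j a b c C" and PD: "P \<in> \<Delta>" using P unfolding pies_def by blast
  note p2 = pie_swap[OF p]
  have bc\<Gamma>: "b \<in> \<Gamma>" "c \<in> \<Gamma>" using pie_a_region[OF PD p] by auto
  have VI: "a \<in> VI D \<Delta>" using VI_I[OF PD pie_is_cell[OF p]] pie_a_region(1)[OF PD p] by blast
  obtain Bb zb where Bb: "Bb \<in> buffers D \<Delta>" "straight_tri Bb b a zb" using pie_buffer[OF P p] .
  obtain Bc zc where Bc: "Bc \<in> buffers D \<Delta>" "straight_tri Bc c a zc" using pie_buffer[OF P p2] .
  obtain \<mu>b where \<mu>b: "\<mu>b *\<^sub>R grad (pw j a) b = g b" using g[of b] P p unfolding gradient_data_def by blast
  obtain \<mu>c where \<mu>c: "\<mu>c *\<^sub>R grad (pw j a) c = g c" using g[of c] P p2 unfolding gradient_data_def by blast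
  let ?five = "{(1,3,0), (1,2,1), (1,1,2), (1,0,3), (0,2,2)} :: (nat \<times> nat \<times> nat) set"
  note w = pw(1,2,3,4,8,9)[OF PD p]
  obtain h where h: "h \<in> Pd 4" "van 3 (\<lambda>x. pw j a x * h x - Q a x) a"
    "\<forall>\<alpha>\<in>?five. bcoef 4 a b c h \<alpha> = X (P, pie_functional D S P j a b c \<alpha>)"
    "h b = \<mu>b" "h c = \<mu>c"
    "bcoef 6 b a zb (\<lambda>x. pw j a x * h x) (4, 1, 1) = X (Bb, tri_functional S 6 Bb b a zb (4, 1, 1))"
    "bcoef 6 c a zc (\<lambda>x. pw j a x * h x) (4, 1, 1) = X (Bc, tri_functional S 6 Bc c a zc (4, 1, 1))"
    by (rule pie_interpolation[OF pie_area2[OF p] straight_tri_area2[OF Bb(2)] straight_tri_area2[OF Bc(2)]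
          w Q[OF VI], of "\<lambda>\<alpha>. X (P, pie_functional D S P j a b c \<alpha>)" \<mu>b \<mu>c
          "X (Bb, tri_functional S 6 Bb b a zb (4, 1, 1))" "X (Bc, tri_functional S 6 Bc c a zc (4, 1, 1))"])
  \<comment> \<open>The buffer triangle at \<open>b\<close> and its third vertex are unique, so the
    mixed derivative arranged for one description serves for all.\<close>
  have buf: "bcoef 6 b a z (\<lambda>x. pw j a x * h x) (4, 1, 1) = X (B, tri_functional S 6 B b a z (4, 1, 1))"
    if eq: "bcoef 6 b a zb (\<lambda>x. pw j a x * h x) (4, 1, 1) = X (Bb, tri_functional S 6 Bb b a zb (4, 1, 1))"
      and Bb: "Bb \<in> buffers D \<Delta>" "straight_tri Bb b a zb" and B: "B \<in> buffers D \<Delta>" "straight_tri B b a z"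
      and b: "b \<in> \<Gamma>" for b Bb zb B z
  proof -
    have "B = Bb" using buffer_at_vertex_unique[OF B Bb b] .
    moreover have "z = zb" using straight_tri_pair[OF B(2)[unfolded \<open>B = Bb\<close>] Bb(2)] by blast
    ultimately show ?thesis using eq by simp
  qed
  have five2: "\<forall>\<alpha>\<in>?five. bcoef 4 a c b h \<alpha> = X (P, pie_functional D S P j a c b \<alpha>)"
  proof
    fix \<alpha> assume \<alpha>: "\<alpha> \<in> ?five"
    obtain i k l where ikl: "\<alpha> = (i, k, l)" by (cases \<alpha>)
    have "(i, l, k) \<in> ?five" using \<alpha> unfolding ikl by auto
    then show "bcoef 4 a c b h \<alpha> = X (P, pie_functional D S P j a c b \<alpha>)"
      unfolding ikl using h(3) by (simp only: bcoef_swap23[OF pie_area2[OF p] h(1)] pie_functional_swap[OF PD p])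
  qed
  have "pie_data X Q g P h" unfolding pie_data_def
  proof (intro conjI[OF h(1)] allI impI)
    fix j' a' b' c' C' assume p': "pie D P j' a' b' c' C'"
    have ja: "j' = j" "a' = a" and "{b', c'} = {b, c}" using pie_unique[OF p' p] by auto
    then consider "b' = b" "c' = c" | "b' = c" "c' = b" by (auto simp: doubleton_eq_iff)
    then show "van 3 (\<lambda>x. pw j' a' x * h x - Q a' x) a' \<and>
     (\<forall>\<alpha>\<in>?five. bcoef 4 a' b' c' h \<alpha> = X (P, pie_functional D S P j' a' b' c' \<alpha>)) \<and>
     h b' *\<^sub>R grad (pw j' a') b' = g b' \<and>
     (\<forall>B\<in>buffers D \<Delta>. \<forall>z. straight_tri B b' a' z \<longrightarrow>
        bcoef 6 b' a' z (\<lambda>x. pw j' a' x * h x) (4, 1, 1) = X (B, tri_functional S 6 B b' a' z (4, 1, 1)))"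
    proof cases
      case 1
      show ?thesis unfolding ja 1
        by (intro conjI ballI allI impI h(2) h(3)[rule_format] buf[OF h(6) Bb _ _ bc\<Gamma>(1)])
          (use \<mu>b h(4) in simp_all)
    next
      case 2
      show ?thesis unfolding ja 2
        by (intro conjI ballI allI impI h(2) five2[rule_format] buf[OF h(7) Bc _ _ bc\<Gamma>(2)])
          (use \<mu>c h(5) in simp_all)
    qed
  qed
  then show ?thesis by blast
qed

definition buffer_data where
  "buffer_data X Q E H B q \<longleftrightarrow> q \<in> Pd 6 \<and> (\<forall>v a z. straight_tri B v a z \<longrightarrow> v \<in> \<Gamma> \<longrightarrow>
     van 3 (\<lambda>x. q x - Q a x) a \<and>
     (\<forall>x\<in>closed_segment a z. van 2 (\<lambda>x. q x - E (closed_segment a z) x) x) \<and>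
     bcoef 6 v a z q (4, 1, 1) = X (B, tri_functional S 6 B v a z (4, 1, 1)) \<and>
     bcoef 6 v a z q (2, 2, 2) = X (B, tri_functional S 6 B v a z (2, 2, 2)) \<and>
     (\<forall>P\<in>pies D \<Delta>. \<forall>j c C. pie D P j a v c C \<longrightarrow>
        (\<forall>x\<in>closed_segment v a. van 2 (\<lambda>x. q x - pw j a x * H P x) x)))"

lemma buffer_data_exists:
  assumes Q: "\<And>v. v \<in> VI D \<Delta> \<Longrightarrow> Q v \<in> Pd 5" and E: "\<And>e. e \<in> EI0 D \<Delta> \<Longrightarrow> edge_data X Q e (E e)"
    and H: "\<And>P. P \<in> pies D \<Delta> \<Longrightarrow> pie_data X Q g P (H P)" and B: "B \<in> buffers D \<Delta>"
  shows "\<exists>q. buffer_data X Q E H B q"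
proof -
  obtain v a b where st: "straight_tri B v a b" and v: "v \<in> \<Gamma>" using buffer_structure[OF B] .
  note st2 = straight_tri_perm(2)[OF st]
  note nc = straight_tri_area2[OF st]
  have BD: "B \<in> \<Delta>" using buffer_straight[OF B] by blast
  have B6: "\<exists>p\<in>Pd 6. \<forall>x\<in>B. s x = p x" if "s \<in> S" for s using in_spline(7)[OF that] B by blast
  let ?e = "closed_segment a b"
  have e: "?e \<in> EI0 D \<Delta>" using buffer_pies(4)[OF B st v] .
  have ab: "a \<in> \<Omega>" "b \<in> \<Omega>" using buffer_pies(1,2)[OF B st v] by auto
  have VI: "a \<in> VI D \<Delta>" "b \<in> VI D \<Delta>"
    using VI_I[OF BD straight_cell[OF st]] ab by blast+
  obtain P1 j1 c1 C1 P2 j2 c2 C2 where P: "P1 \<in> pies D \<Delta>" "pie D P1 j1 a v c1 C1"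
    "P2 \<in> pies D \<Delta>" "pie D P2 j2 b v c2 C2" "P1 \<noteq> P2" using two_pies[OF B st v] .
  have PD: "P1 \<in> \<Delta>" "P2 \<in> \<Delta>" using P by (simp_all add: pies_def)
  let ?G1 = "\<lambda>x. pw j1 a x * H P1 x" and ?G2 = "\<lambda>x. pw j2 b x * H P2 x"
  have H4: "H P1 \<in> Pd 4" "H P2 \<in> Pd 4" using H P unfolding pie_data_def by blast+
  note w1 = pw(1)[OF PD(1) P(2)] and w2 = pw(1)[OF PD(2) P(4)]
  have G: "?G1 \<in> Pd 6" "?G2 \<in> Pd 6" using Pd_mult[OF w1 H4(1)] Pd_mult[OF w2 H4(2)] by simp_all
  have h1: "van 3 (\<lambda>x. ?G1 x - Q a x) a" "H P1 v *\<^sub>R grad (pw j1 a) v = g v"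
    "bcoef 6 v a b ?G1 (4, 1, 1) = X (B, tri_functional S 6 B v a b (4, 1, 1))"
    using H[OF P(1)] P(2) B st unfolding pie_data_def by blast+
  have h2: "van 3 (\<lambda>x. ?G2 x - Q b x) b" "H P2 v *\<^sub>R grad (pw j2 b) v = g v"
    "bcoef 6 v b a ?G2 (4, 1, 1) = X (B, tri_functional S 6 B v b a (4, 1, 1))"
    using H[OF P(3)] P(4) B st2 unfolding pie_data_def by blast+
  have h2': "bcoef 6 v a b ?G2 (4, 1, 1) = X (B, tri_functional S 6 B v a b (4, 1, 1))"
    using h2(3) by (simp only: bcoef_swap23[OF nc G(2)] tri_functional_swap[OF st B6])
  have E5: "E ?e \<in> Pd 5" and Ea: "van 3 (\<lambda>x. E ?e x - Q a x) a" and Eb: "van 3 (\<lambda>x. E ?e x - Q b x) b"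
    using E[OF e] closed_segment_commute[of a b] unfolding edge_data_def by blast+
  have E6: "E ?e \<in> Pd 6" using Pd_mono[OF E5] by simp
  \<comment> \<open>Both products are 0 at \<open>v\<close>, and both have there the gradient
    \<open>g v\<close>.\<close>
  have v2: "van 2 (\<lambda>x. ?G1 x - ?G2 x) v"
    unfolding van_2_iff[OF Pd_diff[OF G]] grad_diff[OF Pd_differentiable[OF G(1)] Pd_differentiable[OF G(2)]]
      grad_pie_product[OF PD(1) P(2) H4(1)] grad_pie_product[OF PD(2) P(4) H4(2)] h1(2) h2(2)
    using pw(3)[OF PD(1) P(2)] pw(3)[OF PD(2) P(4)] by simp
  \<comment> \<open>From either side the mixed derivative was made equal to the value prescribed for
    one and the same functional of the buffer triangle.\<close>
  have c411: "bcoef 6 v a b ?G1 (4, 1, 1) = bcoef 6 v a b ?G2 (4, 1, 1)" using h1(3) h2' by simp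
  obtain q where q: "q \<in> Pd 6"
    "\<forall>x\<in>closed_segment v a. van 2 (\<lambda>x. q x - ?G1 x) x"
    "\<forall>x\<in>closed_segment v b. van 2 (\<lambda>x. q x - ?G2 x) x"
    "\<forall>x\<in>closed_segment a b. van 2 (\<lambda>x. q x - E ?e x) x"
    "van 3 (\<lambda>x. q x - E ?e x) a" "van 3 (\<lambda>x. q x - E ?e x) b"
    "bcoef 6 v a b q (4, 1, 1) = bcoef 6 v a b ?G1 (4, 1, 1)"
    "bcoef 6 v a b q (2, 2, 2) = X (B, tri_functional S 6 B v a b (2, 2, 2))"
    by (rule buffer_interpolation[OF nc G E6 v2 c411 van_trans[OF h1(1) van_sym[OF Ea]]
          van_trans[OF h2(1) van_sym[OF Eb]], of "X (B, tri_functional S 6 B v a b (2, 2, 2))"])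
  have q411: "bcoef 6 v a b q (4, 1, 1) = X (B, tri_functional S 6 B v a b (4, 1, 1))"
    using q(7) h1(3) by simp
  have pies: "\<forall>x\<in>closed_segment v a. van 2 (\<lambda>x. q x - pw j a x * H P x) x"
    if eq: "\<forall>x\<in>closed_segment v a. van 2 (\<lambda>x. q x - pw j1 a x * H P1 x) x"
      and P1: "P1 \<in> pies D \<Delta>" "pie D P1 j1 a v c1 C1" and P: "P \<in> pies D \<Delta>" "pie D P j a v c C"
    for a P1 j1 c1 C1 P j c C
  proof -
    have "P = P1" using pie_edge_same[OF P(1) P1(1) P(2) P1(2)] .
    moreover have "j = j1" using pie_unique(1)[OF P(2)[unfolded \<open>P = P1\<close>] P1(2)] .
    ultimately show ?thesis using eq by simp
  qed
  have "buffer_data X Q E H B q" unfolding buffer_data_def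
  proof (intro conjI[OF q(1)] allI impI)
    fix v' a' z' assume st': "straight_tri B v' a' z'" and v': "v' \<in> \<Gamma>"
    have "v' \<in> {v, a, b}" using straight_tri_unique[OF st' st] by blast
    then have vv: "v' = v" using v' ab closure_region(2) by blast
    from straight_tri_pair[OF st'[unfolded vv] st] consider "a' = a" "z' = b" | "a' = b" "z' = a" by blast
    then show "van 3 (\<lambda>x. q x - Q a' x) a' \<and>
     (\<forall>x\<in>closed_segment a' z'. van 2 (\<lambda>x. q x - E (closed_segment a' z') x) x) \<and>
     bcoef 6 v' a' z' q (4, 1, 1) = X (B, tri_functional S 6 B v' a' z' (4, 1, 1)) \<and>
     bcoef 6 v' a' z' q (2, 2, 2) = X (B, tri_functional S 6 B v' a' z' (2, 2, 2)) \<and>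
     (\<forall>P\<in>pies D \<Delta>. \<forall>j c C. pie D P j a' v' c C \<longrightarrow>
        (\<forall>x\<in>closed_segment v' a'. van 2 (\<lambda>x. q x - pw j a' x * H P x) x))"
    proof cases
      case 1
      show ?thesis unfolding vv 1
        using van_trans[OF q(5) Ea] q(4) q411 q(8) pies[OF q(2) P(1,2)] by blast
    next
      case 2
      have "bcoef 6 v b a q (4, 1, 1) = X (B, tri_functional S 6 B v b a (4, 1, 1))"
        "bcoef 6 v b a q (2, 2, 2) = X (B, tri_functional S 6 B v b a (2, 2, 2))"
        using q411 q(8) by (simp_all only: bcoef_swap23[OF nc q(1)] tri_functional_swap[OF st B6])
      then show ?thesis unfolding vv 2 closed_segment_commute[of b a]
        using van_trans[OF q(6) Eb] q(4) pies[OF q(3) P(3,4)] by blast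
    qed
  qed
  then show ?thesis by blast
qed

lemma data_spline:
  assumes Q: "\<And>v. v \<in> VI D \<Delta> \<Longrightarrow> Q v \<in> Pd 5"
    and E: "\<And>e. e \<in> EI0 D \<Delta> \<Longrightarrow> edge_data X Q e (E e)"
    and F: "\<And>T. T \<in> ordinary D \<Delta> \<Longrightarrow> ordinary_data Q E T (F T)"
    and H: "\<And>P. P \<in> pies D \<Delta> \<Longrightarrow> pie_data X Q g P (H P)"
    and G: "\<And>B. B \<in> buffers D \<Delta> \<Longrightarrow> buffer_data X Q E H B (G B)"
  obtains s where "s \<in> S" "\<And>T x. T \<in> ordinary D \<Delta> \<Longrightarrow> x \<in> T \<Longrightarrow> s x = F T x"
    "\<And>B x. B \<in> buffers D \<Delta> \<Longrightarrow> x \<in> B \<Longrightarrow> s x = G B x"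
    "\<And>P j a b c C x. P \<in> pies D \<Delta> \<Longrightarrow> pie D P j a b c C \<Longrightarrow> x \<in> P \<Longrightarrow> s x = pw j a x * H P x"
proof -
  \<comment> \<open>The choice is harmless, since \<open>j\<close> and \<open>a\<close> are
    determined by the cell.\<close>
  define f where "f T = (if T \<in> pies D \<Delta> then SOME p. \<exists>j a b c C. pie D T j a b c C \<and> p = (\<lambda>x. pw j a x * H T x)
    else if T \<in> buffers D \<Delta> then G T else F T)" for T
  have fP: "f P = (\<lambda>x. pw j a x * H P x)" if P: "P \<in> pies D \<Delta>" "pie D P j a b c C" for P j a b c C
  proof -
    have "(SOME p. \<exists>j a b c C. pie D P j a b c C \<and> p = (\<lambda>x. pw j a x * H P x)) = (\<lambda>x. pw j a x * H P x)"
      by (rule some_equality) (use P pie_unique(1,2)[OF P(2)] in blast)+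
    then show ?thesis unfolding f_def using P(1) by simp
  qed
  have fB: "f B = G B" if "B \<in> buffers D \<Delta>" for B using that buffer_straight[OF that] by (simp add: f_def)
  have fO: "f T = F T" if "T \<in> ordinary D \<Delta>" for T using that ordinary_straight[OF that] by (simp add: f_def)
  have pies_rep: "\<exists>j a b c C. pie D P j a b c C \<and> P \<in> \<Delta>" if "P \<in> pies D \<Delta>" for P
    using that unfolding pies_def by blast
  have nonpie: "van 2 (\<lambda>x. f T x - E e x) x"
    if T: "T \<in> \<Delta>" "T \<notin> pies D \<Delta>" and e: "e \<in> straight_edges D T" "\<not> pie_edge e" and x: "x \<in> e" for T e x
    using cell_kinds[OF T(1)]
  proof (elim disjE)
    assume o: "T \<in> ordinary D \<Delta>"
    show ?thesis using F[OF o] e(1) x unfolding fO[OF o] ordinary_data_def by blast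
  next
    assume B: "T \<in> buffers D \<Delta>"
    obtain v a1 a2 where st: "straight_tri T v a1 a2" and v: "v \<in> \<Gamma>" using buffer_structure[OF B] .
    have "e \<in> {closed_segment v a1, closed_segment a1 a2, closed_segment v a2}"
      using e(1) straight_vertices(2)[OF st] by simp
    then have "e = closed_segment a1 a2" using e(2) fan[OF v T st] by auto
    then show ?thesis using G[OF B] st v x unfolding fB[OF B] buffer_data_def by blast
  qed (use T in simp)
  have pb: "van 2 (\<lambda>x. f T x - f P x) x"
    if P: "P \<in> pies D \<Delta>" and T: "T \<in> \<Delta>" "T \<noteq> P" and e: "e \<in> straight_edges D P" "e \<in> straight_edges D T"
      and x: "x \<in> e" for P T e x
  proof -
    have Tp: "T \<notin> pies D \<Delta>" using pies_edges[OF P _ T(2)[symmetric]] e by blast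
    have B: "T \<in> buffers D \<Delta>"
      by (rule nonpie_pie_edge_buffer[OF T(1) Tp e(2)]) (use P e(1) in \<open>auto simp: pie_edge_def\<close>)
    obtain j a b c C where p: "pie D P j a b c C" "P \<in> \<Delta>" using pies_rep[OF P] by blast
    have "e = closed_segment a b \<or> e = closed_segment a c" using e(1) pie_vertices(2)[OF p(1)] by blast
    then obtain b c where p: "pie D P j a b c C" and eb: "e = closed_segment b a"
      using p pie_swap[OF p(1)] by (metis closed_segment_commute)
    have PD: "P \<in> \<Delta>" using P by (simp add: pies_def)
    have b: "b \<in> \<Gamma>" using pie_a_region(2)[OF PD p] .
    obtain z where "is_cell D T b a z \<or> is_cell D T a b z" using edge_cell e(2) unfolding eb by blast
    then have "straight_tri T b a z"
      using nonpie_straight[OF T(1) Tp] straight_tri_perm(1) by blast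
    then show ?thesis
      using G[OF B] b P p x unfolding fB[OF B] fP[OF P p] eb buffer_data_def by blast
  qed
  have Q6: "Q v \<in> Pd 6" if "v \<in> VI D \<Delta>" for v using Pd_mono[OF Q[OF that]] by simp
  have 1: "f T \<in> Pd 6" if T: "T \<in> \<Delta>" for T
    using cell_kinds[OF T]
  proof (elim disjE)
    assume o: "T \<in> ordinary D \<Delta>"
    have "F T \<in> Pd 5" using F[OF o] unfolding ordinary_data_def by blast
    then show ?thesis unfolding fO[OF o] using Pd_mono[of "F T" 5 6] by simp
  next
    assume P: "T \<in> pies D \<Delta>"
    obtain j a b c C where p: "pie D T j a b c C" using pies_rep[OF P] by blast
    have "H T \<in> Pd 4" using H[OF P] unfolding pie_data_def by blast
    then show ?thesis unfolding fP[OF P p] using Pd_mult[OF pw(1)[OF T p]] by fastforce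
  next
    assume B: "T \<in> buffers D \<Delta>"
    then show ?thesis unfolding fB[OF B] using G[OF B] unfolding buffer_data_def by blast
  qed
  have 2: "f T \<in> Pd 5" if o: "T \<in> ordinary D \<Delta>" for T
    unfolding fO[OF o] using F[OF o] unfolding ordinary_data_def by blast
  have 3: "van 2 (\<lambda>x. f T x - f T' x) x"
    if T: "T \<in> \<Delta>" "T' \<in> \<Delta>" "T \<noteq> T'" and e: "e \<in> straight_edges D T" "e \<in> straight_edges D T'" and x: "x \<in> e"
    for T T' e x
  proof (cases "T \<in> pies D \<Delta> \<or> T' \<in> pies D \<Delta>")
    case True
    then show ?thesis using pb[of T' T e x] van_sym[OF pb[of T T' e x]] T e x by blast
  next
    case False
    \<comment> \<open>Otherwise both cells would be buffer triangles, and two of these never share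
      an edge.\<close>
    have "\<not> pie_edge e"
    proof
      assume pe: "pie_edge e"
      have "T \<in> buffers D \<Delta>" "T' \<in> buffers D \<Delta>" using nonpie_pie_edge_buffer pe T e False by blast+
      then show False using buffers_edges[OF _ _ T(3)] e by blast
    qed
    then show ?thesis
      using van_trans[OF nonpie[OF T(1) _ e(1) _ x] van_sym[OF nonpie[OF T(2) _ e(2) _ x]]] False by blast
  qed
  have 4: "van 3 (\<lambda>x. f T x - Q v x) v" if T: "T \<in> \<Delta>" and v: "v \<in> VI D \<Delta>" "v \<in> vertices D T" for T v
    using cell_kinds[OF T]
  proof (elim disjE)
    assume o: "T \<in> ordinary D \<Delta>"
    show ?thesis using F[OF o] v(2) unfolding fO[OF o] ordinary_data_def by blast
  next
    assume P: "T \<in> pies D \<Delta>"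
    obtain j a b c C where p: "pie D T j a b c C" using pies_rep[OF P] by blast
    have "v \<in> {a, b, c}" using v(2) pie_vertices(1)[OF p] by simp
    moreover have "v \<noteq> b" "v \<noteq> c"
      using pie_a_region(2,3)[OF T p] VI_region[OF v(1)] closure_region(2) by (metis IntI empty_iff)+
    ultimately have "v = a" by simp
    then show ?thesis using H[OF P] p unfolding fP[OF P p] pie_data_def by blast
  next
    assume B: "T \<in> buffers D \<Delta>"
    obtain w a1 a2 where st: "straight_tri T w a1 a2" and w: "w \<in> \<Gamma>" using buffer_structure[OF B] .
    have "v \<in> {w, a1, a2}" using v(2) straight_vertices(1)[OF st] by simp
    moreover have "v \<noteq> w" using w VI_region[OF v(1)] closure_region(2) by (metis IntI empty_iff)
    ultimately have "v = a1 \<or> v = a2" by simp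
    then show ?thesis using G[OF B] st straight_tri_perm(2)[OF st] w unfolding fB[OF B] buffer_data_def by blast
  qed
  have 5: "f T x = 0" if T: "T \<in> \<Delta>" and x: "x \<in> T" "x \<in> \<Gamma>" for T x
    using cell_kinds[OF T]
  proof (elim disjE)
    assume o: "T \<in> ordinary D \<Delta>"
    show ?thesis using cell_region_boundary(1)[OF T o] x by blast
  next
    assume P: "T \<in> pies D \<Delta>"
    obtain j a b c C where p: "pie D T j a b c C" using pies_rep[OF P] by blast
    have "x \<in> C" using cell_region_boundary(3)[OF T p] x by blast
    then show ?thesis unfolding fP[OF P p] using pw(5)[OF T p] by simp
  next
    assume B: "T \<in> buffers D \<Delta>"
    obtain w a1 a2 where st: "straight_tri T w a1 a2" and w: "w \<in> \<Gamma>" using buffer_structure[OF B] .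
    have xw: "x = w" using cell_region_boundary(2)[OF T B st w] x by blast
    obtain P j c C where P: "P \<in> pies D \<Delta>" "pie D P j a1 w c C" using buffer_pies(5)[OF B st w] by blast
    have PD: "P \<in> \<Delta>" using P by (simp add: pies_def)
    have "w \<in> closed_segment w a1" by simp
    then have "van 2 (\<lambda>x. G T x - pw j a1 x * H P x) w"
      using G[OF B] st w P unfolding buffer_data_def by blast
    then have "G T w - pw j a1 w * H P w = 0"
      using van_Suc_imp_zero[of 1 "\<lambda>x. G T x - pw j a1 x * H P x" w] by (simp add: numeral_2_eq_2)
    then show ?thesis unfolding xw fB[OF B] using pw(3)[OF PD P(2)] by simp
  qed
  have "\<exists>s\<in>S. \<forall>T\<in>\<Delta>. \<forall>x\<in>T. s x = f T x"
    by (rule spline_from_pieces[of f Q]) (fact 1 2 3 4 Q6 5)+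
  then obtain s where s: "s \<in> S" "\<forall>T\<in>\<Delta>. \<forall>x\<in>T. s x = f T x" by blast
  show thesis
  proof (rule that[OF s(1)])
    show "s x = F T x" if "T \<in> ordinary D \<Delta>" "x \<in> T" for T x
      using s(2) that ordinary_straight[OF that(1)] fO[OF that(1)] by metis
    show "s x = G B x" if "B \<in> buffers D \<Delta>" "x \<in> B" for B x
      using s(2) that buffer_straight[OF that(1)] fB[OF that(1)] by metis
    show "s x = pw j a x * H P x" if P: "P \<in> pies D \<Delta>" "pie D P j a b c C" "x \<in> P" for P j a b c C x
    proof -
      have "P \<in> \<Delta>" using P(1) by (simp add: pies_def)
      then show ?thesis using s(2) P(3) fP[OF P(1,2)] by metis
    qed
  qed
qed

lemma vertex_indices:
  assumes "\<alpha> \<in> {(5,0,0), (4,1,0), (4,0,1), (3,2,0), (3,0,2), (3,1,1)}"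
  obtains i j k :: nat where "\<alpha> = (i, j, k)" "i + j + k = 5" "j + k < 3"
proof -
  obtain i j k where "\<alpha> = (i, j, k)" by (cases \<alpha>)
  then show thesis using assms by (intro that[of i j k]) auto
qed

text \<open>The prescribed values depend on the pair, not just on the functional. Solvability for
  all such \<open>X\<close> is thus stronger than linear independence: it also shows that pairs with
  different triangles carry different functionals.\<close>

theorem spline_interpolation: "\<exists>s\<in>S. \<forall>(K, l)\<in>LM. l s = X (K, l)"
proof -
  have "\<forall>v\<in>VI D \<Delta>. \<exists>q. jet_data X v q" using jet_exists by blast
  from bchoice[OF this] obtain Q where Q: "\<And>v. v \<in> VI D \<Delta> \<Longrightarrow> jet_data X v (Q v)" by blast
  then have Q5: "Q v \<in> Pd 5" if "v \<in> VI D \<Delta>" for v using that unfolding jet_data_def by blast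
  have "\<forall>e\<in>EI0 D \<Delta>. \<exists>q. edge_data X Q e q" by (intro ballI, rule edge_data_exists[OF Q5])
  from bchoice[OF this] obtain E where E: "\<And>e. e \<in> EI0 D \<Delta> \<Longrightarrow> edge_data X Q e (E e)" by blast
  have "\<forall>T\<in>ordinary D \<Delta>. \<exists>p. ordinary_data Q E T p" by (intro ballI, rule ordinary_data_exists[OF Q5 E])
  from bchoice[OF this] obtain F where F: "\<And>T. T \<in> ordinary D \<Delta> \<Longrightarrow> ordinary_data Q E T (F T)" by blast
  obtain g where g: "\<And>v. gradient_data X v (g v)"
    using Hilbert_Choice.choice[OF allI, of "gradient_data X", OF gradient_data_exists] by blast
  have "\<forall>P\<in>pies D \<Delta>. \<exists>h. pie_data X Q g P h" by (intro ballI, rule pie_data_exists[OF Q5 g])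
  from bchoice[OF this] obtain H where H: "\<And>P. P \<in> pies D \<Delta> \<Longrightarrow> pie_data X Q g P (H P)" by blast
  have "\<forall>B\<in>buffers D \<Delta>. \<exists>q. buffer_data X Q E H B q" by (intro ballI, rule buffer_data_exists[OF Q5 E H])
  from bchoice[OF this] obtain G where G: "\<And>B. B \<in> buffers D \<Delta> \<Longrightarrow> buffer_data X Q E H B (G B)" by blast
  obtain s where s: "s \<in> S" and sO: "\<And>T x. T \<in> ordinary D \<Delta> \<Longrightarrow> x \<in> T \<Longrightarrow> s x = F T x"
    and sB: "\<And>B x. B \<in> buffers D \<Delta> \<Longrightarrow> x \<in> B \<Longrightarrow> s x = G B x"
    and sP: "\<And>P j a b c C x. P \<in> pies D \<Delta> \<Longrightarrow> pie D P j a b c C \<Longrightarrow> x \<in> P \<Longrightarrow> s x = pw j a x * H P x"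
    by (rule data_spline[OF Q5 E F H G]) (assumption | blast)+
  have F5: "F T \<in> Pd 5" if "T \<in> ordinary D \<Delta>" for T using F[OF that] unfolding ordinary_data_def by blast
  have H4: "H P \<in> Pd 4" if "P \<in> pies D \<Delta>" for P using H[OF that] unfolding pie_data_def by blast
  have eP: "pie_functional D S P j a b c \<alpha> s = bcoef 4 a b c (H P) \<alpha>"
    if P: "P \<in> pies D \<Delta>" and p: "pie D P j a b c C" for P j a b c C \<alpha>
  proof (rule pie_functional_eval[OF s _ p H4[OF P] sP[OF P p]])
    show "P \<in> \<Delta>" using P by (simp add: pies_def)
  qed
  have 1: "l s = X (TI v, l)" if v: "v \<in> VI D \<Delta>" and l: "l \<in> Mv S (TI v) v" for v l
  proof -
    obtain b c \<alpha> where l: "l = tri_functional S 5 (TI v) v b c \<alpha>" and st: "straight_tri (TI v) v b c"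
      and \<alpha>: "\<alpha> \<in> {(5,0,0), (4,1,0), (4,0,1), (3,2,0), (3,0,2), (3,1,1)}"
      using l unfolding Mv_def by blast
    obtain i j k where ijk: "\<alpha> = (i, j, k)" "i + j + k = 5" "j + k < 3" using vertex_indices[OF \<alpha>] .
    have o: "TI v \<in> ordinary D \<Delta>" "v \<in> vertices D (TI v)" using TI[OF v] by auto
    have "van 3 (\<lambda>x. F (TI v) x - Q v x) v" using F[OF o(1)] o(2) unfolding ordinary_data_def by blast
    then have "bcoef 5 v b c (F (TI v)) \<alpha> = bcoef 5 v b c (Q v) \<alpha>"
      unfolding vert_a[OF straight_tri_area2[OF st] F5[OF o(1)] Q5[OF v]] using ijk by blast
    moreover have "bcoef 5 v b c (Q v) \<alpha> = X (TI v, l)"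
      using Q[OF v] st ijk unfolding jet_data_def l by (simp add: indices_def)
    ultimately show ?thesis
      unfolding l by (simp only: tri_functional_eval[OF s st F5[OF o(1)] sO[OF o(1)]])
  qed
  have 2: "l s = X (TE e, l)" if e: "e \<in> EI0 D \<Delta>" and l: "l \<in> Me S (TE e) e" for e l
  proof -
    obtain a b c where l: "l = tri_functional S 5 (TE e) a b c (1, 2, 2)" and st: "straight_tri (TE e) a b c"
      and bc: "e = closed_segment b c" using l unfolding Me_def by blast
    have o: "TE e \<in> ordinary D \<Delta>" "e \<in> straight_edges D (TE e)" using TE[OF e] by auto
    have E5: "E e \<in> Pd 5" using E[OF e] unfolding edge_data_def by blast
    have "\<forall>x\<in>closed_segment b c. van 2 (\<lambda>x. F (TE e) x - E e x) x"
      using F[OF o(1)] o(2) unfolding ordinary_data_def bc by blast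
    then have "bcoef 5 a b c (F (TE e)) (1, 2, 2) = bcoef 5 a b c (E e) (1, 2, 2)"
      unfolding edge_a[OF straight_tri_area2[OF st] F5[OF o(1)] E5] by simp
    moreover have "bcoef 5 a b c (E e) (1, 2, 2) = X (TE e, l)"
      using E[OF e] st bc unfolding edge_data_def l by blast
    ultimately show ?thesis
      unfolding l by (simp only: tri_functional_eval[OF s st F5[OF o(1)] sO[OF o(1)]])
  qed
  have 3: "l s = X (TB v, l)" if v: "v \<in> VB1 D \<Delta>" and l: "l \<in> MvP D S (TB v) v" for v l
  proof -
    obtain j a c C where l: "l = pie_functional D S (TB v) j a v c (0, 4, 0)" and p: "pie D (TB v) j a v c C"
      using l unfolding MvP_def by blast
    have P: "TB v \<in> pies D \<Delta>" "TB v \<in> \<Delta>" using TB[OF v] by (auto simp: pies_def)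
    have "H (TB v) v *\<^sub>R grad (pw j a) v = g v" using H[OF P(1)] p unfolding pie_data_def by blast
    moreover have "X (TB v, l) *\<^sub>R grad (pw j a) v = g v"
      using g[of v] v p unfolding gradient_data_def l by blast
    ultimately have "H (TB v) v *\<^sub>R grad (pw j a) v = X (TB v, l) *\<^sub>R grad (pw j a) v" by simp
    then have "H (TB v) v = X (TB v, l)" using grad_pw_nonzero[OF P(2) p] scaleR_cancel_right by blast
    then show ?thesis
      unfolding l by (simp only: eP[OF P(1) p] bcoef_corner_b[OF pie_area2[OF p] H4[OF P(1)]])
  qed
  have 4: "l s = X (P, l)" if P: "P \<in> pies D \<Delta>" and l: "l \<in> MTP D S P" for P l
  proof -
    obtain j a b c \<alpha> C where l: "l = pie_functional D S P j a b c \<alpha>" and p: "pie D P j a b c C"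
      and \<alpha>: "\<alpha> \<in> {(1,3,0), (1,2,1), (1,1,2), (1,0,3), (0,2,2)}"
      using l unfolding MTP_def by blast
    have "bcoef 4 a b c (H P) \<alpha> = X (P, l)" using H[OF P] p \<alpha> unfolding pie_data_def l by blast
    then show ?thesis unfolding l by (simp only: eP[OF P p])
  qed
  have 5: "l s = X (B, l)" if B: "B \<in> buffers D \<Delta>" and l: "l \<in> MTB D S B" for B l
  proof -
    obtain v b c \<alpha> where l: "l = tri_functional S 6 B v b c \<alpha>" and st: "straight_tri B v b c"
      and v: "v \<in> \<Gamma>" and \<alpha>: "\<alpha> = (4, 1, 1) \<or> \<alpha> = (2, 2, 2)"
      using l unfolding MTB_def by blast
    have G6: "G B \<in> Pd 6" using G[OF B] unfolding buffer_data_def by blast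
    have "bcoef 6 v b c (G B) (4, 1, 1) = X (B, tri_functional S 6 B v b c (4, 1, 1)) \<and>
       bcoef 6 v b c (G B) (2, 2, 2) = X (B, tri_functional S 6 B v b c (2, 2, 2))"
      using G[OF B] st v unfolding buffer_data_def by blast
    then have "bcoef 6 v b c (G B) \<alpha> = X (B, l)" using \<alpha> unfolding l by blast
    then show ?thesis unfolding l by (simp only: tri_functional_eval[OF s st G6 sB[OF B]])
  qed
  have "l s = X (K, l)" if "(K, l) \<in> LM" for K l using that 1 2 3 4 5 unfolding LM_def by blast
  then show ?thesis using s by blast
qed

end

section \<open>Minimality and locality\<close>

text \<open>Gaussian elimination: one equation with a nonzero entry is solved for its unknown, which
  costs one equation and one unknown.\<close>

lemma homogeneous_system_solvable:
  fixes m :: "'b \<Rightarrow> 'a \<Rightarrow> 'f::field"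
  assumes "finite B" "finite A" "card B < card A"
  shows "\<exists>x. (\<exists>a\<in>A. x a \<noteq> 0) \<and> (\<forall>b\<in>B. (\<Sum>a\<in>A. m b a * x a) = 0)"
  using assms
proof (induction B arbitrary: A m rule: finite_induct)
  case empty
  then obtain a where "a \<in> A" by fastforce
  then show ?case by (intro exI[of _ "\<lambda>_. 1"]) auto
next
  case (insert b B)
  show ?case
  proof (cases "\<forall>a\<in>A. m b a = 0")
    case True
    obtain x where "(\<exists>a\<in>A. x a \<noteq> 0) \<and> (\<forall>b\<in>B. (\<Sum>a\<in>A. m b a * x a) = 0)"
      using insert.IH[of A m] insert.prems insert.hyps by auto
    then show ?thesis using True by (intro exI[of _ x]) auto
  next
    case False
    then obtain a0 where a0: "a0 \<in> A" "m b a0 \<noteq> 0" by blast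
    let ?A = "A - {a0}"
    have "card B < card ?A" using insert.prems insert.hyps a0 by simp
    with insert.prems obtain x where x: "\<exists>a\<in>?A. x a \<noteq> 0"
      "\<forall>c\<in>B. (\<Sum>a\<in>?A. (m c a - m c a0 * m b a / m b a0) * x a) = 0"
      using insert.IH[of ?A "\<lambda>c a. m c a - m c a0 * m b a / m b a0"] by auto
    define y where "y a = (if a = a0 then - (\<Sum>a\<in>?A. m b a * x a) / m b a0 else x a)" for a
    have split: "(\<Sum>a\<in>A. m c a * y a) = m c a0 * y a0 + (\<Sum>a\<in>?A. m c a * x a)" for c
      unfolding sum.remove[OF insert.prems(1) a0(1)] by (simp add: y_def)
    have "(\<Sum>a\<in>A. m c a * y a) = 0" if "c \<in> insert b B" for c
    proof (cases "c = b")
      case True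
      then show ?thesis unfolding split using a0 by (simp add: y_def)
    next
      case False
      have "m c a0 * y a0 + (\<Sum>a\<in>?A. m c a * x a) = (\<Sum>a\<in>?A. (m c a - m c a0 * m b a / m b a0) * x a)"
        by (simp add: y_def left_diff_distrib sum_subtractf sum_distrib_left sum_divide_distrib
            sum_negf mult.assoc)
      then show ?thesis using x(2) False that split by simp
    qed
    moreover have "\<exists>a\<in>A. y a \<noteq> 0" using x(1) by (auto simp: y_def)
    ultimately show ?thesis by blast
  qed
qed

text \<open>A smaller determining set imposes fewer homogeneous equations than there are dual
  functions, so it annihilates a nontrivial combination of them. This combination would have to be
  0, but the functionals of \<open>\<Lambda>\<close> read off its coefficients.\<close>

lemma minimal_determining_setI:
  assumes add: "\<And>s t. s \<in> S \<Longrightarrow> t \<in> S \<Longrightarrow> (\<lambda>x. s x + t x) \<in> S"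
    and scale: "\<And>s r. s \<in> S \<Longrightarrow> (\<lambda>x. r * s x) \<in> S"
    and det: "determining_set S \<Lambda>"
    and dual: "\<And>l. l \<in> \<Lambda> \<Longrightarrow> \<exists>s\<in>S. \<forall>m\<in>\<Lambda>. m s = (if m = l then 1 else 0)"
  shows "minimal_determining_set S \<Lambda>"
  unfolding minimal_determining_set_def
proof (intro conjI det notI)
  assume "\<exists>\<Lambda>'. determining_set S \<Lambda>' \<and> card \<Lambda>' < card \<Lambda>"
  then obtain \<Lambda>' where \<Lambda>': "determining_set S \<Lambda>'" "card \<Lambda>' < card \<Lambda>" by blast
  obtain f where f: "\<And>l. l \<in> \<Lambda> \<Longrightarrow> f l \<in> S \<and> (\<forall>m\<in>\<Lambda>. m (f l) = (if m = l then 1 else 0))"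
    using bchoice[of \<Lambda> "\<lambda>l s. s \<in> S \<and> (\<forall>m\<in>\<Lambda>. m s = (if m = l then 1 else 0))"] dual by blast
  have fin: "finite \<Lambda>" "finite \<Lambda>'" and sub: "\<Lambda> \<subseteq> dual_space S" "\<Lambda>' \<subseteq> dual_space S"
    using det \<Lambda>' by (auto simp: determining_set_def)
  have lin: "l (\<lambda>x. s x + t x) = l s + l t" "l (\<lambda>x. r * s x) = r * l s"
    if "l \<in> dual_space S" "s \<in> S" "t \<in> S" for l s t r
    using that by (auto simp: dual_space_def)
  obtain y where "(\<exists>l\<in>\<Lambda>. y l \<noteq> 0) \<and> (\<forall>m\<in>\<Lambda>'. (\<Sum>l\<in>\<Lambda>. m (f l) * y l) = 0)"
    by (rule exE[OF homogeneous_system_solvable[OF fin(2,1) \<Lambda>'(2), of "\<lambda>m l. m (f l)"]])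
  then have y: "\<exists>l\<in>\<Lambda>. y l \<noteq> 0" "\<forall>m\<in>\<Lambda>'. (\<Sum>l\<in>\<Lambda>. m (f l) * y l) = 0" by simp_all
  obtain l0 where "l0 \<in> \<Lambda>" using y(1) by blast
  then have zero: "(\<lambda>x. 0) \<in> S" using scale[of "f l0" 0] f by simp
  have sum: "(\<lambda>x. \<Sum>l\<in>A. y l * f l x) \<in> S \<and>
     (\<forall>m\<in>dual_space S. m (\<lambda>x. \<Sum>l\<in>A. y l * f l x) = (\<Sum>l\<in>A. m (f l) * y l))"
    if "finite A" "A \<subseteq> \<Lambda>" for A
    using that
  proof (induction A)
    case empty
    then show ?case using zero lin(2)[OF _ zero zero, of _ 0] by simp
  next
    case (insert l A)
    have "f l \<in> S" using insert.prems f by blast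
    then have "(\<lambda>x. y l * f l x) \<in> S" by (rule scale)
    moreover have "(\<lambda>x. \<Sum>l\<in>A. y l * f l x) \<in> S" using insert by blast
    ultimately show ?case
      using insert add lin(1) lin(2)[OF _ \<open>f l \<in> S\<close> \<open>f l \<in> S\<close>] by (simp add: mult.commute)
  qed
  note s = sum[OF fin(1) subset_refl]
  define t where "t = (\<lambda>x. \<Sum>l\<in>\<Lambda>. y l * f l x)"
  have t: "t \<in> S" "m t = (\<Sum>l\<in>\<Lambda>. m (f l) * y l)" if "m \<in> dual_space S" for m
    using s that unfolding t_def by simp_all
  have "\<forall>m\<in>\<Lambda>'. m t = 0"
  proof
    fix m assume m: "m \<in> \<Lambda>'"
    then show "m t = 0" using t(2)[of m] bspec[OF y(2) m] sub(2) by auto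
  qed
  then have z: "t = (\<lambda>x. 0)" using \<Lambda>'(1) s unfolding determining_set_def t_def[symmetric] by blast
  have "y m = 0" if m: "m \<in> \<Lambda>" for m
  proof -
    have "m (\<lambda>x. 0) = 0" using lin(2)[OF _ zero zero, of m 0] m sub(1) by auto
    then have "(\<Sum>l\<in>\<Lambda>. m (f l) * y l) = 0" using t(2)[of m] m sub(1) unfolding z by auto
    moreover have "m (f l) = (if m = l then 1 else 0)" if "l \<in> \<Lambda>" for l using f[OF that] m by blast
    then have "(\<Sum>l\<in>\<Lambda>. m (f l) * y l) = (\<Sum>l\<in>\<Lambda>. if l = m then y l else 0)"
      by (intro sum.cong) auto
    ultimately show ?thesis using m fin(1) by simp
  qed
  then show False using y(1) by blast
qed

context pie_triangulation
begin

text \<open>For linearity, finiteness and supports only the two shapes of functionals matter: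
  coefficients of a polynomial piece, and coefficients of the conic cofactor.\<close>

lemma LM_cases:
  assumes "(K, l) \<in> LM"
  obtains d a b c \<alpha> where "K \<in> \<Delta>" "d \<le> 6" "straight_tri K a b c" "\<alpha> \<in> indices d"
      "l = tri_functional S d K a b c \<alpha>" "\<And>s. s \<in> S \<Longrightarrow> \<exists>p\<in>Pd d. \<forall>x\<in>K. s x = p x"
  | j a b c C \<alpha> where "K \<in> \<Delta>" "pie D K j a b c C" "\<alpha> \<in> indices 4" "l = pie_functional D S K j a b c \<alpha>"
proof -
  have pD: "P \<in> \<Delta>" if "P \<in> pies D \<Delta>" for P using that by (simp add: pies_def)
  note main = that
  have ord: thesis if K: "K \<in> ordinary D \<Delta>" and st: "straight_tri K a b c" and \<alpha>: "\<alpha> \<in> indices 5"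
    and l: "l = tri_functional S 5 K a b c \<alpha>" for a b c \<alpha>
    by (rule main(1)[of 5 a b c \<alpha>]) (use K st \<alpha> l ordinary_straight in_spline(6) in auto)
  from assms consider v where "v \<in> VI D \<Delta>" "K = TI v" "l \<in> Mv S K v"
    | e where "e \<in> EI0 D \<Delta>" "K = TE e" "l \<in> Me S K e"
    | v where "v \<in> VB1 D \<Delta>" "K = TB v" "l \<in> MvP D S K v"
    | "K \<in> pies D \<Delta>" "l \<in> MTP D S K" | "K \<in> buffers D \<Delta>" "l \<in> MTB D S K"
    unfolding LM_def by blast
  then show thesis
  proof cases
    case (1 v)
    obtain b c \<alpha> where "l = tri_functional S 5 K v b c \<alpha>" "straight_tri K v b c"
      "\<alpha> \<in> {(5,0,0), (4,1,0), (4,0,1), (3,2,0), (3,0,2), (3,1,1)}" using 1(3) unfolding Mv_def by blast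
    then show thesis using ord[of v b c \<alpha>] TI[OF 1(1)] 1(2) by (auto simp: indices_def)
  next
    case (2 e)
    obtain a b c where "l = tri_functional S 5 K a b c (1,2,2)" "straight_tri K a b c"
      using 2(3) unfolding Me_def by blast
    then show thesis using ord[of a b c "(1,2,2)"] TE[OF 2(1)] 2(2) by (auto simp: indices_def)
  next
    case (3 v)
    obtain j a c C where "l = pie_functional D S K j a v c (0,4,0)" "pie D K j a v c C"
      using 3(3) unfolding MvP_def by blast
    then show thesis using that(2)[of j a v c C "(0,4,0)"] TB[OF 3(1)] 3(2) pD by (auto simp: indices_def)
  next
    case 4
    obtain j a b c C \<alpha> where "l = pie_functional D S K j a b c \<alpha>" "pie D K j a b c C"
      "\<alpha> \<in> {(1,3,0), (1,2,1), (1,1,2), (1,0,3), (0,2,2)}" using 4(2) unfolding MTP_def by blast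
    then show thesis using that(2)[of j a b c C \<alpha>] pD[OF 4(1)] by (auto simp: indices_def)
  next
    case 5
    obtain a b c \<alpha> where "l = tri_functional S 6 K a b c \<alpha>" "straight_tri K a b c"
      "\<alpha> \<in> {(4,1,1), (2,2,2)}" using 5(2) unfolding MTB_def by blast
    then show thesis
      using that(1)[of 6 a b c \<alpha>] buffer_straight[OF 5(1)] in_spline(7)[of _ K] 5(1) by (auto simp: indices_def)
  qed
qed

lemma LM_cell: "(K, l) \<in> LM \<Longrightarrow> K \<in> \<Delta>"
  by (erule LM_cases)

lemma finite_LM: "finite LM"
proof -
  have fv: "finite (vertices D K)" if "K \<in> \<Delta>" for K
    using cells[OF that] cell_vertices by (metis finite.emptyI finite_insert)
  let ?t = "\<lambda>K. (\<lambda>(d, a, b, c, \<alpha>). tri_functional S d K a b c \<alpha>) `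
      (SIGMA d:{..6}. vertices D K \<times> vertices D K \<times> vertices D K \<times> indices d)"
  let ?p = "\<lambda>K. (\<lambda>(j, a, b, c, \<alpha>). pie_functional D S K j a b c \<alpha>) `
      ({..<nsides D} \<times> vertices D K \<times> vertices D K \<times> vertices D K \<times> indices 4)"
  have "LM \<subseteq> (SIGMA K:\<Delta>. ?t K \<union> ?p K)"
  proof (rule subrelI)
    fix K l assume "(K, l) \<in> LM"
    then show "(K, l) \<in> (SIGMA K:\<Delta>. ?t K \<union> ?p K)"
    proof (cases rule: LM_cases)
      case (1 d a b c \<alpha>)
      then have "(d, a, b, c, \<alpha>) \<in> (SIGMA d:{..6}. vertices D K \<times> vertices D K \<times> vertices D K \<times> indices d)"
        using straight_vertices(1)[OF 1(3)] by simp
      then have "l \<in> ?t K" unfolding 1(5) by (rule rev_image_eqI) simp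
      then show ?thesis using 1(1) by blast
    next
      case (2 j a b c C \<alpha>)
      then have "(j, a, b, c, \<alpha>) \<in> {..<nsides D} \<times> vertices D K \<times> vertices D K \<times> vertices D K \<times> indices 4"
        using pie_vertices(1)[OF 2(2)] by (simp add: pie_def)
      then have "l \<in> ?p K" unfolding 2(4) by (rule rev_image_eqI) simp
      then show ?thesis using 2(1) by blast
    qed
  qed
  moreover have "finite (SIGMA K:\<Delta>. ?t K \<union> ?p K)"
    by (intro finite_SigmaI finite_UnI finite_imageI finite_cartesian_product fin fv finite_indices) simp_all
  ultimately show ?thesis by (rule finite_subset)
qed

lemma LM_dual_space: assumes "(K, l) \<in> LM" shows "l \<in> dual_space S"
  using assms
proof (cases rule: LM_cases)
  case (1 d a b c \<alpha>)
  note nc = straight_tri_area2[OF 1(3)]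
  have "l (\<lambda>x. s x + t x) = l s + l t" if s: "s \<in> S" and t: "t \<in> S" for s t
  proof -
    obtain p q where p: "p \<in> Pd d" "\<And>x. x \<in> K \<Longrightarrow> s x = p x" and q: "q \<in> Pd d" "\<And>x. x \<in> K \<Longrightarrow> t x = q x"
      using 1(6)[OF s] 1(6)[OF t] by blast
    have e: "\<And>x. x \<in> K \<Longrightarrow> s x + t x = p x + q x" using p q by simp
    show ?thesis unfolding 1(5)
      by (simp only: tri_functional_eval[OF s 1(3) p] tri_functional_eval[OF t 1(3) q]
        tri_functional_eval[OF spline_add[OF s t] 1(3) Pd_add[OF p(1) q(1)] e] bcoef_add[OF nc p(1) q(1)])
  qed
  moreover have "l (\<lambda>x. r * s x) = r * l s" if s: "s \<in> S" for s r
  proof -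
    obtain p where p: "p \<in> Pd d" "\<And>x. x \<in> K \<Longrightarrow> s x = p x" using 1(6)[OF s] by blast
    have e: "\<And>x. x \<in> K \<Longrightarrow> r * s x = r * p x" using p by simp
    show ?thesis unfolding 1(5)
      by (simp only: tri_functional_eval[OF s 1(3) p]
        tri_functional_eval[OF spline_scale[OF s] 1(3) Pd_scale[OF p(1)] e] bcoef_scale[OF nc p(1)])
  qed
  moreover have "l \<in> extensional S" unfolding 1(5) tri_functional_def by (rule restrict_extensional)
  ultimately show ?thesis unfolding dual_space_def by blast
next
  case (2 j a b c C \<alpha>)
  note nc = pie_area2[OF 2(2)]
  have "l (\<lambda>x. s x + t x) = l s + l t" if s: "s \<in> S" and t: "t \<in> S" for s t
  proof -
    obtain p where p: "p \<in> Pd 4" "\<And>x. x \<in> K \<Longrightarrow> s x = pw j a x * p x"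
      by (rule pie_factor[OF s 2(1,2)]) blast
    obtain q where q: "q \<in> Pd 4" "\<And>x. x \<in> K \<Longrightarrow> t x = pw j a x * q x"
      by (rule pie_factor[OF t 2(1,2)]) blast
    have e: "\<And>x. x \<in> K \<Longrightarrow> s x + t x = pw j a x * (p x + q x)" using p q by (simp add: distrib_left)
    show ?thesis unfolding 2(4)
      by (simp only: pie_functional_eval[OF s 2(1,2) p] pie_functional_eval[OF t 2(1,2) q]
        pie_functional_eval[OF spline_add[OF s t] 2(1,2) Pd_add[OF p(1) q(1)] e] bcoef_add[OF nc p(1) q(1)])
  qed
  moreover have "l (\<lambda>x. r * s x) = r * l s" if s: "s \<in> S" for s r
  proof -
    obtain p where p: "p \<in> Pd 4" "\<And>x. x \<in> K \<Longrightarrow> s x = pw j a x * p x"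
      by (rule pie_factor[OF s 2(1,2)]) blast
    have e: "\<And>x. x \<in> K \<Longrightarrow> r * s x = pw j a x * (r * p x)" using p by simp
    show ?thesis unfolding 2(4)
      by (simp only: pie_functional_eval[OF s 2(1,2) p]
        pie_functional_eval[OF spline_scale[OF s] 2(1,2) Pd_scale[OF p(1)] e] bcoef_scale[OF nc p(1)])
  qed
  moreover have "l \<in> extensional S" unfolding 2(4) pie_functional_def by (rule restrict_extensional)
  ultimately show ?thesis unfolding dual_space_def by blast
qed

lemma LM_supporting_set: assumes "(K, l) \<in> LM" shows "supporting_set S l K"
  unfolding supporting_set_def
proof (intro ballI impI)
  fix s assume s: "s \<in> S" and z: "\<forall>x\<in>K. s x = 0"
  from assms show "l s = 0"
  proof (cases rule: LM_cases)
    case (1 d a b c \<alpha>)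
    have "\<And>x. x \<in> K \<Longrightarrow> s x = 0" using z by blast
    from tri_functional_eval[OF s 1(3) Pd_const this] show ?thesis
      unfolding 1(5) using bcoef_zero[OF straight_tri_area2[OF 1(3)]] by simp
  next
    case (2 j a b c C \<alpha>)
    have "\<And>x. x \<in> K \<Longrightarrow> s x = pw j a x * 0" using z by simp
    from pie_functional_eval[OF s 2(1,2) Pd_const this] show ?thesis
      unfolding 2(4) using bcoef_zero[OF pie_area2[OF 2(2)]] by simp
  qed
qed

text \<open>Interpolate the value 1 at the pair \<open>(K, l)\<close> and 0 at all other pairs: a
  second triangle for the same functional would give it both values.\<close>

lemma LM_unique:
  assumes "(K, l) \<in> LM" "(K', l) \<in> LM" shows "K = K'"
proof (rule ccontr)
  assume ne: "K \<noteq> K'"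
  obtain s where "s \<in> S" and s: "\<forall>(L, m)\<in>LM. m s = (if (L, m) = (K, l) then 1 else 0)"
    by (rule bexE[OF spline_interpolation[of "\<lambda>p. if p = (K, l) then 1 else 0"]])
  show False using bspec[OF s assms(1)] bspec[OF s assms(2)] ne by simp
qed

abbreviation "M \<equiv> M_set D \<Delta> TI TE TB"

lemma M_LM: "l \<in> M \<longleftrightarrow> (\<exists>K. (K, l) \<in> LM)"
  unfolding LM_snd[symmetric] by force

lemma M_determining: "determining_set S M"
  unfolding determining_set_def
proof (intro conjI ballI impI)
  show "finite M" unfolding LM_snd[symmetric] using finite_LM by (rule finite_imageI)
  show "M \<subseteq> dual_space S" using M_LM LM_dual_space by blast
  fix s assume s: "s \<in> S" and z: "\<forall>l\<in>M. l s = 0"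
  have "s x = 0" for x
  proof (cases "x \<in> closure \<Omega>")
    case True
    then obtain T where T: "T \<in> \<Delta>" "x \<in> T" using union by blast
    have "\<forall>(K, l)\<in>LM. K \<inter> T \<noteq> {} \<longrightarrow> l s = 0" using z M_LM by blast
    from local_determination[OF s T(1) this T(2)] show ?thesis .
  next
    case False
    then show ?thesis by (rule in_spline(5)[OF s])
  qed
  then show "s = (\<lambda>x. 0)" by (rule ext)
qed

lemma M_dual: "\<exists>s\<in>S. \<forall>m\<in>M. m s = (if m = l then 1 else 0)"
proof -
  obtain s where s: "s \<in> S" "\<forall>(K, m)\<in>LM. m s = (if snd (K, m) = l then 1 else 0)"
    by (rule bexE[OF spline_interpolation[of "\<lambda>p. if snd p = l then 1 else 0"]])
  have "m s = (if m = l then 1 else 0)" if m: "m \<in> M" for m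
  proof -
    obtain K where "(K, m) \<in> LM" using m M_LM by blast
    from bspec[OF s(2) this] show ?thesis by simp
  qed
  then show ?thesis using s(1) by blast
qed

lemma dual_basis_M:
  shows "dual_basis S M l \<in> S" "\<And>m. m \<in> M \<Longrightarrow> m (dual_basis S M l) = (if m = l then 1 else 0)"
proof -
  let ?P = "\<lambda>s. s \<in> S \<and> (\<forall>m\<in>M. m s = (if m = l then 1 else 0))"
  obtain s where s: "?P s" using M_dual[of l] by blast
  have "t = s" if t: "?P t" for t
  proof -
    have "(\<lambda>x. t x + (-1) * s x) \<in> S" using spline_add spline_scale s t by blast
    moreover have "m (\<lambda>x. t x + (-1) * s x) = 0" if m: "m \<in> M" for m
    proof -
      have "m \<in> dual_space S" using M_determining m unfolding determining_set_def by blast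
      then have lin: "\<And>f g. f \<in> S \<Longrightarrow> g \<in> S \<Longrightarrow> m (\<lambda>x. f x + g x) = m f + m g"
        "\<And>f r. f \<in> S \<Longrightarrow> m (\<lambda>x. r * f x) = r * m f"
        unfolding dual_space_def by blast+
      have S: "s \<in> S" "t \<in> S" using s t by auto
      have "m s = (if m = l then 1 else 0)" "m t = (if m = l then 1 else 0)" using s t m by blast+
      then have "m t = m s" by simp
      then show ?thesis unfolding lin(1)[OF S(2) spline_scale[OF S(1)]] lin(2)[OF S(1)] by simp
    qed
    ultimately have "(\<lambda>x. t x + (-1) * s x) = (\<lambda>x. 0)" using M_determining unfolding determining_set_def by blast
    then have "t x + (-1) * s x = 0" for x by (rule fun_cong)
    then show ?thesis by auto
  qed
  with s have "?P (dual_basis S M l)" unfolding dual_basis_def by (rule theI[of ?P])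
  then show "dual_basis S M l \<in> S" "\<And>m. m \<in> M \<Longrightarrow> m (dual_basis S M l) = (if m = l then 1 else 0)" by auto
qed

text \<open>If \<open>K\<close> missed \<open>T\<close>, all functionals evaluated in cells meeting
  \<open>T\<close> would differ from \<open>l\<close> and vanish on the dual function of
  \<open>l\<close>. This function would then be 0 on \<open>T\<close>, whose interior would not meet
  the support.\<close>

lemma active_in_star:
  assumes T: "T \<in> \<Delta>" and l: "l \<in> active_functionals S M T" and K: "(K, l) \<in> LM"
  shows "K \<subseteq> star \<Delta> T"
proof (cases "K \<inter> T = {}")
  case True
  let ?s = "dual_basis S M l"
  have "\<forall>(K', m)\<in>LM. K' \<inter> T \<noteq> {} \<longrightarrow> m ?s = 0"
  proof clarify
    fix K' m assume m: "(K', m) \<in> LM" "K' \<inter> T \<noteq> {}"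
    then have "m \<noteq> l" using LM_unique[OF K] True by blast
    moreover have "m \<in> M" using m(1) M_LM by blast
    ultimately show "m ?s = 0" using dual_basis_M(2)[of m l] by simp
  qed
  then have "?s x = 0" if "x \<in> T" for x using local_determination[OF dual_basis_M(1) T] that by blast
  then have "interior T \<inter> {x. ?s x \<noteq> 0} = {}" using interior_subset by blast
  then have "interior T \<inter> closure {x. ?s x \<noteq> 0} = {}" by (simp add: open_Int_closure_eq_empty)
  moreover have "T \<subseteq> closure {x. ?s x \<noteq> 0}" using l unfolding active_functionals_def by blast
  moreover have "interior T \<noteq> {}" using cells[OF T] cell_fat(3) by blast
  ultimately show ?thesis using interior_subset[of T] by blast
next
  case False
  then show ?thesis using LM_cell[OF K] unfolding star_def by blast
qed

theorem M_local_MDS: "local_MDS 1 \<Delta> S M"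
  unfolding local_MDS_def
proof
  show "minimal_determining_set S M"
    by (rule minimal_determining_setI[OF spline_add spline_scale M_determining M_dual])
  obtain \<omega> where \<omega>: "\<forall>l\<in>M. (\<omega> l, l) \<in> LM" using M_LM bchoice[of M "\<lambda>l K. (K, l) \<in> LM"] by blast
  show "\<exists>\<omega>. (\<forall>l\<in>M. supporting_set S l (\<omega> l)) \<and>
      (\<forall>T\<in>\<Delta>. \<forall>l\<in>active_functionals S M T. \<omega> l \<subseteq> (star \<Delta> ^^ 1) T)"
  proof (intro exI[of _ \<omega>] conjI ballI)
    show "supporting_set S l (\<omega> l)" if "l \<in> M" for l using \<omega> that LM_supporting_set by blast
    fix T l assume T: "T \<in> \<Delta>" and l: "l \<in> active_functionals S M T"
    then have "l \<in> M" by (simp add: active_functionals_def)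
    then show "\<omega> l \<subseteq> (star \<Delta> ^^ 1) T" using active_in_star[OF T l] \<omega> by simp
  qed
qed

end

theorem theorem3p2:
  fixes D :: cdomain
    and \<Delta> :: "(real^2) set set"
    and TI TB :: "real^2 \<Rightarrow> (real^2) set"
    and TE :: "(real^2) set \<Rightarrow> (real^2) set"
  assumes "curvilinear_polygon D"
    and "admissible_triangulation D \<Delta>"
    and "M_choice D \<Delta> TI TE TB"
  shows "local_MDS 1 \<Delta> (spline_space D \<Delta>) (M_set D \<Delta> TI TE TB)"
proof -
  interpret pie_triangulation D \<Delta> TI TB TE by unfold_locales (fact assms)+
  show ?thesis by (rule M_local_MDS)
qed

end
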